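(* Let $N\ge2$ and consider the symmetric half-duplex cooperative multiple-access fading channel with $N$ sources and one destination described in the context. The CMA-NAF protocol (with suitable broadcast and repetition gains satisfying the average power constraint) achieves the optimal (genie-aided) diversity-multiplexing tradeoff, i.e. that of a point-to-point system with $N$ transmit antennas and one receive antenna: for every $0\le r\le1$, the overall diversity gain it achieves at multiplexing gain $r$ is $$d^*(r)=N(1-r).$$
   Context: Channel. All channels are flat, Rayleigh-fading and quasi-static: the gains $g_j$ (source $j$ to destination) and $h_{ji}$ (source $i$ to source $j$) are mutually independent zero-mean unit-variance circularly-symmetric complex Gaussian random variables, constant over a coherence interval. Noises are zero-mean, mutually independent, circularly-symmetric white complex Gaussian, of variance $\sigma_w^2$ at the sources and $\sigma_v^2$ at the destination, with $\sigma_v^2/\sigma_w^2$ a fixed constant. Each node has one antenna, operates synchronously, and may use average energy at most $E$ per transmitted symbol; $\rho=E/\sigma_v^2$ is the signal-to-noise ratio. Channel gains are known only at receiving nodes (the destination knows all the gains it needs for decoding); there is no feedback to transmitters. Half-duplex: a node cannot transmit and receive at the same time. The sources have independent messages, all of the same rate. CMA-NAF protocol. A cooperation frame is $N$ consecutive symbol-intervals; source $j$ transmits only in the $j$-th symbol-interval of each frame. A super-frame is $L$ consecutive cooperation frames, and a coherence interval is $N-1$ consecutive super-frames. In each super-frame every source is helped by one other source: in super-frame $i$ the helpers of sources $(1,\dots,N)$ are given by the $j$-th right circular shift of $(1,\dots,N)$ with $j=((i-1)\bmod (N-1))+1$ (so the helper of source $s$ has index $s-j$ modulo $N$). The reception symbol-interval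 of a source in a frame is the transmission symbol-interval of the source it currently helps; if source $j$ helps source $i$, what it receives is $h_{ji}$ times the signal transmitted by source $i$, plus noise $w_{j,k}$. In its transmission symbol-interval in frame $k$, source $j$ sends $$t_{j,k}=a_jx_{j,k}+b_j\,r,$$ where $x_{j,k}$ is its own new code symbol, $r$ is the signal it observed in its most recent reception symbol-interval (taken as $0$ if there has been none), $a_j$ is its broadcast gain and $b_j$ its repetition gain, chosen so that $\mathbb{E}\{|t_{j,k}|^2\}\le E$. The destination receives $y_{j,k}=g_jt_{j,k}+v_{j,k}$, where $v_{j,k}$ is the destination noise. Each source uses a random Gaussian code-book with codewords of length $l=(N-1)L$ symbols (one symbol per cooperation frame, spanning the entire coherence interval) and rate $R=r\log\rho$ bits per own symbol, so that the destination also receives information at rate $R=r\log\rho$ bits per symbol-interval. Code-lengths (hence $L$) are asymptotically large, and the destination uses maximum-likelihood (ML) decoding. Diversity and multiplexing. The multiplexing gain is $r=\lim_{\rho\to\infty}R(\rho)/\log\rho$, equal for all sources. If $P_{E,j}(\rho)$ is the ML error probability for the message of source $j$ (averaged over the fading and the code ensemble), then $d_j=-\lim_{\rho\to\infty}\log P_{E,j}(\rho)/\log\rho$, and the overall diversity gain is $d=\min_{1\le j\le N}d_j$. The genie-aided optimum is the optimal diversity gain at multiplexing gain $r$ when the $N$ sources cooperate perfectly, i.e. act as one transmitter with $N$ antennas communicating with a single-antenna receiver. *)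

theory Defs
  imports "HOL-Probability.Probability"
begin

section \<open>Circularly-symmetric complex Gaussians\<close>

text \<open>
  The parameter is the variance \<open>s = E |z|\<^sup>2\<close>, so the real and imaginary parts are independent
  real Gaussians of variance \<open>s / 2\<close>. The reference measure is Lebesgue measure on the plane.
\<close>

definition cn_density :: "real \<Rightarrow> complex \<Rightarrow> real" where
  "cn_density s z = exp (- (cmod z)\<^sup>2 / s) / (pi * s)"

definition cn :: "real \<Rightarrow> complex measure" where
  "cn s = density lborel (\<lambda>z. ennreal (cn_density s z))"

section \<open>Multiplexing and diversity\<close>

text \<open>
  Rates are in bits. The second conjunct is implied by the first when \<open>r > 0\<close>. For \<open>r = 0\<close> it
  excludes families whose rate vanishes with the SNR (in particular codes with a single message,
  which are never decoded wrongly).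
\<close>

definition has_multiplexing_gain :: "(real \<Rightarrow> real) \<Rightarrow> real \<Rightarrow> bool" where
  "has_multiplexing_gain R r \<longleftrightarrow>
     ((\<lambda>\<rho>. R \<rho> / log 2 \<rho>) \<longlongrightarrow> r) at_top \<and> (\<exists>c>0. \<forall>\<^sub>F \<rho> in at_top. c \<le> R \<rho>)"

definition error_exponent :: "real \<Rightarrow> real \<Rightarrow> ereal" where
  "error_exponent \<rho> p = (if p = 0 then \<infinity> else ereal (- ln p / ln \<rho>))"

text \<open>
  For an error probability depending on the SNR \<open>\<rho>\<close> and on a length parameter \<open>L\<close> that is
  asymptotically large, both \<open>\<rho>\<close> and \<open>L\<close> tend to infinity, independently of each other.
\<close>

definition has_diversity_gain :: "(real \<Rightarrow> nat \<Rightarrow> real) \<Rightarrow> ereal \<Rightarrow> bool" where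
  "has_diversity_gain P d \<longleftrightarrow>
     ((\<lambda>(\<rho>, L). error_exponent \<rho> (P \<rho> L)) \<longlongrightarrow> d) (at_top \<times>\<^sub>F at_top)"

definition has_overall_diversity_gain ::
    "nat \<Rightarrow> (nat \<Rightarrow> real \<Rightarrow> nat \<Rightarrow> real) \<Rightarrow> ereal \<Rightarrow> bool" where
  "has_overall_diversity_gain N P d \<longleftrightarrow>
     (\<exists>d'. (\<forall>j<N. has_diversity_gain (P j) (d' j)) \<and> d = Min (d' ` {..<N}))"

section \<open>The CMA-NAF protocol\<close>

text \<open>
  Sources, frames and super-frames are numbered from 0: sources are \<open>0, \<dots>, N - 1\<close>, and frame \<open>k\<close>,
  with \<open>k < (N - 1) * L\<close>, belongs to super-frame \<open>k div L\<close>. In the super-frame numbered \<open>i\<close> the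
  helper of \<open>s\<close> is \<open>s - (i + 1)\<close> modulo \<open>N\<close>; equivalently, \<open>m\<close> helps \<open>m + (i + 1)\<close> modulo \<open>N\<close>.
\<close>

definition frames :: "nat \<Rightarrow> nat \<Rightarrow> nat" where
  "frames N L = (N - 1) * L"

definition helped :: "nat \<Rightarrow> nat \<Rightarrow> nat \<Rightarrow> nat \<Rightarrow> nat" where
  "helped N L m k = (m + ((k div L) mod (N - 1) + 1)) mod N"

text \<open>
  \<open>cma_signal N L a b h x w m k\<close> is the signal sent by source \<open>m\<close> in frame \<open>k\<close>, where
  \<open>h (m, p)\<close> is the gain from source \<open>p\<close> to source \<open>m\<close>, \<open>x (m, k)\<close> is the code symbol and \<open>w (m, k)\<close>
  is the noise observed by \<open>m\<close> in frame \<open>k\<close>.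
  Source \<open>m\<close> sends in interval \<open>m\<close> of the frame and listens in interval \<open>helped N L m k\<close>. Hence
  its most recent reception lies in the same frame if it helps a smaller-numbered source, and in
  the previous frame (possibly of the previous super-frame) otherwise.
  The repetition gain \<open>b m c\<close> may depend on the gain \<open>c\<close> of the link over which the repeated signal
  was received, as that gain is known to the receiving source \<open>m\<close>.
\<close>

fun cma_signal :: "nat \<Rightarrow> nat \<Rightarrow> (nat \<Rightarrow> complex) \<Rightarrow> (nat \<Rightarrow> complex \<Rightarrow> complex) \<Rightarrow>
    (nat \<times> nat \<Rightarrow> complex) \<Rightarrow> (nat \<times> nat \<Rightarrow> complex) \<Rightarrow> (nat \<times> nat \<Rightarrow> complex) \<Rightarrow>
    nat \<Rightarrow> nat \<Rightarrow> complex" where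
  "cma_signal N L a b h x w m k =
     a m * x (m, k) +
     (if helped N L m k < m then
        (let p = helped N L m k
         in b m (h (m, p)) * (h (m, p) * cma_signal N L a b h x w p k + w (m, k)))
      else if k = 0 then 0
      else
        (let p = helped N L m (k - 1)
         in b m (h (m, p)) *
              (h (m, p) * cma_signal N L a b h x w p (k - 1) + w (m, k - 1))))"

declare cma_signal.simps [simp del]

text \<open>The random objects, with \<open>n\<close> the number of messages of each source.\<close>

definition dest_gains :: "nat \<Rightarrow> (nat \<Rightarrow> complex) measure" where
  "dest_gains N = PiM {..<N} (\<lambda>_. cn 1)"

definition source_gains :: "nat \<Rightarrow> (nat \<times> nat \<Rightarrow> complex) measure" where
  "source_gains N = PiM {(j, i). j < N \<and> i < N \<and> j \<noteq> i} (\<lambda>_. cn 1)"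

definition frame_noise :: "nat \<Rightarrow> nat \<Rightarrow> real \<Rightarrow> (nat \<times> nat \<Rightarrow> complex) measure" where
  "frame_noise N L s = PiM ({..<N} \<times> {..<frames N L}) (\<lambda>_. cn s)"

definition codebooks :: "nat \<Rightarrow> nat \<Rightarrow> nat \<Rightarrow> real \<Rightarrow> (nat \<times> nat \<times> nat \<Rightarrow> complex) measure" where
  "codebooks N L n E = PiM ({..<N} \<times> {..<n} \<times> {..<frames N L}) (\<lambda>_. cn E)"

definition messages :: "nat \<Rightarrow> nat \<Rightarrow> (nat \<Rightarrow> nat) measure" where
  "messages N n = PiM {..<N} (\<lambda>_. uniform_count_measure {..<n})"

definition code_symbols ::
    "(nat \<times> nat \<times> nat \<Rightarrow> complex) \<Rightarrow> (nat \<Rightarrow> nat) \<Rightarrow> nat \<times> nat \<Rightarrow> complex" where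
  "code_symbols C \<mu> = (\<lambda>(m, k). C (m, \<mu> m, k))"

text \<open>
  The conditional density, at \<open>y\<close>, of the signals received in the coherence interval, given the
  gains and the code symbols. The noise of the sources, which reaches the destination through
  the repeated signals, is averaged out.
\<close>

definition cma_likelihood :: "nat \<Rightarrow> nat \<Rightarrow> real \<Rightarrow> real \<Rightarrow> (nat \<Rightarrow> complex) \<Rightarrow>
    (nat \<Rightarrow> complex \<Rightarrow> complex) \<Rightarrow> (nat \<Rightarrow> complex) \<Rightarrow> (nat \<times> nat \<Rightarrow> complex) \<Rightarrow>
    (nat \<times> nat \<Rightarrow> complex) \<Rightarrow> (nat \<times> nat \<Rightarrow> complex) \<Rightarrow> real" where
  "cma_likelihood N L \<sigma>v2 \<sigma>w2 a b g h x y =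
     (\<integral>w. (\<Prod>(j, k)\<in>{..<N} \<times> {..<frames N L}.
              cn_density \<sigma>v2 (y (j, k) - g j * cma_signal N L a b h x w j k))
        \<partial>frame_noise N L \<sigma>w2)"

text \<open>
  The message tuples that joint maximum-likelihood decoding may return. The decoder knows the
  codebook and all gains.
\<close>

definition cma_ml_decisions :: "nat \<Rightarrow> nat \<Rightarrow> nat \<Rightarrow> real \<Rightarrow> real \<Rightarrow> (nat \<Rightarrow> complex) \<Rightarrow>
    (nat \<Rightarrow> complex \<Rightarrow> complex) \<Rightarrow> (nat \<Rightarrow> complex) \<Rightarrow> (nat \<times> nat \<Rightarrow> complex) \<Rightarrow>
    (nat \<times> nat \<times> nat \<Rightarrow> complex) \<Rightarrow> (nat \<times> nat \<Rightarrow> complex) \<Rightarrow> (nat \<Rightarrow> nat) set" where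
  "cma_ml_decisions N L n \<sigma>v2 \<sigma>w2 a b g h C y =
     {\<mu> \<in> {..<N} \<rightarrow>\<^sub>E {..<n}. \<forall>\<mu>' \<in> {..<N} \<rightarrow>\<^sub>E {..<n}.
        cma_likelihood N L \<sigma>v2 \<sigma>w2 a b g h (code_symbols C \<mu>') y
          \<le> cma_likelihood N L \<sigma>v2 \<sigma>w2 a b g h (code_symbols C \<mu>) y}"

text \<open>
  Error probability for the message of source \<open>j\<close>, averaged over fading, code ensemble, messages
  and noise; \<open>E\<close> is the energy of the code symbols. A tie with a decision that is wrong for
  \<open>j\<close> counts as an error.
\<close>

definition cma_error_prob :: "nat \<Rightarrow> nat \<Rightarrow> nat \<Rightarrow> real \<Rightarrow> real \<Rightarrow> real \<Rightarrow> (nat \<Rightarrow> complex) \<Rightarrow>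
    (nat \<Rightarrow> complex \<Rightarrow> complex) \<Rightarrow> nat \<Rightarrow> real" where
  "cma_error_prob N L n \<sigma>v2 \<sigma>w2 E a b j =
     (let \<Omega> = dest_gains N \<Otimes>\<^sub>M source_gains N \<Otimes>\<^sub>M codebooks N L n E \<Otimes>\<^sub>M messages N n \<Otimes>\<^sub>M
              frame_noise N L \<sigma>w2 \<Otimes>\<^sub>M frame_noise N L \<sigma>v2
      in measure \<Omega> {(g, h, C, \<mu>, w, v) \<in> space \<Omega>.
           \<exists>\<mu>' \<in> cma_ml_decisions N L n \<sigma>v2 \<sigma>w2 a b g h C
                  (\<lambda>(i, k). g i * cma_signal N L a b h (code_symbols C \<mu>) w i k + v (i, k)).
             \<mu>' j \<noteq> \<mu> j})"

text \<open>
  The average-energy constraint, imposed for every value of the gains between the sources (and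
  hence also on average over them). The broadcast and repetition gains may depend on the SNR
  \<open>\<rho> = E / \<sigma>v2\<close>.
\<close>

definition cma_power_constraint :: "nat \<Rightarrow> real \<Rightarrow> real \<Rightarrow> (real \<Rightarrow> nat \<Rightarrow> complex) \<Rightarrow>
    (real \<Rightarrow> nat \<Rightarrow> complex \<Rightarrow> complex) \<Rightarrow> bool" where
  "cma_power_constraint N \<sigma>v2 \<sigma>w2 a b \<longleftrightarrow>
     (\<forall>\<rho>>0. \<forall>L n h j k. n > 0 \<longrightarrow> j < N \<longrightarrow> k < frames N L \<longrightarrow>
        (\<integral>\<^sup>+(C, \<mu>, w). ennreal ((cmod (cma_signal N L (a \<rho>) (b \<rho>) h (code_symbols C \<mu>) w j k))\<^sup>2)
           \<partial>(codebooks N L n (\<rho> * \<sigma>v2) \<Otimes>\<^sub>M messages N n \<Otimes>\<^sub>M frame_noise N L \<sigma>w2))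
          \<le> ennreal (\<rho> * \<sigma>v2))"

definition cma_gains :: "nat \<Rightarrow> real \<Rightarrow> real \<Rightarrow> (real \<Rightarrow> nat \<Rightarrow> complex) \<Rightarrow>
    (real \<Rightarrow> nat \<Rightarrow> complex \<Rightarrow> complex) \<Rightarrow> bool" where
  "cma_gains N \<sigma>v2 \<sigma>w2 a b \<longleftrightarrow>
     (\<forall>\<rho> j. b \<rho> j \<in> borel_measurable borel) \<and> cma_power_constraint N \<sigma>v2 \<sigma>w2 a b"

text \<open>Number of messages of a code of length \<open>l\<close> and rate \<open>R\<close> bits per symbol.\<close>

definition num_messages :: "nat \<Rightarrow> real \<Rightarrow> nat" where
  "num_messages l R = nat \<lfloor>2 powr (real l * R)\<rfloor>"

definition cma_naf_error :: "nat \<Rightarrow> real \<Rightarrow> real \<Rightarrow> (real \<Rightarrow> nat \<Rightarrow> complex) \<Rightarrow>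
    (real \<Rightarrow> nat \<Rightarrow> complex \<Rightarrow> complex) \<Rightarrow> (real \<Rightarrow> real) \<Rightarrow> nat \<Rightarrow> real \<Rightarrow> nat \<Rightarrow> real" where
  "cma_naf_error N \<sigma>v2 \<sigma>w2 a b R j \<rho> L =
     cma_error_prob N L (num_messages (frames N L) (R \<rho>)) \<sigma>v2 \<sigma>w2 (\<rho> * \<sigma>v2) (a \<rho>) (b \<rho>) j"

section \<open>The genie-aided optimum\<close>

text \<open>
  One transmitter with \<open>N\<close> antennas and a single-antenna receiver. A code of block length \<open>T\<close> with
  \<open>n\<close> messages sends \<open>X \<mu> t i\<close> from antenna \<open>i\<close> at time \<open>t\<close> for message \<open>\<mu>\<close>; \<open>D\<close> is an arbitrary
  decoder knowing the gains. The gains are constant over the block, and every antenna obeys the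
  average-energy constraint \<open>E\<close> of a source.
\<close>

definition miso_code :: "nat \<Rightarrow> real \<Rightarrow> nat \<Rightarrow> nat \<Rightarrow> (nat \<Rightarrow> nat \<Rightarrow> nat \<Rightarrow> complex) \<Rightarrow>
    ((nat \<Rightarrow> complex) \<times> (nat \<Rightarrow> complex) \<Rightarrow> nat) \<Rightarrow> bool" where
  "miso_code N E T n X D \<longleftrightarrow>
     T > 0 \<and> n > 0 \<and>
     (\<forall>i<N. (\<Sum>\<mu><n. \<Sum>t<T. (cmod (X \<mu> t i))\<^sup>2) / (real n * real T) \<le> E) \<and>
     D \<in> measurable (dest_gains N \<Otimes>\<^sub>M PiM {..<T} (\<lambda>_. borel)) (count_space UNIV)"

definition miso_error_prob :: "nat \<Rightarrow> real \<Rightarrow> nat \<Rightarrow> nat \<Rightarrow> (nat \<Rightarrow> nat \<Rightarrow> nat \<Rightarrow> complex) \<Rightarrow>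
    ((nat \<Rightarrow> complex) \<times> (nat \<Rightarrow> complex) \<Rightarrow> nat) \<Rightarrow> real" where
  "miso_error_prob N \<sigma>v2 T n X D =
     (let \<Omega> = dest_gains N \<Otimes>\<^sub>M uniform_count_measure {..<n} \<Otimes>\<^sub>M PiM {..<T} (\<lambda>_. cn \<sigma>v2)
      in measure \<Omega> {(g, \<mu>, v) \<in> space \<Omega>.
           D (g, \<lambda>t\<in>{..<T}. (\<Sum>i<N. g i * X \<mu> t i) + v t) \<noteq> \<mu>})"

text \<open>The supremum is over families of codes, one code for each SNR.\<close>

definition genie_optimal_diversity :: "nat \<Rightarrow> real \<Rightarrow> real \<Rightarrow> ereal" where
  "genie_optimal_diversity N \<sigma>v2 r =
     Sup {d. \<exists>T n X D.
       (\<forall>\<rho>>0. miso_code N (\<rho> * \<sigma>v2) (T \<rho>) (n \<rho>) (X \<rho>) (D \<rho>)) \<and>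
       has_multiplexing_gain (\<lambda>\<rho>. log 2 (real (n \<rho>)) / real (T \<rho>)) r \<and>
       ((\<lambda>\<rho>. error_exponent \<rho> (miso_error_prob N \<sigma>v2 (T \<rho>) (n \<rho>) (X \<rho>) (D \<rho>))) \<longlongrightarrow> d) at_top}"

end

theory Submission
  imports Defs "HOL-Real_Asymp.Real_Asymp"
begin

text \<open>
  Put \<open>d = N * (1 - r)\<close>. No scheme beats \<open>d\<close>: with probability of order \<open>\<rho> powr (- d - e)\<close> all gains to
  the destination are so small that the rate exceeds capacity, and then a strong converse, which
  smooths the noise with a Gaussian, makes an error likely.

  Conversely let \<open>S\<close> be the set of sources whose messages are confused. Every symbol of a source in
  \<open>S\<close> is received directly and, if its helper is not in \<open>S\<close>, repeated. A fraction \<open>1 / N\<close> of the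
  direct and \<open>1 - 1 / N\<close> of the relayed bound bound the pairwise error probability by a negative
  power of \<open>\<rho> ^ N\<close> times the product of the squared moduli of all gains, truncated at 1.
  This product is below \<open>\<rho> powr (- d)\<close> with probability of about that order, because
  \<open>E (min 1 \<bar>z\<bar>\<^sup>2) powr (- p)\<close> is finite for \<open>p < 1\<close>; otherwise the union bound shows that long codes
  have negligible error. A cyclic code, in which one antenna is active at a time, gives the same for
  the point-to-point system.
\<close>

section \<open>Circularly-symmetric Gaussians\<close>

text \<open>Helpers forward noise, so the noise at the destination is correlated and the likelihood
  has no simple form. It is never computed: only its optimality among all tests is used, and a
  linear test is analysed instead. The noise of that test stays bounded because the broadcast gain 1
  / 9 and repetition gains of at most 1 / (9 * N), also after multiplication with the link gain,
  keep the network from creating energy. These constants are generous, as constant factors do not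
  change an exponent. Helpers also mix the symbols of different sources. Yet every signal is a
  multiple of its own new symbol plus something determined by earlier slots, so Gaussian codebooks
  can be integrated slot by slot, with a bound that does not see the offset. Since
  \<open>\<rho>\<close> and \<open>L\<close> tend to infinity independently, every bound has to hold
  from some \<open>L\<close> on that does not depend on \<open>\<rho>\<close>. A large
  \<open>L\<close> also pays for the last frame of each super-frame, whose copy may be lost. In the
  converse the rate at r = 0 may stay constant, down to two messages per code, so its constants have
  to work for two messages already.\<close>

lemma nn_integral_exp_square_real:
  fixes c :: real
  assumes "c > 0"
  shows "(\<integral>\<^sup>+x. ennreal (exp (- c * x\<^sup>2)) \<partial>lborel) = ennreal (sqrt (pi / c))"
proof -
  \<comment> \<open>The normal density with this standard deviation is a multiple of the integrand,
    so its total mass 1 gives the integral.\<close>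
  define \<sigma> where "\<sigma> = sqrt (1 / (2 * c))"
  have \<sigma>: "\<sigma> > 0" "\<sigma>\<^sup>2 = 1 / (2 * c)" using assms by (auto simp: \<sigma>_def)
  interpret prob_space "density lborel (normal_density 0 \<sigma>)"
    by (rule prob_space_normal_density) (fact \<sigma>)
  have "1 = (\<integral>\<^sup>+x. ennreal (normal_density 0 \<sigma> x) \<partial>lborel)"
    using emeasure_space_1 by (simp add: emeasure_density)
  also have "\<dots> = (\<integral>\<^sup>+x. ennreal (1 / sqrt (pi / c)) * ennreal (exp (- c * x\<^sup>2)) \<partial>lborel)"
    using assms \<sigma> by (intro nn_integral_cong) (auto simp: normal_density_def ennreal_mult' [symmetric])
  also have "\<dots> = ennreal (1 / sqrt (pi / c)) * (\<integral>\<^sup>+x. ennreal (exp (- c * x\<^sup>2)) \<partial>lborel)"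
    by (rule nn_integral_cmult) auto
  finally have *: "1 = ennreal (1 / sqrt (pi / c)) * (\<integral>\<^sup>+x. ennreal (exp (- c * x\<^sup>2)) \<partial>lborel)" .
  have "ennreal (sqrt (pi / c)) =
      ennreal (sqrt (pi / c)) * ennreal (1 / sqrt (pi / c)) * (\<integral>\<^sup>+x. ennreal (exp (- c * x\<^sup>2)) \<partial>lborel)"
    using * by (simp add: mult.assoc)
  also have "ennreal (sqrt (pi / c)) * ennreal (1 / sqrt (pi / c)) = 1"
    using assms by (simp add: ennreal_mult' [symmetric])
  finally show ?thesis by simp
qed

lemma nn_integral_exp_cmod_square:
  fixes c :: real
  assumes "c > 0"
  shows "(\<integral>\<^sup>+z. ennreal (exp (- c * (cmod z)\<^sup>2)) \<partial>lborel) = ennreal (pi / c)"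
proof -
  have "(\<integral>\<^sup>+z. ennreal (exp (- c * (cmod z)\<^sup>2)) \<partial>lborel)
      = (\<integral>\<^sup>+z. (\<Prod>b\<in>Basis. ennreal (exp (- c * ((z::complex) \<bullet> b)\<^sup>2))) \<partial>lborel)"
    by (intro nn_integral_cong)
      (simp add: Basis_complex_def cmod_power2 ennreal_mult' [symmetric] exp_add [symmetric]
        algebra_simps complex_inner_1_right complex_inner_i_right)
  also have "\<dots> = (\<Prod>b\<in>(Basis :: complex set). (\<integral>\<^sup>+x. ennreal (exp (- c * x\<^sup>2)) \<partial>lborel))"
    using nn_integral_lborel_prod[where 'a=complex and f="\<lambda>_ x. exp (- c * x\<^sup>2)"] by (simp add: prod_ennreal)
  also have "\<dots> = ennreal (sqrt (pi / c)) * ennreal (sqrt (pi / c))"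
    by (simp only: nn_integral_exp_square_real[OF assms]) (simp add: Basis_complex_def)
  also have "\<dots> = ennreal (pi / c)"
    using assms by (simp add: ennreal_mult' [symmetric])
  finally show ?thesis .
qed

lemma nn_integral_lborel_translate:
  fixes f :: "'a::euclidean_space \<Rightarrow> ennreal"
  assumes [measurable]: "f \<in> borel_measurable borel"
  shows "(\<integral>\<^sup>+z. f (c + z) \<partial>lborel) = (\<integral>\<^sup>+z. f z \<partial>lborel)"
proof -
  have "(\<integral>\<^sup>+z. f z \<partial>lborel) = (\<integral>\<^sup>+z. f z \<partial>distr lborel borel ((+) c))"
    by (simp add: lborel_distr_plus)
  also have "\<dots> = (\<integral>\<^sup>+z. f (c + z) \<partial>lborel)"
    by (rule nn_integral_distr) auto
  finally show ?thesis by simp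
qed

lemma measurable_cn_density [measurable]: "cn_density s \<in> borel_measurable borel"
  unfolding cn_density_def[abs_def] by measurable

lemma cn_density_nonneg: "s > 0 \<Longrightarrow> cn_density s z \<ge> 0"
  by (simp add: cn_density_def)

lemma sets_cn [simp, measurable_cong]: "sets (cn s) = sets borel"
  by (simp add: cn_def)

lemma space_cn [simp]: "space (cn s) = UNIV"
  by (simp add: cn_def)

lemma nn_integral_cn:
  assumes [measurable]: "f \<in> borel_measurable borel"
  shows "(\<integral>\<^sup>+z. f z \<partial>cn s) = (\<integral>\<^sup>+z. ennreal (cn_density s z) * f z \<partial>lborel)"
  unfolding cn_def by (subst nn_integral_density) auto

lemma prob_space_cn:
  assumes "s > 0"
  shows "prob_space (cn s)"
proof
  have "emeasure (cn s) (space (cn s)) = (\<integral>\<^sup>+z. ennreal (cn_density s z) \<partial>lborel)"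
    by (simp add: cn_def emeasure_density)
  also have "\<dots> = (\<integral>\<^sup>+z. ennreal (1 / (pi * s)) * ennreal (exp (- (1 / s) * (cmod z)\<^sup>2)) \<partial>lborel)"
    using assms by (intro nn_integral_cong) (auto simp: cn_density_def ennreal_mult' [symmetric])
  also have "\<dots> = ennreal (1 / (pi * s)) * ennreal (pi / (1 / s))"
    using assms by (subst nn_integral_cmult) (simp_all add: nn_integral_exp_cmod_square[of "1/s", simplified])
  also have "\<dots> = 1"
    using assms by (simp add: ennreal_mult' [symmetric])
  finally show "emeasure (cn s) (space (cn s)) = 1" .
qed

lemma nn_integral_cn_exp_shift:
  assumes "s > 0" "c \<ge> 0"
  shows "(\<integral>\<^sup>+z. ennreal (exp (- c * (cmod z)\<^sup>2)) \<partial>cn s) = ennreal (1 / (1 + c * s))"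
proof -
  have "(\<integral>\<^sup>+z. ennreal (exp (- c * (cmod z)\<^sup>2)) \<partial>cn s)
      = (\<integral>\<^sup>+z. ennreal (1 / (pi * s)) * ennreal (exp (- (c + 1 / s) * (cmod z)\<^sup>2)) \<partial>lborel)"
    using assms by (subst nn_integral_cn, measurable, intro nn_integral_cong)
      (auto simp: cn_density_def ennreal_mult' [symmetric] exp_add [symmetric] field_simps)
  also have "\<dots> = ennreal (1 / (pi * s)) * ennreal (pi / (c + 1 / s))"
    using assms by (subst nn_integral_cmult)
      (simp_all add: nn_integral_exp_cmod_square[of "c + 1/s", simplified] add_nonneg_pos)
  also have "\<dots> = ennreal (1 / (1 + c * s))"
    using assms by (simp add: ennreal_mult' [symmetric] field_simps)
  finally show ?thesis .
qed

text \<open>The density of \<open>cn s\<close> is at most 1 / (pi * s), after which translation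
  invariance removes \<open>\<beta>\<close>. Because the bound does not see the offset, symbols can
  be integrated one at a time although relays mix them.\<close>

lemma nn_integral_cn_exp_affine_le:
  assumes "s > 0" "c > 0" "\<alpha> \<noteq> 0"
  shows "(\<integral>\<^sup>+z. ennreal (exp (- c * (cmod (\<alpha> * z + \<beta>))\<^sup>2)) \<partial>cn s)
    \<le> ennreal (min 1 (1 / (c * (cmod \<alpha>)\<^sup>2 * s)))"
proof -
  interpret prob_space "cn s" by (rule prob_space_cn) fact
  have "(\<integral>\<^sup>+z. ennreal (exp (- c * (cmod (\<alpha> * z + \<beta>))\<^sup>2)) \<partial>cn s) \<le> (\<integral>\<^sup>+z. 1 \<partial>cn s)"
    using assms by (intro nn_integral_mono) (simp)
  hence 1: "(\<integral>\<^sup>+z. ennreal (exp (- c * (cmod (\<alpha> * z + \<beta>))\<^sup>2)) \<partial>cn s) \<le> 1"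
    using emeasure_space_1 by simp
  have "(\<integral>\<^sup>+z. ennreal (exp (- c * (cmod (\<alpha> * z + \<beta>))\<^sup>2)) \<partial>cn s)
      = (\<integral>\<^sup>+z. ennreal (cn_density s z) * ennreal (exp (- c * (cmod (\<alpha> * z + \<beta>))\<^sup>2)) \<partial>lborel)"
    by (subst nn_integral_cn) auto
  also have "\<dots> \<le> (\<integral>\<^sup>+z. ennreal (1 / (pi * s)) *
        ennreal (exp (- (c * (cmod \<alpha>)\<^sup>2) * (cmod (\<beta> / \<alpha> + z))\<^sup>2)) \<partial>lborel)"
  proof (intro nn_integral_mono)
    fix z :: complex
    have "\<alpha> * z + \<beta> = \<alpha> * (\<beta> / \<alpha> + z)" using assms by (simp add: field_simps)
    hence "(cmod (\<alpha> * z + \<beta>))\<^sup>2 = (cmod \<alpha>)\<^sup>2 * (cmod (\<beta> / \<alpha> + z))\<^sup>2"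
      by (simp add: norm_mult power_mult_distrib)
    moreover have "cn_density s z \<le> 1 / (pi * s)"
      using assms by (simp add: cn_density_def divide_right_mono)
    ultimately show "ennreal (cn_density s z) * ennreal (exp (- c * (cmod (\<alpha> * z + \<beta>))\<^sup>2))
       \<le> ennreal (1 / (pi * s)) * ennreal (exp (- (c * (cmod \<alpha>)\<^sup>2) * (cmod (\<beta> / \<alpha> + z))\<^sup>2))"
      by (intro mult_mono) (auto intro!: ennreal_leI simp: mult.assoc)
  qed
  also have "\<dots> = ennreal (1 / (pi * s)) *
      (\<integral>\<^sup>+z. ennreal (exp (- (c * (cmod \<alpha>)\<^sup>2) * (cmod z)\<^sup>2)) \<partial>lborel)"
    by (subst nn_integral_cmult)
       (auto simp: nn_integral_lborel_translate[where f="\<lambda>z. ennreal (exp (- (c * (cmod \<alpha>)\<^sup>2) * (cmod z)\<^sup>2))", simplified])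
  also have "\<dots> = ennreal (1 / (c * (cmod \<alpha>)\<^sup>2 * s))"
    using assms nn_integral_exp_cmod_square[of "c * (cmod \<alpha>)\<^sup>2"] by (simp add: ennreal_mult' [symmetric])
  finally show ?thesis using 1 by (auto simp: min_def)
qed

lemma nn_integral_cn_exp_Re:
  assumes "s > 0"
  shows "(\<integral>\<^sup>+z. ennreal (exp (Re (\<alpha> * z))) \<partial>cn s) = ennreal (exp (s * (cmod \<alpha>)\<^sup>2 / 4))"
proof -
  \<comment> \<open>\<open>m\<close> is minus the centre of the Gaussian tilted by
    \<open>exp (Re (\<alpha> * z))\<close>; completing the square there leaves the constant s *
    |alpha|^2 / 4.\<close>
  define m where "m = - (complex_of_real (s / 2) * cnj \<alpha>)"
  have eq: "- (cmod z)\<^sup>2 / s + Re (\<alpha> * z) = s * (cmod \<alpha>)\<^sup>2 / 4 - (1 / s) * (cmod (m + z))\<^sup>2" for z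
    using assms by (simp only: cmod_power2) (simp add: m_def field_simps power2_eq_square)
  have "(\<integral>\<^sup>+z. ennreal (exp (Re (\<alpha> * z))) \<partial>cn s)
      = (\<integral>\<^sup>+z. ennreal (exp (s * (cmod \<alpha>)\<^sup>2 / 4) / (pi * s)) *
          ennreal (exp (- (1 / s) * (cmod (m + z))\<^sup>2)) \<partial>lborel)"
  proof (subst nn_integral_cn, measurable, intro nn_integral_cong)
    fix z
    have "cn_density s z * exp (Re (\<alpha> * z)) = exp (- (cmod z)\<^sup>2 / s + Re (\<alpha> * z)) / (pi * s)"
      by (simp add: cn_density_def exp_add[symmetric])
    also have "\<dots> = exp (s * (cmod \<alpha>)\<^sup>2 / 4) / (pi * s) * exp (- (1 / s) * (cmod (m + z))\<^sup>2)"
      unfolding eq exp_diff mult_minus_left exp_minus by (simp only: divide_inverse mult_ac)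
    finally show "ennreal (cn_density s z) * ennreal (exp (Re (\<alpha> * z))) =
        ennreal (exp (s * (cmod \<alpha>)\<^sup>2 / 4) / (pi * s)) * ennreal (exp (- (1 / s) * (cmod (m + z))\<^sup>2))"
      using assms by (simp add: ennreal_mult' [symmetric] cn_density_nonneg)
  qed
  also have "\<dots> = ennreal (exp (s * (cmod \<alpha>)\<^sup>2 / 4) / (pi * s)) *
      (\<integral>\<^sup>+z. ennreal (exp (- (1 / s) * (cmod z)\<^sup>2)) \<partial>lborel)"
    by (subst nn_integral_cmult)
      (auto simp: nn_integral_lborel_translate[where f="\<lambda>z. ennreal (exp (- (1 / s) * (cmod z)\<^sup>2))", simplified])
  also have "\<dots> = ennreal (exp (s * (cmod \<alpha>)\<^sup>2 / 4))"
    using assms nn_integral_exp_cmod_square[of "1 / s"] by (simp add: ennreal_mult' [symmetric])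
  finally show ?thesis .
qed

lemma le_exp_half: "(x::real) \<le> exp (x / 2)"
proof -
  have "x / 2 \<le> exp (x / 2 - 1)" using exp_ge_add_one_self[of "x/2 - 1"] by simp
  also have "\<dots> = exp (x / 2) * exp (-1)" by (simp add: exp_add[symmetric])
  also have "\<dots> \<le> exp (x / 2) * (1 / 2)"
    using exp_ge_add_one_self[of 1] by (intro mult_left_mono) (auto simp: exp_minus divide_simps)
  finally show ?thesis by simp
qed

text \<open>The exact value is \<open>s\<close>, but a multiple of it suffices.
  \<open>le_exp_half\<close> trades the factor |z|^2 for half of the exponent, which leaves a
  Gaussian of twice the variance.\<close>

lemma nn_integral_cn_cmod_square_le:
  assumes "s > 0"
  shows "(\<integral>\<^sup>+z. ennreal ((cmod z)\<^sup>2) \<partial>cn s) \<le> ennreal (4 * s)"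
proof -
  interpret prob_space "cn s" by (rule prob_space_cn) fact
  have "(\<integral>\<^sup>+z. ennreal ((cmod z)\<^sup>2) \<partial>cn s) = (\<integral>\<^sup>+z. ennreal ((cmod z)\<^sup>2) * ennreal (cn_density s z) \<partial>lborel)"
    by (subst nn_integral_cn) (auto simp: mult.commute)
  also have "\<dots> \<le> (\<integral>\<^sup>+z. ennreal (1 / pi) * ennreal (exp (- (1 / (2 * s)) * (cmod z)\<^sup>2)) \<partial>lborel)"
  proof (intro nn_integral_mono)
    fix z :: complex
    have "(cmod z)\<^sup>2 / s \<le> exp ((cmod z)\<^sup>2 / s / 2)" by (rule le_exp_half)
    hence "(cmod z)\<^sup>2 / s * (exp (- (cmod z)\<^sup>2 / s) / pi)
        \<le> exp ((cmod z)\<^sup>2 / s / 2) * (exp (- (cmod z)\<^sup>2 / s) / pi)"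
      by (intro mult_right_mono) auto
    also have "\<dots> = 1 / pi * exp (- (1 / (2 * s)) * (cmod z)\<^sup>2)"
      using assms by (simp add: exp_add[symmetric] field_simps)
    finally have "(cmod z)\<^sup>2 * cn_density s z \<le> 1 / pi * exp (- (1 / (2 * s)) * (cmod z)\<^sup>2)"
      using assms by (simp add: cn_density_def field_simps)
    thus "ennreal ((cmod z)\<^sup>2) * ennreal (cn_density s z)
        \<le> ennreal (1 / pi) * ennreal (exp (- (1 / (2 * s)) * (cmod z)\<^sup>2))"
      using assms by (auto simp: ennreal_mult' [symmetric] cn_density_nonneg intro!: ennreal_leI)
  qed
  also have "\<dots> = ennreal (1 / pi) * ennreal (pi / (1 / (2 * s)))"
    using assms nn_integral_exp_cmod_square[of "1 / (2 * s)"] by (subst nn_integral_cmult) auto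
  also have "\<dots> = ennreal (2 * s)"
    using assms by (simp add: ennreal_mult' [symmetric])
  also have "\<dots> \<le> ennreal (4 * s)" using assms by (intro ennreal_leI) auto
  finally show ?thesis .
qed

section \<open>Product measures: densities, translations and reflections\<close>

lemma product_sigma_finite_cn: "s > 0 \<Longrightarrow> product_sigma_finite (\<lambda>_. cn s)"
  by (rule product_sigma_finite.intro) (intro prob_space_imp_sigma_finite prob_space_cn)

lemma product_sigma_finite_lborel: "product_sigma_finite (\<lambda>_. lborel)"
  by (rule product_sigma_finite.intro) (rule lborel.sigma_finite_measure_axioms)

lemma prob_space_PiM_cn: "s > 0 \<Longrightarrow> prob_space (PiM I (\<lambda>_. cn s))"
  by (intro prob_space_PiM prob_space_cn)

lemma sets_PiM_cn [measurable_cong]: "sets (PiM I (\<lambda>_. cn s)) = sets (PiM I (\<lambda>_. borel))"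
  by (intro sets_PiM_cong) auto

lemma sets_PiM_lborel [measurable_cong]: "sets (PiM I (\<lambda>_. lborel)) = sets (PiM I (\<lambda>_. borel))"
  by (intro sets_PiM_cong) auto

lemma PiM_cn_eq_density:
  fixes I :: "'i set"
  assumes "finite I" "s > 0"
  shows "PiM I (\<lambda>_. cn s) = density (PiM I (\<lambda>_. lborel)) (\<lambda>x. \<Prod>i\<in>I. ennreal (cn_density s (x i)))"
proof -
  interpret product_sigma_finite "\<lambda>_. cn s" by (rule product_sigma_finite_cn) fact
  interpret L: product_sigma_finite "\<lambda>_. lborel :: complex measure" by (rule product_sigma_finite_lborel)
  show ?thesis
  proof (rule PiM_eqI[symmetric, OF assms(1)])
    show "sets (density (Pi\<^sub>M I (\<lambda>_. lborel)) (\<lambda>x. \<Prod>i\<in>I. ennreal (cn_density s (x i)))) = sets (Pi\<^sub>M I (\<lambda>_. cn s))"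
      by (simp add: sets_PiM_lborel sets_PiM_cn)
  next
    fix A :: "'i \<Rightarrow> complex set" assume A: "\<And>i. i \<in> I \<Longrightarrow> A i \<in> sets (cn s)"
    hence A': "\<And>i. i \<in> I \<Longrightarrow> A i \<in> sets borel" by simp
    have "PiE I A \<in> sets (PiM I (\<lambda>_. lborel))"
      using A' by (intro sets_PiM_I_finite assms) auto
    hence "emeasure (density (PiM I (\<lambda>_. lborel)) (\<lambda>x. \<Prod>i\<in>I. ennreal (cn_density s (x i)))) (PiE I A)
        = (\<integral>\<^sup>+x. (\<Prod>i\<in>I. ennreal (cn_density s (x i))) * indicator (PiE I A) x \<partial>PiM I (\<lambda>_. lborel))"
      by (subst emeasure_density) auto
    also have "\<dots> = (\<integral>\<^sup>+x. (\<Prod>i\<in>I. ennreal (cn_density s (x i)) * indicator (A i) (x i)) \<partial>PiM I (\<lambda>_. lborel))"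
    proof (intro nn_integral_cong)
      fix x :: "'i \<Rightarrow> complex" assume "x \<in> space (Pi\<^sub>M I (\<lambda>_. lborel))"
      hence "x \<in> extensional I" by (simp add: space_PiM PiE_def)
      hence "indicator (PiE I A) x = (\<Prod>i\<in>I. indicator (A i) (x i) :: ennreal)"
        using assms(1) by (cases "x \<in> Pi I A") (auto simp: indicator_def PiE_def Pi_iff)
      thus "(\<Prod>i\<in>I. ennreal (cn_density s (x i))) * indicator (PiE I A) x
          = (\<Prod>i\<in>I. ennreal (cn_density s (x i)) * indicator (A i) (x i))"
        by (simp add: prod.distrib)
    qed
    also have "\<dots> = (\<Prod>i\<in>I. \<integral>\<^sup>+z. ennreal (cn_density s z) * indicator (A i) z \<partial>lborel)"
    proof (rule L.product_nn_integral_prod[OF assms(1)])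
      fix i assume "i \<in> I"
      note [measurable] = A'[OF this]
      show "(\<lambda>z. ennreal (cn_density s z) * indicator (A i) z) \<in> borel_measurable lborel"
        by measurable
    qed
    also have "\<dots> = (\<Prod>i\<in>I. emeasure (cn s) (A i))"
      using A' by (intro prod.cong refl) (simp add: cn_def emeasure_density)
    finally show "emeasure (density (PiM I (\<lambda>_. lborel)) (\<lambda>x. \<Prod>i\<in>I. ennreal (cn_density s (x i)))) (PiE I A)
       = (\<Prod>i\<in>I. emeasure (cn s) (A i))" .
  qed
qed

text \<open>Serves two invariances: that of Lebesgue measure under translations and that of
  \<open>cn s\<close> under negation.\<close>

lemma distr_PiM_componentwise:
  fixes I :: "'i set"
  assumes "product_sigma_finite (\<lambda>_::'i. M)" and I: "finite I"
    and f [measurable]: "\<And>i. i \<in> I \<Longrightarrow> f i \<in> measurable M M" and inv: "\<And>i. i \<in> I \<Longrightarrow> distr M M (f i) = M"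
  shows "distr (PiM I (\<lambda>_. M)) (PiM I (\<lambda>_. M)) (\<lambda>x. \<lambda>i\<in>I. f i (x i)) = PiM I (\<lambda>_. M)"
proof -
  interpret product_sigma_finite "\<lambda>_::'i. M" by fact
  have meas: "(\<lambda>x. \<lambda>i\<in>I. f i (x i)) \<in> measurable (PiM I (\<lambda>_. M)) (PiM I (\<lambda>_. M))"
    by (intro measurable_restrict) measurable
  show ?thesis
  proof (rule PiM_eqI[OF I])
    fix A assume A: "\<And>i. i \<in> I \<Longrightarrow> A i \<in> sets M"
    have "emeasure (distr (PiM I (\<lambda>_. M)) (PiM I (\<lambda>_. M)) (\<lambda>x. \<lambda>i\<in>I. f i (x i))) (PiE I A)
        = emeasure (PiM I (\<lambda>_. M)) ((\<lambda>x. \<lambda>i\<in>I. f i (x i)) -` PiE I A \<inter> space (PiM I (\<lambda>_. M)))"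
      using A by (intro emeasure_distr meas sets_PiM_I_finite I) auto
    also have "(\<lambda>x. \<lambda>i\<in>I. f i (x i)) -` PiE I A \<inter> space (PiM I (\<lambda>_. M)) = PiE I (\<lambda>i. f i -` A i \<inter> space M)"
      by (auto simp: space_PiM PiE_def Pi_def)
    also have "emeasure (PiM I (\<lambda>_. M)) \<dots> = (\<Prod>i\<in>I. emeasure M (f i -` A i \<inter> space M))"
      using A by (intro emeasure_PiM I) auto
    also have "\<dots> = (\<Prod>i\<in>I. emeasure (distr M M (f i)) (A i))"
      using A by (intro prod.cong refl) (simp add: emeasure_distr)
    also have "\<dots> = (\<Prod>i\<in>I. emeasure M (A i))"
      by (intro prod.cong refl) (simp add: inv)
    finally show "emeasure (distr (PiM I (\<lambda>_. M)) (PiM I (\<lambda>_. M)) (\<lambda>x. \<lambda>i\<in>I. f i (x i))) (PiE I A)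
        = (\<Prod>i\<in>I. emeasure M (A i))" .
  qed simp
qed

lemma nn_integral_PiM_lborel_translate:
  fixes d :: "'i \<Rightarrow> complex"
  assumes "finite I" and [measurable]: "F \<in> borel_measurable (PiM I (\<lambda>_. borel))"
  shows "(\<integral>\<^sup>+x. F (\<lambda>i\<in>I. d i + x i) \<partial>PiM I (\<lambda>_. lborel)) = (\<integral>\<^sup>+x. F x \<partial>PiM I (\<lambda>_. lborel))"
proof -
  have "(\<integral>\<^sup>+x. F x \<partial>PiM I (\<lambda>_. lborel)) =
      (\<integral>\<^sup>+x. F x \<partial>distr (PiM I (\<lambda>_. lborel)) (PiM I (\<lambda>_. lborel)) (\<lambda>x. \<lambda>i\<in>I. d i + x i))"
  proof (subst distr_PiM_componentwise[OF product_sigma_finite_lborel assms(1)])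
    show "distr lborel lborel ((+) (d i)) = lborel" for i
      using lborel_distr_plus[of "d i"] by (simp cong: distr_cong)
  qed simp_all
  also have "\<dots> = (\<integral>\<^sup>+x. F (\<lambda>i\<in>I. d i + x i) \<partial>PiM I (\<lambda>_. lborel))"
    by (rule nn_integral_distr) measurable
  finally show ?thesis by simp
qed

lemma nn_integral_PiM_cn:
  assumes "finite I" "s > 0" and [measurable]: "F \<in> borel_measurable (PiM I (\<lambda>_. borel))"
  shows "(\<integral>\<^sup>+x. F x \<partial>PiM I (\<lambda>_. cn s)) =
    (\<integral>\<^sup>+x. (\<Prod>i\<in>I. ennreal (cn_density s (x i))) * F x \<partial>PiM I (\<lambda>_. lborel))"
  unfolding PiM_cn_eq_density[OF assms(1,2)] by (rule nn_integral_density) measurable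

text \<open>A mean \<open>d\<close> of the noise moves into the density, so that the laws of the
  output for different inputs share one reference measure.\<close>

lemma nn_integral_PiM_cn_translate:
  assumes "finite I" "s > 0" and [measurable]: "F \<in> borel_measurable (PiM I (\<lambda>_. borel))"
  shows "(\<integral>\<^sup>+x. F (\<lambda>i\<in>I. d i + x i) \<partial>PiM I (\<lambda>_. cn s)) =
    (\<integral>\<^sup>+y. (\<Prod>i\<in>I. ennreal (cn_density s (y i - d i))) * F y \<partial>PiM I (\<lambda>_. lborel))"
proof -
  let ?G = "\<lambda>y. (\<Prod>i\<in>I. ennreal (cn_density s (y i - d i))) * F y"
  have "(\<integral>\<^sup>+x. F (\<lambda>i\<in>I. d i + x i) \<partial>PiM I (\<lambda>_. cn s)) =
     (\<integral>\<^sup>+x. (\<Prod>i\<in>I. ennreal (cn_density s (x i))) * F (\<lambda>i\<in>I. d i + x i) \<partial>PiM I (\<lambda>_. lborel))"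
    by (intro nn_integral_PiM_cn assms) measurable
  also have "\<dots> = (\<integral>\<^sup>+x. ?G (\<lambda>i\<in>I. d i + x i) \<partial>PiM I (\<lambda>_. lborel))"
    by (intro nn_integral_cong arg_cong2[of _ _ _ _ "(*)"] prod.cong) auto
  also have "\<dots> = (\<integral>\<^sup>+y. ?G y \<partial>PiM I (\<lambda>_. lborel))"
    by (intro nn_integral_PiM_lborel_translate assms) measurable
  finally show ?thesis .
qed

lemma nn_integral_PiM_cn_uminus:
  assumes "finite I" "s > 0" and [measurable]: "F \<in> borel_measurable (PiM I (\<lambda>_. borel))"
  shows "(\<integral>\<^sup>+x. F (\<lambda>i\<in>I. - x i) \<partial>PiM I (\<lambda>_. cn s)) = (\<integral>\<^sup>+x. F x \<partial>PiM I (\<lambda>_. cn s))"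
proof -
  have L: "distr lborel borel uminus = (lborel :: complex measure)"
    using lborel_affine[of "-1" "0::complex"] by (simp add: density_1)
  have "distr (cn s) (cn s) uminus = cn s"
  proof (rule measure_eqI)
    fix A assume "A \<in> sets (distr (cn s) (cn s) uminus)"
    hence [measurable]: "A \<in> sets borel" by simp
    have "emeasure (distr (cn s) (cn s) uminus) A = (\<integral>\<^sup>+z. indicator A (- z) \<partial>cn s)"
      by (subst nn_integral_indicator[symmetric], simp, subst nn_integral_distr) measurable
    also have "\<dots> = (\<integral>\<^sup>+z. ennreal (cn_density s z) * indicator A (- z) \<partial>lborel)"
      by (rule nn_integral_cn) measurable
    also have "\<dots> = (\<integral>\<^sup>+z. ennreal (cn_density s (- z)) * indicator A (- z) \<partial>lborel)"
      by (simp add: cn_density_def)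
    also have "\<dots> = (\<integral>\<^sup>+z. ennreal (cn_density s z) * indicator A z \<partial>distr lborel borel uminus)"
      by (subst nn_integral_distr) auto
    also have "\<dots> = emeasure (cn s) A"
      unfolding L by (simp add: cn_def emeasure_density)
    finally show "emeasure (distr (cn s) (cn s) uminus) A = emeasure (cn s) A" .
  qed simp
  hence "(\<integral>\<^sup>+x. F x \<partial>PiM I (\<lambda>_. cn s)) =
      (\<integral>\<^sup>+x. F x \<partial>distr (PiM I (\<lambda>_. cn s)) (PiM I (\<lambda>_. cn s)) (\<lambda>x. \<lambda>i\<in>I. - x i))"
    by (subst distr_PiM_componentwise[OF product_sigma_finite_cn[OF assms(2)] assms(1)]) simp_all
  also have "\<dots> = (\<integral>\<^sup>+x. F (\<lambda>i\<in>I. - x i) \<partial>PiM I (\<lambda>_. cn s))"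
    by (rule nn_integral_distr) measurable
  finally show ?thesis by simp
qed

section \<open>Probabilities of discs and negative moments of a gain\<close>

lemma square_box_subset:
  fixes r :: real
  shows "cbox (Complex (- r / 2) (- r / 2)) (Complex (r / 2) (r / 2)) \<subseteq> {z. (cmod z)\<^sup>2 \<le> r\<^sup>2}"
    and "{z. (cmod z)\<^sup>2 \<le> r\<^sup>2} \<subseteq> cbox (Complex (- \<bar>r\<bar>) (- \<bar>r\<bar>)) (Complex \<bar>r\<bar> \<bar>r\<bar>)"
proof -
  have "(cmod z)\<^sup>2 \<le> r\<^sup>2" if "\<bar>Re z\<bar> \<le> r / 2" "\<bar>Im z\<bar> \<le> r / 2" for z
  proof -
    have "(Re z)\<^sup>2 \<le> (r / 2)\<^sup>2" "(Im z)\<^sup>2 \<le> (r / 2)\<^sup>2"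
      using power_mono[OF that(1), of 2] power_mono[OF that(2), of 2] by simp_all
    hence "(cmod z)\<^sup>2 \<le> r\<^sup>2 / 4 + r\<^sup>2 / 4"
      unfolding cmod_power2 power_divide by simp
    also have "\<dots> \<le> r\<^sup>2" by simp
    finally show ?thesis .
  qed
  thus "cbox (Complex (- r / 2) (- r / 2)) (Complex (r / 2) (r / 2)) \<subseteq> {z. (cmod z)\<^sup>2 \<le> r\<^sup>2}"
    by (auto simp: cbox_def Basis_complex_def)
  have "\<bar>Re z\<bar> \<le> \<bar>r\<bar>" "\<bar>Im z\<bar> \<le> \<bar>r\<bar>" if "(cmod z)\<^sup>2 \<le> r\<^sup>2" for z
    using that power2_le_iff_abs_le[of "\<bar>r\<bar>" "cmod z"] abs_Re_le_cmod[of z] abs_Im_le_cmod[of z] by simp_all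
  thus "{z. (cmod z)\<^sup>2 \<le> r\<^sup>2} \<subseteq> cbox (Complex (- \<bar>r\<bar>) (- \<bar>r\<bar>)) (Complex \<bar>r\<bar> \<bar>r\<bar>)"
    by (fastforce simp: cbox_def Basis_complex_def)
qed

lemma emeasure_lborel_square:
  assumes "l \<ge> 0"
  shows "emeasure lborel (cbox (Complex (- l) (- l)) (Complex l l)) = ennreal (4 * l\<^sup>2)"
proof -
  have "Complex l l - Complex (- l) (- l) = Complex (2 * l) (2 * l)" by (simp add: complex_eq_iff)
  thus ?thesis using assms
    by (subst emeasure_lborel_cbox) (auto simp: Basis_complex_def power2_eq_square)
qed

text \<open>On the unit disc the density is at least 1 / (pi * e). Only the power of
  \<open>t\<close> matters, so an inscribed square of area \<open>t\<close> replaces the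
  disc.\<close>

lemma emeasure_cn_disc_ge:
  assumes "0 < t" "t \<le> 1"
  shows "emeasure (cn 1) {z. (cmod z)\<^sup>2 \<le> t} \<ge> ennreal (t / (pi * exp 1))"
proof -
  define A where "A = {z. (cmod z)\<^sup>2 \<le> t}"
  have A [measurable]: "A \<in> sets borel" unfolding A_def by measurable
  let ?B = "cbox (Complex (- sqrt t / 2) (- sqrt t / 2)) (Complex (sqrt t / 2) (sqrt t / 2))"
  have "ennreal (t / (pi * exp 1)) = ennreal (1 / (pi * exp 1)) * ennreal (4 * (sqrt t / 2)\<^sup>2)"
    using assms by (simp add: ennreal_mult' [symmetric] power_divide)
  also have "ennreal (4 * (sqrt t / 2)\<^sup>2) = emeasure lborel ?B"
    using emeasure_lborel_square[of "sqrt t / 2"] assms by simp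
  also have "\<dots> \<le> emeasure lborel A"
    using square_box_subset(1)[of "sqrt t"] assms by (intro emeasure_mono) (auto simp: A_def)
  also have "ennreal (1 / (pi * exp 1)) * emeasure lborel A
      = (\<integral>\<^sup>+z. ennreal (1 / (pi * exp 1)) * indicator A z \<partial>lborel)"
    by (subst nn_integral_cmult_indicator) auto
  also have "\<dots> \<le> (\<integral>\<^sup>+z. ennreal (cn_density 1 z) * indicator A z \<partial>lborel)"
    using assms by (intro nn_integral_mono)
      (auto simp: indicator_def A_def cn_density_def exp_minus field_simps intro!: ennreal_leI)
  also have "\<dots> = emeasure (cn 1) A"
    by (simp add: cn_def emeasure_density)
  finally show ?thesis by (simp add: A_def mult_left_mono)
qed

lemma emeasure_cn_disc_le:
  assumes "0 \<le> t"
  shows "emeasure (cn 1) {z. (cmod z)\<^sup>2 \<le> t} \<le> ennreal (4 * t)"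
proof -
  define A where "A = {z. (cmod z)\<^sup>2 \<le> t}"
  have A [measurable]: "A \<in> sets borel" unfolding A_def by measurable
  have "emeasure (cn 1) A = (\<integral>\<^sup>+z. ennreal (cn_density 1 z) * indicator A z \<partial>lborel)"
    by (simp add: cn_def emeasure_density)
  also have "\<dots> \<le> (\<integral>\<^sup>+z. indicator A z \<partial>lborel)"
  proof (intro nn_integral_mono)
    fix z
    have "cn_density 1 z \<le> 1 / pi" by (simp add: cn_density_def divide_right_mono)
    also have "\<dots> \<le> 1" using pi_gt3 by simp
    finally show "ennreal (cn_density 1 z) * indicator A z \<le> indicator A z"
      by (auto simp: indicator_def)
  qed
  also have "\<dots> = emeasure lborel A" by simp
  also have "\<dots> \<le> emeasure lborel (cbox (Complex (- sqrt t) (- sqrt t)) (Complex (sqrt t) (sqrt t)))"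
    using square_box_subset(2)[of "sqrt t"] assms by (intro emeasure_mono) (auto simp: A_def)
  also have "\<dots> = ennreal (4 * t)"
    using emeasure_lborel_square[of "sqrt t"] assms by simp
  finally show ?thesis by (simp add: A_def)
qed

text \<open>At \<open>z = 0\<close> the integrand below is \<open>0 powr (- p) = 0\<close>; this point has measure zero.\<close>

lemma nn_integral_cn_negative_moment:
  assumes p: "0 < p" "p < 1"
  shows "(\<integral>\<^sup>+z. ennreal (min 1 ((cmod z)\<^sup>2) powr (- p)) \<partial>cn 1) < \<infinity>"
proof -
  interpret prob_space "cn 1" by (rule prob_space_cn) simp
  \<comment> \<open>Dyadic shells: where |z|^2 lies between 2^(-k-1) and 2^(-k), the integrand is at
    most 2^(p * (k + 1)), and this has probability at most 4 * 2^(-k). The resulting geometric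
    series has ratio \<open>q\<close>, which is below 1 because \<open>p < 1\<close>.\<close>
  define q where "q = 2 powr (p - 1)"
  have q: "0 < q" "q < 1" using p by (auto simp: q_def powr_less_one)
  define A where "A k = {z. (cmod z)\<^sup>2 \<le> (1 / 2) ^ k}" for k
  have [measurable]: "A k \<in> sets borel" for k unfolding A_def by measurable
  let ?c = "\<lambda>k. 2 powr (p * (real k + 1))"
  have single: "f k \<le> (\<Sum>k. f k)" for f :: "nat \<Rightarrow> ennreal" and k
    using sum_le_suminf[of f "{k}"] by simp
  have le: "ennreal (min 1 ((cmod z)\<^sup>2) powr (- p)) \<le> 1 + (\<Sum>k. ennreal (?c k) * indicator (A k) z)" for z
  proof (cases "z = 0 \<or> (cmod z)\<^sup>2 > 1")
    case True thus ?thesis by (auto simp: min_def)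
  next
    case False
    define u where "u = (cmod z)\<^sup>2"
    have u: "0 < u" "u \<le> 1" "min 1 ((cmod z)\<^sup>2) = u" using False by (auto simp: u_def)
    define k where "k = nat \<lfloor>log 2 (1 / u)\<rfloor>"
    have l0: "log 2 (1 / u) \<ge> 0" using u by simp
    have k: "real k \<le> log 2 (1 / u)" "log 2 (1 / u) < real k + 1"
      using l0 unfolding k_def by linarith+
    have "2 ^ k \<le> 1 / u" using k(1) u by (simp add: le_log_iff powr_realpow)
    hence "u \<le> (1 / 2) ^ k" using u by (simp add: field_simps power_one_over)
    hence kA: "z \<in> A k" by (simp add: A_def u_def)
    have "u powr (- p) = (1 / u) powr p" using u by (simp add: powr_minus inverse_powr inverse_eq_divide[symmetric])
    also have "\<dots> = (2 powr log 2 (1 / u)) powr p" using u by simp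
    also have "\<dots> \<le> (2 powr (real k + 1)) powr p"
      using k(2) p by (intro powr_mono2 powr_mono) auto
    also have "\<dots> = ?c k" by (simp add: powr_powr mult.commute)
    finally have "ennreal (min 1 ((cmod z)\<^sup>2) powr (- p)) \<le> ennreal (?c k) * indicator (A k) z"
      using kA u(3) by (simp add: ennreal_leI)
    also have "\<dots> \<le> (\<Sum>k. ennreal (?c k) * indicator (A k) z)"
      by (rule single) 
    also have "\<dots> \<le> 1 + (\<Sum>k. ennreal (?c k) * indicator (A k) z)" by simp
    finally show ?thesis .
  qed
  have "(\<integral>\<^sup>+z. ennreal (min 1 ((cmod z)\<^sup>2) powr (- p)) \<partial>cn 1)
      \<le> (\<integral>\<^sup>+z. 1 + (\<Sum>k. ennreal (?c k) * indicator (A k) z) \<partial>cn 1)"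
    by (intro nn_integral_mono le)
  also have "\<dots> = 1 + (\<integral>\<^sup>+z. (\<Sum>k. ennreal (?c k) * indicator (A k) z) \<partial>cn 1)"
    using emeasure_space_1 by (subst nn_integral_add) auto
  also have "(\<integral>\<^sup>+z. (\<Sum>k. ennreal (?c k) * indicator (A k) z) \<partial>cn 1)
      = (\<Sum>k. ennreal (?c k) * emeasure (cn 1) (A k))"
    by (subst nn_integral_suminf) (auto simp: nn_integral_cmult_indicator)
  also have "\<dots> \<le> (\<Sum>k. ennreal (8 * q ^ k))"
  proof (intro suminf_le allI)
    fix k
    have "ennreal (?c k) * emeasure (cn 1) (A k) \<le> ennreal (?c k) * ennreal (4 * (1 / 2) ^ k)"
      unfolding A_def by (intro mult_left_mono emeasure_cn_disc_le) auto
    also have "\<dots> = ennreal (?c k * (4 * (1 / 2) ^ k))" by (simp add: ennreal_mult')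
    also have "?c k * (4 * (1 / 2) ^ k) \<le> 8 * q ^ k"
    proof -
      have "(1 / 2 :: real) ^ k = 2 powr (- real k)"
        by (simp add: powr_minus powr_realpow power_one_over inverse_eq_divide)
      moreover have "q ^ k = 2 powr ((p - 1) * real k)"
        by (simp add: q_def powr_powr flip: powr_realpow)
      ultimately have "?c k * (4 * (1 / 2) ^ k) = 4 * 2 powr p * q ^ k"
        by (simp add: algebra_simps flip: powr_add)
      moreover have "2 powr p \<le> 2 powr 1" using p by (intro powr_mono) auto
      moreover from this have "4 * 2 powr p * q ^ k \<le> 8 * q ^ k"
        using q by (intro mult_right_mono) auto
      ultimately show ?thesis by (simp only:)
    qed
    finally show "ennreal (?c k) * emeasure (cn 1) (A k) \<le> ennreal (8 * q ^ k)"
      by (simp add: ennreal_leI)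
  qed auto
  also have "\<dots> < \<infinity>"
    using q by (subst suminf_ennreal2) (auto intro!: summable_mult summable_geometric)
  finally show ?thesis by (simp add: top.not_eq_extremum)
qed

section \<open>A strong converse for Gaussian noise\<close>

definition energy :: "'i set \<Rightarrow> ('i \<Rightarrow> complex) \<Rightarrow> real" where
  "energy I x = (\<Sum>i\<in>I. (cmod (x i))\<^sup>2)"

lemma energy_nonneg [simp]: "energy I x \<ge> 0"
  by (auto simp: energy_def intro: sum_nonneg)

lemma measurable_energy [measurable]:
  assumes "\<And>i. i \<in> I \<Longrightarrow> (\<lambda>x. f x i) \<in> borel_measurable M"
  shows "(\<lambda>x. energy I (f x)) \<in> borel_measurable M"
  unfolding energy_def using assms by measurable

lemma energy_cong: "(\<And>i. i \<in> I \<Longrightarrow> x i = y i) \<Longrightarrow> energy I x = energy I y"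
  by (simp add: energy_def)

lemma energy_parallelogram:
  "energy I (\<lambda>i. x i - y i) + energy I (\<lambda>i. x i + y i) = 2 * (energy I x + energy I y)"
  unfolding energy_def sum.distrib[symmetric] sum_distrib_left
  by (intro sum.cong refl, simp only: cmod_power2) (simp add: power2_eq_square algebra_simps)

lemma prod_cn_density:
  assumes "finite I" "s > 0"
  shows "(\<Prod>i\<in>I. ennreal (cn_density s (x i))) = ennreal (exp (- energy I x / s) / (pi * s) ^ card I)"
proof -
  have "(\<Prod>i\<in>I. ennreal (cn_density s (x i))) = ennreal (\<Prod>i\<in>I. cn_density s (x i))"
    using assms by (intro prod_ennreal) (simp add: cn_density_nonneg)
  also have "(\<Prod>i\<in>I. cn_density s (x i)) = (\<Prod>i\<in>I. exp (- (cmod (x i))\<^sup>2 / s)) / (pi * s) ^ card I"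
    by (simp add: cn_density_def prod_dividef)
  also have "(\<Prod>i\<in>I. exp (- (cmod (x i))\<^sup>2 / s)) = exp (- energy I x / s)"
    using assms by (simp add: energy_def sum_divide_distrib sum_negf flip: exp_sum)
  finally show ?thesis .
qed

lemma nn_integral_exp_energy:
  assumes "finite I" "s > 0" "c \<ge> 0"
  shows "(\<integral>\<^sup>+x. ennreal (exp (- c * energy I x)) \<partial>PiM I (\<lambda>_. cn s)) = ennreal (1 / (1 + c * s) ^ card I)"
proof -
  interpret product_sigma_finite "\<lambda>_. cn s" by (rule product_sigma_finite_cn) fact
  have "(\<integral>\<^sup>+x. ennreal (exp (- c * energy I x)) \<partial>PiM I (\<lambda>_. cn s))
      = (\<integral>\<^sup>+x. (\<Prod>i\<in>I. ennreal (exp (- c * (cmod (x i))\<^sup>2))) \<partial>PiM I (\<lambda>_. cn s))"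
    using assms(1) by (intro nn_integral_cong)
      (simp add: energy_def sum_distrib_left prod_ennreal sum_negf flip: exp_sum)
  also have "\<dots> = (\<Prod>i\<in>I. ennreal (1 / (1 + c * s)))"
    using assms by (subst product_nn_integral_prod) (auto simp: nn_integral_cn_exp_shift[simplified])
  also have "\<dots> = ennreal (1 / (1 + c * s) ^ card I)"
    using assms by (subst prod_ennreal) (auto simp: power_one_over)
  finally show ?thesis .
qed

text \<open>Arithmetic-geometric mean inequality; with the parallelogram law it bounds the average
  of the densities at \<open>z - H u\<close> and \<open>z + H u\<close> from below.\<close>

lemma two_exp_mean_le: "2 * exp ((a + b) / 2) \<le> exp a + exp (b::real)"
proof -
  have "0 \<le> (exp (a / 2) - exp (b / 2))\<^sup>2" by simp
  also have "\<dots> = exp a + exp b - 2 * exp ((a + b) / 2)"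
    by (simp add: power2_eq_square algebra_simps add_divide_distrib flip: exp_add)
  finally show ?thesis by simp
qed

text \<open>Pairing \<open>u\<close> with \<open>- u\<close> removes the inner product of \<open>z\<close> and \<open>H u\<close> from the exponent.\<close>

lemma gaussian_density_le_smoothed:
  fixes H :: "('i \<Rightarrow> complex) \<Rightarrow> 'j \<Rightarrow> complex"
  assumes I: "finite I" and J: "finite J" and pos: "s > 0" "\<tau> > 0" "\<kappa> \<ge> 0"
    and H [measurable]: "\<And>j. j \<in> J \<Longrightarrow> (\<lambda>u. H u j) \<in> borel_measurable (PiM I (\<lambda>_. borel))"
    and neg: "\<And>u j. j \<in> J \<Longrightarrow> H (\<lambda>i\<in>I. - u i) j = - H u j"
    and bound: "\<And>u. energy J (H u) \<le> \<kappa> * energy I u"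
  shows "(\<Prod>j\<in>J. ennreal (cn_density s (z j))) \<le> ennreal ((1 + \<kappa> * \<tau> / s) ^ card I) *
    (\<integral>\<^sup>+u. (\<Prod>j\<in>J. ennreal (cn_density s (z j - H u j))) \<partial>PiM I (\<lambda>_. cn \<tau>))"
proof -
  define K where "K = (pi * s) ^ card J"
  have K: "K > 0" using pos by (simp add: K_def)
  define G where "G u = exp (- energy J (\<lambda>j. z j - H u j) / s) / K" for u
  have Gm [measurable]: "(\<lambda>u. ennreal (G u)) \<in> borel_measurable (PiM I (\<lambda>_. borel))"
    unfolding G_def by measurable
  have Gpos: "G u \<ge> 0" for u using K by (simp add: G_def)
  let ?P = "PiM I (\<lambda>_. cn \<tau>)"
  have Gneg: "G (\<lambda>i\<in>I. - u i) = exp (- energy J (\<lambda>j. z j + H u j) / s) / K" for u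
    unfolding G_def by (simp add: neg cong: energy_cong)
  have key: "2 * (exp (- energy J z / s) / K * exp (- (\<kappa> / s) * energy I u)) \<le> G u + G (\<lambda>i\<in>I. - u i)" for u
  proof -
    let ?a = "- energy J (\<lambda>j. z j - H u j) / s" and ?b = "- energy J (\<lambda>j. z j + H u j) / s"
    have "?a + ?b = - (2 * (energy J z + energy J (H u))) / s"
      unfolding energy_parallelogram[of J z "H u", symmetric] by (simp add: diff_divide_distrib)
    hence ab: "(?a + ?b) / 2 = - energy J z / s - energy J (H u) / s"
      by (simp add: diff_divide_distrib add_divide_distrib)
    have "exp (- energy J z / s) * exp (- (\<kappa> / s) * energy I u) = exp (- energy J z / s - \<kappa> * energy I u / s)"
      by (simp add: exp_add[symmetric])
    also have "\<dots> \<le> exp ((?a + ?b) / 2)"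
      unfolding ab using bound[of u] pos by (simp add: divide_right_mono)
    finally have "2 * (exp (- energy J z / s) * exp (- (\<kappa> / s) * energy I u)) \<le> exp ?a + exp ?b"
      using two_exp_mean_le[of ?a ?b] by simp
    hence "2 * (exp (- energy J z / s) * exp (- (\<kappa> / s) * energy I u)) / K \<le> (exp ?a + exp ?b) / K"
      using K by (intro divide_right_mono) auto
    thus ?thesis unfolding Gneg by (simp add: G_def add_divide_distrib)
  qed
  let ?c = "exp (- energy J z / s) / K"
  have mult2: "2 * (ennreal a * ennreal b) = ennreal (2 * (a * b))" if "a \<ge> 0" "b \<ge> 0" for a b
    using that by (simp add: ennreal_mult)
  have "2 * (ennreal ?c * ennreal (1 / (1 + \<kappa> / s * \<tau>) ^ card I)) =
      2 * (ennreal ?c * (\<integral>\<^sup>+u. ennreal (exp (- (\<kappa> / s) * energy I u)) \<partial>?P))"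
    using pos by (subst nn_integral_exp_energy[OF I]) auto
  also have "\<dots> = (\<integral>\<^sup>+u. 2 * (ennreal ?c * ennreal (exp (- (\<kappa> / s) * energy I u))) \<partial>?P)"
    by (simp add: nn_integral_cmult)
  also have "\<dots> \<le> (\<integral>\<^sup>+u. ennreal (G u) + ennreal (G (\<lambda>i\<in>I. - u i)) \<partial>?P)"
  proof (intro nn_integral_mono)
    fix u
    have "2 * (ennreal ?c * ennreal (exp (- (\<kappa> / s) * energy I u))) =
        ennreal (2 * (?c * exp (- (\<kappa> / s) * energy I u)))"
      using K by (intro mult2) auto
    also have "\<dots> \<le> ennreal (G u + G (\<lambda>i\<in>I. - u i))"
      by (intro ennreal_leI key)
    finally show "2 * (ennreal ?c * ennreal (exp (- (\<kappa> / s) * energy I u)))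
        \<le> ennreal (G u) + ennreal (G (\<lambda>i\<in>I. - u i))"
      using Gpos by simp
  qed
  also have "\<dots> = (\<integral>\<^sup>+u. ennreal (G u) \<partial>?P) + (\<integral>\<^sup>+u. ennreal (G (\<lambda>i\<in>I. - u i)) \<partial>?P)"
    by (rule nn_integral_add) measurable
  also have "(\<integral>\<^sup>+u. ennreal (G (\<lambda>i\<in>I. - u i)) \<partial>?P) = (\<integral>\<^sup>+u. ennreal (G u) \<partial>?P)"
    by (rule nn_integral_PiM_cn_uminus[OF I pos(2) Gm])
  finally have "2 * (ennreal ?c * ennreal (1 / (1 + \<kappa> / s * \<tau>) ^ card I)) \<le> 2 * (\<integral>\<^sup>+u. ennreal (G u) \<partial>?P)"
    by (simp add: mult_2)
  hence le: "ennreal ?c * ennreal (1 / (1 + \<kappa> / s * \<tau>) ^ card I) \<le> (\<integral>\<^sup>+u. ennreal (G u) \<partial>?P)"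
    by (subst (asm) ennreal_mult_le_mult_iff) auto
  have q: "(1 + \<kappa> * \<tau> / s) ^ card I > 0"
    using pos by (intro zero_less_power add_pos_nonneg) auto
  have "ennreal ?c = ennreal ((1 + \<kappa> * \<tau> / s) ^ card I) * (ennreal ?c * ennreal (1 / (1 + \<kappa> * \<tau> / s) ^ card I))"
  proof -
    have "ennreal a = ennreal q * (ennreal a * ennreal (1 / q))" if "q > 0" "a \<ge> 0" for a q :: real
      using that by (simp add: ennreal_mult[symmetric])
    thus ?thesis using q K by simp
  qed
  also have "\<dots> \<le> ennreal ((1 + \<kappa> * \<tau> / s) ^ card I) * (\<integral>\<^sup>+u. ennreal (G u) \<partial>?P)"
    using le by (intro mult_left_mono) auto
  finally show ?thesis
    by (simp add: prod_cn_density[OF J pos(1)] G_def K_def)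
qed

text \<open>Moving a Gaussian by \<open>x\<close> is paid for by enlarging its variance by the
  factor \<open>1 + t\<close>: the estimate \<open>pt\<close> is a weighted triangle inequality in
  which the shift costs |a|^2 / t. The power of \<open>1 + t\<close> is the ratio of the normalising
  constants.\<close>

lemma cn_density_translate_le:
  assumes I: "finite I" and pos: "\<tau> > 0" "t > 0" and B: "energy I x \<le> B"
  shows "(\<Prod>i\<in>I. ennreal (cn_density \<tau> (y i - x i)))
    \<le> ennreal ((1 + t) ^ card I * exp (B / (\<tau> * t))) * (\<Prod>i\<in>I. ennreal (cn_density (\<tau> * (1 + t)) (y i)))"
proof -
  have pt: "(cmod b)\<^sup>2 / (1 + t) \<le> (cmod (b - a))\<^sup>2 + (cmod a)\<^sup>2 / t" for a b :: complex
  proof -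
    define p q where "p = cmod (b - a)" and "q = cmod a"
    have "cmod b \<le> p + q" unfolding p_def q_def using norm_triangle_sub[of b a] by simp
    hence "(cmod b)\<^sup>2 \<le> (p + q)\<^sup>2" by (intro power_mono) auto
    also have "\<dots> \<le> (1 + t) * (p\<^sup>2 + q\<^sup>2 / t)"
    proof -
      have "0 \<le> (t * p - q)\<^sup>2 / t" using pos by simp
      also have "\<dots> = (1 + t) * (p\<^sup>2 + q\<^sup>2 / t) - (p + q)\<^sup>2"
        using pos by (simp add: field_simps power2_eq_square)
      finally show ?thesis by simp
    qed
    finally show ?thesis using pos by (simp add: p_def q_def field_simps)
  qed
  have "energy I y / (1 + t) \<le> energy I (\<lambda>i. y i - x i) + energy I x / t"
    unfolding energy_def sum_divide_distrib sum.distrib[symmetric] by (intro sum_mono pt)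
  also have "\<dots> \<le> energy I (\<lambda>i. y i - x i) + B / t"
    using B pos by (intro add_left_mono divide_right_mono) auto
  finally have "(energy I y / (1 + t)) / \<tau> \<le> (energy I (\<lambda>i. y i - x i) + B / t) / \<tau>"
    using pos by (intro divide_right_mono) auto
  hence "- energy I (\<lambda>i. y i - x i) / \<tau> \<le> B / (\<tau> * t) + - energy I y / (\<tau> * (1 + t))"
    by (simp add: add_divide_distrib mult.commute)
  hence "exp (- energy I (\<lambda>i. y i - x i) / \<tau>) \<le> exp (B / (\<tau> * t)) * exp (- energy I y / (\<tau> * (1 + t)))"
    by (simp flip: exp_add)
  hence "exp (- energy I (\<lambda>i. y i - x i) / \<tau>) / (pi * \<tau>) ^ card I
      \<le> exp (B / (\<tau> * t)) * exp (- energy I y / (\<tau> * (1 + t))) / (pi * \<tau>) ^ card I"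
    using pos by (intro divide_right_mono) auto
  also have "\<dots> = (1 + t) ^ card I * exp (B / (\<tau> * t)) *
      (exp (- energy I y / (\<tau> * (1 + t))) / (pi * (\<tau> * (1 + t))) ^ card I)"
    using pos by (simp add: power_mult_distrib)
  finally show ?thesis
    using pos I by (simp add: prod_cn_density ennreal_mult'[symmetric] ennreal_leI)
qed

lemma sigma_finite_PiM_lborel: "finite J \<Longrightarrow> sigma_finite_measure (PiM J (\<lambda>_. lborel :: complex measure))"
  by (rule product_sigma_finite.sigma_finite[OF product_sigma_finite_lborel])

lemma sigma_finite_PiM_cn: "s > 0 \<Longrightarrow> sigma_finite_measure (PiM J (\<lambda>_. cn s))"
  by (intro prob_space_imp_sigma_finite prob_space_PiM_cn)

text \<open>Integrated form of \<open>gaussian_density_le_smoothed\<close>: once the integrals are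
  exchanged, the shift \<open>H u\<close> in the density becomes a shift of the output.\<close>

lemma nn_integral_le_smoothed:
  fixes H :: "('i \<Rightarrow> complex) \<Rightarrow> 'j \<Rightarrow> complex"
  assumes I: "finite I" and J: "finite J" and pos: "s > 0" "\<tau> > 0" "\<kappa> \<ge> 0"
    and H [measurable]: "\<And>j. j \<in> J \<Longrightarrow> (\<lambda>u. H u j) \<in> borel_measurable (PiM I (\<lambda>_. borel))"
    and neg: "\<And>u j. j \<in> J \<Longrightarrow> H (\<lambda>i\<in>I. - u i) j = - H u j"
    and bound: "\<And>u. energy J (H u) \<le> \<kappa> * energy I u"
    and F [measurable]: "F \<in> borel_measurable (PiM J (\<lambda>_. borel))"
  shows "(\<integral>\<^sup>+v. F v \<partial>PiM J (\<lambda>_. cn s)) \<le> ennreal ((1 + \<kappa> * \<tau> / s) ^ card I) *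
    (\<integral>\<^sup>+u. (\<integral>\<^sup>+v. F (\<lambda>j\<in>J. H u j + v j) \<partial>PiM J (\<lambda>_. cn s)) \<partial>PiM I (\<lambda>_. cn \<tau>))"
proof -
  let ?L = "PiM J (\<lambda>_. lborel :: complex measure)" and ?P = "PiM I (\<lambda>_. cn \<tau>)"
  let ?c = "ennreal ((1 + \<kappa> * \<tau> / s) ^ card I)"
  let ?f = "\<lambda>u y. \<Prod>j\<in>J. ennreal (cn_density s (y j - H u j))"
  interpret pair_sigma_finite ?L ?P
    by (intro pair_sigma_finite.intro sigma_finite_PiM_lborel sigma_finite_PiM_cn J pos)
  have "(\<integral>\<^sup>+v. F v \<partial>PiM J (\<lambda>_. cn s)) = (\<integral>\<^sup>+y. (\<Prod>j\<in>J. ennreal (cn_density s (y j))) * F y \<partial>?L)"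
    by (rule nn_integral_PiM_cn[OF J pos(1) F])
  also have "\<dots> \<le> (\<integral>\<^sup>+y. (?c * (\<integral>\<^sup>+u. ?f u y \<partial>?P)) * F y \<partial>?L)"
    by (intro nn_integral_mono mult_right_mono gaussian_density_le_smoothed assms) auto
  also have "\<dots> = (\<integral>\<^sup>+y. ?c * (\<integral>\<^sup>+u. ?f u y * F y \<partial>?P) \<partial>?L)"
    by (intro nn_integral_cong) (simp add: nn_integral_multc mult.assoc)
  also have "\<dots> = ?c * (\<integral>\<^sup>+y. (\<integral>\<^sup>+u. ?f u y * F y \<partial>?P) \<partial>?L)"
    by (rule nn_integral_cmult) measurable
  also have "(\<integral>\<^sup>+y. (\<integral>\<^sup>+u. ?f u y * F y \<partial>?P) \<partial>?L) = (\<integral>\<^sup>+u. (\<integral>\<^sup>+y. ?f u y * F y \<partial>?L) \<partial>?P)"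
    by (rule Fubini'[symmetric]) measurable
  also have "\<dots> = (\<integral>\<^sup>+u. (\<integral>\<^sup>+v. F (\<lambda>j\<in>J. H u j + v j) \<partial>PiM J (\<lambda>_. cn s)) \<partial>?P)"
    by (intro nn_integral_cong) (simp add: nn_integral_PiM_cn_translate[OF J pos(1) F])
  finally show ?thesis .
qed

lemma nn_integral_cn_translate_le:
  assumes I: "finite I" and pos: "\<tau> > 0" "t > 0" and B: "energy I x \<le> B"
    and F [measurable]: "F \<in> borel_measurable (PiM I (\<lambda>_. borel))"
  shows "(\<integral>\<^sup>+u. F (\<lambda>i\<in>I. x i + u i) \<partial>PiM I (\<lambda>_. cn \<tau>))
    \<le> ennreal ((1 + t) ^ card I * exp (B / (\<tau> * t))) * (\<integral>\<^sup>+u. F u \<partial>PiM I (\<lambda>_. cn (\<tau> * (1 + t))))"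
proof -
  let ?L = "PiM I (\<lambda>_. lborel :: complex measure)"
  let ?c = "ennreal ((1 + t) ^ card I * exp (B / (\<tau> * t)))"
  have "(\<integral>\<^sup>+u. F (\<lambda>i\<in>I. x i + u i) \<partial>PiM I (\<lambda>_. cn \<tau>)) =
      (\<integral>\<^sup>+y. (\<Prod>i\<in>I. ennreal (cn_density \<tau> (y i - x i))) * F y \<partial>?L)"
    by (rule nn_integral_PiM_cn_translate[OF I pos(1) F])
  also have "\<dots> \<le> (\<integral>\<^sup>+y. (?c * (\<Prod>i\<in>I. ennreal (cn_density (\<tau> * (1 + t)) (y i)))) * F y \<partial>?L)"
    by (intro nn_integral_mono mult_right_mono cn_density_translate_le assms) auto
  also have "\<dots> = ?c * (\<integral>\<^sup>+y. (\<Prod>i\<in>I. ennreal (cn_density (\<tau> * (1 + t)) (y i))) * F y \<partial>?L)"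
    by (simp only: mult.assoc) (rule nn_integral_cmult, measurable)
  also have "(\<integral>\<^sup>+y. (\<Prod>i\<in>I. ennreal (cn_density (\<tau> * (1 + t)) (y i))) * F y \<partial>?L) =
      (\<integral>\<^sup>+u. F u \<partial>PiM I (\<lambda>_. cn (\<tau> * (1 + t))))"
    using pos by (intro nn_integral_PiM_cn[OF I _ F, symmetric]) auto
  finally show ?thesis .
qed

text \<open>
  The strong converse. Smoothing the noise by \<open>H u\<close>, with \<open>u\<close> Gaussian, costs the first factor of the
  bound. The smoothed input \<open>x i + u\<close> is dominated, at the cost of the other factors, by one
  Gaussian law which does not depend on \<open>i\<close>, and under it the disjoint events \<open>D i\<close> have total
  probability at most 1.
\<close>

lemma gaussian_converse:
  fixes H :: "('i \<Rightarrow> complex) \<Rightarrow> 'j \<Rightarrow> complex" and x :: "'m \<Rightarrow> 'i \<Rightarrow> complex"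
  assumes I: "finite I" and J: "finite J" and pos: "s > 0" "\<tau> > 0" "t > 0" "\<kappa> \<ge> 0"
    and H [measurable]: "\<And>j. j \<in> J \<Longrightarrow> (\<lambda>u. H u j) \<in> borel_measurable (PiM I (\<lambda>_. borel))"
    and neg: "\<And>u j. j \<in> J \<Longrightarrow> H (\<lambda>i\<in>I. - u i) j = - H u j"
    and add: "\<And>m u j. m \<in> A \<Longrightarrow> j \<in> J \<Longrightarrow> H (\<lambda>i\<in>I. x m i + u i) j = H (x m) j + H u j"
    and bound: "\<And>u. energy J (H u) \<le> \<kappa> * energy I u"
    and A: "finite A" and B: "\<And>m. m \<in> A \<Longrightarrow> energy I (x m) \<le> B"
    and D: "\<And>m. m \<in> A \<Longrightarrow> D m \<in> sets (PiM J (\<lambda>_. borel))" and disj: "disjoint_family_on D A"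
  shows "(\<Sum>m\<in>A. \<integral>\<^sup>+v. indicator (D m) (\<lambda>j\<in>J. d j + H (x m) j + v j) \<partial>PiM J (\<lambda>_. cn s))
    \<le> ennreal ((1 + \<kappa> * \<tau> / s) ^ card I * ((1 + t) ^ card I * exp (B / (\<tau> * t))))"
proof -
  let ?c = "ennreal ((1 + \<kappa> * \<tau> / s) ^ card I)" and ?c' = "ennreal ((1 + t) ^ card I * exp (B / (\<tau> * t)))"
  let ?V = "PiM J (\<lambda>_. cn s)" and ?U = "PiM I (\<lambda>_. cn \<tau>)" and ?U' = "PiM I (\<lambda>_. cn (\<tau> * (1 + t)))"
  have pos': "\<tau> * (1 + t) > 0" using pos by simp
  interpret V: prob_space ?V by (intro prob_space_PiM_cn pos)
  interpret U': prob_space ?U' by (intro prob_space_PiM_cn pos')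
  let ?\<Phi> = "\<lambda>m u. \<integral>\<^sup>+v. indicator (D m) (\<lambda>j\<in>J. d j + H u j + v j) \<partial>?V"
  have dm: "(\<lambda>z. indicator (D m) (\<lambda>j\<in>J. e j + z j) :: ennreal) \<in> borel_measurable (PiM J (\<lambda>_. borel))"
    if "m \<in> A" for m e
    by (rule measurable_compose[of _ _ "PiM J (\<lambda>_. borel)"]) (use D[OF that] in measurable)
  have \<Phi>m: "?\<Phi> m \<in> borel_measurable (PiM I (\<lambda>_. borel))" if "m \<in> A" for m
  proof -
    note [measurable] = D[OF that]
    have "(\<lambda>(u, v). indicator (D m) (\<lambda>j\<in>J. d j + H u j + v j) :: ennreal)
        \<in> borel_measurable (PiM I (\<lambda>_. borel) \<Otimes>\<^sub>M ?V)"
      by measurable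
    thus ?thesis using V.borel_measurable_nn_integral by auto
  qed
  have "(\<integral>\<^sup>+v. indicator (D m) (\<lambda>j\<in>J. d j + H (x m) j + v j) \<partial>?V) \<le> ?c * (?c' * (\<integral>\<^sup>+u. ?\<Phi> m u \<partial>?U'))"
    if m: "m \<in> A" for m
  proof -
    have 1: "(\<integral>\<^sup>+v. indicator (D m) (\<lambda>j\<in>J. (d j + H (x m) j) + v j) \<partial>?V)
        \<le> ?c * (\<integral>\<^sup>+u. (\<integral>\<^sup>+v. indicator (D m) (\<lambda>j\<in>J. (d j + H (x m) j) + (\<lambda>j\<in>J. H u j + v j) j) \<partial>?V) \<partial>?U)"
      by (rule nn_integral_le_smoothed[OF I J pos(1,2,4) H neg bound dm[OF m]])
    \<comment> \<open>\<open>add\<close> turns the shift of the output by \<open>H (x m)\<close>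
      into a shift of the input \<open>u\<close> by \<open>x m\<close>, to which
      \<open>nn_integral_cn_translate_le\<close> applies.\<close>
    have "(\<integral>\<^sup>+u. (\<integral>\<^sup>+v. indicator (D m) (\<lambda>j\<in>J. (d j + H (x m) j) + (\<lambda>j\<in>J. H u j + v j) j) \<partial>?V) \<partial>?U)
        = (\<integral>\<^sup>+u. ?\<Phi> m (\<lambda>i\<in>I. x m i + u i) \<partial>?U)"
      by (intro nn_integral_cong arg_cong[of _ _ "indicator (D m)"] restrict_ext)
        (simp add: add[OF m] add.assoc)
    also have "\<dots> \<le> ?c' * (\<integral>\<^sup>+u. ?\<Phi> m u \<partial>?U')"
      by (intro nn_integral_cn_translate_le[OF I pos(2,3) B[OF m] \<Phi>m[OF m]])
    finally show ?thesis by (intro order_trans[OF 1] mult_left_mono) auto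
  qed
  hence "(\<Sum>m\<in>A. \<integral>\<^sup>+v. indicator (D m) (\<lambda>j\<in>J. d j + H (x m) j + v j) \<partial>?V)
      \<le> (\<Sum>m\<in>A. ?c * (?c' * (\<integral>\<^sup>+u. ?\<Phi> m u \<partial>?U')))"
    by (intro sum_mono)
  also have "\<dots> = ?c * (?c' * (\<integral>\<^sup>+u. (\<Sum>m\<in>A. ?\<Phi> m u) \<partial>?U'))"
    using \<Phi>m by (subst nn_integral_sum) (auto simp: sum_distrib_left)
  finally have 1: "(\<Sum>m\<in>A. \<integral>\<^sup>+v. indicator (D m) (\<lambda>j\<in>J. d j + H (x m) j + v j) \<partial>?V)
      \<le> ?c * (?c' * (\<integral>\<^sup>+u. (\<Sum>m\<in>A. ?\<Phi> m u) \<partial>?U'))" .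
  have "(\<integral>\<^sup>+u. (\<Sum>m\<in>A. ?\<Phi> m u) \<partial>?U') \<le> (\<integral>\<^sup>+u. 1 \<partial>?U')"
  proof (intro nn_integral_mono)
    fix u
    have "(\<Sum>m\<in>A. ?\<Phi> m u) = (\<integral>\<^sup>+v. (\<Sum>m\<in>A. indicator (D m) (\<lambda>j\<in>J. d j + H u j + v j)) \<partial>?V)"
      using dm[of _ "\<lambda>j. d j + H u j"] by (subst nn_integral_sum) auto
    also have "\<dots> \<le> (\<integral>\<^sup>+v. 1 \<partial>?V)"
    proof (intro nn_integral_mono)
      fix v
      let ?y = "\<lambda>j\<in>J. d j + H u j + v j"
      have "(\<Sum>m\<in>A. indicator (D m) ?y :: ennreal) = indicator (\<Union>m\<in>A. D m) ?y"
        by (rule indicator_UN_disjoint[symmetric, OF A disj])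
      thus "(\<Sum>m\<in>A. indicator (D m) ?y :: ennreal) \<le> 1" by (auto simp: indicator_def)
    qed
    finally show "(\<Sum>m\<in>A. ?\<Phi> m u) \<le> 1" using V.emeasure_space_1 by simp
  qed
  also have "(\<integral>\<^sup>+u. 1 \<partial>?U') = 1" using U'.emeasure_space_1 by simp
  finally have "?c * (?c' * (\<integral>\<^sup>+u. (\<Sum>m\<in>A. ?\<Phi> m u) \<partial>?U')) \<le> ?c * (?c' * 1)"
    by (intro mult_left_mono) auto
  also have "\<dots> = ennreal ((1 + \<kappa> * \<tau> / s) ^ card I * ((1 + t) ^ card I * exp (B / (\<tau> * t))))"
    using pos by (simp add: ennreal_mult)
  finally show ?thesis using 1 by (rule order_trans[rotated])
qed

section \<open>Weights for fading gains\<close>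

text \<open>
  At \<open>z = 0\<close>, where \<open>powr\<close> has the junk value 0, the weight has to be infinite.
\<close>

definition inv_weight :: "real \<Rightarrow> complex \<Rightarrow> ennreal" where
  "inv_weight p z = (if z = 0 then \<infinity> else ennreal (min 1 ((cmod z)\<^sup>2) powr (- p)))"

lemma measurable_inv_weight [measurable]: "inv_weight p \<in> borel_measurable borel"
  unfolding inv_weight_def[abs_def] by measurable

lemma inv_weight_ge_1: "p > 0 \<Longrightarrow> inv_weight p z \<ge> 1"
proof (cases "z = 0")
  case False
  assume p: "p > 0"
  define u where "u = min 1 ((cmod z)\<^sup>2)"
  have "0 < u" "u \<le> 1" using False by (auto simp: u_def)
  hence "1 \<le> inverse (u powr p)" using p by (intro one_le_inverse) (auto simp: powr_le1)
  thus ?thesis using False by (simp add: inv_weight_def u_def[symmetric] powr_minus)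
qed (simp add: inv_weight_def)

text \<open>Rules out a factor 0 next to an infinite one: in \<open>ennreal\<close> their product
  would be 0, and the weight of a vanishing gain would be lost.\<close>

lemma prod_inv_weight_ge_1: "p > 0 \<Longrightarrow> 1 \<le> (\<Prod>i\<in>I. inv_weight p (x i))"
proof (induction I rule: infinite_finite_induct)
  case (insert i I)
  thus ?case using mult_mono[OF inv_weight_ge_1[of p "x i"] insert.IH] by simp
qed auto

lemma inv_weight_moment_finite:
  assumes "0 < p" "p < 1"
  shows "(\<integral>\<^sup>+z. inv_weight p z \<partial>cn 1) < \<infinity>"
proof -
  have "(\<integral>\<^sup>+z. inv_weight p z \<partial>cn 1) = (\<integral>\<^sup>+z. ennreal (cn_density 1 z) * inv_weight p z \<partial>lborel)"
    by (rule nn_integral_cn) measurable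
  also have "\<dots> = (\<integral>\<^sup>+z. ennreal (cn_density 1 z) * ennreal (min 1 ((cmod z)\<^sup>2) powr (- p)) \<partial>lborel)"
    using AE_lborel_singleton[of "0 :: complex"]
    by (intro nn_integral_cong_AE, elim eventually_mono) (simp add: inv_weight_def)
  also have "\<dots> = (\<integral>\<^sup>+z. ennreal (min 1 ((cmod z)\<^sup>2) powr (- p)) \<partial>cn 1)"
    by (rule nn_integral_cn[symmetric]) measurable
  finally show ?thesis using nn_integral_cn_negative_moment[OF assms] by simp
qed

lemma nn_integral_prod_inv_weight:
  assumes "finite I"
  shows "(\<integral>\<^sup>+x. (\<Prod>i\<in>I. inv_weight p (x i)) \<partial>PiM I (\<lambda>_. cn 1)) = (\<integral>\<^sup>+z. inv_weight p z \<partial>cn 1) ^ card I"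
proof -
  interpret product_sigma_finite "\<lambda>_. cn 1" by (rule product_sigma_finite_cn) simp
  show ?thesis using assms by (subst product_nn_integral_prod) auto
qed

text \<open>Truncation at 1 makes the logarithm of every factor nonpositive. Hence estimates may
  include further factors at will, and no strong link can hide a weak one.\<close>

definition trunc_gain :: "'i set \<Rightarrow> ('i \<Rightarrow> complex) \<Rightarrow> real" where
  "trunc_gain I x = (\<Prod>i\<in>I. min 1 ((cmod (x i))\<^sup>2))"

lemma trunc_gain_nonneg: "trunc_gain I x \<ge> 0"
  by (auto simp: trunc_gain_def intro!: prod_nonneg)

lemma measurable_trunc_gain [measurable]:
  "trunc_gain I \<in> borel_measurable (PiM I (\<lambda>_. borel))"
  unfolding trunc_gain_def[abs_def] by measurable

lemma trunc_gain_inv_weight: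
  assumes "finite I" "p > 0"
  shows "(if trunc_gain I x = 0 then \<infinity> else ennreal (trunc_gain I x powr (- p))) \<le> (\<Prod>i\<in>I. inv_weight p (x i))"
proof (cases "\<exists>i\<in>I. x i = 0")
  case True
  then obtain i where i: "i \<in> I" "x i = 0" by blast
  have "(\<Prod>j\<in>I - {i}. inv_weight p (x j)) \<noteq> 0"
    using prod_inv_weight_ge_1[OF assms(2), of x "I - {i}"] by (metis not_one_le_zero)
  hence "(\<Prod>i\<in>I. inv_weight p (x i)) = \<infinity>"
    using i assms(1) by (subst prod.remove[of _ i]) (simp_all add: inv_weight_def[of p 0] ennreal_top_mult)
  thus ?thesis by simp
next
  case False
  hence "(\<Prod>i\<in>I. inv_weight p (x i)) = (\<Prod>i\<in>I. ennreal (min 1 ((cmod (x i))\<^sup>2) powr (- p)))"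
    by (intro prod.cong) (auto simp: inv_weight_def)
  also have "\<dots> = ennreal (trunc_gain I x powr (- p))"
    unfolding trunc_gain_def by (subst prod_ennreal) (auto simp: prod_powr_distrib)
  moreover have "trunc_gain I x \<noteq> 0" using False assms(1) by (auto simp: trunc_gain_def min_def)
  ultimately show ?thesis by simp
qed

text \<open>Markov's inequality for the moment of order \<open>- p\<close>, written pointwise. The
  two index sets are for the gains to the destination and for those between the sources.\<close>

lemma trunc_gain_indicator_le:
  assumes "finite I" "finite J" "p > 0" "\<epsilon> > 0"
  shows "indicator {(x, y). trunc_gain I x * trunc_gain J y < \<epsilon>} (x, y)
    \<le> ennreal (\<epsilon> powr p) * ((\<Prod>i\<in>I. inv_weight p (x i)) * (\<Prod>j\<in>J. inv_weight p (y j)))"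
proof (cases "trunc_gain I x * trunc_gain J y < \<epsilon>")
  case True
  let ?X = "\<Prod>i\<in>I. inv_weight p (x i)" and ?Y = "\<Prod>j\<in>J. inv_weight p (y j)"
  have top: "indicator A z \<le> ennreal (\<epsilon> powr p) * w" if "w = \<infinity>"
    for A :: "(('a \<Rightarrow> complex) \<times> ('b \<Rightarrow> complex)) set" and z w
    using that assms by (simp add: ennreal_mult_top)
  consider "trunc_gain I x = 0" | "trunc_gain J y = 0" | "trunc_gain I x > 0" "trunc_gain J y > 0"
    using trunc_gain_nonneg[of I x] trunc_gain_nonneg[of J y] by linarith
  thus ?thesis
  proof cases
    case 1
    hence "?X = \<infinity>" using trunc_gain_inv_weight[OF assms(1,3), of x] by (simp add: top_unique)
    moreover have "?Y \<noteq> 0"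
      using prod_inv_weight_ge_1[OF assms(3), of y J] by (metis not_one_le_zero)
    ultimately show ?thesis
      by (intro top) (simp only: infinity_ennreal_def ennreal_top_mult ennreal_mult_top if_False)
  next
    case 2
    hence "?Y = \<infinity>" using trunc_gain_inv_weight[OF assms(2,3), of y] by (simp add: top_unique)
    moreover have "?X \<noteq> 0"
      using prod_inv_weight_ge_1[OF assms(3), of x I] by (metis not_one_le_zero)
    ultimately show ?thesis
      by (intro top) (simp only: infinity_ennreal_def ennreal_top_mult ennreal_mult_top if_False)
  next
    case 3
    let ?q = "trunc_gain I x * trunc_gain J y"
    have q: "?q > 0" using 3 by simp
    have "1 = a powr p * a powr (- p)" if "a > 0" for a :: real using that by (simp add: powr_minus)
    from this[OF q] have "1 = ?q powr p * ?q powr (- p)" .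
    also have "\<dots> \<le> \<epsilon> powr p * ?q powr (- p)"
      using True q assms(3) by (intro mult_right_mono powr_mono2) auto
    also have "\<dots> = \<epsilon> powr p * (trunc_gain I x powr (- p) * trunc_gain J y powr (- p))"
      using 3 by (simp add: powr_mult)
    finally have "ennreal 1 \<le> ennreal (\<epsilon> powr p * (trunc_gain I x powr (- p) * trunc_gain J y powr (- p)))"
      by (rule ennreal_leI)
    also have "\<dots> = ennreal (\<epsilon> powr p) * (ennreal (trunc_gain I x powr (- p)) * ennreal (trunc_gain J y powr (- p)))"
      by (simp add: ennreal_mult)
    also have "\<dots> \<le> ennreal (\<epsilon> powr p) * (?X * ?Y)"
      using 3 trunc_gain_inv_weight[OF assms(1,3), of x] trunc_gain_inv_weight[OF assms(2,3), of y]
      by (intro mult_mono) auto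
    finally show ?thesis by (simp add: indicator_def)
  qed
qed simp

section \<open>Chernoff bounds and integration of the coordinates one by one\<close>

lemma nn_integral_cn_exp_linear:
  assumes "finite I" "s > 0"
  shows "(\<integral>\<^sup>+x. ennreal (exp (Re (\<Sum>i\<in>I. e i * x i))) \<partial>PiM I (\<lambda>_. cn s)) = ennreal (exp (s * energy I e / 4))"
proof -
  interpret product_sigma_finite "\<lambda>_. cn s" by (rule product_sigma_finite_cn) fact
  have "(\<integral>\<^sup>+x. ennreal (exp (Re (\<Sum>i\<in>I. e i * x i))) \<partial>PiM I (\<lambda>_. cn s))
      = (\<integral>\<^sup>+x. (\<Prod>i\<in>I. ennreal (exp (Re (e i * x i)))) \<partial>PiM I (\<lambda>_. cn s))"
    using assms(1) by (intro nn_integral_cong) (simp only: Re_sum exp_sum prod_ennreal exp_ge_zero)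
  also have "\<dots> = (\<Prod>i\<in>I. ennreal (exp (s * (cmod (e i))\<^sup>2 / 4)))"
    using assms by (subst product_nn_integral_prod) (auto simp: nn_integral_cn_exp_Re simp del: times_complex.sel)
  also have "\<dots> = ennreal (exp (s * energy I e / 4))"
    using assms(1) by (simp add: prod_ennreal energy_def sum_distrib_left sum_divide_distrib flip: exp_sum)
  finally show ?thesis .
qed

text \<open>Chernoff's bound. The parameter \<open>l\<close> stays free; it will be the reciprocal
  of the total noise variance.\<close>

lemma gaussian_linear_tail:
  assumes "finite J" "s > 0" "l \<ge> 0"
  shows "(\<integral>\<^sup>+v. indicator {v. \<theta> \<le> c + Re (\<Sum>j\<in>J. e j * v j)} v \<partial>PiM J (\<lambda>_. cn s))
    \<le> ennreal (exp (l * (c - \<theta>) + l\<^sup>2 * (s * energy J e) / 4))"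
proof -
  have "(\<integral>\<^sup>+v. indicator {v. \<theta> \<le> c + Re (\<Sum>j\<in>J. e j * v j)} v \<partial>PiM J (\<lambda>_. cn s))
    \<le> (\<integral>\<^sup>+v. ennreal (exp (l * (c - \<theta>))) * ennreal (exp (Re (\<Sum>j\<in>J. (complex_of_real l * e j) * v j))) \<partial>PiM J (\<lambda>_. cn s))"
  proof (intro nn_integral_mono)
    fix v
    have "Re (\<Sum>j\<in>J. (complex_of_real l * e j) * v j) = l * Re (\<Sum>j\<in>J. e j * v j)"
      by (simp only: mult.assoc sum_distrib_left[symmetric]) simp
    moreover have "1 \<le> exp (l * (c - \<theta>)) * exp (l * Re (\<Sum>j\<in>J. e j * v j))"
      if "\<theta> \<le> c + Re (\<Sum>j\<in>J. e j * v j)"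
    proof -
      have "0 \<le> l * (c + Re (\<Sum>j\<in>J. e j * v j) - \<theta>)" using that \<open>l \<ge> 0\<close> by (intro mult_nonneg_nonneg) auto
      thus ?thesis by (simp add: algebra_simps flip: exp_add)
    qed
    ultimately show "indicator {v. \<theta> \<le> c + Re (\<Sum>j\<in>J. e j * v j)} v \<le> ennreal (exp (l * (c - \<theta>))) * ennreal (exp (Re (\<Sum>j\<in>J. (complex_of_real l * e j) * v j)))"
      by (auto simp: indicator_def ennreal_mult'[symmetric] simp del: Re_sum)
  qed
  also have "\<dots> = ennreal (exp (l * (c - \<theta>))) * ennreal (exp (s * energy J (\<lambda>j. complex_of_real l * e j) / 4))"
    by (subst nn_integral_cmult, measurable) (simp only: nn_integral_cn_exp_linear[OF assms(1,2)])
  also have "energy J (\<lambda>j. complex_of_real l * e j) = l\<^sup>2 * energy J e"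
    by (simp add: energy_def norm_mult power_mult_distrib sum_distrib_left)
  finally show ?thesis by (simp add: ennreal_mult'[symmetric] exp_add mult_ac)
qed

text \<open>Integrate the coordinates in \<open>J\<close> in decreasing order of \<open>time\<close>.\<close>

lemma nn_integral_triangular_le:
  fixes time :: "'i \<Rightarrow> nat" and z :: "'i \<Rightarrow> ('i \<Rightarrow> complex) \<Rightarrow> complex"
  assumes I: "finite I" and J: "J \<subseteq> I" and s: "s > 0" and inj: "inj_on time J"
    and c: "\<And>i. i \<in> J \<Longrightarrow> c i > 0" and \<alpha>: "\<alpha> \<noteq> 0"
    and z [measurable]: "\<And>i. i \<in> J \<Longrightarrow> z i \<in> borel_measurable (PiM I (\<lambda>_. borel))"
    and indep: "\<And>i j x y. i \<in> J \<Longrightarrow> j \<in> J \<Longrightarrow> time i \<le> time j \<Longrightarrow> z i (x(j := y)) = z i x"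
  shows "(\<integral>\<^sup>+x. (\<Prod>i\<in>J. ennreal (exp (- c i * (cmod (\<alpha> * x i + z i x))\<^sup>2))) \<partial>PiM I (\<lambda>_. cn s))
    \<le> (\<Prod>i\<in>J. ennreal (min 1 (1 / (c i * (cmod \<alpha>)\<^sup>2 * s))))"
proof -
  have fin: "finite J" using I J by (rule finite_subset[rotated])
  interpret product_sigma_finite "\<lambda>_. cn s" by (rule product_sigma_finite_cn) fact
  interpret P: prob_space "cn s" by (rule prob_space_cn) fact
  let ?g = "\<lambda>i x. ennreal (exp (- c i * (cmod (\<alpha> * x i + z i x))\<^sup>2))"
  let ?\<psi> = "\<lambda>i. ennreal (min 1 (1 / (c i * (cmod \<alpha>)\<^sup>2 * s)))"
  \<comment> \<open>The element \<open>m\<close> added in this induction has the largest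
    \<open>time\<close>, so by \<open>indep\<close> no other offset depends on its
    coordinate.\<close>
  from fin show ?thesis using J inj c z indep
  proof (induction rule: finite_ranking_induct[where f=time])
    case empty
    interpret prob_space "PiM I (\<lambda>_. cn s)" by (rule prob_space_PiM_cn) fact
    show ?case using emeasure_space_1 by simp
  next
    case (insert m S)
    show ?case
    proof (cases "m \<in> S")
      case True
      thus ?thesis using insert by (simp add: insert_absorb)
    next
      case False
      have m: "m \<in> I" using insert by auto
      have Im: "insert m (I - {m}) = I" using m by auto
      note zm [measurable] = insert.prems(4)
      have gm [measurable]: "?g i \<in> borel_measurable (PiM I (\<lambda>_. cn s))" if "i \<in> insert m S" for i
      proof -
        have "i \<in> I" "z i \<in> borel_measurable (PiM I (\<lambda>_. borel))"
          using that insert.prems(1) zm by auto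
        thus ?thesis by measurable
      qed
      have Gm [measurable]: "(\<lambda>x. \<Prod>i\<in>S. ?g i x) \<in> borel_measurable (PiM I (\<lambda>_. cn s))"
        by (intro borel_measurable_prod_ennreal gm) auto
      have split: "(\<integral>\<^sup>+x. f x \<partial>PiM I (\<lambda>_. cn s)) = (\<integral>\<^sup>+x. (\<integral>\<^sup>+y. f (x(m := y)) \<partial>cn s) \<partial>PiM (I - {m}) (\<lambda>_. cn s))"
        if "f \<in> borel_measurable (PiM I (\<lambda>_. cn s))" for f
        using product_nn_integral_insert[of "I - {m}" m f, unfolded Im] that I by simp
      have const: "(\<Prod>i\<in>S. ?g i (x(m := y))) = (\<Prod>i\<in>S. ?g i x)" for x y
      proof (intro prod.cong refl)
        fix i assume i: "i \<in> S"
        have "time i \<le> time m" using insert.hyps i by auto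
        hence "z i (x(m := y)) = z i x" for y using i by (intro insert.prems(5)) auto
        moreover have "i \<noteq> m" using False i by auto
        ultimately show "?g i (x(m := y)) = ?g i x" by simp
      qed
      have "(\<integral>\<^sup>+x. (\<Prod>i\<in>insert m S. ?g i x) \<partial>PiM I (\<lambda>_. cn s))
          = (\<integral>\<^sup>+x. (\<Prod>i\<in>S. ?g i x) * ?g m x \<partial>PiM I (\<lambda>_. cn s))"
        using insert.hyps False by (simp add: mult.commute)
      also have "\<dots> = (\<integral>\<^sup>+x. (\<integral>\<^sup>+y. (\<Prod>i\<in>S. ?g i (x(m := y))) * ?g m (x(m := y)) \<partial>cn s) \<partial>PiM (I - {m}) (\<lambda>_. cn s))"
        by (rule split) measurable
      also have "\<dots> \<le> (\<integral>\<^sup>+x. (\<Prod>i\<in>S. ?g i x) * ?\<psi> m \<partial>PiM (I - {m}) (\<lambda>_. cn s))"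
      proof (intro nn_integral_mono)
        fix x
        have zc: "z m (x(m := y)) = z m x" for y by (intro insert.prems(5)) auto
        have "(\<integral>\<^sup>+y. (\<Prod>i\<in>S. ?g i (x(m := y))) * ?g m (x(m := y)) \<partial>cn s)
            = (\<Prod>i\<in>S. ?g i x) * (\<integral>\<^sup>+y. ennreal (exp (- c m * (cmod (\<alpha> * y + z m x))\<^sup>2)) \<partial>cn s)"
          unfolding const zc by (subst nn_integral_cmult[symmetric]) auto
        also have "\<dots> \<le> (\<Prod>i\<in>S. ?g i x) * ?\<psi> m"
          using insert.prems(3)[of m] by (intro mult_left_mono nn_integral_cn_exp_affine_le s \<alpha>) auto
        finally show "(\<integral>\<^sup>+y. (\<Prod>i\<in>S. ?g i (x(m := y))) * ?g m (x(m := y)) \<partial>cn s)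
            \<le> (\<Prod>i\<in>S. ?g i x) * ?\<psi> m" .
      qed
      \<comment> \<open>Nothing depends on the coordinate \<open>m\<close> any more; integrating
        over it again restores the full product measure of the induction hypothesis.\<close>
      also have "\<dots> = (\<integral>\<^sup>+x. (\<integral>\<^sup>+y. (\<Prod>i\<in>S. ?g i (x(m := y))) * ?\<psi> m \<partial>cn s) \<partial>PiM (I - {m}) (\<lambda>_. cn s))"
        unfolding const using P.emeasure_space_1 by simp
      also have "\<dots> = (\<integral>\<^sup>+x. (\<Prod>i\<in>S. ?g i x) * ?\<psi> m \<partial>PiM I (\<lambda>_. cn s))"
        by (rule split[symmetric]) measurable
      also have "\<dots> = (\<integral>\<^sup>+x. (\<Prod>i\<in>S. ?g i x) \<partial>PiM I (\<lambda>_. cn s)) * ?\<psi> m"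
        by (rule nn_integral_multc) measurable
      also have "\<dots> \<le> (\<Prod>i\<in>S. ?\<psi> i) * ?\<psi> m"
        using insert.prems by (intro mult_right_mono insert.IH) (auto intro: inj_on_subset)
      also have "\<dots> = (\<Prod>i\<in>insert m S. ?\<psi> i)"
        using insert.hyps False by (simp add: mult.commute)
      finally show ?thesis .
    qed
  qed
qed

section \<open>Propagation of the signals through the relays\<close>

lemma helped_less: "N > 0 \<Longrightarrow> helped N L m k < N"
  by (simp add: helped_def)

lemma helped_neq:
  assumes "N \<ge> 2" "m < N"
  shows "helped N L m k \<noteq> m"
proof
  assume *: "helped N L m k = m"
  define i where "i = (k div L) mod (N - 1) + 1"
  have i: "0 < i" "i < N"
    using assms mod_less_divisor[of "N - 1" "k div L"] unfolding i_def by linarith+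
  have "(m + i) mod N = m" using * by (simp add: helped_def i_def)
  thus False using i assms(2) by (cases "m + i < N") (auto simp: le_mod_geq)
qed

text \<open>The slot whose signal is repeated by \<open>m\<close> in frame \<open>k\<close>.
  \<open>None\<close> occurs only in frame 0, before anything was received.\<close>

definition cma_prev :: "nat \<Rightarrow> nat \<Rightarrow> nat \<Rightarrow> nat \<Rightarrow> (nat \<times> nat) option" where
  "cma_prev N L m k =
     (if helped N L m k < m then Some (helped N L m k, k)
      else if k = 0 then None else Some (helped N L m (k - 1), k - 1))"

text \<open>Slots are numbered in order of time by \<open>k * N + m\<close>; the last inequality is
  causality and drives \<open>cma_induct\<close>.\<close>

lemma cma_prevD:
  assumes "N \<ge> 2" "m < N" "cma_prev N L m k = Some (p, k')"
  shows "p < N" "k' \<le> k" "p \<noteq> m" "k' = k \<or> k' = k - 1 \<and> k > 0" "k' * N + p < k * N + m"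
proof -
  show 1: "p < N" "k' \<le> k" "p \<noteq> m" "k' = k \<or> k' = k - 1 \<and> k > 0"
    using assms helped_less[of N L m] helped_neq[OF assms(1,2), of L]
    by (auto simp: cma_prev_def split: if_splits)
  show "k' * N + p < k * N + m"
  proof (cases "k' = k")
    case True
    thus ?thesis using assms by (auto simp: cma_prev_def split: if_splits)
  next
    case False
    hence "k = Suc k'" using 1(4) by auto
    thus ?thesis using 1(1) by simp
  qed
qed

text \<open>Split off so that a signal is a multiple of its own symbol plus a term that involves
  only symbols of earlier slots.\<close>

definition cma_relayed where
  "cma_relayed N L a b h x w m k = (case cma_prev N L m k of None \<Rightarrow> 0
     | Some (p, k') \<Rightarrow> b m (h (m, p)) * (h (m, p) * cma_signal N L a b h x w p k' + w (m, k')))"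

lemma cma_signal_eq: "cma_signal N L a b h x w m k = a m * x (m, k) + cma_relayed N L a b h x w m k"
  by (subst cma_signal.simps) (simp add: cma_relayed_def cma_prev_def Let_def)

lemma cma_induct [consumes 2, case_names step]:
  assumes N: "N \<ge> 2" and m: "m < N"
    and step: "\<And>m k. m < N \<Longrightarrow> (\<And>p k'. cma_prev N L m k = Some (p, k') \<Longrightarrow> P p k') \<Longrightarrow> P m k"
  shows "P m k"
  using m
proof (induction "k * N + m" arbitrary: m k rule: less_induct)
  case less
  show ?case
  proof (rule step[OF less.prems])
    fix p k' assume "cma_prev N L m k = Some (p, k')"
    from cma_prevD(5,1)[OF N less.prems this] show "P p k'" by (rule less.hyps)
  qed
qed

text \<open>For fixed gains the network is linear jointly in the symbols and the forwarded noise,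
  which lets the two be separated.\<close>

lemma cma_signal_add:
  assumes "N \<ge> 2" "m < N"
  shows "cma_signal N L a b h (\<lambda>i. x i + x' i) (\<lambda>i. w i + w' i) m k =
    cma_signal N L a b h x w m k + cma_signal N L a b h x' w' m k"
  using assms
proof (induction rule: cma_induct[where L=L and k=k])
  case (step m k)
  thus ?case
    by (subst (1 2 3) cma_signal_eq)
      (auto simp: cma_relayed_def algebra_simps split: option.splits)
qed

lemma cma_signal_scale:
  assumes "N \<ge> 2" "m < N"
  shows "cma_signal N L a b h (\<lambda>i. c * x i) (\<lambda>i. c * w i) m k = c * cma_signal N L a b h x w m k"
  using assms
proof (induction rule: cma_induct[where L=L and k=k])
  case (step m k)
  thus ?case
    by (subst (1 2) cma_signal_eq) (auto simp: cma_relayed_def algebra_simps split: option.splits)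
qed

lemma cma_signal_cong:
  assumes "N \<ge> 2" "m < N"
    and "\<And>p k'. p < N \<Longrightarrow> k' \<le> k \<Longrightarrow> x (p, k') = x' (p, k')"
    and "\<And>p k'. p < N \<Longrightarrow> k' \<le> k \<Longrightarrow> w (p, k') = w' (p, k')"
  shows "cma_signal N L a b h x w m k = cma_signal N L a b h x' w' m k"
  using assms
proof (induction rule: cma_induct[where L=L and k=k])
  case (step m k)
  show ?case
  proof (cases "cma_prev N L m k")
    case None
    thus ?thesis using step by (subst (1 2) cma_signal_eq) (simp add: cma_relayed_def)
  next
    case (Some pk)
    obtain p k' where pk: "pk = (p, k')" by fastforce
    have d: "k' \<le> k" using cma_prevD[OF assms(1) step.hyps] Some pk by auto
    have "cma_signal N L a b h x w p k' = cma_signal N L a b h x' w' p k'"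
      using Some pk d by (intro step.IH step.prems) auto
    thus ?thesis using step d Some pk by (subst (1 2) cma_signal_eq) (simp add: cma_relayed_def)
  qed
qed

text \<open>Causality in the symbols: this is the triangular structure that the slot-by-slot
  integration needs.\<close>

lemma cma_relayed_cong:
  assumes "N \<ge> 2" "m < N"
    and "\<And>p k'. p < N \<Longrightarrow> k' * N + p < k * N + m \<Longrightarrow> x (p, k') = x' (p, k')"
  shows "cma_relayed N L a b h x w m k = cma_relayed N L a b h x' w m k"
  using assms
proof (induction rule: cma_induct[where L=L and k=k])
  case (step m k)
  show ?case
  proof (cases "cma_prev N L m k")
    case (Some pk)
    obtain p k' where pk: "pk = (p, k')" by fastforce
    have d: "p < N" "k' * N + p < k * N + m" using cma_prevD[OF assms(1) step.hyps] Some pk by auto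
    have "cma_relayed N L a b h x w p k' = cma_relayed N L a b h x' w p k'"
      using Some pk d by (intro step.IH step.prems) auto
    moreover have "x (p, k') = x' (p, k')" using d by (intro step.prems)
    ultimately have "cma_signal N L a b h x w p k' = cma_signal N L a b h x' w p k'"
      by (simp only: cma_signal_eq)
    thus ?thesis using Some pk by (simp add: cma_relayed_def)
  qed (simp add: cma_relayed_def)
qed

text \<open>Existence of the coefficients is enough; their size is controlled by duality from the
  energy bound.\<close>

lemma cma_signal_noise_linear:
  assumes "N \<ge> 2" "m < N" "k < K"
  shows "\<exists>e. \<forall>w. cma_signal N L a b h (\<lambda>_. 0) w m k = (\<Sum>i\<in>{..<N} \<times> {..<K}. e i * w i)"
  using assms
proof (induction rule: cma_induct[where L=L and k=k])
  case (step m k)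
  let ?I = "{..<N} \<times> {..<K}"
  show ?case
  proof (cases "cma_prev N L m k")
    case None
    show ?thesis
      by (rule exI[of _ "\<lambda>_. 0"]) (simp add: cma_signal_eq[of N L a b h _ _ m k] cma_relayed_def None)
  next
    case (Some pk)
    obtain p k' where pk: "pk = (p, k')" by fastforce
    have d: "k' \<le> k" using cma_prevD[OF assms(1) step.hyps] Some pk by auto
    obtain e where e: "\<And>w. cma_signal N L a b h (\<lambda>_. 0) w p k' = (\<Sum>i\<in>?I. e i * w i)"
      using step.IH[of p k'] Some pk d step.prems by auto
    let ?e = "\<lambda>i. b m (h (m, p)) * (h (m, p) * e i + (if i = (m, k') then 1 else 0))"
    have "cma_signal N L a b h (\<lambda>_. 0) w m k = (\<Sum>i\<in>?I. ?e i * w i)" for w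
    proof -
      have "(\<Sum>i\<in>?I. ?e i * w i) = b m (h (m, p)) * (h (m, p) * (\<Sum>i\<in>?I. e i * w i) +
          (\<Sum>i\<in>?I. (if i = (m, k') then w i else 0)))"
        by (simp only: sum_distrib_left sum.distrib[symmetric])
          (intro sum.cong refl, auto simp: algebra_simps)
      also have "(\<Sum>i\<in>?I. (if i = (m, k') then w i else 0)) = w (m, k')"
        using step.hyps step.prems d by (subst sum.delta) auto
      finally show ?thesis
        by (simp add: cma_signal_eq[of N L a b h _ _ m k] cma_relayed_def Some pk e)
    qed
    thus ?thesis by (intro exI[of _ ?e] allI)
  qed
qed

text \<open>Links are asked for only with \<open>p \<noteq> q\<close>, as in the index set of
  \<open>source_gains\<close>. This suffices because a source never helps itself.\<close>

lemma measurable_cma_signal: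
  assumes "N \<ge> 2" "m < N" "k < K"
    and b [measurable]: "\<And>m. b m \<in> borel_measurable borel"
    and h [measurable]: "\<And>p q. p < N \<Longrightarrow> q < N \<Longrightarrow> p \<noteq> q \<Longrightarrow> (\<lambda>\<omega>. h \<omega> (p, q)) \<in> borel_measurable M"
    and x [measurable]: "\<And>p k. p < N \<Longrightarrow> k < K \<Longrightarrow> (\<lambda>\<omega>. x \<omega> (p, k)) \<in> borel_measurable M"
    and w [measurable]: "\<And>p k. p < N \<Longrightarrow> k < K \<Longrightarrow> (\<lambda>\<omega>. w \<omega> (p, k)) \<in> borel_measurable M"
  shows "(\<lambda>\<omega>. cma_signal N L a b (h \<omega>) (x \<omega>) (w \<omega>) m k) \<in> borel_measurable M"
  using assms(1-3)
proof (induction rule: cma_induct[where L=L and k=k])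
  case (step m k)
  note [measurable] = x[OF step.hyps step.prems]
  show ?case
  proof (cases "cma_prev N L m k")
    case None
    thus ?thesis by (subst cma_signal_eq) (simp add: cma_relayed_def)
  next
    case (Some pk)
    obtain p k' where pk: "pk = (p, k')" by fastforce
    have d: "k' \<le> k" "p < N" "p \<noteq> m" using cma_prevD[OF assms(1) step.hyps] Some pk by auto
    have [measurable]: "(\<lambda>\<omega>. cma_signal N L a b (h \<omega>) (x \<omega>) (w \<omega>) p k') \<in> borel_measurable M"
      using step.IH[of p k'] Some pk d step.prems by auto
    have [measurable]: "(\<lambda>\<omega>. h \<omega> (m, p)) \<in> borel_measurable M" "(\<lambda>\<omega>. w \<omega> (m, k')) \<in> borel_measurable M"
      using d step by auto
    show ?thesis by (subst cma_signal_eq) (simp add: cma_relayed_def Some pk)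
  qed
qed

text \<open>
  Each signal is repeated in a slot of its own frame or of the next one, hence at most \<open>2 * N\<close>
  times. The small repetition gain lets the energy of the repetitions be absorbed.
\<close>

lemma cma_signal_energy:
  assumes N: "N \<ge> 2" and a: "\<And>m. cmod (a m) \<le> 1 / 9"
    and b: "\<And>m c. cmod (b m c) \<le> 1 / (9 * real N)" "\<And>m c. cmod (b m c * c) \<le> 1 / (9 * real N)"
  shows "energy ({..<N} \<times> {..<K}) (\<lambda>(m, k). cma_signal N L a b h x w m k)
    \<le> energy ({..<N} \<times> {..<K}) x + energy ({..<N} \<times> {..<K}) w"
proof -
  let ?T = "cma_signal N L a b h x w"
  define \<beta> where "\<beta> = 1 / (9 * real N)"
  \<comment> \<open>The energy of the whole frame stands in for that of the one helped source, so
    the schedule need not be followed.\<close>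
  define t where "t k = (\<Sum>p<N. (cmod (?T p k))\<^sup>2)" for k
  have t0: "t k \<ge> 0" for k by (auto simp: t_def intro: sum_nonneg)
  have \<beta>: "0 \<le> \<beta>" by (simp add: \<beta>_def)
  have sq3: "(cmod (u + (v + z)))\<^sup>2 \<le> 3 * ((cmod u)\<^sup>2 + (cmod v)\<^sup>2 + (cmod z)\<^sup>2)" for u v z :: complex
  proof -
    have "cmod (u + (v + z)) \<le> cmod u + cmod v + cmod z"
      using norm_triangle_ineq[of u "v + z"] norm_triangle_ineq[of v z] by simp
    hence "(cmod (u + (v + z)))\<^sup>2 \<le> (cmod u + cmod v + cmod z)\<^sup>2" by (intro power_mono) auto
    also have "\<dots> \<le> 3 * ((cmod u)\<^sup>2 + (cmod v)\<^sup>2 + (cmod z)\<^sup>2)"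
      using sum_squares_bound[of "cmod u" "cmod v"] sum_squares_bound[of "cmod u" "cmod z"]
        sum_squares_bound[of "cmod v" "cmod z"] by (simp add: power2_eq_square algebra_simps)
    finally show ?thesis .
  qed
  let ?W = "\<lambda>m k. (cmod (w (m, k)))\<^sup>2"
  \<comment> \<open>The factor 3 comes from squaring a sum of three terms, 1 / 81 from the broadcast
    gain 1 / 9. The conditionals guard frame 0, where \<open>k - 1\<close> would be 0 again.\<close>
  have pt: "(cmod (?T m k))\<^sup>2 \<le> 3 * ((1 / 81) * (cmod (x (m, k)))\<^sup>2
      + \<beta>\<^sup>2 * (t k + (if k > 0 then t (k - 1) else 0))
      + \<beta>\<^sup>2 * (?W m k + (if k > 0 then ?W m (k - 1) else 0)))"
    if m: "m < N" for m k
  proof -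
    have ax: "(cmod (a m * x (m, k)))\<^sup>2 \<le> (1 / 81) * (cmod (x (m, k)))\<^sup>2"
      using power_mono[OF a[of m], of 2] unfolding norm_mult power_mult_distrib
      by (intro mult_right_mono) (auto simp: power_divide)
    show ?thesis
    proof (cases "cma_prev N L m k")
      case None
      have "(cmod (?T m k))\<^sup>2 = (cmod (a m * x (m, k)))\<^sup>2"
        by (subst cma_signal_eq) (simp add: cma_relayed_def None)
      also have "\<dots> \<le> 3 * ((1 / 81) * (cmod (x (m, k)))\<^sup>2)"
        using ax zero_le_power2[of "cmod (x (m, k))"] by linarith
      also have "\<dots> \<le> 3 * ((1 / 81) * (cmod (x (m, k)))\<^sup>2
          + \<beta>\<^sup>2 * (t k + (if k > 0 then t (k - 1) else 0))
          + \<beta>\<^sup>2 * (?W m k + (if k > 0 then ?W m (k - 1) else 0)))"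
        using t0 by simp
      finally show ?thesis .
    next
      case (Some pk)
      obtain p k' where pk: "pk = (p, k')" by fastforce
      note d = cma_prevD[OF N m Some[unfolded pk]]
      let ?c = "h (m, p)"
      have "(cmod (?T p k'))\<^sup>2 \<le> t k'"
        unfolding t_def using d(1) by (intro member_le_sum) auto
      also have "\<dots> \<le> t k + (if k > 0 then t (k - 1) else 0)"
        using d(4) t0 by auto
      finally have T: "(cmod (?T p k'))\<^sup>2 \<le> t k + (if k > 0 then t (k - 1) else 0)" .
      have W: "?W m k' \<le> ?W m k + (if k > 0 then ?W m (k - 1) else 0)"
        using d(4) by auto
      have "(cmod (b m ?c * ?c * ?T p k'))\<^sup>2 \<le> \<beta>\<^sup>2 * (cmod (?T p k'))\<^sup>2"
        using power_mono[OF b(2)[of m ?c], of 2] unfolding norm_mult[of "b m ?c * ?c"] power_mult_distrib \<beta>_def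
        by (intro mult_right_mono) auto
      hence 1: "(cmod (b m ?c * ?c * ?T p k'))\<^sup>2 \<le> \<beta>\<^sup>2 * (t k + (if k > 0 then t (k - 1) else 0))"
        using T by (meson mult_left_mono order_trans zero_le_power2)
      have "(cmod (b m ?c * w (m, k')))\<^sup>2 \<le> \<beta>\<^sup>2 * ?W m k'"
        using power_mono[OF b(1)[of m ?c], of 2] unfolding norm_mult power_mult_distrib \<beta>_def
        by (intro mult_right_mono) auto
      hence 2: "(cmod (b m ?c * w (m, k')))\<^sup>2 \<le> \<beta>\<^sup>2 * (?W m k + (if k > 0 then ?W m (k - 1) else 0))"
        using W by (meson mult_left_mono order_trans zero_le_power2)
      have eq: "?T m k = a m * x (m, k) + (b m ?c * ?c * ?T p k' + b m ?c * w (m, k'))"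
        by (subst cma_signal_eq) (simp add: cma_relayed_def Some pk algebra_simps)
      show ?thesis unfolding eq
        by (rule order_trans[OF sq3]) (intro mult_left_mono add_mono ax 1 2, simp)
    qed
  qed
  have shift: "(\<Sum>k<K. f k + (if k > 0 then f (k - 1) else 0)) \<le> 2 * (\<Sum>k<K. f k)"
    if "\<And>k. f k \<ge> 0" for f :: "nat \<Rightarrow> real"
  proof -
    have "(\<Sum>k<K. if k > 0 then f (k - 1) else 0) \<le> (\<Sum>k<K. f k)"
    proof (cases K)
      case (Suc K')
      have "(\<Sum>k<Suc K'. if k > 0 then f (k - 1) else 0) = (\<Sum>k<K'. f k)"
        by (subst sum.lessThan_Suc_shift) simp
      thus ?thesis using that[of K'] by (simp add: Suc)
    qed simp
    thus ?thesis by (simp add: sum.distrib)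
  qed
  define TE XE WE where "TE = (\<Sum>m<N. \<Sum>k<K. (cmod (?T m k))\<^sup>2)"
    and "XE = (\<Sum>m<N. \<Sum>k<K. (cmod (x (m, k)))\<^sup>2)" and "WE = (\<Sum>m<N. \<Sum>k<K. ?W m k)"
  have eq: "energy ({..<N} \<times> {..<K}) (\<lambda>(m, k). ?T m k) = TE" "energy ({..<N} \<times> {..<K}) x = XE"
    "energy ({..<N} \<times> {..<K}) w = WE"
    by (simp_all add: energy_def TE_def XE_def WE_def sum.cartesian_product case_prod_unfold)
  have tTE: "(\<Sum>k<K. t k) = TE" unfolding t_def TE_def by (rule sum.swap)
  have ET0: "TE \<ge> 0" and XE0: "XE \<ge> 0" and EW0: "WE \<ge> 0"
    by (auto simp: TE_def XE_def WE_def intro!: sum_nonneg)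
  have "TE \<le> (\<Sum>m<N. \<Sum>k<K. 3 * ((1 / 81) * (cmod (x (m, k)))\<^sup>2
      + \<beta>\<^sup>2 * (t k + (if k > 0 then t (k - 1) else 0))
      + \<beta>\<^sup>2 * (?W m k + (if k > 0 then ?W m (k - 1) else 0))))"
    unfolding TE_def by (intro sum_mono pt) auto
  also have "\<dots> = 3 * ((1 / 81) * XE + \<beta>\<^sup>2 * (\<Sum>m<N. \<Sum>k<K. t k + (if k > 0 then t (k - 1) else 0))
      + \<beta>\<^sup>2 * (\<Sum>m<N. \<Sum>k<K. ?W m k + (if k > 0 then ?W m (k - 1) else 0)))"
    by (simp only: sum_distrib_left[symmetric] sum.distrib XE_def)
  also have "\<dots> \<le> 3 * ((1 / 81) * XE + \<beta>\<^sup>2 * (\<Sum>m<N. 2 * TE) + \<beta>\<^sup>2 * (\<Sum>m<N. 2 * (\<Sum>k<K. ?W m k)))"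
    unfolding tTE[symmetric] using t0
    by (intro mult_left_mono add_mono sum_mono shift order_refl) auto
  also have "\<dots> = XE / 27 + 6 * (\<beta>\<^sup>2 * real N) * TE + 6 * \<beta>\<^sup>2 * WE"
    by (simp add: WE_def sum_distrib_left[symmetric] algebra_simps)
  also have "\<beta>\<^sup>2 * real N = (1 / 81) * (1 / real N)" using N by (simp add: \<beta>_def power2_eq_square)
  also have "\<beta>\<^sup>2 = (1 / 81) * (1 / (real N)\<^sup>2)" by (simp add: \<beta>_def power_divide power_mult_distrib)
  \<comment> \<open>\<open>TE\<close> also stands on the right; its coefficient there is at most 6 /
    81, so that term can be moved to the left.\<close>
  finally have "TE \<le> XE / 27 + 6 * (1 / 81 * (1 / real N)) * TE + 6 * (1 / 81 * (1 / (real N)\<^sup>2)) * WE" .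
  moreover have "1 / real N \<le> 1" "1 / (real N)\<^sup>2 \<le> 1" using N by (auto simp: one_le_power)
  hence "1 / real N * TE \<le> 1 * TE" "1 / (real N)\<^sup>2 * WE \<le> 1 * WE"
    using ET0 EW0 by (intro mult_right_mono; simp)+
  ultimately have "TE \<le> XE + WE" using XE0 EW0 by linarith
  thus ?thesis unfolding eq .
qed

section \<open>The schedule of the helpers and the repeated copies\<close>

definition helper :: "nat \<Rightarrow> nat \<Rightarrow> nat \<Rightarrow> nat \<Rightarrow> nat" where
  "helper N L p k = (p + (N - ((k div L) mod (N - 1) + 1))) mod N"

lemma helper_less: "N > 0 \<Longrightarrow> helper N L p k < N"
  by (simp add: helper_def)

text \<open>In every frame \<open>helped\<close> permutes the sources and \<open>helper\<close> is
  its inverse. The latter adds \<open>N - i\<close> instead of subtracting \<open>i\<close>, since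
  subtraction of naturals is cut off at 0.\<close>

lemma helped_helper:
  assumes "N \<ge> 2" "p < N"
  shows "helped N L (helper N L p k) k = p"
proof -
  define i where "i = (k div L) mod (N - 1) + 1"
  have i: "i \<le> N"
    using assms mod_less_divisor[of "N - 1" "k div L"] unfolding i_def by linarith
  have "helped N L (helper N L p k) k = ((p + (N - i)) mod N + i) mod N"
    by (simp add: helped_def helper_def i_def)
  also have "\<dots> = (p + (N - i) + i) mod N" by (rule mod_add_left_eq)
  also have "\<dots> = p" using i assms by simp
  finally show ?thesis .
qed

lemma helper_neq: "N \<ge> 2 \<Longrightarrow> p < N \<Longrightarrow> helper N L p k \<noteq> p"
  using helped_helper[of N p L k] helped_neq[of N p L k] by force

text \<open>The cyclic shifts by 1, ..., N - 1 run through all other sources, one per super-frame;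
  \<open>i * L\<close> is the first frame of super-frame \<open>i\<close>. Hence every link between
  two sources is used for the same number of frames.\<close>

lemma bij_betw_helper:
  assumes N: "N \<ge> 2" and L: "L > 0" and p: "p < N"
  shows "bij_betw (\<lambda>i. helper N L p (i * L)) {..<N - 1} ({..<N} - {p})"
proof -
  let ?f = "\<lambda>i. helper N L p (i * L)"
  have eq: "?f i = (p + (N - (i + 1))) mod N" if "i < N - 1" for i
    using that L by (simp add: helper_def)
  have inj: "inj_on ?f {..<N - 1}"
  proof (rule inj_onI)
    fix i j assume ij: "i \<in> {..<N - 1}" "j \<in> {..<N - 1}" and "?f i = ?f j"
    hence *: "(p + (N - (i + 1))) mod N = (p + (N - (j + 1))) mod N" by (simp add: eq)
    have m: "(p + a) mod N = (if p + a < N then p + a else p + a - N)" if "a \<le> N" for a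
      using that p by (auto simp: le_mod_geq)
    show "i = j" using * ij p by (simp add: m split: if_splits)
  qed
  have sub: "?f ` {..<N - 1} \<subseteq> {..<N} - {p}"
    using helper_less[of N] helper_neq[OF N p] N by auto
  have "card (?f ` {..<N - 1}) = card ({..<N} - {p})"
    using p by (subst card_image[OF inj]) simp
  hence "?f ` {..<N - 1} = {..<N} - {p}" by (intro card_subset_eq sub) auto
  thus ?thesis using inj by (simp add: bij_betw_def)
qed

text \<open>A helper with a larger number sends later in the same frame, one with a smaller number
  only in the next frame. The last frame of a super-frame is excluded because the partner may have
  changed by then.\<close>

lemma cma_signal_repeated:
  assumes N: "N \<ge> 2" and p: "p < N" and L: "L > 0" and k: "k mod L \<noteq> L - 1"
    and q: "q = helper N L p k" and x: "\<And>k. x (q, k) = 0"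
  shows "cma_signal N L a b h x (\<lambda>_. 0) q (if p < q then k else Suc k)
    = b q (h (q, p)) * h (q, p) * cma_signal N L a b h x (\<lambda>_. 0) p k"
proof -
  have hp: "helped N L q k = p" unfolding q by (rule helped_helper[OF N p])
  have "Suc k mod L \<noteq> 0" using k L by (auto simp: mod_Suc)
  hence "Suc k div L = k div L" by (simp add: div_Suc)
  hence hp': "helped N L q (Suc k) = p" using hp by (simp add: helped_def)
  have "cma_prev N L q (if p < q then k else Suc k) = Some (p, k)"
    using hp hp' by (cases "p < q") (auto simp: cma_prev_def)
  thus ?thesis by (subst cma_signal_eq) (simp add: cma_relayed_def x)
qed

text \<open>For squared moduli \<open>\<gamma>\<close>, the squared gain with which the destination
  sees the signal of \<open>p\<close>: the direct link, and the copy sent by the helper, provided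
  that no symbol of the helper disturbs it and no super-frame ends in between.\<close>

definition pair_weight where
  "pair_weight N L b h \<gamma> S p k = \<gamma> p + (if k mod L \<noteq> L - 1 \<and> helper N L p k \<notin> S
     then \<gamma> (helper N L p k) * (cmod (b (helper N L p k) (h (helper N L p k, p)) * h (helper N L p k, p)))\<^sup>2 else 0)"

text \<open>
  If the helper \<open>q\<close> of \<open>p\<close> has no symbol of its own, then its slot shows another copy of the signal
  of \<open>p\<close>, unless a change of super-frame intervenes.
\<close>

lemma sum_pair_weight_le:
  fixes \<gamma> :: "nat \<Rightarrow> real" and a b h
  assumes N: "N \<ge> 2" and L: "L > 0" and S: "S \<subseteq> {..<N}" and \<gamma>: "\<And>m. \<gamma> m \<ge> 0"
    and x: "\<And>q k. q \<notin> S \<Longrightarrow> x (q, k) = 0"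
  defines "T \<equiv> cma_signal N L a b h x (\<lambda>_. 0)"
  shows "(\<Sum>p\<in>S. \<Sum>k<frames N L. pair_weight N L b h \<gamma> S p k * (cmod (T p k))\<^sup>2)
    \<le> 3 * (\<Sum>m<N. \<Sum>k<frames N L. \<gamma> m * (cmod (T m k))\<^sup>2)"
proof -
  let ?K = "frames N L"
  define G where "G q k = \<gamma> q * (cmod (T q k))\<^sup>2" for q k
  define g where "g k = (\<Sum>q<N. G q k)" for k
  have G0: "G q k \<ge> 0" for q k using \<gamma> by (simp add: G_def)
  have g0: "g k \<ge> 0" for k using G0 by (auto simp: g_def intro: sum_nonneg)
  have fin: "finite S" using S finite_subset by blast
  define c where "c p k = (if k mod L \<noteq> L - 1 \<and> helper N L p k \<notin> S
     then \<gamma> (helper N L p k) * (cmod (b (helper N L p k) (h (helper N L p k, p)) * h (helper N L p k, p)))\<^sup>2 else 0)"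
    for p k
  have c: "(\<Sum>p\<in>S. c p k * (cmod (T p k))\<^sup>2) \<le> g k + (if Suc k < ?K then g (Suc k) else 0)" if k: "k < ?K" for k
  proof (cases "k mod L = L - 1")
    case True
    thus ?thesis using g0 by (simp add: c_def)
  next
    case False
    have "Suc k mod L \<noteq> 0" using False L by (auto simp: mod_Suc)
    \<comment> \<open>\<open>?K\<close> is a multiple of \<open>L\<close>, so a copy postponed to
      the next frame still falls inside the coherence interval.\<close>
    hence "Suc k \<noteq> ?K" by (auto simp: frames_def)
    hence Suc: "Suc k < ?K" using k by simp
    have "(\<Sum>p\<in>S. c p k * (cmod (T p k))\<^sup>2) \<le> (\<Sum>p\<in>S. G (helper N L p k) k + G (helper N L p k) (Suc k))"
    proof (rule sum_mono)
      fix p assume "p \<in> S"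
      hence p: "p < N" using S by auto
      define q where "q = helper N L p k"
      show "c p k * (cmod (T p k))\<^sup>2 \<le> G (helper N L p k) k + G (helper N L p k) (Suc k)"
      proof (cases "q \<in> S")
        case True
        thus ?thesis using G0 by (simp add: c_def q_def)
      next
        case q: False
        have "T q (if p < q then k else Suc k) = b q (h (q, p)) * h (q, p) * T p k"
          unfolding T_def by (intro cma_signal_repeated N p L False q_def x q)
        hence "c p k * (cmod (T p k))\<^sup>2 = G q (if p < q then k else Suc k)"
          using q False by (simp add: c_def q_def[symmetric] G_def norm_mult power_mult_distrib)
        thus ?thesis using G0[of q] by (auto simp: q_def[symmetric])
      qed
    qed
    \<comment> \<open>Distinct sources have distinct helpers, so no helper is counted twice.\<close>
    also have "\<dots> = (\<Sum>q\<in>(\<lambda>p. helper N L p k) ` S. G q k + G q (Suc k))"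
    proof (subst sum.reindex)
      show "inj_on (\<lambda>p. helper N L p k) S"
        using S helped_helper[OF N, of _ L k] by (intro inj_on_inverseI[of _ "\<lambda>q. helped N L q k"]) auto
    qed simp
    also have "\<dots> \<le> (\<Sum>q<N. G q k + G q (Suc k))"
      using G0 N helper_less[of N L _ k] by (intro sum_mono2) (auto intro: add_nonneg_nonneg)
    finally show ?thesis using Suc by (simp add: sum.distrib g_def)
  qed
  have shift: "(\<Sum>k<K. if Suc k < K then g (Suc k) else 0) \<le> (\<Sum>k<K. g k)" for K
  proof (cases K)
    case (Suc K')
    have "(\<Sum>k<Suc K'. if Suc k < Suc K' then g (Suc k) else 0) = (\<Sum>k<K'. g (Suc k))"
      by (simp add: sum.lessThan_Suc)
    also have "\<dots> \<le> (\<Sum>k<Suc K'. g k)"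
      using g0[of 0] by (simp add: sum.lessThan_Suc_shift del: sum.lessThan_Suc)
    finally show ?thesis by (simp add: Suc)
  qed simp
  have "(\<Sum>p\<in>S. \<Sum>k<?K. pair_weight N L b h \<gamma> S p k * (cmod (T p k))\<^sup>2)
      = (\<Sum>k<?K. (\<Sum>p\<in>S. G p k) + (\<Sum>p\<in>S. c p k * (cmod (T p k))\<^sup>2))"
    by (subst sum.swap) (simp add: pair_weight_def c_def G_def algebra_simps sum.distrib)
  \<comment> \<open>A slot counts once as a direct signal and at most twice as a copy, of a signal
    in its own frame or in the previous one. This is the factor 3.\<close>
  also have "\<dots> \<le> (\<Sum>k<?K. g k + (g k + (if Suc k < ?K then g (Suc k) else 0)))"
  proof (intro sum_mono add_mono)
    fix k assume "k \<in> {..<?K}"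
    thus "(\<Sum>p\<in>S. c p k * (cmod (T p k))\<^sup>2) \<le> g k + (if Suc k < ?K then g (Suc k) else 0)"
      by (intro c) simp
    show "(\<Sum>p\<in>S. G p k) \<le> g k" unfolding g_def using S G0 by (intro sum_mono2) auto
  qed
  also have "\<dots> \<le> 3 * (\<Sum>k<?K. g k)" using shift[of ?K] unfolding sum.distrib by linarith
  also have "(\<Sum>k<?K. g k) = (\<Sum>m<N. \<Sum>k<?K. G m k)" unfolding g_def by (rule sum.swap)
  finally show ?thesis by (simp add: G_def)
qed

text \<open>
  For a helper in \<open>S\<close>, whose own symbols also change, only the direct link is available. For a helper
  outside \<open>S\<close>, the bounds for the direct and for the relayed copy enter with weights \<open>1 / N\<close> and
  \<open>1 - 1 / N\<close>; over all pairs, every gain then gets the same exponent, whatever the set \<open>S\<close> is.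
\<close>

lemma prod_pair_bound:
  fixes \<psi> :: "nat \<Rightarrow> nat \<Rightarrow> real" and \<gamma> :: "nat \<Rightarrow> real" and \<eta> :: "nat \<times> nat \<Rightarrow> real"
  assumes N: "N \<ge> 2" and L: "L > 0" and S: "S \<subseteq> {..<N}" "S \<noteq> {}" and \<kappa>: "\<kappa> > 0"
    and \<gamma>: "\<And>m. m < N \<Longrightarrow> 0 < \<gamma> m \<and> \<gamma> m \<le> 1"
    and \<eta>: "\<And>q p. q < N \<Longrightarrow> p < N \<Longrightarrow> q \<noteq> p \<Longrightarrow> 0 < \<eta> (q, p) \<and> \<eta> (q, p) \<le> 1"
    and \<psi>: "\<And>p k. p \<in> S \<Longrightarrow> k < frames N L \<Longrightarrow> 0 < \<psi> p k \<and> \<psi> p k \<le> 1"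
    and direct: "\<And>p k. p \<in> S \<Longrightarrow> k < frames N L \<Longrightarrow> \<psi> p k \<le> 1 / (\<kappa> * \<gamma> p)"
    and relayed: "\<And>p k q. p \<in> S \<Longrightarrow> k < frames N L \<Longrightarrow> k mod L \<noteq> L - 1 \<Longrightarrow> q = helper N L p k \<Longrightarrow> q \<notin> S
      \<Longrightarrow> \<psi> p k \<le> 1 / (\<kappa> * (\<gamma> q * \<eta> (q, p)))"
  defines "Q \<equiv> (\<Prod>m<N. \<gamma> m) * (\<Prod>i\<in>{(j, i). j < N \<and> i < N \<and> j \<noteq> i}. \<eta> i)"
  shows "(\<Prod>p\<in>S. \<Prod>k<frames N L. \<psi> p k)
    \<le> exp (real (L - 1) * (real (card S) * real (N - 1) / real N) * (- real N * ln \<kappa> - ln Q))"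
proof -
  let ?O = "{(j, i). j < N \<and> i < N \<and> j \<noteq> (i::nat)}"
  define y where "y m = - ln (\<gamma> m)" for m
  define z where "z i = - ln (\<eta> i)" for i
  define s where "s = real (card S)"
  define n where "n = real N"
  have n: "n \<ge> 2" using N by (simp add: n_def)
  have fin: "finite S" using S finite_subset by blast
  have finO: "finite ?O" by (rule finite_subset[of _ "{..<N} \<times> {..<N}"]) auto
  have y: "y m \<ge> 0" if "m < N" for m using \<gamma>[OF that] by (simp add: y_def)
  have z: "z i \<ge> 0" if "i \<in> ?O" for i using \<eta>[of "fst i" "snd i"] that by (auto simp: z_def)
  have s: "1 \<le> s" using S fin by (simp add: s_def Suc_le_eq card_gt_0_iff)
  have sn: "s \<le> n" using card_mono[OF _ S(1)] by (simp add: s_def n_def)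
  \<comment> \<open>\<open>B p q\<close> bounds the logarithm of \<open>\<psi> p k\<close> in frames
    where \<open>q\<close> helps \<open>p\<close>. As all gains are at most 1, \<open>y\<close> and
    \<open>z\<close> are nonnegative.\<close>
  define B where "B p q = (if q \<in> S then - ln \<kappa> + y p
      else - ln \<kappa> + (1 / n) * y p + ((n - 1) / n) * (y q + z (q, p)))" for p q
  have lnB: "ln (\<psi> p k) \<le> B p (helper N L p k)" if p: "p \<in> S" and k: "k < frames N L" "k mod L \<noteq> L - 1" for p k
  proof -
    let ?q = "helper N L p k"
    have pN: "p < N" using p S by auto
    have q: "?q < N" "?q \<noteq> p" using helper_less[of N L p k] helper_neq[OF N pN] N by auto
    have \<psi>0: "\<psi> p k > 0" using \<psi>[OF p k(1)] by simp
    have "ln (\<psi> p k) \<le> ln (1 / (\<kappa> * \<gamma> p))"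
      using direct[OF p k(1)] \<psi>0 \<gamma>[OF pN] \<kappa> by simp
    also have "\<dots> = - ln \<kappa> + y p" using \<kappa> \<gamma>[OF pN] by (simp add: y_def ln_div ln_mult)
    finally have 1: "ln (\<psi> p k) \<le> - ln \<kappa> + y p" .
    show ?thesis
    proof (cases "?q \<in> S")
      case False
      have "ln (\<psi> p k) \<le> ln (1 / (\<kappa> * (\<gamma> ?q * \<eta> (?q, p))))"
        using relayed[OF p k refl False] \<psi>0 \<gamma>[OF q(1)] \<eta>[OF q(1) pN q(2)] \<kappa> by simp
      also have "\<dots> = - ln \<kappa> + (y ?q + z (?q, p))"
        using \<kappa> \<gamma>[OF q(1)] \<eta>[OF q(1) pN q(2)] by (simp add: y_def z_def ln_div ln_mult)
      finally have 2: "ln (\<psi> p k) \<le> - ln \<kappa> + (y ?q + z (?q, p))" .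
      have "ln (\<psi> p k) = (1 / n) * ln (\<psi> p k) + ((n - 1) / n) * ln (\<psi> p k)"
        using n by (simp add: field_simps)
      also have "\<dots> \<le> (1 / n) * (- ln \<kappa> + y p) + ((n - 1) / n) * (- ln \<kappa> + (y ?q + z (?q, p)))"
        using 1 2 n by (intro add_mono mult_left_mono) auto
      also have "\<dots> = B p ?q" using False n by (simp add: B_def field_simps)
      finally show ?thesis .
    qed (use 1 in \<open>simp add: B_def\<close>)
  qed
  have pbound: "(\<Sum>k<frames N L. ln (\<psi> p k)) \<le> real (L - 1) * (\<Sum>q\<in>{..<N} - {p}. B p q)" if p: "p \<in> S" for p
  proof -
    have pN: "p < N" using p S by auto
    have "(\<Sum>k<frames N L. ln (\<psi> p k)) = (\<Sum>i<N - 1. \<Sum>k\<in>{i * L..<i * L + L}. ln (\<psi> p k))"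
      unfolding frames_def by (rule sum.nat_group[symmetric])
    also have "\<dots> \<le> (\<Sum>i<N - 1. real (L - 1) * B p (helper N L p (i * L)))"
    proof (rule sum_mono)
      fix i assume "i \<in> {..<N - 1}"
      hence i: "i < N - 1" by simp
      have "i * L + L \<le> (N - 1) * L" using mult_le_mono1[of "Suc i" "N - 1" L] i by simp
      hence K: "k < frames N L" if "k < i * L + L" for k using that by (simp add: frames_def)
      have "(\<Sum>k\<in>{i * L..<i * L + L}. ln (\<psi> p k)) = (\<Sum>l<L. ln (\<psi> p (i * L + l)))"
        using sum.shift_bounds_nat_ivl[of "\<lambda>k. ln (\<psi> p k)" 0 "i * L" L]
        by (simp add: atLeast0LessThan add.commute)
      \<comment> \<open>In the last frame of the super-frame only \<open>\<psi> \<le> 1\<close> is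
        used, hence the \<open>L - 1\<close> in the bound.\<close>
      also have "\<dots> \<le> (\<Sum>l<L. if l = L - 1 then 0 else B p (helper N L p (i * L)))"
      proof (rule sum_mono)
        fix l assume "l \<in> {..<L}"
        hence l: "l < L" by simp
        have d: "(i * L + l) div L = i" "(i * L + l) mod L = l" using l by auto
        have h: "helper N L p (i * L + l) = helper N L p (i * L)" using L by (simp add: helper_def d)
        show "ln (\<psi> p (i * L + l)) \<le> (if l = L - 1 then 0 else B p (helper N L p (i * L)))"
          using \<psi>[OF p K[of "i * L + l"]] lnB[OF p K[of "i * L + l"]] l d h by auto
      qed
      also have "\<dots> = real (L - 1) * B p (helper N L p (i * L))"
      proof -
        obtain L' where "L = Suc L'" using L gr0_conv_Suc by auto
        thus ?thesis by (simp add: sum.lessThan_Suc)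
      qed
      finally show "(\<Sum>k\<in>{i * L..<i * L + L}. ln (\<psi> p k)) \<le> real (L - 1) * B p (helper N L p (i * L))" .
    qed
    also have "\<dots> = real (L - 1) * (\<Sum>q\<in>{..<N} - {p}. B p q)"
      using sum.reindex_bij_betw[OF bij_betw_helper[OF N L pN], of "B p"]
      by (simp add: sum_distrib_left[symmetric])
    finally show ?thesis .
  qed
  have total: "(\<Sum>p\<in>S. \<Sum>q\<in>{..<N} - {p}. B p q) \<le> (s * (n - 1) / n) * (- n * ln \<kappa> + ((\<Sum>m<N. y m) + (\<Sum>i\<in>?O. z i)))"
  proof -
    have cN: "real (card ({..<N} - S)) = n - s"
      using S fin by (subst card_Diff_subset) (auto simp: s_def n_def of_nat_diff card_mono[of "{..<N}", simplified])
    have inner: "(\<Sum>q\<in>{..<N} - {p}. B p q) = - (n - 1) * ln \<kappa> + ((s - 1) + (n - s) / n) * y p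
        + ((n - 1) / n) * (\<Sum>q\<in>{..<N} - S. y q + z (q, p))" if p: "p \<in> S" for p
    proof -
      have eq: "{..<N} - {p} = (S - {p}) \<union> ({..<N} - S)" using p S by auto
      have c1: "real (card (S - {p})) = s - 1" using p fin s by (simp add: s_def of_nat_diff Suc_le_eq card_gt_0_iff)
      have "(\<Sum>q\<in>{..<N} - {p}. B p q) = (\<Sum>q\<in>S - {p}. B p q) + (\<Sum>q\<in>{..<N} - S. B p q)"
        unfolding eq using fin by (intro sum.union_disjoint) auto
      also have "(\<Sum>q\<in>S - {p}. B p q) = (s - 1) * (- ln \<kappa> + y p)"
        by (simp add: B_def c1)
      also have "(\<Sum>q\<in>{..<N} - S. B p q)
          = (n - s) * (- ln \<kappa> + (1 / n) * y p) + ((n - 1) / n) * (\<Sum>q\<in>{..<N} - S. y q + z (q, p))"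
        by (simp add: B_def sum.distrib cN sum_distrib_left[symmetric] sum_divide_distrib[symmetric])
      finally show ?thesis by (simp add: algebra_simps)
    qed
    have "(\<Sum>p\<in>S. \<Sum>q\<in>{..<N} - {p}. B p q) = (\<Sum>p\<in>S. - (n - 1) * ln \<kappa> + ((s - 1) + (n - s) / n) * y p
        + ((n - 1) / n) * (\<Sum>q\<in>{..<N} - S. y q + z (q, p)))"
      by (intro sum.cong refl inner)
    also have "\<dots> = - s * (n - 1) * ln \<kappa> + ((s - 1) + (n - s) / n) * (\<Sum>p\<in>S. y p)
        + ((n - 1) / n) * (\<Sum>p\<in>S. \<Sum>q\<in>{..<N} - S. y q + z (q, p))"
      by (simp only: sum.distrib sum_distrib_left[symmetric]) (simp add: s_def algebra_simps)
    also have "(\<Sum>p\<in>S. \<Sum>q\<in>{..<N} - S. y q + z (q, p))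
        = s * (\<Sum>q\<in>{..<N} - S. y q) + (\<Sum>p\<in>S. \<Sum>q\<in>{..<N} - S. z (q, p))"
      by (simp add: sum.distrib s_def)
    \<comment> \<open>This equality is what singles out the weights: with weight u for the direct
      link, (s - 1) + (n - s) * u and s * (1 - u) agree for every s exactly if u = 1 / n.\<close>
    also have "(s - 1) + (n - s) / n = s * (n - 1) / n" using n by (simp add: field_simps)
    finally have "(\<Sum>p\<in>S. \<Sum>q\<in>{..<N} - {p}. B p q) = - s * (n - 1) * ln \<kappa>
        + (s * (n - 1) / n) * ((\<Sum>p\<in>S. y p) + (\<Sum>q\<in>{..<N} - S. y q))
        + ((n - 1) / n) * (\<Sum>p\<in>S. \<Sum>q\<in>{..<N} - S. z (q, p))"
      by (simp add: algebra_simps)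
    also have "(\<Sum>p\<in>S. y p) + (\<Sum>q\<in>{..<N} - S. y q) = (\<Sum>m<N. y m)"
      using S by (subst add.commute) (rule sum.subset_diff[symmetric], auto)
    also have "(\<Sum>p\<in>S. \<Sum>q\<in>{..<N} - S. z (q, p)) = (\<Sum>i\<in>({..<N} - S) \<times> S. z i)"
      by (subst sum.swap) (simp add: sum.cartesian_product)
    \<comment> \<open>Of the links between sources only those from \<open>S\<close> to its
      complement occur. The sum may be enlarged to all links because \<open>z\<close> is nonnegative
      and \<open>s \<ge> 1\<close>.\<close>
    also have "((n - 1) / n) * (\<Sum>i\<in>({..<N} - S) \<times> S. z i) \<le> (s * (n - 1) / n) * (\<Sum>i\<in>?O. z i)"
    proof (rule mult_mono)
      show "(\<Sum>i\<in>({..<N} - S) \<times> S. z i) \<le> (\<Sum>i\<in>?O. z i)"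
        using S z by (intro sum_mono2 finO) auto
      show "(\<Sum>i\<in>({..<N} - S) \<times> S. z i) \<ge> 0"
        using S by (intro sum_nonneg z) auto
      show "(n - 1) / n \<le> s * (n - 1) / n"
        using s n mult_right_mono[of 1 s "n - 1"] by (intro divide_right_mono) auto
    qed (use s n in auto)
    also have "- s * (n - 1) * ln \<kappa> = (s * (n - 1) / n) * (- n * ln \<kappa>)" using n by simp
    finally show ?thesis by (simp only: distrib_left add.assoc)
  qed
  have lnQ: "- ln Q = (\<Sum>m<N. y m) + (\<Sum>i\<in>?O. z i)"
  proof -
    have p1: "(\<Prod>m<N. \<gamma> m) > 0" using \<gamma> by (intro prod_pos) auto
    have p2: "(\<Prod>i\<in>?O. \<eta> i) > 0" using \<eta> by (intro prod_pos) auto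
    have "ln (\<Prod>m<N. \<gamma> m) = (\<Sum>m<N. ln (\<gamma> m))" using \<gamma> by (intro ln_prod) force+
    moreover have "ln (\<Prod>i\<in>?O. \<eta> i) = (\<Sum>i\<in>?O. ln (\<eta> i))" using \<eta> finO by (intro ln_prod) force+
    moreover have "ln Q = ln (\<Prod>m<N. \<gamma> m) + ln (\<Prod>i\<in>?O. \<eta> i)"
      unfolding Q_def by (rule ln_mult_pos[OF p1 p2])
    ultimately have "ln Q = (\<Sum>m<N. ln (\<gamma> m)) + (\<Sum>i\<in>?O. ln (\<eta> i))" by simp
    thus ?thesis by (simp add: y_def z_def sum_negf)
  qed
  have "(\<Prod>p\<in>S. \<Prod>k<frames N L. \<psi> p k) = exp (\<Sum>p\<in>S. \<Sum>k<frames N L. ln (\<psi> p k))"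
    using \<psi> fin by (simp add: exp_sum)
  also have "\<dots> \<le> exp (\<Sum>p\<in>S. real (L - 1) * (\<Sum>q\<in>{..<N} - {p}. B p q))"
    unfolding exp_le_cancel_iff by (intro sum_mono pbound)
  also have "(\<Sum>p\<in>S. real (L - 1) * (\<Sum>q\<in>{..<N} - {p}. B p q)) = real (L - 1) * (\<Sum>p\<in>S. \<Sum>q\<in>{..<N} - {p}. B p q)"
    by (simp add: sum_distrib_left)
  also have "\<dots> \<le> real (L - 1) * ((s * (n - 1) / n) * (- n * ln \<kappa> + ((\<Sum>m<N. y m) + (\<Sum>i\<in>?O. z i))))"
    by (intro mult_left_mono total) auto
  finally show ?thesis using N by (simp add: lnQ[symmetric] s_def n_def of_nat_diff mult.assoc)
qed

section \<open>Likelihood tests\<close>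

lemma cmod_sum_mult_square_le:
  fixes u v :: "'i \<Rightarrow> complex"
  shows "(cmod (\<Sum>i\<in>I. u i * v i))\<^sup>2 \<le> energy I u * energy I v"
proof -
  have "cmod (\<Sum>i\<in>I. u i * v i) \<le> (\<Sum>i\<in>I. cmod (u i) * cmod (v i))"
    by (rule order_trans[OF norm_sum]) (simp add: norm_mult)
  hence "(cmod (\<Sum>i\<in>I. u i * v i))\<^sup>2 \<le> (\<Sum>i\<in>I. cmod (u i) * cmod (v i))\<^sup>2"
    by (intro power_mono) auto
  also have "\<dots> \<le> energy I u * energy I v"
    unfolding energy_def by (rule Cauchy_Schwarz_ineq_sum)
  finally show ?thesis .
qed

text \<open>Duality: the functional is tested at the conjugate of \<open>f\<close>. Thus the
  coefficients of the forwarded noise are bounded through the energy bound, without a formula for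
  them.\<close>

lemma energy_le_of_functional_bound:
  assumes d: "d \<ge> 0" and bound: "\<And>w. (cmod (\<Sum>i\<in>I. f i * w i))\<^sup>2 \<le> d * energy I w"
  shows "energy I f \<le> d"
proof -
  have eq: "(\<Sum>i\<in>I. f i * cnj (f i)) = complex_of_real (energy I f)"
    by (simp only: complex_norm_square[symmetric] energy_def of_real_sum of_real_power)
  have cnj: "energy I (\<lambda>i. cnj (f i)) = energy I f" by (simp add: energy_def)
  have "(cmod (\<Sum>i\<in>I. f i * cnj (f i)))\<^sup>2 \<le> d * energy I (\<lambda>i. cnj (f i))"
    by (rule bound)
  hence "energy I f * energy I f \<le> d * energy I f"
    by (simp only: eq norm_of_real power2_abs cnj power2_eq_square abs_mult_self_eq)
  thus ?thesis
    using d by (cases "energy I f = 0")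
      (auto simp: energy_nonneg order_less_le dest: mult_right_le_imp_le)
qed

text \<open>\<open>b\<close> is bounded but not fixed, so that the converse and the power constraint
  also cover repetitions that are switched off. The second bound in \<open>b_bounds\<close> keeps a
  strong link from amplifying.\<close>

locale cma =
  fixes N L :: nat and \<sigma>v2 \<sigma>w2 :: real and a :: "nat \<Rightarrow> complex" and b :: "nat \<Rightarrow> complex \<Rightarrow> complex"
  assumes N: "N \<ge> 2" and \<sigma>v2: "\<sigma>v2 > 0" and \<sigma>w2: "\<sigma>w2 > 0"
    and a: "\<And>m. a m = 1 / 9"
    and b_measurable [measurable]: "\<And>m. b m \<in> borel_measurable borel"
    and b_bounds: "\<And>m c. cmod (b m c) \<le> 1 / (9 * real N)" "\<And>m c. cmod (b m c * c) \<le> 1 / (9 * real N)"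
begin

abbreviation "K \<equiv> frames N L"
abbreviation "slots \<equiv> {..<N} \<times> {..<K}"
abbreviation "T \<equiv> cma_signal N L a b"
abbreviation "lik \<equiv> cma_likelihood N L \<sigma>v2 \<sigma>w2 a b"

lemma T_energy: "energy slots (\<lambda>(m, k). T h x w m k) \<le> energy slots x + energy slots w"
  by (rule cma_signal_energy[OF N _ b_bounds]) (simp add: a)

lemma T_split: "m < N \<Longrightarrow> T h x w m k = T h x (\<lambda>_. 0) m k + T h (\<lambda>_. 0) w m k"
  using cma_signal_add[OF N, where x=x and x'="\<lambda>_. 0" and w="\<lambda>_. 0" and w'=w] by simp

lemma T_diff: "m < N \<Longrightarrow> T h (\<lambda>i. x' i - x i) (\<lambda>_. 0) m k = T h x' (\<lambda>_. 0) m k - T h x (\<lambda>_. 0) m k"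
  using cma_signal_add[OF N, where x="\<lambda>i. x' i - x i" and x'="x" and w="\<lambda>_. 0" and w'="\<lambda>_. 0"] by simp

lemma measurable_T [measurable (raw)]:
  assumes "m < N" "k < K"
    and "\<And>p q. p < N \<Longrightarrow> q < N \<Longrightarrow> p \<noteq> q \<Longrightarrow> (\<lambda>\<omega>. h \<omega> (p, q)) \<in> borel_measurable M"
    and "\<And>p k. p < N \<Longrightarrow> k < K \<Longrightarrow> (\<lambda>\<omega>. x \<omega> (p, k)) \<in> borel_measurable M"
    and "\<And>p k. p < N \<Longrightarrow> k < K \<Longrightarrow> (\<lambda>\<omega>. w \<omega> (p, k)) \<in> borel_measurable M"
  shows "(\<lambda>\<omega>. T (h \<omega>) (x \<omega>) (w \<omega>) m k) \<in> borel_measurable M"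
  by (rule measurable_cma_signal[OF N assms(1,2)]) (use assms in auto)

lemma measurable_T_noise:
  "m < N \<Longrightarrow> k < K \<Longrightarrow> (\<lambda>w. T h x w m k) \<in> borel_measurable (PiM slots (\<lambda>_. borel))"
  by (intro measurable_T) auto

lemma ennreal_lik:
  "ennreal (lik g h x y) = (\<integral>\<^sup>+w. (\<Prod>(j, k)\<in>slots. ennreal (cn_density \<sigma>v2 (y (j, k) - g j * T h x w j k))) \<partial>frame_noise N L \<sigma>w2)"
proof -
  interpret prob_space "frame_noise N L \<sigma>w2"
    unfolding frame_noise_def by (rule prob_space_PiM_cn) (rule \<sigma>w2)
  let ?f = "\<lambda>w. \<Prod>(j, k)\<in>slots. cn_density \<sigma>v2 (y (j, k) - g j * T h x w j k)"
  have f0: "?f w \<ge> 0" for w using cn_density_nonneg[OF \<sigma>v2] by (auto intro!: prod_nonneg)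
  have [measurable]: "?f \<in> borel_measurable (frame_noise N L \<sigma>w2)"
    unfolding frame_noise_def
    by (intro borel_measurable_prod) (auto simp: sets_PiM_cn intro!: measurable_compose[OF _ measurable_cn_density]
        borel_measurable_diff borel_measurable_times measurable_T_noise cong: measurable_cong_sets)
  have "?f w \<le> (\<Prod>i\<in>slots. 1 / (pi * \<sigma>v2))" for w
    using \<sigma>v2 by (intro prod_mono) (auto simp: cn_density_def divide_right_mono)
  hence "integrable (frame_noise N L \<sigma>w2) ?f"
    using f0 by (intro integrable_const_bound[of _ "\<Prod>i\<in>slots. 1 / (pi * \<sigma>v2)"] AE_I2) (simp_all add: abs_of_nonneg)
  hence "(\<integral>\<^sup>+w. ennreal (?f w) \<partial>frame_noise N L \<sigma>w2) = ennreal (lik g h x y)"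
    unfolding cma_likelihood_def by (intro nn_integral_eq_integral AE_I2 f0)
  moreover have "ennreal (?f w) = (\<Prod>(j, k)\<in>slots. ennreal (cn_density \<sigma>v2 (y (j, k) - g j * T h x w j k)))" for w
    using cn_density_nonneg[OF \<sigma>v2] by (subst prod_ennreal[symmetric]) (auto simp: case_prod_unfold)
  ultimately show ?thesis by simp
qed

lemma measurable_lik:
  assumes [measurable]: "\<And>p. p < N \<Longrightarrow> (\<lambda>\<omega>. g \<omega> p) \<in> borel_measurable M"
    and [measurable]: "\<And>p q. p < N \<Longrightarrow> q < N \<Longrightarrow> p \<noteq> q \<Longrightarrow> (\<lambda>\<omega>. h \<omega> (p, q)) \<in> borel_measurable M"
    and [measurable]: "\<And>p k. p < N \<Longrightarrow> k < K \<Longrightarrow> (\<lambda>\<omega>. x \<omega> (p, k)) \<in> borel_measurable M"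
    and [measurable]: "\<And>p k. p < N \<Longrightarrow> k < K \<Longrightarrow> (\<lambda>\<omega>. y \<omega> (p, k)) \<in> borel_measurable M"
  shows "(\<lambda>\<omega>. lik (g \<omega>) (h \<omega>) (x \<omega>) (y \<omega>)) \<in> borel_measurable M"
proof -
  interpret prob_space "frame_noise N L \<sigma>w2"
    unfolding frame_noise_def by (rule prob_space_PiM_cn) (rule \<sigma>w2)
  have w: "(\<lambda>z. snd z (p, k)) \<in> borel_measurable (M \<Otimes>\<^sub>M frame_noise N L \<sigma>w2)" if "p < N" "k < K" for p k
  proof -
    have [simp]: "p < N" "k < K" by fact+
    show ?thesis unfolding frame_noise_def by measurable
  qed
  have "(\<lambda>(\<omega>, w). \<Prod>(j, k)\<in>slots. cn_density \<sigma>v2 (y \<omega> (j, k) - g \<omega> j * T (h \<omega>) (x \<omega>) w j k))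
      \<in> borel_measurable (M \<Otimes>\<^sub>M frame_noise N L \<sigma>w2)"
    unfolding case_prod_unfold
  proof (intro borel_measurable_prod)
    fix i assume "i \<in> slots"
    hence i: "fst i < N" "snd i < K" by auto
    have [measurable]: "(\<lambda>z. T (h (fst z)) (x (fst z)) (snd z) (fst i) (snd i)) \<in> borel_measurable (M \<Otimes>\<^sub>M frame_noise N L \<sigma>w2)"
      using i by (intro measurable_T w) measurable
    show "(\<lambda>z. cn_density \<sigma>v2 (y (fst z) (fst i, snd i) - g (fst z) (fst i) * T (h (fst z)) (x (fst z)) (snd z) (fst i) (snd i)))
        \<in> borel_measurable (M \<Otimes>\<^sub>M frame_noise N L \<sigma>w2)"
      using i by measurable
  qed
  thus ?thesis unfolding cma_likelihood_def by (rule borel_measurable_lebesgue_integral)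
qed

lemma measurable_lik_output:
  "lik g h x \<in> borel_measurable (PiM slots (\<lambda>_. borel))"
  using measurable_lik[of "\<lambda>_. g" "PiM slots (\<lambda>_. borel)" "\<lambda>_. h" "\<lambda>_. x" "\<lambda>y. y"] by measurable

lemma lik_restrict: "lik g h x (restrict y slots) = lik g h x y"
  unfolding cma_likelihood_def by (intro Bochner_Integration.integral_cong refl prod.cong) auto

definition received where
  "received g h x w v = (\<lambda>(j, k). g j * T h x w j k + v (j, k))"

text \<open>Identifies \<open>lik\<close> as the density of the output when both noises are
  averaged. Outputs are restricted to \<open>slots\<close> because the product measure lives on
  extensional functions.\<close>

lemma nn_integral_received:
  assumes F [measurable]: "F \<in> borel_measurable (PiM slots (\<lambda>_. borel))"
  shows "(\<integral>\<^sup>+w. (\<integral>\<^sup>+v. F (restrict (received g h x w v) slots) \<partial>frame_noise N L \<sigma>v2) \<partial>frame_noise N L \<sigma>w2)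
    = (\<integral>\<^sup>+y. ennreal (lik g h x y) * F y \<partial>PiM slots (\<lambda>_. lborel))"
proof -
  let ?W = "frame_noise N L \<sigma>w2" and ?L = "PiM slots (\<lambda>_. lborel :: complex measure)"
  let ?f = "\<lambda>w y. \<Prod>(j, k)\<in>slots. ennreal (cn_density \<sigma>v2 (y (j, k) - g j * T h x w j k))"
  have fin: "finite slots" by simp
  interpret W: prob_space ?W unfolding frame_noise_def by (rule prob_space_PiM_cn) (rule \<sigma>w2)
  interpret pair_sigma_finite ?L ?W
    unfolding frame_noise_def by (intro pair_sigma_finite.intro sigma_finite_PiM_lborel sigma_finite_PiM_cn \<sigma>w2 fin)
  have w: "(\<lambda>z. snd z (p, k)) \<in> borel_measurable (?L \<Otimes>\<^sub>M ?W)" if "p < N" "k < K" for p k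
  proof -
    have [simp]: "p < N" "k < K" by fact+
    show ?thesis unfolding frame_noise_def by measurable
  qed
  have fm [measurable]: "(\<lambda>(y, w). ?f w y) \<in> borel_measurable (?L \<Otimes>\<^sub>M ?W)"
    unfolding case_prod_unfold
  proof (intro borel_measurable_prod_ennreal)
    fix i assume "i \<in> slots"
    hence i: "fst i < N" "snd i < K" "(fst i, snd i) \<in> slots" by auto
    have [measurable]: "(\<lambda>z. T h x (snd z) (fst i) (snd i)) \<in> borel_measurable (?L \<Otimes>\<^sub>M ?W)"
      using i by (intro measurable_T w) measurable
    show "(\<lambda>z. ennreal (cn_density \<sigma>v2 (fst z (fst i, snd i) - g (fst i) * T h x (snd z) (fst i) (snd i))))
        \<in> borel_measurable (?L \<Otimes>\<^sub>M ?W)"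
      using i by measurable
  qed
  have "(\<integral>\<^sup>+v. F (restrict (received g h x w v) slots) \<partial>frame_noise N L \<sigma>v2) = (\<integral>\<^sup>+y. ?f w y * F y \<partial>?L)" for w
    using nn_integral_PiM_cn_translate[OF fin \<sigma>v2 F, of "\<lambda>(j, k). g j * T h x w j k"]
    by (simp add: frame_noise_def received_def case_prod_unfold)
  hence "(\<integral>\<^sup>+w. (\<integral>\<^sup>+v. F (restrict (received g h x w v) slots) \<partial>frame_noise N L \<sigma>v2) \<partial>?W)
      = (\<integral>\<^sup>+w. (\<integral>\<^sup>+y. ?f w y * F y \<partial>?L) \<partial>?W)" by simp
  also have "\<dots> = (\<integral>\<^sup>+y. (\<integral>\<^sup>+w. ?f w y * F y \<partial>?W) \<partial>?L)"
    by (rule Fubini') measurable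
  also have "\<dots> = (\<integral>\<^sup>+y. ennreal (lik g h x y) * F y \<partial>?L)"
  proof (intro nn_integral_cong)
    fix y assume "y \<in> space ?L"
    hence "(\<lambda>w. ?f w y) \<in> borel_measurable ?W"
      using measurable_compose[OF measurable_Pair1' fm] by simp
    thus "(\<integral>\<^sup>+w. ?f w y * F y \<partial>?W) = ennreal (lik g h x y) * F y"
      by (subst nn_integral_multc) (auto simp: ennreal_lik)
  qed
  finally show ?thesis .
qed

text \<open>
  Comparing likelihoods is at least as good as any other test \<open>A\<close> between \<open>x\<close> and \<open>x'\<close>, in the
  sense of the sum of the two error probabilities.
\<close>

lemma likelihood_test_le:
  assumes A [measurable]: "A \<in> sets (PiM slots (\<lambda>_. borel))"
  shows "(\<integral>\<^sup>+w. (\<integral>\<^sup>+v. indicator {y. lik g h x y \<le> lik g h x' y} (received g h x w v)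
        \<partial>frame_noise N L \<sigma>v2) \<partial>frame_noise N L \<sigma>w2)
    \<le> (\<integral>\<^sup>+w. (\<integral>\<^sup>+v. indicator A (restrict (received g h x w v) slots)
        \<partial>frame_noise N L \<sigma>v2) \<partial>frame_noise N L \<sigma>w2)
    + (\<integral>\<^sup>+w. (\<integral>\<^sup>+v. indicator (- A) (restrict (received g h x' w v) slots)
        \<partial>frame_noise N L \<sigma>v2) \<partial>frame_noise N L \<sigma>w2)"
proof -
  let ?L = "PiM slots (\<lambda>_. lborel :: complex measure)"
  have [measurable]: "Measurable.pred (PiM slots (\<lambda>_. borel)) (\<lambda>y. lik g h x y \<le> lik g h x' y)"
    unfolding pred_def by (intro borel_measurable_le measurable_lik_output)
  have [measurable]: "(\<lambda>y. lik g h x y) \<in> borel_measurable (PiM slots (\<lambda>_. borel))" for x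
    by (rule measurable_lik_output)
  let ?F = "\<lambda>y. indicator {y. lik g h x y \<le> lik g h x' y} y :: ennreal"
  have Fm [measurable]: "?F \<in> borel_measurable (PiM slots (\<lambda>_. borel))" by measurable
  have Am [measurable]: "indicator A \<in> borel_measurable (PiM slots (\<lambda>_. borel))"
    "indicator (- A) \<in> borel_measurable (PiM slots (\<lambda>_. borel))"
  proof -
    show "indicator (- A) \<in> borel_measurable (PiM slots (\<lambda>_. borel))"
      by (subst measurable_cong[where g="indicator (space (PiM slots (\<lambda>_. borel)) - A)"]) (auto simp: indicator_def)
  qed measurable
  have "(\<integral>\<^sup>+w. (\<integral>\<^sup>+v. ?F (received g h x w v) \<partial>frame_noise N L \<sigma>v2) \<partial>frame_noise N L \<sigma>w2)
      = (\<integral>\<^sup>+w. (\<integral>\<^sup>+v. ?F (restrict (received g h x w v) slots) \<partial>frame_noise N L \<sigma>v2) \<partial>frame_noise N L \<sigma>w2)"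
    by (simp add: indicator_def lik_restrict)
  also have "\<dots> = (\<integral>\<^sup>+y. ennreal (lik g h x y) * ?F y \<partial>?L)"
    by (rule nn_integral_received[OF Fm])
  \<comment> \<open>Where the likelihood test errs, \<open>lik g h x y\<close> is the smaller
    likelihood, hence at most the one that \<open>A\<close> selects at \<open>y\<close>.\<close>
  also have "\<dots> \<le> (\<integral>\<^sup>+y. ennreal (lik g h x y) * indicator A y + ennreal (lik g h x' y) * indicator (- A) y \<partial>?L)"
    by (intro nn_integral_mono) (auto simp: indicator_def ennreal_leI)
  also have "\<dots> = (\<integral>\<^sup>+y. ennreal (lik g h x y) * indicator A y \<partial>?L) + (\<integral>\<^sup>+y. ennreal (lik g h x' y) * indicator (- A) y \<partial>?L)"
    by (rule nn_integral_add) measurable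
  finally show ?thesis by (simp only: nn_integral_received[OF Am(1)] nn_integral_received[OF Am(2)])
qed

text \<open>Keeps the phase and cuts the modulus at 1. Dividing the output by
  \<open>max 1 (cmod z)\<close> makes the last hop a contraction, so forwarded noise is not
  amplified there, and it can only shrink the noise of the destination.\<close>

definition norm_gain :: "complex \<Rightarrow> complex" where
  "norm_gain z = z / complex_of_real (max 1 (cmod z))"

lemma cmod_norm_gain: "(cmod (norm_gain z))\<^sup>2 = min 1 ((cmod z)\<^sup>2)"
proof (cases "cmod z \<le> 1")
  case True
  thus ?thesis using power_mono[OF True, of 2] by (simp add: norm_gain_def norm_divide max_def)
next
  case False
  hence "1 < (cmod z)\<^sup>2" "z \<noteq> 0" by (auto simp: one_less_power)
  thus ?thesis using False by (simp add: norm_gain_def norm_divide power_divide max_def)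
qed

text \<open>\<open>T_energy\<close> bounds the variance of the two noise parts of the linear test
  \<open>e\<close> by \<open>d * \<sigma>w2\<close> and \<open>d * \<sigma>v2\<close>. With
  \<open>s\<close> the sum of both noise variances, Chernoff's parameter 1 / s turns the threshold
  \<open>d / 2\<close> into the exponent - d / (2 * s) + d / (4 * s).\<close>

lemma noise_tail:
  assumes d: "energy slots e = d" "d > 0"
  shows "(\<integral>\<^sup>+w. (\<integral>\<^sup>+v. indicator {v. d / 2 \<le> Re (\<Sum>(m, k)\<in>slots. e (m, k) * (norm_gain (g m) * T h (\<lambda>_. 0) w m k))
        + Re (\<Sum>(m, k)\<in>slots. e (m, k) / complex_of_real (max 1 (cmod (g m))) * v (m, k))} v
      \<partial>frame_noise N L \<sigma>v2) \<partial>frame_noise N L \<sigma>w2)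
    \<le> ennreal (exp (- d / (4 * (\<sigma>v2 + \<sigma>w2))))"
proof -
  define s where "s = \<sigma>v2 + \<sigma>w2"
  have s: "s > 0" using \<sigma>v2 \<sigma>w2 by (simp add: s_def)
  define c where "c w = (\<Sum>(m, k)\<in>slots. e (m, k) * (norm_gain (g m) * T h (\<lambda>_. 0) w m k))" for w
  define e' where "e' = (\<lambda>(m, k). e (m, k) / complex_of_real (max 1 (cmod (g m))))"
  have "\<exists>f. \<forall>i\<in>slots. \<forall>w. T h (\<lambda>_. 0) w (fst i) (snd i) = (\<Sum>j\<in>slots. f i j * w j)"
    using cma_signal_noise_linear[OF N, where K=K and L=L and a=a and b=b and h=h] by (intro bchoice) auto
  then obtain f where f: "\<And>i w. i \<in> slots \<Longrightarrow> T h (\<lambda>_. 0) w (fst i) (snd i) = (\<Sum>j\<in>slots. f i j * w j)"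
    by blast
  \<comment> \<open>Coefficients of the source noise in the test, collected over all slots in which
    it reaches the destination.\<close>
  define F where "F j = (\<Sum>i\<in>slots. e i * norm_gain (g (fst i)) * f i j)" for j
  have cF: "c w = (\<Sum>j\<in>slots. F j * w j)" for w
  proof -
    have "c w = (\<Sum>i\<in>slots. \<Sum>j\<in>slots. e i * norm_gain (g (fst i)) * f i j * w j)"
      unfolding c_def case_prod_unfold by (intro sum.cong refl) (simp add: f sum_distrib_left mult.assoc)
    also have "\<dots> = (\<Sum>j\<in>slots. \<Sum>i\<in>slots. e i * norm_gain (g (fst i)) * f i j * w j)" by (rule sum.swap)
    finally show ?thesis by (simp add: F_def sum_distrib_right)
  qed
  have "(cmod (\<Sum>j\<in>slots. F j * w j))\<^sup>2 \<le> d * energy slots w" for w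
  proof -
    have "(cmod (c w))\<^sup>2 \<le> energy slots e * energy slots (\<lambda>(m, k). norm_gain (g m) * T h (\<lambda>_. 0) w m k)"
      using cmod_sum_mult_square_le[of e "\<lambda>(m, k). norm_gain (g m) * T h (\<lambda>_. 0) w m k" slots]
      by (simp add: c_def case_prod_unfold)
    also have "energy slots (\<lambda>(m, k). norm_gain (g m) * T h (\<lambda>_. 0) w m k) \<le> energy slots (\<lambda>(m, k). T h (\<lambda>_. 0) w m k)"
      unfolding energy_def
    proof (rule sum_mono)
      fix i assume "i \<in> slots"
      show "(cmod (case i of (m, k) \<Rightarrow> norm_gain (g m) * T h (\<lambda>_. 0) w m k))\<^sup>2
          \<le> (cmod (case i of (m, k) \<Rightarrow> T h (\<lambda>_. 0) w m k))\<^sup>2"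
        using mult_right_mono[of "(cmod (norm_gain (g (fst i))))\<^sup>2" 1 "(cmod (T h (\<lambda>_. 0) w (fst i) (snd i)))\<^sup>2"]
        by (simp add: case_prod_unfold norm_mult power_mult_distrib cmod_norm_gain)
    qed
    also have "\<dots> \<le> energy slots w" using T_energy[of h "\<lambda>_. 0" w] by (simp add: energy_def)
    finally show ?thesis using d by (simp add: cF mult_left_mono)
  qed
  hence Fd: "energy slots F \<le> d" using d by (intro energy_le_of_functional_bound) auto
  have "energy slots e' \<le> energy slots e"
    unfolding energy_def
  proof (rule sum_mono)
    fix i assume "i \<in> slots"
    have "cmod (e' i) \<le> cmod (e i)"
      by (simp add: e'_def case_prod_unfold norm_divide divide_le_eq mult_le_cancel_left1)
    thus "(cmod (e' i))\<^sup>2 \<le> (cmod (e i))\<^sup>2" by (intro power_mono) auto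
  qed
  hence e'd: "energy slots e' \<le> d" using d by simp
  have "(\<integral>\<^sup>+w. (\<integral>\<^sup>+v. indicator {v. d / 2 \<le> Re (c w) + Re (\<Sum>i\<in>slots. e' i * v i)} v
      \<partial>frame_noise N L \<sigma>v2) \<partial>frame_noise N L \<sigma>w2)
    \<le> (\<integral>\<^sup>+w. ennreal (exp ((1 / s) * (Re (c w) - d / 2) + (1 / s)\<^sup>2 * (\<sigma>v2 * energy slots e') / 4)) \<partial>frame_noise N L \<sigma>w2)"
    unfolding frame_noise_def using \<sigma>v2 s by (intro nn_integral_mono gaussian_linear_tail) auto
  also have "\<dots> \<le> (\<integral>\<^sup>+w. ennreal (exp (- d / (2 * s) + (1 / s)\<^sup>2 * (\<sigma>v2 * d) / 4)) *
      ennreal (exp (Re (\<Sum>j\<in>slots. (complex_of_real (1 / s) * F j) * w j))) \<partial>frame_noise N L \<sigma>w2)"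
  proof (intro nn_integral_mono)
    fix w
    have "(\<Sum>j\<in>slots. (complex_of_real (1 / s) * F j) * w j) = complex_of_real (1 / s) * c w"
      by (simp only: cF sum_distrib_left mult.assoc)
    hence R: "Re (\<Sum>j\<in>slots. (complex_of_real (1 / s) * F j) * w j) = (1 / s) * Re (c w)"
      by (simp only:) simp
    have "(1 / s)\<^sup>2 * (\<sigma>v2 * energy slots e') / 4 \<le> (1 / s)\<^sup>2 * (\<sigma>v2 * d) / 4"
      using e'd \<sigma>v2 by (intro divide_right_mono mult_left_mono) auto
    hence "exp ((1 / s) * (Re (c w) - d / 2) + (1 / s)\<^sup>2 * (\<sigma>v2 * energy slots e') / 4)
        \<le> exp ((- d / (2 * s) + (1 / s)\<^sup>2 * (\<sigma>v2 * d) / 4) + (1 / s) * Re (c w))"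
      by (simp add: diff_divide_distrib)
    also have "\<dots> = exp (- d / (2 * s) + (1 / s)\<^sup>2 * (\<sigma>v2 * d) / 4) * exp ((1 / s) * Re (c w))"
      by (rule exp_add)
    finally show "ennreal (exp ((1 / s) * (Re (c w) - d / 2) + (1 / s)\<^sup>2 * (\<sigma>v2 * energy slots e') / 4))
      \<le> ennreal (exp (- d / (2 * s) + (1 / s)\<^sup>2 * (\<sigma>v2 * d) / 4)) *
        ennreal (exp (Re (\<Sum>j\<in>slots. (complex_of_real (1 / s) * F j) * w j)))"
      unfolding R by (simp only: ennreal_mult'[symmetric] exp_ge_zero ennreal_leI)
  qed
  also have "\<dots> = ennreal (exp (- d / (2 * s) + (1 / s)\<^sup>2 * (\<sigma>v2 * d) / 4)) *
      ennreal (exp (\<sigma>w2 * energy slots (\<lambda>j. complex_of_real (1 / s) * F j) / 4))"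
    unfolding frame_noise_def
    by (subst nn_integral_cmult, measurable) (simp only: nn_integral_cn_exp_linear[OF _ \<sigma>w2] finite_SigmaI finite_lessThan)
  also have "\<dots> \<le> ennreal (exp (- d / (2 * s) + (1 / s)\<^sup>2 * (\<sigma>v2 * d) / 4)) * ennreal (exp ((1 / s)\<^sup>2 * (\<sigma>w2 * d) / 4))"
  proof -
    have "energy slots (\<lambda>j. complex_of_real (1 / s) * F j) = (1 / s)\<^sup>2 * energy slots F"
      using s by (simp add: energy_def norm_mult norm_divide power_mult_distrib power_divide sum_divide_distrib)
    also have "\<dots> \<le> (1 / s)\<^sup>2 * d" using Fd by (intro mult_left_mono) auto
    finally have "\<sigma>w2 * energy slots (\<lambda>j. complex_of_real (1 / s) * F j) / 4 \<le> \<sigma>w2 * ((1 / s)\<^sup>2 * d) / 4"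
      using \<sigma>w2 by (intro divide_right_mono mult_left_mono) auto
    thus ?thesis by (intro mult_left_mono ennreal_leI) (auto simp: mult_ac)
  qed
  also have "\<dots> = ennreal (exp (- d / (4 * s)))"
  proof -
    have "- d / (2 * s) + (1 / s)\<^sup>2 * (\<sigma>v2 * d) / 4 + (1 / s)\<^sup>2 * (\<sigma>w2 * d) / 4 = - d / (2 * s) + (1 / s)\<^sup>2 * (s * d) / 4"
      by (simp add: s_def algebra_simps add_divide_distrib)
    also have "\<dots> = - d / (4 * s)" using s by (simp add: power2_eq_square field_simps)
    finally show ?thesis by (simp only: ennreal_mult'[symmetric] exp_ge_zero exp_add[symmetric])
  qed
  finally show ?thesis by (simp add: c_def e'_def s_def case_prod_unfold)
qed

end

section \<open>Pairwise error probabilities and their average over the codebooks\<close>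

context cma
begin

text \<open>The rival test correlates the rescaled output with the difference of the two signals.
  Its mean is 0 for \<open>x\<close> and \<open>D2\<close> for \<open>x'\<close>, so either error
  means that the noise passes \<open>D2 / 2\<close>.\<close>

lemma pairwise_error:
  assumes D2: "D2 = (\<Sum>m<N. \<Sum>k<K. min 1 ((cmod (g m))\<^sup>2) * (cmod (T h (\<lambda>i. x' i - x i) (\<lambda>_. 0) m k))\<^sup>2)"
  shows "(\<integral>\<^sup>+w. (\<integral>\<^sup>+v. indicator {y. lik g h x y \<le> lik g h x' y} (received g h x w v)
        \<partial>frame_noise N L \<sigma>v2) \<partial>frame_noise N L \<sigma>w2)
    \<le> 2 * ennreal (exp (- D2 / (4 * (\<sigma>v2 + \<sigma>w2))))"
proof (cases "D2 = 0")
  case True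
  interpret W: prob_space "frame_noise N L \<sigma>w2" unfolding frame_noise_def by (rule prob_space_PiM_cn) (rule \<sigma>w2)
  interpret V: prob_space "frame_noise N L \<sigma>v2" unfolding frame_noise_def by (rule prob_space_PiM_cn) (rule \<sigma>v2)
  have "(\<integral>\<^sup>+w. (\<integral>\<^sup>+v. indicator {y. lik g h x y \<le> lik g h x' y} (received g h x w v)
        \<partial>frame_noise N L \<sigma>v2) \<partial>frame_noise N L \<sigma>w2)
    \<le> (\<integral>\<^sup>+w. (\<integral>\<^sup>+v. 1 \<partial>frame_noise N L \<sigma>v2) \<partial>frame_noise N L \<sigma>w2)"
    by (intro nn_integral_mono) (simp add: indicator_def)
  also have "\<dots> = 1" using V.emeasure_space_1 W.emeasure_space_1 by simp
  also have "(1::ennreal) \<le> 2" by simp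
  finally show ?thesis using True by simp
next
  case False
  define D where "D = (\<lambda>(m, k). norm_gain (g m) * T h (\<lambda>i. x' i - x i) (\<lambda>_. 0) m k)"
  define e where "e i = cnj (D i)" for i
  define M where "M i = complex_of_real (max 1 (cmod (g (fst i))))" for i :: "nat \<times> nat"
  have M: "M i \<noteq> 0" for i by (auto simp: M_def)
  have ng: "norm_gain (g (fst i)) = g (fst i) / M i" for i by (simp add: M_def norm_gain_def)
  have en: "energy slots D = D2"
    by (simp add: D2 energy_def D_def case_prod_unfold norm_mult power_mult_distrib cmod_norm_gain sum.cartesian_product)
  hence ene: "energy slots e = D2" "energy slots (\<lambda>i. - e i) = D2"
    by (simp_all add: e_def energy_def)
  have pos: "D2 > 0" using False energy_nonneg[of slots D] en by simp
  have eD: "(\<Sum>i\<in>slots. e i * D i) = complex_of_real D2"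
    unfolding en[symmetric] energy_def of_real_sum e_def
    by (intro sum.cong refl) (simp only: complex_norm_square mult.commute)
  define noise where "noise w v = Re (\<Sum>(m, k)\<in>slots. e (m, k) * (norm_gain (g m) * T h (\<lambda>_. 0) w m k))
        + Re (\<Sum>(m, k)\<in>slots. e (m, k) / complex_of_real (max 1 (cmod (g m))) * v (m, k))" for w v
  define \<Lambda> where "\<Lambda> y = Re (\<Sum>i\<in>slots. e i * (y i / M i - norm_gain (g (fst i)) * T h x (\<lambda>_. 0) (fst i) (snd i)))" for y
  define A where "A = {y \<in> space (PiM slots (\<lambda>_. borel)). D2 / 2 \<le> \<Lambda> y}"
  have A: "A \<in> sets (PiM slots (\<lambda>_. borel))"
  proof -
    have [measurable]: "(\<lambda>y. y i) \<in> borel_measurable (PiM slots (\<lambda>_. borel :: complex measure))" if "i \<in> slots" for i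
      using that by (rule measurable_component_singleton)
    show ?thesis unfolding A_def \<Lambda>_def by measurable
  qed
  have sp: "restrict y slots \<in> space (PiM slots (\<lambda>_. borel))" for y :: "nat \<times> nat \<Rightarrow> complex"
    by (auto simp: space_PiM)
  have \<Lambda>: "\<Lambda> (restrict (received g h z w v) slots) = noise w v
      + Re (\<Sum>i\<in>slots. e i * (norm_gain (g (fst i)) * (T h z (\<lambda>_. 0) (fst i) (snd i) - T h x (\<lambda>_. 0) (fst i) (snd i))))" for z w v
  proof -
    have "(\<Sum>i\<in>slots. e i * (restrict (received g h z w v) slots i / M i - norm_gain (g (fst i)) * T h x (\<lambda>_. 0) (fst i) (snd i)))
        = (\<Sum>i\<in>slots. e i * (norm_gain (g (fst i)) * T h (\<lambda>_. 0) w (fst i) (snd i)) + e i / M i * v i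
          + e i * (norm_gain (g (fst i)) * (T h z (\<lambda>_. 0) (fst i) (snd i) - T h x (\<lambda>_. 0) (fst i) (snd i))))"
    proof (intro sum.cong refl)
      fix i assume i: "i \<in> slots"
      hence "T h z w (fst i) (snd i) = T h z (\<lambda>_. 0) (fst i) (snd i) + T h (\<lambda>_. 0) w (fst i) (snd i)"
        by (intro T_split) auto
      thus "e i * (restrict (received g h z w v) slots i / M i - norm_gain (g (fst i)) * T h x (\<lambda>_. 0) (fst i) (snd i))
        = e i * (norm_gain (g (fst i)) * T h (\<lambda>_. 0) w (fst i) (snd i)) + e i / M i * v i
          + e i * (norm_gain (g (fst i)) * (T h z (\<lambda>_. 0) (fst i) (snd i) - T h x (\<lambda>_. 0) (fst i) (snd i)))"
        using i M[of i] by (simp add: received_def case_prod_unfold ng field_simps)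
    qed
    thus ?thesis by (simp add: \<Lambda>_def noise_def M_def case_prod_unfold sum.distrib)
  qed
  have \<Lambda>1: "\<Lambda> (restrict (received g h x w v) slots) = noise w v" for w v
    by (simp add: \<Lambda>)
  have \<Lambda>2: "\<Lambda> (restrict (received g h x' w v) slots) = noise w v + D2" for w v
  proof -
    have "(\<Sum>i\<in>slots. e i * (norm_gain (g (fst i)) * (T h x' (\<lambda>_. 0) (fst i) (snd i) - T h x (\<lambda>_. 0) (fst i) (snd i))))
        = (\<Sum>i\<in>slots. e i * D i)"
      by (intro sum.cong refl) (auto simp: D_def T_diff)
    thus ?thesis unfolding \<Lambda> eD by simp
  qed
  have neg: "- noise w v = Re (\<Sum>(m, k)\<in>slots. - e (m, k) * (norm_gain (g m) * T h (\<lambda>_. 0) w m k))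
        + Re (\<Sum>(m, k)\<in>slots. - e (m, k) / complex_of_real (max 1 (cmod (g m))) * v (m, k))" for w v
    by (simp add: noise_def case_prod_unfold sum_negf)
  have 1: "indicator A (restrict (received g h x w v) slots) \<le> (indicator {v. D2 / 2 \<le> noise w v} v :: ennreal)" for w v
    using \<Lambda>1[of w v] by (auto simp: A_def indicator_def)
  have 2: "indicator (- A) (restrict (received g h x' w v) slots) \<le> (indicator {v. D2 / 2 \<le> - noise w v} v :: ennreal)" for w v
    using \<Lambda>2[of w v] sp[of "received g h x' w v"] by (auto simp: A_def indicator_def)
  have "(\<integral>\<^sup>+w. (\<integral>\<^sup>+v. indicator {y. lik g h x y \<le> lik g h x' y} (received g h x w v)
        \<partial>frame_noise N L \<sigma>v2) \<partial>frame_noise N L \<sigma>w2)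
    \<le> (\<integral>\<^sup>+w. (\<integral>\<^sup>+v. indicator A (restrict (received g h x w v) slots)
        \<partial>frame_noise N L \<sigma>v2) \<partial>frame_noise N L \<sigma>w2)
    + (\<integral>\<^sup>+w. (\<integral>\<^sup>+v. indicator (- A) (restrict (received g h x' w v) slots)
        \<partial>frame_noise N L \<sigma>v2) \<partial>frame_noise N L \<sigma>w2)"
    by (rule likelihood_test_le[OF A])
  also have "\<dots> \<le> (\<integral>\<^sup>+w. (\<integral>\<^sup>+v. indicator {v. D2 / 2 \<le> noise w v} v \<partial>frame_noise N L \<sigma>v2) \<partial>frame_noise N L \<sigma>w2)
    + (\<integral>\<^sup>+w. (\<integral>\<^sup>+v. indicator {v. D2 / 2 \<le> - noise w v} v \<partial>frame_noise N L \<sigma>v2) \<partial>frame_noise N L \<sigma>w2)"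
    by (intro add_mono nn_integral_mono 1 2)
  also have "\<dots> \<le> ennreal (exp (- D2 / (4 * (\<sigma>v2 + \<sigma>w2)))) + ennreal (exp (- D2 / (4 * (\<sigma>v2 + \<sigma>w2))))"
    unfolding neg unfolding noise_def
    by (intro add_mono noise_tail[OF ene(1) pos] noise_tail[OF ene(2) pos])
  finally show ?thesis by (simp add: mult_2)
qed

text \<open>12 = 4 * 3: the 4 of \<open>pairwise_error\<close> and the 3 that
  \<open>sum_pair_weight_le\<close> loses by counting slots repeatedly.\<close>

definition err_const :: real where
  "err_const = 1 / (12 * (\<sigma>v2 + \<sigma>w2))"

lemma err_const_pos: "err_const > 0"
  using \<sigma>v2 \<sigma>w2 by (simp add: err_const_def)

text \<open>The gain comes from integrating only the codewords of \<open>\<mu>'\<close> for the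
  sources in \<open>S\<close>, in order of time. All others, including those of
  \<open>\<mu>\<close>, act as offsets that the integration does not see.\<close>

lemma averaged_pairwise_error:
  assumes E: "E > 0" and L: "L > 0"
    and \<mu>: "\<mu> \<in> {..<N} \<rightarrow>\<^sub>E {..<n}" and \<mu>': "\<mu>' \<in> {..<N} \<rightarrow>\<^sub>E {..<n}"
    and g: "\<And>m. m < N \<Longrightarrow> g m \<noteq> 0"
    and S: "S = {p. p < N \<and> \<mu>' p \<noteq> \<mu> p}"
  shows "(\<integral>\<^sup>+C. (\<integral>\<^sup>+w. (\<integral>\<^sup>+v. indicator {y. lik g h (code_symbols C \<mu>) y \<le> lik g h (code_symbols C \<mu>') y}
          (received g h (code_symbols C \<mu>) w v)
        \<partial>frame_noise N L \<sigma>v2) \<partial>frame_noise N L \<sigma>w2) \<partial>codebooks N L n E)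
    \<le> 2 * (\<Prod>p\<in>S. \<Prod>k<K. ennreal (min 1 (1 / (err_const * pair_weight N L b h (\<lambda>m. min 1 ((cmod (g m))\<^sup>2)) S p k * (cmod (1 / 9))\<^sup>2 * E))))"
proof -
  define \<gamma> where "\<gamma> m = min 1 ((cmod (g m))\<^sup>2)" for m
  have \<gamma>0: "\<gamma> m \<ge> 0" for m by (simp add: \<gamma>_def)
  define W where "W = pair_weight N L b h \<gamma> S"
  have SN: "S \<subseteq> {..<N}" by (auto simp: S)
  have fin: "finite S" using SN finite_subset by blast
  have W0: "W p k > 0" if "p \<in> S" for p k
    using that SN g[of p] \<gamma>0 by (auto simp: W_def pair_weight_def \<gamma>_def intro!: add_pos_nonneg)
  \<comment> \<open>Set to 0 outside \<open>S\<close> also for indices beyond \<open>N\<close>, as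
    \<open>sum_pair_weight_le\<close> demands; the signals of the sources below \<open>N\<close> are
    unchanged.\<close>
  define \<Delta> where "\<Delta> C = (\<lambda>(p, k). if p \<in> S then C (p, \<mu>' p, k) - C (p, \<mu> p, k) else 0)"
    for C :: "nat \<times> nat \<times> nat \<Rightarrow> complex"
  \<comment> \<open>The signal of \<open>p\<close> in frame \<open>k\<close> without the multiple 1
    / 9 of the integrated symbol.\<close>
  define z where "z = (\<lambda>(p, i :: nat, k) C. - (1 / 9) * C (p, \<mu> p, k) + cma_relayed N L a b h (\<Delta> C) (\<lambda>_. 0) p k)"
  define \<iota> where "\<iota> = (\<lambda>(p, k). (p, \<mu>' p, k :: nat))"
  define J where "J = \<iota> ` (S \<times> {..<K})"
  define time where "time = (\<lambda>(p, i :: nat, k). k * N + p)"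
  define c where "c = (\<lambda>(p, i :: nat, k). err_const * W p k)"
  let ?I = "{..<N} \<times> {..<n} \<times> {..<K}"
  have inj\<iota>: "inj_on \<iota> (S \<times> {..<K})" by (auto simp: inj_on_def \<iota>_def)
  have T\<Delta>: "T h (\<Delta> C) (\<lambda>_. 0) p k = 1 / 9 * C (p, \<mu>' p, k) + z (p, \<mu>' p, k) C" if "p \<in> S" for C p k
    using that by (subst cma_signal_eq) (simp add: z_def a \<Delta>_def algebra_simps)
  have D2: "(\<Sum>p\<in>S. \<Sum>k<K. W p k * (cmod (T h (\<Delta> C) (\<lambda>_. 0) p k))\<^sup>2)
      \<le> 3 * (\<Sum>m<N. \<Sum>k<K. \<gamma> m * (cmod (T h (\<lambda>i. code_symbols C \<mu>' i - code_symbols C \<mu> i) (\<lambda>_. 0) m k))\<^sup>2)" for C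
  proof -
    have "T h (\<lambda>i. code_symbols C \<mu>' i - code_symbols C \<mu> i) (\<lambda>_. 0) m k = T h (\<Delta> C) (\<lambda>_. 0) m k" if "m < N" for m k
      by (rule cma_signal_cong[OF N that]) (auto simp: code_symbols_def \<Delta>_def S)
    moreover have "(\<Sum>p\<in>S. \<Sum>k<K. W p k * (cmod (T h (\<Delta> C) (\<lambda>_. 0) p k))\<^sup>2)
        \<le> 3 * (\<Sum>m<N. \<Sum>k<K. \<gamma> m * (cmod (T h (\<Delta> C) (\<lambda>_. 0) m k))\<^sup>2)"
      unfolding W_def by (rule sum_pair_weight_le[OF N L SN \<gamma>0]) (simp add: \<Delta>_def)
    ultimately show ?thesis by simp
  qed
  have c3: "err_const * (3 * X) = X / (4 * (\<sigma>v2 + \<sigma>w2))" for X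
    using \<sigma>v2 \<sigma>w2 by (simp add: err_const_def field_simps)
  have pt: "(\<integral>\<^sup>+w. (\<integral>\<^sup>+v. indicator {y. lik g h (code_symbols C \<mu>) y \<le> lik g h (code_symbols C \<mu>') y}
          (received g h (code_symbols C \<mu>) w v)
        \<partial>frame_noise N L \<sigma>v2) \<partial>frame_noise N L \<sigma>w2)
      \<le> 2 * (\<Prod>i\<in>J. ennreal (exp (- c i * (cmod (1 / 9 * C i + z i C))\<^sup>2)))" for C
  proof -
    let ?D = "\<Sum>m<N. \<Sum>k<K. min 1 ((cmod (g m))\<^sup>2) * (cmod (T h (\<lambda>i. code_symbols C \<mu>' i - code_symbols C \<mu> i) (\<lambda>_. 0) m k))\<^sup>2"
    have "(\<Sum>i\<in>J. c i * (cmod (1 / 9 * C i + z i C))\<^sup>2)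
        = (\<Sum>i\<in>S \<times> {..<K}. c (\<iota> i) * (cmod (1 / 9 * C (\<iota> i) + z (\<iota> i) C))\<^sup>2)"
      unfolding J_def by (simp add: sum.reindex[OF inj\<iota>])
    also have "\<dots> = (\<Sum>i\<in>S \<times> {..<K}. err_const * (W (fst i) (snd i) * (cmod (T h (\<Delta> C) (\<lambda>_. 0) (fst i) (snd i)))\<^sup>2))"
      by (intro sum.cong refl) (auto simp: T\<Delta> c_def \<iota>_def)
    also have "\<dots> = err_const * (\<Sum>p\<in>S. \<Sum>k<K. W p k * (cmod (T h (\<Delta> C) (\<lambda>_. 0) p k))\<^sup>2)"
      by (simp only: sum_distrib_left[symmetric] sum.cartesian_product case_prod_unfold)
    also have "\<dots> \<le> err_const * (3 * ?D)"
      using D2[of C] err_const_pos by (intro mult_left_mono) (auto simp: \<gamma>_def)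
    also have "\<dots> = ?D / (4 * (\<sigma>v2 + \<sigma>w2))" by (rule c3)
    finally have "exp (- ?D / (4 * (\<sigma>v2 + \<sigma>w2))) \<le> exp (- (\<Sum>i\<in>J. c i * (cmod (1 / 9 * C i + z i C))\<^sup>2))"
      by simp
    also have "\<dots> = (\<Prod>i\<in>J. exp (- c i * (cmod (1 / 9 * C i + z i C))\<^sup>2))"
      using fin by (simp add: J_def exp_sum sum_negf[symmetric])
    finally have "ennreal (exp (- ?D / (4 * (\<sigma>v2 + \<sigma>w2)))) \<le> (\<Prod>i\<in>J. ennreal (exp (- c i * (cmod (1 / 9 * C i + z i C))\<^sup>2)))"
      by (simp add: prod_ennreal ennreal_leI)
    thus ?thesis by (intro order_trans[OF pairwise_error[OF refl]] mult_left_mono) auto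
  qed
  have Jsub: "J \<subseteq> ?I" using SN \<mu>' by (auto simp: J_def \<iota>_def PiE_def Pi_def)
  have compm [measurable]: "(\<lambda>C. C i) \<in> borel_measurable (PiM ?I (\<lambda>_. borel :: complex measure))" if "i \<in> ?I" for i
    using that by (rule measurable_component_singleton)
  have \<mu>n: "\<mu> p < n" "\<mu>' p < n" if "p < N" for p using \<mu> \<mu>' that by (auto simp: PiE_def Pi_def)
  have zm: "z i \<in> borel_measurable (PiM ?I (\<lambda>_. borel))" if iJ: "i \<in> J" for i
  proof -
    obtain p k where i: "i = (p, \<mu>' p, k)" "p \<in> S" "k < K" using iJ by (auto simp: J_def \<iota>_def)
    hence p: "p < N" using SN by auto
    have "(\<lambda>C. T h (\<Delta> C) (\<lambda>_. 0) p k - 1 / 9 * C (p, \<mu>' p, k)) \<in> borel_measurable (PiM ?I (\<lambda>_. borel))"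
    proof -
      have "(\<lambda>C. \<Delta> C (q, l)) \<in> borel_measurable (PiM ?I (\<lambda>_. borel))" if "q < N" "l < K" for q l
        using that \<mu>n by (cases "q \<in> S") (auto simp: \<Delta>_def intro!: borel_measurable_diff compm)
      hence "(\<lambda>C. T h (\<Delta> C) (\<lambda>_. 0) p k) \<in> borel_measurable (PiM ?I (\<lambda>_. borel))"
        using p i by (intro measurable_T) auto
      thus ?thesis using p i \<mu>n by (intro borel_measurable_diff borel_measurable_times compm) auto
    qed
    also have "(\<lambda>C. T h (\<Delta> C) (\<lambda>_. 0) p k - 1 / 9 * C (p, \<mu>' p, k)) = z i"
      using i by (auto simp: T\<Delta>)
    finally show ?thesis .
  qed
  have "(\<integral>\<^sup>+C. (\<Prod>i\<in>J. ennreal (exp (- c i * (cmod (1 / 9 * C i + z i C))\<^sup>2))) \<partial>codebooks N L n E)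
      \<le> (\<Prod>i\<in>J. ennreal (min 1 (1 / (c i * (cmod (1 / 9))\<^sup>2 * E))))"
    unfolding codebooks_def
  proof (rule nn_integral_triangular_le[where time=time, OF _ Jsub E])
    show "inj_on time J"
    proof (rule inj_onI)
      fix i j assume "i \<in> J" "j \<in> J" and t: "time i = time j"
      then obtain p k q l where ij: "i = (p, \<mu>' p, k)" "j = (q, \<mu>' q, l)" "p < N" "q < N"
        using SN by (auto simp: J_def \<iota>_def subset_iff)
      have "p + N * k = q + N * l" using t ij by (simp add: time_def mult.commute add.commute)
      hence "(p + N * k) mod N = (q + N * l) mod N" "(p + N * k) div N = (q + N * l) div N" by simp_all
      thus "i = j" using ij by simp
    qed
    show "c i > 0" if "i \<in> J" for i using that W0 err_const_pos by (auto simp: c_def J_def \<iota>_def)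
    show "z i \<in> borel_measurable (PiM ?I (\<lambda>_. borel))" if "i \<in> J" for i
      using that by (rule zm)
    show "z i (x(j := y)) = z i x" if ij: "i \<in> J" "j \<in> J" "time i \<le> time j" for i j x y
    proof -
      obtain p k where i: "i = (p, \<mu>' p, k)" "p \<in> S" "k < K" using ij(1) by (auto simp: J_def \<iota>_def)
      obtain q l where j: "j = (q, \<mu>' q, l)" "q \<in> S" "l < K" using ij(2) by (auto simp: J_def \<iota>_def)
      have t: "k * N + p \<le> l * N + q" using ij(3) i j by (simp add: time_def)
      have p: "p < N" using i SN by auto
      have "cma_relayed N L a b h (\<Delta> (x(j := y))) (\<lambda>_. 0) p k = cma_relayed N L a b h (\<Delta> x) (\<lambda>_. 0) p k"
      proof (rule cma_relayed_cong[OF N p])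
        fix r s assume "r < N" "s * N + r < k * N + p"
        hence "(r, s) \<noteq> (q, l)" using t by auto
        thus "\<Delta> (x(j := y)) (r, s) = \<Delta> x (r, s)" by (auto simp: \<Delta>_def j)
      qed
      \<comment> \<open>On \<open>S\<close> the two messages differ, so the transmitted codewords
        are never among the integrated coordinates.\<close>
      moreover have "(p, \<mu> p, k) \<noteq> j" using i j by (auto simp: S)
      ultimately show ?thesis using i by (simp add: z_def)
    qed
  qed auto
  also have "\<dots> = (\<Prod>i\<in>S \<times> {..<K}. ennreal (min 1 (1 / (c (\<iota> i) * (cmod (1 / 9))\<^sup>2 * E))))"
    unfolding J_def by (simp add: prod.reindex[OF inj\<iota>])
  also have "\<dots> = (\<Prod>p\<in>S. \<Prod>k<K. ennreal (min 1 (1 / (err_const * W p k * (cmod (1 / 9))\<^sup>2 * E))))"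
    by (simp add: prod.cartesian_product case_prod_unfold c_def \<iota>_def)
  finally have avg: "(\<integral>\<^sup>+C. (\<Prod>i\<in>J. ennreal (exp (- c i * (cmod (1 / 9 * C i + z i C))\<^sup>2))) \<partial>codebooks N L n E)
      \<le> (\<Prod>p\<in>S. \<Prod>k<K. ennreal (min 1 (1 / (err_const * W p k * (cmod (1 / 9))\<^sup>2 * E))))" .
  have "(\<integral>\<^sup>+C. (\<integral>\<^sup>+w. (\<integral>\<^sup>+v. indicator {y. lik g h (code_symbols C \<mu>) y \<le> lik g h (code_symbols C \<mu>') y}
          (received g h (code_symbols C \<mu>) w v)
        \<partial>frame_noise N L \<sigma>v2) \<partial>frame_noise N L \<sigma>w2) \<partial>codebooks N L n E)
    \<le> (\<integral>\<^sup>+C. 2 * (\<Prod>i\<in>J. ennreal (exp (- c i * (cmod (1 / 9 * C i + z i C))\<^sup>2))) \<partial>codebooks N L n E)"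
    by (intro nn_integral_mono pt)
  also have "\<dots> \<le> 2 * (\<Prod>p\<in>S. \<Prod>k<K. ennreal (min 1 (1 / (err_const * W p k * (cmod (1 / 9))\<^sup>2 * E))))"
  proof -
    have "(\<lambda>C. ennreal (exp (- c i * (cmod (1 / 9 * C i + z i C))\<^sup>2))) \<in> borel_measurable (codebooks N L n E)" if "i \<in> J" for i
    proof -
      have [measurable]: "z i \<in> borel_measurable (PiM ?I (\<lambda>_. borel))" using that by (rule zm)
      have [simp]: "i \<in> ?I" using that Jsub by blast
      show ?thesis unfolding codebooks_def by measurable
    qed
    hence "(\<lambda>C. \<Prod>i\<in>J. ennreal (exp (- c i * (cmod (1 / 9 * C i + z i C))\<^sup>2))) \<in> borel_measurable (codebooks N L n E)"
      by (intro borel_measurable_prod_ennreal)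
    thus ?thesis using avg by (subst nn_integral_cmult) (auto intro: mult_left_mono)
  qed
  finally show ?thesis by (simp only: W_def \<gamma>_def[abs_def])
qed

text \<open>In \<open>\<kappa>\<close>, 1 / 81 is the squared broadcast gain and 1 / (81 * N^2) the
  squared bound of the repetition gain. A power whose exponent is the number of confused sources is
  a form that can be summed over all tuples.\<close>

lemma averaged_pairwise_bound:
  assumes b: "\<And>m c. b m c = complex_of_real (1 / (9 * real N * max 1 (cmod c)))"
    and E: "E > 0" and L: "L > 0"
    and \<mu>: "\<mu> \<in> {..<N} \<rightarrow>\<^sub>E {..<n}" and \<mu>': "\<mu>' \<in> {..<N} \<rightarrow>\<^sub>E {..<n}" "\<mu>' \<noteq> \<mu>"
    and Q: "Q = trunc_gain {..<N} g * trunc_gain {(j, i). j < N \<and> i < N \<and> j \<noteq> i} h" "Q \<noteq> 0"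
    and \<kappa>: "\<kappa> = err_const / 81 * E * (1 / (81 * (real N)\<^sup>2))"
  shows "(\<integral>\<^sup>+C. (\<integral>\<^sup>+w. (\<integral>\<^sup>+v. indicator {y. lik g h (code_symbols C \<mu>) y \<le> lik g h (code_symbols C \<mu>') y}
          (received g h (code_symbols C \<mu>) w v)
        \<partial>frame_noise N L \<sigma>v2) \<partial>frame_noise N L \<sigma>w2) \<partial>codebooks N L n E)
    \<le> 2 * ennreal (exp (real (L - 1) * (real (N - 1) / real N) * (- real N * ln \<kappa> - ln Q)) ^ card {p. p < N \<and> \<mu>' p \<noteq> \<mu> p})"
proof -
  let ?O = "{(j, i). j < N \<and> i < N \<and> j \<noteq> (i::nat)}"
  define S where "S = {p. p < N \<and> \<mu>' p \<noteq> \<mu> p}"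
  define \<gamma> where "\<gamma> m = min 1 ((cmod (g m))\<^sup>2)" for m
  define \<eta> where "\<eta> i = min 1 ((cmod (h i))\<^sup>2)" for i
  define W where "W = pair_weight N L b h \<gamma> S"
  define \<psi> where "\<psi> p k = min 1 (1 / (err_const * W p k * (cmod (1 / 9))\<^sup>2 * E))" for p k
  have finO: "finite ?O" by (rule finite_subset[of _ "{..<N} \<times> {..<N}"]) auto
  have SN: "S \<subseteq> {..<N}" by (auto simp: S_def)
  have Sne: "S \<noteq> {}"
  proof
    assume "S = {}"
    hence "\<mu>' = \<mu>" using \<mu> \<mu>' by (intro PiE_ext[of _ "{..<N}" "\<lambda>_. {..<n}"]) (auto simp: S_def)
    with \<mu>' show False by simp
  qed
  have Q': "Q = (\<Prod>m<N. \<gamma> m) * (\<Prod>i\<in>?O. \<eta> i)" by (simp add: Q trunc_gain_def \<gamma>_def \<eta>_def)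
  have \<gamma>: "0 < \<gamma> m \<and> \<gamma> m \<le> 1" if "m < N" for m
  proof -
    have "\<gamma> m \<noteq> 0" using Q'  Q(2) that by (auto simp: prod_zero_iff)
    thus ?thesis by (auto simp: \<gamma>_def min_def split: if_splits)
  qed
  have \<eta>: "0 < \<eta> (q, p) \<and> \<eta> (q, p) \<le> 1" if "q < N" "p < N" "q \<noteq> p" for q p
  proof -
    have "\<eta> (q, p) \<noteq> 0" using Q' Q(2) that finO by (auto simp: prod_zero_iff)
    thus ?thesis by (auto simp: \<eta>_def min_def split: if_splits)
  qed
  have g: "g m \<noteq> 0" if "m < N" for m using \<gamma>[OF that] by (auto simp: \<gamma>_def)
  define \<beta>2 where "\<beta>2 = 1 / (81 * (real N)\<^sup>2)"
  have \<beta>2: "0 < \<beta>2" "\<beta>2 \<le> 1" 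
  proof -
    have "1 \<le> real N ^ 2" using N by (intro one_le_power) auto
    moreover from this have "0 < 81 * (real N)\<^sup>2" "1 \<le> 81 * (real N)\<^sup>2" by linarith+
    ultimately show "0 < \<beta>2" "\<beta>2 \<le> 1" unfolding \<beta>2_def by (simp_all only: zero_less_divide_1_iff divide_le_eq_1_pos)
  qed
  define \<alpha> where "\<alpha> = err_const / 81 * E"
  have \<alpha>: "\<alpha> > 0" using err_const_pos E by (simp add: \<alpha>_def)
  have \<kappa>\<alpha>: "\<kappa> = \<alpha> * \<beta>2" by (simp add: \<kappa> \<alpha>_def \<beta>2_def)
  have \<psi>W: "\<psi> p k = min 1 (1 / (\<alpha> * W p k))" for p k
    by (simp add: \<psi>_def \<alpha>_def norm_divide power_divide mult_ac)
  have bc: "(cmod (b q c * c))\<^sup>2 = \<beta>2 * min 1 ((cmod c)\<^sup>2)" for q c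
  proof -
    have "cmod (b q c * c) = 1 / (9 * real N) * cmod (norm_gain c)"
      by (simp add: b norm_gain_def norm_mult norm_divide)
    thus ?thesis by (simp only: power_mult_distrib cmod_norm_gain) (simp add: \<beta>2_def power_divide power_mult_distrib)
  qed
  have Wge: "W p k \<ge> \<gamma> p" if "p \<in> S" for p k
    using that SN \<gamma>[of "helper N L p k"] helper_less[of N L p k] N by (auto simp: W_def pair_weight_def)
  have bound: "\<psi> p k \<le> 1 / (\<kappa> * t)" if "t > 0" "\<beta>2 * t \<le> W p k" for p k t
  proof -
    have "\<kappa> * t \<le> \<alpha> * W p k" using that \<alpha> by (simp add: \<kappa>\<alpha> mult.assoc)
    moreover have "\<kappa> * t > 0" using that \<alpha> \<beta>2 by (simp add: \<kappa>\<alpha>)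
    ultimately have "1 / (\<alpha> * W p k) \<le> 1 / (\<kappa> * t)" by (intro frac_le) auto
    thus ?thesis by (simp add: \<psi>W min_le_iff_disj)
  qed
  have \<psi>pos: "0 < \<psi> p k \<and> \<psi> p k \<le> 1" if "p \<in> S" for p k
  proof -
    have "W p k > 0" using Wge[OF that, of k] \<gamma>[of p] that SN by force
    thus ?thesis using \<alpha> by (simp add: \<psi>W)
  qed
  have "(\<Prod>p\<in>S. \<Prod>k<K. \<psi> p k)
    \<le> exp (real (L - 1) * (real (card S) * real (N - 1) / real N) * (- real N * ln \<kappa> - ln Q))"
    unfolding Q'
  proof (rule prod_pair_bound[where \<gamma>=\<gamma> and \<eta>=\<eta> and \<psi>=\<psi>, OF N L SN Sne])
    show "0 < \<gamma> m \<and> \<gamma> m \<le> 1" if "m < N" for m using that by (rule \<gamma>)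
    show "0 < \<eta> (q, p) \<and> \<eta> (q, p) \<le> 1" if "q < N" "p < N" "q \<noteq> p" for q p using that by (rule \<eta>)
    show "0 < \<psi> p k \<and> \<psi> p k \<le> 1" if "p \<in> S" for p k using that by (rule \<psi>pos)
    show "\<kappa> > 0" using \<alpha> \<beta>2 by (simp add: \<kappa>\<alpha>)
    show "\<psi> p k \<le> 1 / (\<kappa> * \<gamma> p)" if "p \<in> S" for p k
    proof (rule bound)
      show "\<gamma> p > 0" using \<gamma>[of p] that SN by force
      \<comment> \<open>The direct link gives away the factor \<open>\<beta>2\<close> so that both
        kinds of links share one \<open>\<kappa>\<close>.\<close>
      hence "\<beta>2 * \<gamma> p \<le> \<gamma> p" using \<beta>2 by (simp add: mult_left_le_one_le)
      thus "\<beta>2 * \<gamma> p \<le> W p k" using Wge[OF that, of k] by simp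
    qed
    show "\<psi> p k \<le> 1 / (\<kappa> * (\<gamma> q * \<eta> (q, p)))"
      if "p \<in> S" "k mod L \<noteq> L - 1" "q = helper N L p k" "q \<notin> S" for p k q
    proof (rule bound)
      have p: "p < N" using that SN by auto
      have q: "q < N" "q \<noteq> p" using that helper_less[of N L p k] helper_neq[OF N p] N by auto
      show "\<gamma> q * \<eta> (q, p) > 0" using \<gamma>[OF q(1)] \<eta>[OF q(1) p q(2)] by simp
      have "W p k = \<gamma> p + \<gamma> q * (\<beta>2 * \<eta> (q, p))"
        using that by (simp add: W_def pair_weight_def bc \<eta>_def)
      thus "\<beta>2 * (\<gamma> q * \<eta> (q, p)) \<le> W p k" using \<gamma>[OF p] by (simp add: algebra_simps)
    qed
  qed
  also have "\<dots> = exp (real (L - 1) * (real (N - 1) / real N) * (- real N * ln \<kappa> - ln Q)) ^ card S"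
    by (simp add: exp_of_nat_mult[symmetric] mult_ac)
  finally have fin: "ennreal (\<Prod>p\<in>S. \<Prod>k<K. \<psi> p k)
      \<le> ennreal (exp (real (L - 1) * (real (N - 1) / real N) * (- real N * ln \<kappa> - ln Q)) ^ card S)"
    by (rule ennreal_leI)
  have "ennreal (\<Prod>p\<in>S. \<Prod>k<K. \<psi> p k) = (\<Prod>p\<in>S. \<Prod>k<K. ennreal (\<psi> p k))"
    using \<psi>pos by (subst prod_ennreal[symmetric]) (auto intro!: prod_nonneg prod.cong simp: prod_ennreal less_imp_le)
  hence le: "(\<Prod>p\<in>S. \<Prod>k<K. ennreal (\<psi> p k))
      \<le> ennreal (exp (real (L - 1) * (real (N - 1) / real N) * (- real N * ln \<kappa> - ln Q)) ^ card S)"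
    using fin by (simp only:)
  show ?thesis
    using averaged_pairwise_error[where g=g and h=h, OF E L \<mu> \<mu>'(1) g S_def]
    unfolding S_def[symmetric] \<gamma>_def[symmetric] W_def[symmetric] \<psi>_def[symmetric]
    by (rule order_trans) (assumption, intro mult_left_mono le, simp)
qed

end

text \<open>Generating function of the Hamming distance to \<open>\<mu>\<close>: a component
  contributes 1 where it agrees and \<open>r\<close> for each of the n - 1 other values.\<close>

lemma sum_power_card_neq:
  fixes r :: real
  assumes \<mu>: "\<mu> \<in> {..<N} \<rightarrow>\<^sub>E {..<n}"
  shows "(\<Sum>\<mu>'\<in>{..<N} \<rightarrow>\<^sub>E {..<n}. r ^ card {p. p < N \<and> \<mu>' p \<noteq> \<mu> p}) = (1 + (real n - 1) * r) ^ N"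
proof -
  have "r ^ card {p. p < N \<and> \<mu>' p \<noteq> \<mu> p} = (\<Prod>p<N. if \<mu>' p \<noteq> \<mu> p then r else 1)" for \<mu>'
  proof -
    have "(\<Prod>p<N. if \<mu>' p \<noteq> \<mu> p then r else 1) = (\<Prod>p\<in>{p \<in> {..<N}. \<mu>' p \<noteq> \<mu> p}. r)"
      by (rule prod.inter_filter[symmetric]) simp
    thus ?thesis by simp
  qed
  hence "(\<Sum>\<mu>'\<in>{..<N} \<rightarrow>\<^sub>E {..<n}. r ^ card {p. p < N \<and> \<mu>' p \<noteq> \<mu> p})
      = (\<Sum>\<mu>'\<in>{..<N} \<rightarrow>\<^sub>E {..<n}. \<Prod>p<N. if \<mu>' p \<noteq> \<mu> p then r else 1)" by simp
  also have "\<dots> = (\<Prod>p<N. \<Sum>i<n. if i \<noteq> \<mu> p then r else 1)"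
    by (rule prod_sum_PiE[symmetric]) auto
  also have "\<dots> = (\<Prod>p<N. 1 + (real n - 1) * r)"
  proof (intro prod.cong refl)
    fix p assume "p \<in> {..<N}"
    hence p: "\<mu> p \<in> {..<n}" using \<mu> by (auto simp: PiE_def Pi_def)
    have "(\<Sum>i<n. if i \<noteq> \<mu> p then r else 1) = 1 + (\<Sum>i\<in>{..<n} - {\<mu> p}. if i \<noteq> \<mu> p then r else 1)"
      using p by (subst sum.remove[of _ "\<mu> p"]) auto
    also have "(\<Sum>i\<in>{..<n} - {\<mu> p}. if i \<noteq> \<mu> p then r else 1) = (\<Sum>i\<in>{..<n} - {\<mu> p}. r)"
      by (intro sum.cong) auto
    also have "\<dots> = (real n - 1) * r" using p by (cases n) auto
    finally show "(\<Sum>i<n. if i \<noteq> \<mu> p then r else 1) = 1 + (real n - 1) * r" .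
  qed
  finally show ?thesis by simp
qed

section \<open>The error probability of the protocol\<close>

lemma nn_integral_pair_iterate:
  assumes "prob_space M2" and f: "f \<in> borel_measurable (M1 \<Otimes>\<^sub>M M2)"
  shows "(\<integral>\<^sup>+z. f z \<partial>(M1 \<Otimes>\<^sub>M M2)) = (\<integral>\<^sup>+x. (\<integral>\<^sup>+y. f (x, y) \<partial>M2) \<partial>M1)"
proof -
  interpret prob_space M2 by fact
  show ?thesis using nn_integral_fst[OF f] by simp
qed

lemma measurable_section: "f \<in> measurable (M1 \<Otimes>\<^sub>M M2) M3 \<Longrightarrow> x \<in> space M1 \<Longrightarrow> (\<lambda>y. f (x, y)) \<in> measurable M2 M3"
  by (rule measurable_compose[OF measurable_Pair1'])

lemma prob_space_messages: "n > 0 \<Longrightarrow> prob_space (messages N n)"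
  unfolding messages_def by (intro prob_space_PiM prob_space_uniform_count_measure) auto

lemma prob_space_dest_gains: "prob_space (dest_gains N)"
  unfolding dest_gains_def by (rule prob_space_PiM_cn) simp

section \<open>Iterated integrals for the error probability and the union bound\<close>

context cma
begin

lemma prob_space_frame_noise: "s > 0 \<Longrightarrow> prob_space (frame_noise N L s)"
  unfolding frame_noise_def by (rule prob_space_PiM_cn)

lemma prob_space_codebooks: "E > 0 \<Longrightarrow> prob_space (codebooks N L n E)"
  unfolding codebooks_def by (rule prob_space_PiM_cn)

lemma prob_space_source_gains: "prob_space (source_gains N)"
  unfolding source_gains_def by (rule prob_space_PiM_cn) simp

lemma measurable_component_cn:
  "i \<in> I \<Longrightarrow> f \<in> measurable M (PiM I (\<lambda>_. cn s)) \<Longrightarrow> (\<lambda>\<omega>. f \<omega> i) \<in> borel_measurable M"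
  using measurable_compose[of f M "PiM I (\<lambda>_. cn s)" "\<lambda>x. x i" "cn s"] measurable_component_singleton[of i I "\<lambda>_. cn s"]
  by (simp add: measurable_cong_sets[OF refl sets_cn])

abbreviation "tuples n \<equiv> {..<N} \<rightarrow>\<^sub>E {..<n :: nat}"

lemma finite_tuples: "finite (tuples n)"
  by (intro finite_PiE) auto

definition ml_error where
  "ml_error n j g h C \<mu> w v \<longleftrightarrow> (\<exists>\<mu>'\<in>tuples n. (\<forall>\<mu>''\<in>tuples n.
     lik g h (code_symbols C \<mu>'') (received g h (code_symbols C \<mu>) w v)
       \<le> lik g h (code_symbols C \<mu>') (received g h (code_symbols C \<mu>) w v)) \<and> \<mu>' j \<noteq> \<mu> j)"

text \<open>The random message selects among finitely many measurable coordinates, so the symbol is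
  a finite sum over the message values.\<close>

lemma measurable_message_symbol:
  assumes [measurable]: "\<And>p i k. p < N \<Longrightarrow> i < n \<Longrightarrow> k < K \<Longrightarrow> (\<lambda>\<omega>. C \<omega> (p, i, k)) \<in> borel_measurable M"
    and \<mu>: "\<mu> \<in> measurable M (messages N n)" and pk: "p < N" "k < K"
  shows "(\<lambda>\<omega>. code_symbols (C \<omega>) (\<mu> \<omega>) (p, k)) \<in> borel_measurable M"
proof -
  have m: "(\<lambda>\<omega>. \<mu> \<omega> p) \<in> measurable M (uniform_count_measure {..<n})"
    using measurable_compose[OF \<mu>[unfolded messages_def] measurable_component_singleton[of p]] pk by simp
  have [measurable]: "Measurable.pred M (\<lambda>\<omega>. \<mu> \<omega> p = i)" if "i < n" for i
    using measurable_sets[OF m, of "{i}"] that by (simp add: pred_def vimage_def Int_def conj_commute sets_uniform_count_measure)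
  have "(\<lambda>\<omega>. \<Sum>i<n. if \<mu> \<omega> p = i then C \<omega> (p, i, k) else 0) \<in> borel_measurable M"
    using pk by (intro borel_measurable_sum) auto
  also have "?this \<longleftrightarrow> (\<lambda>\<omega>. code_symbols (C \<omega>) (\<mu> \<omega>) (p, k)) \<in> borel_measurable M"
  proof (rule measurable_cong)
    fix \<omega> assume "\<omega> \<in> space M"
    hence "\<mu> \<omega> p < n" using measurable_space[OF m] by (simp add: space_uniform_count_measure)
    thus "(\<Sum>i<n. if \<mu> \<omega> p = i then C \<omega> (p, i, k) else 0) = code_symbols (C \<omega>) (\<mu> \<omega>) (p, k)"
      by (simp add: code_symbols_def)
  qed
  finally show ?thesis .
qed

lemma measurable_ml_error:
  assumes g: "g \<in> measurable M (dest_gains N)" and h: "h \<in> measurable M (source_gains N)"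
    and C: "C \<in> measurable M (codebooks N L n E)" and \<mu>: "\<mu> \<in> measurable M (messages N n)"
    and w: "w \<in> measurable M (frame_noise N L s)" and v: "v \<in> measurable M (frame_noise N L s')"
    and j: "j < N"
  shows "Measurable.pred M (\<lambda>\<omega>. ml_error n j (g \<omega>) (h \<omega>) (C \<omega>) (\<mu> \<omega>) (w \<omega>) (v \<omega>))"
    and "\<mu>1 \<in> tuples n \<Longrightarrow> \<mu>2 \<in> tuples n \<Longrightarrow> Measurable.pred M (\<lambda>\<omega>.
      lik (g \<omega>) (h \<omega>) (code_symbols (C \<omega>) \<mu>1) (received (g \<omega>) (h \<omega>) (code_symbols (C \<omega>) (\<mu> \<omega>)) (w \<omega>) (v \<omega>))
      \<le> lik (g \<omega>) (h \<omega>) (code_symbols (C \<omega>) \<mu>2) (received (g \<omega>) (h \<omega>) (code_symbols (C \<omega>) (\<mu> \<omega>)) (w \<omega>) (v \<omega>)))"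
proof -
  have gm: "(\<lambda>\<omega>. g \<omega> p) \<in> borel_measurable M" if "p < N" for p
    using that g unfolding dest_gains_def by (intro measurable_component_cn) auto
  have hm: "(\<lambda>\<omega>. h \<omega> (p, q)) \<in> borel_measurable M" if "p < N" "q < N" "p \<noteq> q" for p q
    using that h unfolding source_gains_def by (intro measurable_component_cn) auto
  have Cm: "(\<lambda>\<omega>. C \<omega> (p, i, k)) \<in> borel_measurable M" if "p < N" "i < n" "k < K" for p i k
    using that C unfolding codebooks_def by (intro measurable_component_cn) auto
  have wm: "(\<lambda>\<omega>. w \<omega> (p, k)) \<in> borel_measurable M" if "p < N" "k < K" for p k
    using that w unfolding frame_noise_def by (intro measurable_component_cn) auto
  have vm: "(\<lambda>\<omega>. v \<omega> (p, k)) \<in> borel_measurable M" if "p < N" "k < K" for p k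
    using that v unfolding frame_noise_def by (intro measurable_component_cn) auto
  have ym: "(\<lambda>\<omega>. received (g \<omega>) (h \<omega>) (code_symbols (C \<omega>) (\<mu> \<omega>)) (w \<omega>) (v \<omega>) (p, k)) \<in> borel_measurable M"
    if "p < N" "k < K" for p k
    unfolding received_def prod.case using that
    by (intro borel_measurable_add borel_measurable_times gm vm measurable_T hm wm
        measurable_message_symbol[where C=C and \<mu>=\<mu> and n=n] Cm \<mu>)
  have lm: "(\<lambda>\<omega>. lik (g \<omega>) (h \<omega>) (code_symbols (C \<omega>) \<mu>') (received (g \<omega>) (h \<omega>) (code_symbols (C \<omega>) (\<mu> \<omega>)) (w \<omega>) (v \<omega>))) \<in> borel_measurable M"
    if "\<mu>' \<in> tuples n" for \<mu>'
  proof (intro measurable_lik gm hm ym)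
    fix p k assume pk: "p < N" "k < K"
    have "\<mu>' p < n" using that pk by (auto simp: PiE_def Pi_def)
    thus "(\<lambda>\<omega>. code_symbols (C \<omega>) \<mu>' (p, k)) \<in> borel_measurable M"
      using Cm pk by (simp add: code_symbols_def)
  qed
  show 2: "Measurable.pred M (\<lambda>\<omega>.
      lik (g \<omega>) (h \<omega>) (code_symbols (C \<omega>) \<mu>1) (received (g \<omega>) (h \<omega>) (code_symbols (C \<omega>) (\<mu> \<omega>)) (w \<omega>) (v \<omega>))
      \<le> lik (g \<omega>) (h \<omega>) (code_symbols (C \<omega>) \<mu>2) (received (g \<omega>) (h \<omega>) (code_symbols (C \<omega>) (\<mu> \<omega>)) (w \<omega>) (v \<omega>)))"
    if "\<mu>1 \<in> tuples n" "\<mu>2 \<in> tuples n" for \<mu>1 \<mu>2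
    unfolding pred_def by (intro borel_measurable_le lm that)
  have m: "(\<lambda>\<omega>. \<mu> \<omega> j) \<in> measurable M (uniform_count_measure {..<n})"
    using measurable_compose[OF \<mu>[unfolded messages_def] measurable_component_singleton[of j]] j by simp
  have 3: "Measurable.pred M (\<lambda>\<omega>. \<mu>' j = \<mu> \<omega> j)" for \<mu>'
  proof -
    have "(\<lambda>\<omega>. \<mu> \<omega> j) -` ({..<n} \<inter> {\<mu>' j}) \<inter> space M = {\<omega> \<in> space M. \<mu>' j = \<mu> \<omega> j}"
      using measurable_space[OF m] by (auto simp: space_uniform_count_measure)
    thus ?thesis using measurable_sets[OF m, of "{..<n} \<inter> {\<mu>' j}"]
      by (simp add: pred_def sets_uniform_count_measure)
  qed
  show "Measurable.pred M (\<lambda>\<omega>. ml_error n j (g \<omega>) (h \<omega>) (C \<omega>) (\<mu> \<omega>) (w \<omega>) (v \<omega>))"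
    unfolding ml_error_def using 2 3
    by (intro pred_intros_finite(4) pred_intros_finite(3) pred_intros_logic finite_tuples) auto
qed

lemma cma_error_prob_eq:
  assumes n: "n > 0" and E: "E > 0" and j: "j < N"
  shows "ennreal (cma_error_prob N L n \<sigma>v2 \<sigma>w2 E a b j) =
    (\<integral>\<^sup>+g. (\<integral>\<^sup>+h. (\<integral>\<^sup>+C. (\<integral>\<^sup>+\<mu>. (\<integral>\<^sup>+w. (\<integral>\<^sup>+v. indicator {v. ml_error n j g h C \<mu> w v} v
      \<partial>frame_noise N L \<sigma>v2) \<partial>frame_noise N L \<sigma>w2) \<partial>messages N n) \<partial>codebooks N L n E)
      \<partial>source_gains N) \<partial>dest_gains N)"
proof -
  let ?V = "frame_noise N L \<sigma>v2" let ?W = "frame_noise N L \<sigma>w2 \<Otimes>\<^sub>M ?V"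
  let ?M = "messages N n \<Otimes>\<^sub>M ?W" let ?C = "codebooks N L n E \<Otimes>\<^sub>M ?M"
  let ?H = "source_gains N \<Otimes>\<^sub>M ?C" let ?G = "dest_gains N \<Otimes>\<^sub>M ?H"
  note ps = prob_space_frame_noise[OF \<sigma>v2] prob_space_frame_noise[OF \<sigma>w2] prob_space_messages[OF n, of N]
    prob_space_codebooks[OF E, of n] prob_space_source_gains prob_space_dest_gains
  have W: "prob_space ?W" by (intro prob_space_pair ps)
  have M: "prob_space ?M" by (intro prob_space_pair ps W)
  have C: "prob_space ?C" by (intro prob_space_pair ps M)
  have H: "prob_space ?H" by (intro prob_space_pair ps C)
  have G: "prob_space ?G" by (intro prob_space_pair ps H)
  interpret G: prob_space ?G by (rule G)
  define f :: "_ \<Rightarrow> ennreal" where "f = (\<lambda>(g, h, C, \<mu>, w, v). indicator {v. ml_error n j g h C \<mu> w v} v)"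
  have pm: "Measurable.pred ?G (\<lambda>z. ml_error n j (fst z) (fst (snd z)) (fst (snd (snd z))) (fst (snd (snd (snd z))))
      (fst (snd (snd (snd (snd z))))) (snd (snd (snd (snd (snd z))))))"
    by (rule measurable_ml_error(1)[OF _ _ _ _ _ _ j]) measurable
  hence fm: "f \<in> borel_measurable ?G"
    unfolding f_def case_prod_unfold indicator_def mem_Collect_eq by measurable
  have err: "(\<exists>\<mu>' \<in> cma_ml_decisions N L n \<sigma>v2 \<sigma>w2 a b g h C
      (\<lambda>(i, k). g i * cma_signal N L a b h (code_symbols C \<mu>) w i k + v (i, k)). \<mu>' j \<noteq> \<mu> j)
      \<longleftrightarrow> ml_error n j g h C \<mu> w v" for g h C \<mu> w v
    unfolding ml_error_def cma_ml_decisions_def received_def by blast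
  have set: "{(g, h, C, \<mu>, w, v) \<in> space ?G.
           \<exists>\<mu>' \<in> cma_ml_decisions N L n \<sigma>v2 \<sigma>w2 a b g h C
                  (\<lambda>(i, k). g i * cma_signal N L a b h (code_symbols C \<mu>) w i k + v (i, k)).
             \<mu>' j \<noteq> \<mu> j} = {z \<in> space ?G. ml_error n j (fst z) (fst (snd z)) (fst (snd (snd z))) (fst (snd (snd (snd z))))
      (fst (snd (snd (snd (snd z))))) (snd (snd (snd (snd (snd z)))))}"
    by (simp only: err) (auto simp: case_prod_unfold)
  have "ennreal (cma_error_prob N L n \<sigma>v2 \<sigma>w2 E a b j) = emeasure ?G {z \<in> space ?G. ml_error n j (fst z) (fst (snd z)) (fst (snd (snd z))) (fst (snd (snd (snd z))))
      (fst (snd (snd (snd (snd z))))) (snd (snd (snd (snd (snd z)))))}"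
    unfolding cma_error_prob_def Let_def set by (simp add: G.emeasure_eq_measure)
  also have "\<dots> = (\<integral>\<^sup>+z. indicator {z \<in> space ?G. ml_error n j (fst z) (fst (snd z)) (fst (snd (snd z))) (fst (snd (snd (snd z))))
      (fst (snd (snd (snd (snd z))))) (snd (snd (snd (snd (snd z)))))} z \<partial>?G)"
    using pm by (intro nn_integral_indicator[symmetric]) (simp add: pred_def)
  also have "\<dots> = (\<integral>\<^sup>+z. f z \<partial>?G)"
    by (intro nn_integral_cong) (auto simp: f_def indicator_def)
  also have "\<dots> = (\<integral>\<^sup>+g. (\<integral>\<^sup>+z. f (g, z) \<partial>?H) \<partial>dest_gains N)"
    by (rule nn_integral_pair_iterate[OF H fm])
  also have "\<dots> = (\<integral>\<^sup>+g. (\<integral>\<^sup>+h. (\<integral>\<^sup>+C. (\<integral>\<^sup>+\<mu>. (\<integral>\<^sup>+w. (\<integral>\<^sup>+v. f (g, h, C, \<mu>, w, v)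
      \<partial>frame_noise N L \<sigma>v2) \<partial>frame_noise N L \<sigma>w2) \<partial>messages N n) \<partial>codebooks N L n E)
      \<partial>source_gains N) \<partial>dest_gains N)"
  proof (intro nn_integral_cong)
    fix g assume "g \<in> space (dest_gains N)"
    note f1 = measurable_section[OF fm this]
    show "(\<integral>\<^sup>+z. f (g, z) \<partial>?H) = (\<integral>\<^sup>+h. (\<integral>\<^sup>+C. (\<integral>\<^sup>+\<mu>. (\<integral>\<^sup>+w. (\<integral>\<^sup>+v. f (g, h, C, \<mu>, w, v)
      \<partial>frame_noise N L \<sigma>v2) \<partial>frame_noise N L \<sigma>w2) \<partial>messages N n) \<partial>codebooks N L n E)
      \<partial>source_gains N)"
    proof (subst nn_integral_pair_iterate[OF C f1], intro nn_integral_cong)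
      fix h assume "h \<in> space (source_gains N)"
      note f2 = measurable_section[OF f1 this]
      show "(\<integral>\<^sup>+z. f (g, h, z) \<partial>?C) = (\<integral>\<^sup>+C. (\<integral>\<^sup>+\<mu>. (\<integral>\<^sup>+w. (\<integral>\<^sup>+v. f (g, h, C, \<mu>, w, v)
        \<partial>frame_noise N L \<sigma>v2) \<partial>frame_noise N L \<sigma>w2) \<partial>messages N n) \<partial>codebooks N L n E)"
      proof (subst nn_integral_pair_iterate[OF M f2], intro nn_integral_cong)
        fix C assume "C \<in> space (codebooks N L n E)"
        note f3 = measurable_section[OF f2 this]
        show "(\<integral>\<^sup>+z. f (g, h, C, z) \<partial>?M) = (\<integral>\<^sup>+\<mu>. (\<integral>\<^sup>+w. (\<integral>\<^sup>+v. f (g, h, C, \<mu>, w, v)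
          \<partial>frame_noise N L \<sigma>v2) \<partial>frame_noise N L \<sigma>w2) \<partial>messages N n)"
        proof (subst nn_integral_pair_iterate[OF W f3], intro nn_integral_cong)
          fix \<mu> assume "\<mu> \<in> space (messages N n)"
          note f4 = measurable_section[OF f3 this]
          show "(\<integral>\<^sup>+z. f (g, h, C, \<mu>, z) \<partial>?W) = (\<integral>\<^sup>+w. (\<integral>\<^sup>+v. f (g, h, C, \<mu>, w, v)
            \<partial>frame_noise N L \<sigma>v2) \<partial>frame_noise N L \<sigma>w2)"
            by (rule nn_integral_pair_iterate[OF ps(1) f4])
        qed
      qed
    qed
  qed
  finally show ?thesis by (simp add: f_def)
qed

lemma ml_error_union:
  assumes \<mu>: "\<mu> \<in> tuples n" and err: "ml_error n j g h C \<mu> w v" and j: "j < N"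
  shows "\<exists>\<mu>'\<in>tuples n - {\<mu>}. lik g h (code_symbols C \<mu>) (received g h (code_symbols C \<mu>) w v)
    \<le> lik g h (code_symbols C \<mu>') (received g h (code_symbols C \<mu>) w v)"
  using assms unfolding ml_error_def by blast

text \<open>Union bound over all wrong tuples, those that are right for \<open>j\<close> included.
  The pairwise bounds hold for fixed messages and averaged codebooks, hence the exchange of these
  two integrals.\<close>

lemma conditional_error_le:
  assumes b: "\<And>m c. b m c = complex_of_real (1 / (9 * real N * max 1 (cmod c)))"
    and n: "n > 0" and E: "E > 0" and L: "L > 0" and j: "j < N"
    and g: "g \<in> space (dest_gains N)" and h: "h \<in> space (source_gains N)"
    and Q: "Q = trunc_gain {..<N} g * trunc_gain {(j, i). j < N \<and> i < N \<and> j \<noteq> i} h" "Q \<noteq> 0"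
    and \<kappa>: "\<kappa> = err_const / 81 * E * (1 / (81 * (real N)\<^sup>2))"
    and r: "r = exp (real (L - 1) * (real (N - 1) / real N) * (- real N * ln \<kappa> - ln Q))"
  shows "(\<integral>\<^sup>+C. (\<integral>\<^sup>+\<mu>. (\<integral>\<^sup>+w. (\<integral>\<^sup>+v. indicator {v. ml_error n j g h C \<mu> w v} v
      \<partial>frame_noise N L \<sigma>v2) \<partial>frame_noise N L \<sigma>w2) \<partial>messages N n) \<partial>codebooks N L n E)
    \<le> 2 * ennreal ((1 + (real n - 1) * r) ^ N - 1)"
proof -
  let ?V = "frame_noise N L \<sigma>v2" let ?W = "frame_noise N L \<sigma>w2"
  let ?WV = "?W \<Otimes>\<^sub>M ?V" let ?C = "codebooks N L n E" let ?M = "messages N n"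
  note ps = prob_space_frame_noise[OF \<sigma>v2] prob_space_frame_noise[OF \<sigma>w2] prob_space_messages[OF n, of N]
    prob_space_codebooks[OF E, of n]
  have WV: "prob_space ?WV" by (intro prob_space_pair ps)
  interpret M: prob_space ?M by (rule ps)
  interpret WV: prob_space ?WV by (rule WV)
  interpret CM: pair_sigma_finite ?C ?M
    by (intro pair_sigma_finite.intro prob_space_imp_sigma_finite ps)
  have gh: "(\<lambda>_. g) \<in> measurable X (dest_gains N)" "(\<lambda>_. h) \<in> measurable X (source_gains N)" for X
    using g h by auto
  define f :: "_ \<Rightarrow> ennreal" where "f = (\<lambda>((C, \<mu>), w, v). indicator {v. ml_error n j g h C \<mu> w v} v)"
  have "Measurable.pred ((?C \<Otimes>\<^sub>M ?M) \<Otimes>\<^sub>M ?WV) (\<lambda>z. ml_error n j g h (fst (fst z)) (snd (fst z)) (fst (snd z)) (snd (snd z)))"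
    by (rule measurable_ml_error(1)[OF gh _ _ _ _ j]) measurable
  hence fm: "f \<in> borel_measurable ((?C \<Otimes>\<^sub>M ?M) \<Otimes>\<^sub>M ?WV)"
    unfolding f_def case_prod_unfold indicator_def mem_Collect_eq by measurable
  define Pe where "Pe C \<mu> = (\<integral>\<^sup>+w. (\<integral>\<^sup>+v. indicator {v. ml_error n j g h C \<mu> w v} v \<partial>?V) \<partial>?W)" for C \<mu>
  have Pe: "Pe C \<mu> = (\<integral>\<^sup>+z. f ((C, \<mu>), z) \<partial>?WV)" if "C \<in> space ?C" "\<mu> \<in> space ?M" for C \<mu>
  proof -
    have "(C, \<mu>) \<in> space (?C \<Otimes>\<^sub>M ?M)" using that by (simp add: space_pair_measure)
    from nn_integral_pair_iterate[OF ps(1) measurable_section[OF fm this]]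
    show ?thesis by (simp add: Pe_def f_def)
  qed
  have Pem: "(\<lambda>(C, \<mu>). Pe C \<mu>) \<in> borel_measurable (?C \<Otimes>\<^sub>M ?M)"
  proof -
    have "(\<lambda>x. \<integral>\<^sup>+z. f (x, z) \<partial>?WV) \<in> borel_measurable (?C \<Otimes>\<^sub>M ?M)"
      using fm by (intro WV.borel_measurable_nn_integral) simp
    also have "?this \<longleftrightarrow> ?thesis"
      by (rule measurable_cong) (auto simp: Pe space_pair_measure)
    finally show ?thesis .
  qed
  have "(\<integral>\<^sup>+C. (\<integral>\<^sup>+\<mu>. Pe C \<mu> \<partial>?M) \<partial>?C) = (\<integral>\<^sup>+\<mu>. (\<integral>\<^sup>+C. Pe C \<mu> \<partial>?C) \<partial>?M)"
    by (rule CM.Fubini'[symmetric]) (use Pem in simp)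
  also have "\<dots> \<le> (\<integral>\<^sup>+\<mu>. 2 * ennreal ((1 + (real n - 1) * r) ^ N - 1) \<partial>?M)"
  proof (intro nn_integral_mono)
    fix \<mu> assume \<mu>s: "\<mu> \<in> space ?M"
    hence \<mu>: "\<mu> \<in> tuples n"
      by (simp add: messages_def space_PiM space_uniform_count_measure)
    define F :: "_ \<Rightarrow> _ \<Rightarrow> ennreal" where "F \<mu>' = (\<lambda>(C, w, v). indicator {y. lik g h (code_symbols C \<mu>) y \<le> lik g h (code_symbols C \<mu>') y}
          (received g h (code_symbols C \<mu>) w v))" for \<mu>'
    have Fm: "F \<mu>' \<in> borel_measurable (?C \<Otimes>\<^sub>M ?WV)" if "\<mu>' \<in> tuples n" for \<mu>'
    proof -
      have "Measurable.pred (?C \<Otimes>\<^sub>M ?WV) (\<lambda>z. lik g h (code_symbols (fst z) \<mu>) (received g h (code_symbols (fst z) \<mu>) (fst (snd z)) (snd (snd z)))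
          \<le> lik g h (code_symbols (fst z) \<mu>') (received g h (code_symbols (fst z) \<mu>) (fst (snd z)) (snd (snd z))))"
        by (rule measurable_ml_error(2)[where C=fst and \<mu>="\<lambda>_. \<mu>" and w="\<lambda>z. fst (snd z)" and v="\<lambda>z. snd (snd z)"
              and n=n and E=E and s=\<sigma>w2 and s'=\<sigma>v2, OF gh _ _ _ _ j \<mu> that])
          (use \<mu>s in measurable)
      thus ?thesis unfolding F_def case_prod_unfold indicator_def mem_Collect_eq by measurable
    qed
    have FI: "(\<integral>\<^sup>+z. F \<mu>' z \<partial>(?C \<Otimes>\<^sub>M ?WV)) \<le> 2 * ennreal (r ^ card {p. p < N \<and> \<mu>' p \<noteq> \<mu> p})"
      if \<mu>': "\<mu>' \<in> tuples n - {\<mu>}" for \<mu>'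
    proof -
      have m': "\<mu>' \<in> tuples n" "\<mu>' \<noteq> \<mu>" using \<mu>' by auto
      have "(\<integral>\<^sup>+z. F \<mu>' z \<partial>(?C \<Otimes>\<^sub>M ?WV)) = (\<integral>\<^sup>+C. (\<integral>\<^sup>+z. F \<mu>' (C, z) \<partial>?WV) \<partial>?C)"
        by (rule nn_integral_pair_iterate[OF WV Fm[OF m'(1)]])
      also have "\<dots> = (\<integral>\<^sup>+C. (\<integral>\<^sup>+w. (\<integral>\<^sup>+v. F \<mu>' (C, w, v) \<partial>?V) \<partial>?W) \<partial>?C)"
        by (intro nn_integral_cong nn_integral_pair_iterate[OF ps(1)] measurable_section[OF Fm[OF m'(1)]])
      also have "\<dots> \<le> 2 * ennreal (r ^ card {p. p < N \<and> \<mu>' p \<noteq> \<mu> p})"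
        unfolding F_def prod.case r by (rule averaged_pairwise_bound[OF b E L \<mu> m' Q \<kappa>])
      finally show ?thesis .
    qed
    have fm': "(\<lambda>z. f ((fst z, \<mu>), snd z)) \<in> borel_measurable (?C \<Otimes>\<^sub>M ?WV)"
      using \<mu>s by (intro measurable_compose[OF _ fm]) measurable
    have "(\<integral>\<^sup>+C. Pe C \<mu> \<partial>?C) = (\<integral>\<^sup>+C. (\<integral>\<^sup>+z. f ((C, \<mu>), z) \<partial>?WV) \<partial>?C)"
      using Pe \<mu>s by (intro nn_integral_cong) auto
    also have "\<dots> = (\<integral>\<^sup>+z. f ((fst z, \<mu>), snd z) \<partial>(?C \<Otimes>\<^sub>M ?WV))"
      by (subst nn_integral_pair_iterate[OF WV fm']) simp
    also have "\<dots> \<le> (\<integral>\<^sup>+z. (\<Sum>\<mu>'\<in>tuples n - {\<mu>}. F \<mu>' z) \<partial>(?C \<Otimes>\<^sub>M ?WV))"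
    proof (intro nn_integral_mono)
      fix z
      show "f ((fst z, \<mu>), snd z) \<le> (\<Sum>\<mu>'\<in>tuples n - {\<mu>}. F \<mu>' z)"
      proof (cases "ml_error n j g h (fst z) \<mu> (fst (snd z)) (snd (snd z))")
        case True
        from ml_error_union[OF \<mu> this j] obtain \<mu>' where \<mu>': "\<mu>' \<in> tuples n - {\<mu>}" "F \<mu>' z = 1"
          by (auto simp: F_def case_prod_unfold indicator_def)
        have "F \<mu>' z \<le> (\<Sum>\<mu>'\<in>tuples n - {\<mu>}. F \<mu>' z)"
          using \<mu>'(1) finite_tuples by (intro member_le_sum) auto
        thus ?thesis using \<mu>'(2) by (simp add: f_def case_prod_unfold indicator_def)
      qed (simp add: f_def case_prod_unfold)
    qed
    also have "\<dots> = (\<Sum>\<mu>'\<in>tuples n - {\<mu>}. \<integral>\<^sup>+z. F \<mu>' z \<partial>(?C \<Otimes>\<^sub>M ?WV))"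
      by (intro nn_integral_sum Fm) auto
    also have "\<dots> \<le> (\<Sum>\<mu>'\<in>tuples n - {\<mu>}. 2 * ennreal (r ^ card {p. p < N \<and> \<mu>' p \<noteq> \<mu> p}))"
      by (intro sum_mono FI)
    also have "\<dots> = 2 * ennreal (\<Sum>\<mu>'\<in>tuples n - {\<mu>}. r ^ card {p. p < N \<and> \<mu>' p \<noteq> \<mu> p})"
      by (simp add: sum_distrib_left[symmetric] sum_ennreal r)
    \<comment> \<open>The subtracted 1 is the term of \<open>\<mu>\<close> itself, at distance
      0.\<close>
    also have "(\<Sum>\<mu>'\<in>tuples n - {\<mu>}. r ^ card {p. p < N \<and> \<mu>' p \<noteq> \<mu> p}) = (1 + (real n - 1) * r) ^ N - 1"
      using sum_power_card_neq[OF \<mu>, of r] \<mu> finite_tuples by (subst sum_diff1) auto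
    finally show "(\<integral>\<^sup>+C. Pe C \<mu> \<partial>?C) \<le> 2 * ennreal ((1 + (real n - 1) * r) ^ N - 1)" .
  qed
  also have "\<dots> = 2 * ennreal ((1 + (real n - 1) * r) ^ N - 1)"
    using M.emeasure_space_1 by simp
  finally show ?thesis by (simp add: Pe_def)
qed

end

lemma nn_integral_uniform_count_measure:
  assumes "finite A" "A \<noteq> {}"
  shows "(\<integral>\<^sup>+x. f x \<partial>uniform_count_measure A) = ennreal (1 / real (card A)) * (\<Sum>x\<in>A. f x)"
  unfolding uniform_count_measure_def using assms
  by (subst nn_integral_point_measure_finite) (auto simp: sum_distrib_left)

lemma prob_space_PiM_uniform:
  fixes n :: nat
  shows "n > 0 \<Longrightarrow> prob_space (PiM I (\<lambda>_. uniform_count_measure {..<n}))"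
  by (intro prob_space_PiM prob_space_uniform_count_measure) auto

lemma nn_integral_PiM_cn_component:
  assumes "s > 0" "i \<in> I" and f [measurable]: "f \<in> borel_measurable borel"
  shows "(\<integral>\<^sup>+x. f (x i) \<partial>PiM I (\<lambda>_. cn s)) = (\<integral>\<^sup>+z. f z \<partial>cn s)"
proof -
  have "(\<integral>\<^sup>+z. f z \<partial>cn s) = (\<integral>\<^sup>+z. f z \<partial>distr (PiM I (\<lambda>_. cn s)) (cn s) (\<lambda>x. x i))"
    using assms by (subst distr_PiM_component) (auto intro: prob_space_cn)
  also have "\<dots> = (\<integral>\<^sup>+x. f (x i) \<partial>PiM I (\<lambda>_. cn s))"
    using assms(2) by (intro nn_integral_distr) (auto intro: measurable_component_singleton)
  finally show ?thesis by simp
qed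

text \<open>Turns an upper bound for the probability of success into a lower bound for that of an
  error. It is phrased with a sum because subtraction in \<open>ennreal\<close> is cut off at
  0.\<close>

lemma ennreal_ge_diff_of_add_eq_1:
  fixes x y :: ennreal
  assumes "x + y = 1" "y \<le> ennreal c" "c \<ge> 0"
  shows "ennreal (1 - c) \<le> x"
proof -
  have "x \<le> 1" "y \<le> 1" using assms(1) by (metis le_iff_add add.commute)+
  then obtain a b where ab: "x = ennreal a" "y = ennreal b" "a \<ge> 0" "b \<ge> 0"
    by (metis ennreal_cases ennreal_one_less_top leD top_unique neq_top_trans)
  hence "ennreal (a + b) = ennreal 1" using assms(1) by simp
  hence "a + b = 1" using ab by (subst (asm) ennreal_inj) auto
  moreover have "b \<le> c" using assms(2,3) ab by simp
  ultimately show ?thesis unfolding ab by (intro ennreal_leI) simp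
qed

text \<open>The outage event of the converse. Independence of the gains gives the power
  \<open>N\<close>, which becomes the factor \<open>N\<close> of the diversity.\<close>

lemma emeasure_small_gains_ge:
  assumes "0 < t" "t \<le> 1"
  shows "emeasure (dest_gains N) ({..<N} \<rightarrow>\<^sub>E {z. (cmod z)\<^sup>2 \<le> t}) \<ge> ennreal ((t / (pi * exp 1)) ^ N)"
proof -
  interpret product_sigma_finite "\<lambda>_. cn 1" by (rule product_sigma_finite_cn) simp
  have A: "{z. (cmod z)\<^sup>2 \<le> t} \<in> sets (cn 1)" by measurable
  have "ennreal ((t / (pi * exp 1)) ^ N) = (\<Prod>i<N. ennreal (t / (pi * exp 1)))"
    using assms by (simp add: ennreal_power)
  also have "\<dots> \<le> (\<Prod>i<N. emeasure (cn 1) {z. (cmod z)\<^sup>2 \<le> t})"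
    unfolding prod_constant by (intro power_mono emeasure_cn_disc_ge[OF assms]) auto
  also have "\<dots> = emeasure (dest_gains N) ({..<N} \<rightarrow>\<^sub>E {z. (cmod z)\<^sup>2 \<le> t})"
    unfolding dest_gains_def using A by (intro emeasure_PiM[symmetric]) auto
  finally show ?thesis .
qed

text \<open>Cost per symbol of \<open>gaussian_converse\<close> when the smoothing Gaussian has
  variance \<open>A\<close> times the signal energy and is widened by the factor
  \<open>1 + s\<close>. The exponential stems from an energy budget of 16 times the mean energy per
  symbol; \<open>\<eta>\<close> is the received signal-to-noise ratio.\<close>

definition conv_base :: "real \<Rightarrow> real \<Rightarrow> real \<Rightarrow> real" where
  "conv_base \<eta> A s = (1 + \<eta> * A) * (1 + s) * exp (16 / (A * s))"

lemma conv_base_pos: "\<eta> > 0 \<Longrightarrow> A > 0 \<Longrightarrow> s > 0 \<Longrightarrow> conv_base \<eta> A s > 0"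
  unfolding conv_base_def by (intro mult_pos_pos add_pos_pos) auto

section \<open>Lower bound for the error probability of the protocol\<close>

context cma
begin

text \<open>Markov's inequality: \<open>nn_integral_cn_cmod_square_le\<close> bounds the mean energy
  per symbol by \<open>4 * E\<close>, a quarter of the budget.\<close>

lemma codeword_energy_tail:
  assumes E: "E > 0" and K: "K > 0" and ji: "j < N" "i < n"
  shows "(\<integral>\<^sup>+C. indicator {C. energy {..<K} (\<lambda>k. C (j, i, k)) > 16 * real K * E} C \<partial>codebooks N L n E) \<le> ennreal (1 / 4)"
proof -
  define B where "B = 16 * real K * E"
  have B: "B > 0" using E K by (simp add: B_def)
  have mem: "(j, i, k) \<in> {..<N} \<times> {..<n} \<times> {..<K}" if "k < K" for k using ji that by simp
  have m: "(\<lambda>C. ennreal ((cmod (C (j, i, k)))\<^sup>2)) \<in> borel_measurable (codebooks N L n E)" if "k < K" for k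
  proof -
    have "(\<lambda>C. C (j, i, k)) \<in> borel_measurable (codebooks N L n E)"
      unfolding codebooks_def by (rule measurable_component_cn[OF mem[OF that] measurable_ident_sets[OF refl]])
    thus ?thesis by measurable
  qed
  have "(\<integral>\<^sup>+C. indicator {C. energy {..<K} (\<lambda>k. C (j, i, k)) > B} C \<partial>codebooks N L n E)
      \<le> (\<integral>\<^sup>+C. ennreal (1 / B) * (\<Sum>k<K. ennreal ((cmod (C (j, i, k)))\<^sup>2)) \<partial>codebooks N L n E)"
  proof (intro nn_integral_mono)
    fix C :: "nat \<times> nat \<times> nat \<Rightarrow> complex"
    have "indicator {C. energy {..<K} (\<lambda>k. C (j, i, k)) > B} C \<le> ennreal (1 / B * energy {..<K} (\<lambda>k. C (j, i, k)))"
      using B by (auto simp: indicator_def le_divide_eq simp flip: ennreal_1 intro!: ennreal_leI)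
    also have "\<dots> = ennreal (1 / B) * (\<Sum>k<K. ennreal ((cmod (C (j, i, k)))\<^sup>2))"
      using B by (subst ennreal_mult) (auto simp: energy_def intro: sum_nonneg)
    finally show "indicator {C. energy {..<K} (\<lambda>k. C (j, i, k)) > B} C
        \<le> ennreal (1 / B) * (\<Sum>k<K. ennreal ((cmod (C (j, i, k)))\<^sup>2))" .
  qed
  also have "\<dots> = ennreal (1 / B) * (\<integral>\<^sup>+C. (\<Sum>k<K. ennreal ((cmod (C (j, i, k)))\<^sup>2)) \<partial>codebooks N L n E)"
    by (intro nn_integral_cmult borel_measurable_sum m) simp
  also have "(\<integral>\<^sup>+C. (\<Sum>k<K. ennreal ((cmod (C (j, i, k)))\<^sup>2)) \<partial>codebooks N L n E)
      = (\<Sum>k<K. \<integral>\<^sup>+C. ennreal ((cmod (C (j, i, k)))\<^sup>2) \<partial>codebooks N L n E)"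
    by (intro nn_integral_sum m) simp
  also have "ennreal (1 / B) * (\<Sum>k<K. \<integral>\<^sup>+C. ennreal ((cmod (C (j, i, k)))\<^sup>2) \<partial>codebooks N L n E)
      \<le> ennreal (1 / B) * (\<Sum>k<K. ennreal (4 * E))"
  proof (intro mult_left_mono sum_mono)
    fix k assume "k \<in> {..<K}"
    hence "(\<integral>\<^sup>+C. ennreal ((cmod (C (j, i, k)))\<^sup>2) \<partial>codebooks N L n E) = (\<integral>\<^sup>+z. ennreal ((cmod z)\<^sup>2) \<partial>cn E)"
      unfolding codebooks_def using mem E by (intro nn_integral_PiM_cn_component[where f="\<lambda>z. ennreal ((cmod z)\<^sup>2)"]) auto
    also have "\<dots> \<le> ennreal (4 * E)" by (rule nn_integral_cn_cmod_square_le[OF E])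
    finally show "(\<integral>\<^sup>+C. ennreal ((cmod (C (j, i, k)))\<^sup>2) \<partial>codebooks N L n E) \<le> ennreal (4 * E)" .
  qed auto
  also have "\<dots> = ennreal (1 / B * (real K * (4 * E)))"
  proof -
    have "(\<Sum>k<K. ennreal (4 * E)) = ennreal (real K * (4 * E))"
      using E by (subst sum_ennreal) auto
    thus ?thesis using B E by (simp only:) (rule ennreal_mult[symmetric], auto)
  qed
  also have "1 / B * (real K * (4 * E)) = 1 / 4"
    using E K by (simp add: B_def)
  finally show ?thesis by (simp only: B_def)
qed

text \<open>The messages and codewords of the other sources and the noise of the sources are fixed,
  so they only shift the output by \<open>d\<close>. What remains is a channel with the single user
  \<open>j\<close> and codewords of bounded energy.\<close>

lemma success_sum_le:
  assumes n: "n > 0" and E: "E > 0" and K: "K > 0" and j: "j < N" and t: "t > 0" and pos: "A > 0" "s > 0"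
    and g: "\<And>m. m < N \<Longrightarrow> (cmod (g m))\<^sup>2 \<le> t"
    and h: "h \<in> space (source_gains N)" and C: "C \<in> space (codebooks N L n E)"
    and \<mu>: "\<And>i. i < n \<Longrightarrow> \<mu>(j := i) \<in> tuples n"
    and good: "I = {i. i < n \<and> energy {..<K} (\<lambda>k. C (j, i, k)) \<le> 16 * real K * E}"
  shows "(\<Sum>i\<in>I. \<integral>\<^sup>+v. indicator {v. \<not> ml_error n j g h C (\<mu>(j := i)) w v} v \<partial>frame_noise N L \<sigma>v2)
    \<le> ennreal (conv_base (t * E / \<sigma>v2) A s ^ K)"
proof -
  \<comment> \<open>All maximisers must agree on \<open>i\<close>. Thus ties are errors, and the
    regions of different \<open>i\<close> are disjoint.\<close>
  define D where "D i = {y \<in> space (PiM slots (\<lambda>_. borel)). \<forall>\<mu>'\<in>tuples n.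
      (\<forall>\<mu>''\<in>tuples n. lik g h (code_symbols C \<mu>'') y \<le> lik g h (code_symbols C \<mu>') y) \<longrightarrow> \<mu>' j = i}" for i
  define emb :: "(nat \<Rightarrow> complex) \<Rightarrow> nat \<times> nat \<Rightarrow> complex"
    where "emb u = (\<lambda>(p, k). if p = j \<and> k < K then u k else 0)" for u
  define H where "H u = (\<lambda>(m, k). g m * T h (emb u) (\<lambda>_. 0) m k)" for u
  define base where "base = (\<lambda>(p, k). if p = j then 0 else C (p, \<mu> p, k))"
  define d where "d = (\<lambda>(m, k). g m * T h base w m k)"
  define x where "x i = (\<lambda>k. C (j, i, k))" for i
  let ?B = "16 * real K * E" and ?\<tau> = "E * A"
  have D: "D i \<in> sets (PiM slots (\<lambda>_. borel))" for i
  proof -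
    have "Measurable.pred (PiM slots (\<lambda>_. borel)) (\<lambda>y. \<forall>\<mu>'\<in>tuples n.
      (\<forall>\<mu>''\<in>tuples n. lik g h (code_symbols C \<mu>'') y \<le> lik g h (code_symbols C \<mu>') y) \<longrightarrow> \<mu>' j = i)"
    proof (intro pred_intros_finite(3) pred_intros_logic finite_tuples)
      show "Measurable.pred (PiM slots (\<lambda>_. borel)) (\<lambda>y. lik g h (code_symbols C \<mu>'') y \<le> lik g h (code_symbols C \<mu>') y)" for \<mu>' \<mu>''
        unfolding pred_def by (intro borel_measurable_le measurable_lik_output)
    qed auto
    thus ?thesis by (simp add: D_def pred_def)
  qed
  have disj: "disjoint_family_on D I"
    unfolding disjoint_family_on_def
  proof (intro ballI impI)
    fix i i' :: nat assume "i \<noteq> i'"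
    have "\<mu>(j := 0) \<in> tuples n" using \<mu> n by simp
    hence ne: "tuples n \<noteq> {}" by blast
    show "D i \<inter> D i' = {}"
    proof (rule ccontr)
      assume "D i \<inter> D i' \<noteq> {}"
      then obtain y where y: "y \<in> D i" "y \<in> D i'" by blast
      let ?f = "\<lambda>\<mu>. lik g h (code_symbols C \<mu>) y"
      \<comment> \<open>Disjointness needs some maximiser to exist; otherwise an output would lie in
        all regions vacuously.\<close>
      have "Max (?f ` tuples n) \<in> ?f ` tuples n" using ne finite_tuples by (intro Max_in) auto
      then obtain \<mu>' where \<mu>': "\<mu>' \<in> tuples n" "Max (?f ` tuples n) = ?f \<mu>'" by blast
      have "\<forall>\<mu>''\<in>tuples n. ?f \<mu>'' \<le> ?f \<mu>'"
        using \<mu>'(2)[symmetric] finite_tuples by auto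
      hence "\<mu>' j = i" "\<mu>' j = i'" using y \<mu>'(1) by (auto simp: D_def)
      with \<open>i \<noteq> i'\<close> show False by simp
    qed
  qed
  have succ: "indicator {v. \<not> ml_error n j g h C (\<mu>(j := i)) w v} v
      = (indicator (D i) (\<lambda>z\<in>slots. d z + H (x i) z + v z) :: ennreal)" for i v
  proof -
    let ?cs = "code_symbols C (\<mu>(j := i))"
    have y: "restrict (received g h ?cs w v) slots = (\<lambda>z\<in>slots. d z + H (x i) z + v z)"
    proof (rule restrict_ext)
      fix z assume "z \<in> slots"
      then obtain m k where z: "z = (m, k)" "m < N" "k < K" by auto
      have "T h ?cs w m k = T h (\<lambda>z. base z + emb (x i) z) (\<lambda>z. w z + 0) m k"
        using z by (intro cma_signal_cong[OF N]) (auto simp: code_symbols_def base_def emb_def x_def)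
      also have "\<dots> = T h base w m k + T h (emb (x i)) (\<lambda>_. 0) m k"
        using z by (intro cma_signal_add[OF N])
      finally show "received g h ?cs w v z = d z + H (x i) z + v z"
        by (simp add: z received_def d_def H_def algebra_simps)
    qed
    have sp: "restrict (received g h ?cs w v) slots \<in> space (PiM slots (\<lambda>_. borel))"
      by (auto simp: space_PiM)
    have "\<not> ml_error n j g h C (\<mu>(j := i)) w v \<longleftrightarrow> restrict (received g h ?cs w v) slots \<in> D i"
      using sp by (auto simp: ml_error_def D_def lik_restrict)
    thus ?thesis unfolding y by (simp add: indicator_def)
  qed
  have emb_energy: "energy slots (emb u) = energy {..<K} u" for u
  proof -
    have "energy slots (emb u) = (\<Sum>p<N. \<Sum>k<K. if p = j then (cmod (u k))\<^sup>2 else 0)"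
      unfolding energy_def emb_def sum.cartesian_product by (intro sum.cong refl) auto
    also have "\<dots> = (\<Sum>p<N. if p = j then energy {..<K} u else 0)"
      by (intro sum.cong refl) (auto simp: energy_def)
    finally show ?thesis using j by simp
  qed
  \<comment> \<open>The network does not create energy, and the gains to the destination have square
    at most \<open>t\<close>; so \<open>t\<close> is the \<open>\<kappa>\<close> of
    \<open>gaussian_converse\<close>.\<close>
  have bound: "energy slots (H u) \<le> t * energy {..<K} u" for u
  proof -
    have "energy slots (H u) \<le> t * energy slots (\<lambda>(m, k). T h (emb u) (\<lambda>_. 0) m k)"
      unfolding energy_def sum_distrib_left
    proof (rule sum_mono)
      fix z assume "z \<in> slots"
      then obtain m k where z: "z = (m, k)" "m < N" by auto
      show "(cmod (H u z))\<^sup>2 \<le> t * (cmod (case z of (m, k) \<Rightarrow> T h (emb u) (\<lambda>_. 0) m k))\<^sup>2"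
        using g[OF z(2)] by (simp add: z H_def norm_mult power_mult_distrib mult_right_mono)
    qed
    also have "\<dots> \<le> t * energy slots (emb u)"
      using T_energy[of h "emb u" "\<lambda>_. 0"] t by (simp add: energy_def)
    finally show ?thesis by (simp add: emb_energy)
  qed
  have hm: "(\<lambda>_. h (p, q)) \<in> borel_measurable M" for p q and M :: "(nat \<Rightarrow> complex) measure" by simp
  have Hm: "(\<lambda>u. H u z) \<in> borel_measurable (PiM {..<K} (\<lambda>_. borel))" if zs: "z \<in> slots" for z
  proof -
    obtain m k where z: "z = (m, k)" "m < N" "k < K" using zs by auto
    have "(\<lambda>u. emb u (p, k)) \<in> borel_measurable (PiM {..<K} (\<lambda>_. borel))" if "k < K" for p k
      using that by (cases "p = j") (auto simp: emb_def)
    hence "(\<lambda>u. T h (emb u) (\<lambda>_. 0) m k) \<in> borel_measurable (PiM {..<K} (\<lambda>_. borel))"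
      using z by (intro measurable_T) auto
    thus ?thesis by (simp add: z H_def)
  qed
  have neg: "H (\<lambda>i\<in>{..<K}. - u i) z = - H u z" if zs: "z \<in> slots" for u z
  proof -
    obtain m k where z: "z = (m, k)" "m < N" using zs by auto
    have "T h (emb (\<lambda>i\<in>{..<K}. - u i)) (\<lambda>_. 0) m k = T h (\<lambda>i. -1 * emb u i) (\<lambda>i. -1 * 0) m k"
      using z by (intro cma_signal_cong[OF N]) (auto simp: emb_def)
    also have "\<dots> = -1 * T h (emb u) (\<lambda>_. 0) m k" using z by (intro cma_signal_scale[OF N])
    finally show ?thesis by (simp add: z H_def)
  qed
  have add: "H (\<lambda>k\<in>{..<K}. x i k + u k) z = H (x i) z + H u z" if zs: "z \<in> slots" for i u z
  proof -
    obtain m k where z: "z = (m, k)" "m < N" using zs by auto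
    have "T h (emb (\<lambda>k\<in>{..<K}. x i k + u k)) (\<lambda>_. 0) m k = T h (\<lambda>z. emb (x i) z + emb u z) (\<lambda>z. 0 + 0) m k"
      using z by (intro cma_signal_cong[OF N]) (auto simp: emb_def)
    also have "\<dots> = T h (emb (x i)) (\<lambda>_. 0) m k + T h (emb u) (\<lambda>_. 0) m k" using z by (intro cma_signal_add[OF N])
    finally show ?thesis by (simp add: z H_def algebra_simps)
  qed
  have \<tau>: "?\<tau> > 0" using E pos by simp
  have finI: "finite I" by (simp add: good)
  have "(\<Sum>i\<in>I. \<integral>\<^sup>+v. indicator (D i) (\<lambda>z\<in>slots. d z + H (x i) z + v z) \<partial>PiM slots (\<lambda>_. cn \<sigma>v2))
      \<le> ennreal ((1 + t * ?\<tau> / \<sigma>v2) ^ card {..<K} * ((1 + s) ^ card {..<K} * exp (?B / (?\<tau> * s))))"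
    using t by (intro gaussian_converse[OF _ _ \<sigma>v2 \<tau> pos(2) _ Hm neg add bound finI _ D disj])
      (auto simp: good x_def)
  also have "(1 + t * ?\<tau> / \<sigma>v2) ^ card {..<K} * ((1 + s) ^ card {..<K} * exp (?B / (?\<tau> * s))) = conv_base (t * E / \<sigma>v2) A s ^ K"
  proof -
    have "?B / (?\<tau> * s) = real K * (16 / (A * s))" using E by simp
    thus ?thesis by (simp add: conv_base_def power_mult_distrib exp_of_nat_mult[symmetric] mult_ac)
  qed
  finally show ?thesis unfolding succ frame_noise_def .
qed

text \<open>3 / 4 is what remains when the codewords over the energy budget, on average at most a
  quarter of them, are counted as decoded correctly.\<close>

lemma conditional_error_ge:
  assumes n: "n > 0" and E: "E > 0" and K: "K > 0" and j: "j < N" and t: "t > 0" and pos: "A > 0" "s > 0"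
    and g: "g \<in> space (dest_gains N)" "\<And>m. m < N \<Longrightarrow> (cmod (g m))\<^sup>2 \<le> t"
    and h: "h \<in> space (source_gains N)"
  shows "ennreal (3 / 4 - conv_base (t * E / \<sigma>v2) A s ^ K / real n) \<le>
    (\<integral>\<^sup>+C. (\<integral>\<^sup>+\<mu>. (\<integral>\<^sup>+w. (\<integral>\<^sup>+v. indicator {v. ml_error n j g h C \<mu> w v} v
      \<partial>frame_noise N L \<sigma>v2) \<partial>frame_noise N L \<sigma>w2) \<partial>messages N n) \<partial>codebooks N L n E)"
proof -
  let ?V = "frame_noise N L \<sigma>v2" let ?W = "frame_noise N L \<sigma>w2"
  let ?C = "codebooks N L n E" let ?M = "messages N n"
  let ?R = "PiM ({..<N} - {j}) (\<lambda>_. uniform_count_measure {..<n})"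
  define F where "F = conv_base (t * E / \<sigma>v2) A s ^ K"
  have F: "F \<ge> 0" unfolding F_def using t E \<sigma>v2 pos by (intro zero_le_power less_imp_le[OF conv_base_pos]) auto
  note ps = prob_space_frame_noise[OF \<sigma>v2] prob_space_frame_noise[OF \<sigma>w2] prob_space_messages[OF n, of N]
    prob_space_codebooks[OF E, of n]
  interpret V: prob_space ?V by (rule ps)
  interpret W: prob_space ?W by (rule ps)
  interpret M: prob_space ?M by (rule ps)
  interpret C: prob_space ?C by (rule ps)
  have pM0: "prob_space ?R"
    by (rule prob_space_PiM_uniform[OF n])
  interpret M0: prob_space ?R by (rule pM0)
  interpret U: product_sigma_finite "\<lambda>_ :: nat. uniform_count_measure {..<n}"
    using n by (intro product_sigma_finite.intro prob_space_imp_sigma_finite prob_space_uniform_count_measure) auto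
  have gh: "(\<lambda>_. g) \<in> measurable X (dest_gains N)" "(\<lambda>_. h) \<in> measurable X (source_gains N)" for X
    using g h by auto
  define ind :: "bool \<Rightarrow> _ \<Rightarrow> ennreal" where
    "ind e = (\<lambda>(((C, \<mu>), w), v). indicator {v. ml_error n j g h C \<mu> w v = e} v)" for e
  have indm: "ind e \<in> borel_measurable (((?C \<Otimes>\<^sub>M ?M) \<Otimes>\<^sub>M ?W) \<Otimes>\<^sub>M ?V)" for e
  proof -
    have [measurable]: "Measurable.pred (((?C \<Otimes>\<^sub>M ?M) \<Otimes>\<^sub>M ?W) \<Otimes>\<^sub>M ?V)
        (\<lambda>z. ml_error n j g h (fst (fst (fst z))) (snd (fst (fst z))) (snd (fst z)) (snd z))"
      by (rule measurable_ml_error(1)[OF gh _ _ _ _ j]) measurable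
    show ?thesis unfolding ind_def case_prod_unfold indicator_def mem_Collect_eq by measurable
  qed
  define P3 where "P3 e C \<mu> w = (\<integral>\<^sup>+v. indicator {v. ml_error n j g h C \<mu> w v = e} v \<partial>?V)" for e C \<mu> w
  define P2 where "P2 e C \<mu> = (\<integral>\<^sup>+w. P3 e C \<mu> w \<partial>?W)" for e C \<mu>
  have P3m: "(\<lambda>((C, \<mu>), w). P3 e C \<mu> w) \<in> borel_measurable ((?C \<Otimes>\<^sub>M ?M) \<Otimes>\<^sub>M ?W)" for e
    using V.borel_measurable_nn_integral[of "\<lambda>z v. ind e (z, v)"] indm[of e]
    by (simp add: P3_def ind_def case_prod_unfold)
  have P2m: "(\<lambda>(C, \<mu>). P2 e C \<mu>) \<in> borel_measurable (?C \<Otimes>\<^sub>M ?M)" for e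
    using W.borel_measurable_nn_integral[of "\<lambda>z w. P3 e (fst z) (snd z) w"] P3m[of e]
    by (simp add: P2_def case_prod_unfold)
  have P1m: "(\<lambda>C. \<integral>\<^sup>+\<mu>. P2 e C \<mu> \<partial>?M) \<in> borel_measurable ?C" for e
    using M.borel_measurable_nn_integral[of "\<lambda>C \<mu>. P2 e C \<mu>"] P2m[of e] by simp
  have P2C: "P2 e C \<in> borel_measurable ?M" if "C \<in> space ?C" for e C
    using measurable_section[OF P2m that] by simp
  have P3C: "P3 e C \<mu> \<in> borel_measurable ?W" if "C \<in> space ?C" "\<mu> \<in> space ?M" for e C \<mu>
    using measurable_section[OF P3m, of "(C, \<mu>)"] that by (simp add: space_pair_measure)
  have indC: "(\<lambda>v. indicator {v. ml_error n j g h C \<mu> w v = e} v :: ennreal) \<in> borel_measurable ?V"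
    if "C \<in> space ?C" "\<mu> \<in> space ?M" "w \<in> space ?W" for e C \<mu> w
    using measurable_section[OF indm, of "((C, \<mu>), w)"] that by (simp add: space_pair_measure ind_def)
  have one3: "P3 True C \<mu> w + P3 False C \<mu> w = 1"
    if "C \<in> space ?C" "\<mu> \<in> space ?M" "w \<in> space ?W" for C \<mu> w
  proof -
    have "P3 True C \<mu> w + P3 False C \<mu> w = (\<integral>\<^sup>+v. indicator {v. ml_error n j g h C \<mu> w v = True} v
        + indicator {v. ml_error n j g h C \<mu> w v = False} v \<partial>?V)"
      unfolding P3_def by (intro nn_integral_add[symmetric] indC that)
    also have "\<dots> = (\<integral>\<^sup>+v. 1 \<partial>?V)" by (intro nn_integral_cong) (simp add: indicator_def)
    finally show ?thesis using V.emeasure_space_1 by simp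
  qed
  have one2: "P2 True C \<mu> + P2 False C \<mu> = 1" if "C \<in> space ?C" "\<mu> \<in> space ?M" for C \<mu>
  proof -
    have "P2 True C \<mu> + P2 False C \<mu> = (\<integral>\<^sup>+w. P3 True C \<mu> w + P3 False C \<mu> w \<partial>?W)"
      unfolding P2_def by (intro nn_integral_add[symmetric] P3C that)
    also have "\<dots> = (\<integral>\<^sup>+w. 1 \<partial>?W)" by (intro nn_integral_cong one3 that)
    finally show ?thesis using W.emeasure_space_1 by simp
  qed
  have one1: "(\<integral>\<^sup>+\<mu>. P2 True C \<mu> \<partial>?M) + (\<integral>\<^sup>+\<mu>. P2 False C \<mu> \<partial>?M) = 1" if "C \<in> space ?C" for C
  proof -
    have "(\<integral>\<^sup>+\<mu>. P2 True C \<mu> \<partial>?M) + (\<integral>\<^sup>+\<mu>. P2 False C \<mu> \<partial>?M) = (\<integral>\<^sup>+\<mu>. P2 True C \<mu> + P2 False C \<mu> \<partial>?M)"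
      by (intro nn_integral_add[symmetric] P2C that)
    also have "\<dots> = (\<integral>\<^sup>+\<mu>. 1 \<partial>?M)" by (intro nn_integral_cong one2 that)
    finally show ?thesis using M.emeasure_space_1 by simp
  qed
  have one0: "(\<integral>\<^sup>+C. (\<integral>\<^sup>+\<mu>. P2 True C \<mu> \<partial>?M) \<partial>?C) + (\<integral>\<^sup>+C. (\<integral>\<^sup>+\<mu>. P2 False C \<mu> \<partial>?M) \<partial>?C) = 1"
  proof -
    have "(\<integral>\<^sup>+C. (\<integral>\<^sup>+\<mu>. P2 True C \<mu> \<partial>?M) \<partial>?C) + (\<integral>\<^sup>+C. (\<integral>\<^sup>+\<mu>. P2 False C \<mu> \<partial>?M) \<partial>?C)
        = (\<integral>\<^sup>+C. (\<integral>\<^sup>+\<mu>. P2 True C \<mu> \<partial>?M) + (\<integral>\<^sup>+\<mu>. P2 False C \<mu> \<partial>?M) \<partial>?C)"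
      by (intro nn_integral_add[symmetric] P1m)
    also have "\<dots> = (\<integral>\<^sup>+C. 1 \<partial>?C)" by (intro nn_integral_cong one1)
    finally show ?thesis using C.emeasure_space_1 by simp
  qed
  let ?bad = "\<lambda>i C. indicator {C. energy {..<K} (\<lambda>k. C (j, i, k)) > 16 * real K * E} C :: ennreal"
  have "(\<integral>\<^sup>+\<mu>. P2 False C \<mu> \<partial>?M) \<le> ennreal (1 / real n) * ((\<Sum>i<n. ?bad i C) + ennreal F)" if C: "C \<in> space ?C" for C
  proof -
    define I where "I = {i. i < n \<and> energy {..<K} (\<lambda>k. C (j, i, k)) \<le> 16 * real K * E}"
    have ins: "insert j ({..<N} - {j}) = {..<N}" using j by auto
    \<comment> \<open>The message of \<open>j\<close> is integrated innermost, so that its decision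
      regions can be summed while the other messages are fixed.\<close>
    have "(\<integral>\<^sup>+\<mu>. P2 False C \<mu> \<partial>?M) = (\<integral>\<^sup>+\<mu>. (\<integral>\<^sup>+i. P2 False C (\<mu>(j := i)) \<partial>uniform_count_measure {..<n}) \<partial>?R)"
      using U.product_nn_integral_insert[of "{..<N} - {j}" j "P2 False C", unfolded ins] P2C[OF C, of False]
      by (simp add: messages_def)
    also have "\<dots> = (\<integral>\<^sup>+\<mu>. ennreal (1 / real n) * (\<Sum>i<n. P2 False C (\<mu>(j := i))) \<partial>?R)"
      using n by (subst nn_integral_uniform_count_measure) auto
    also have "\<dots> \<le> (\<integral>\<^sup>+\<mu>. ennreal (1 / real n) * ((\<Sum>i<n. ?bad i C) + ennreal F) \<partial>?R)"
    proof (intro nn_integral_mono mult_left_mono)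
      fix \<mu> assume "\<mu> \<in> space ?R"
      hence \<mu>: "\<mu>(j := i) \<in> tuples n" if "i < n" for i
        using that j by (auto simp: space_PiM space_uniform_count_measure PiE_def Pi_def extensional_def)
      hence \<mu>s: "\<mu>(j := i) \<in> space ?M" if "i < n" for i
        using that by (simp add: messages_def space_PiM space_uniform_count_measure)
      have split: "(\<Sum>i<n. P2 False C (\<mu>(j := i))) = (\<Sum>i\<in>{..<n} - I. P2 False C (\<mu>(j := i))) + (\<Sum>i\<in>I. P2 False C (\<mu>(j := i)))"
        by (rule sum.subset_diff) (auto simp: I_def)
      have "(\<Sum>i\<in>{..<n} - I. P2 False C (\<mu>(j := i))) \<le> (\<Sum>i\<in>{..<n} - I. ?bad i C)"
      proof (rule sum_mono)
        fix i assume i: "i \<in> {..<n} - I"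
        have "P2 False C (\<mu>(j := i)) \<le> P2 True C (\<mu>(j := i)) + P2 False C (\<mu>(j := i))" by simp
        also have "\<dots> = 1" using i by (intro one2 C \<mu>s) auto
        also have "1 = ?bad i C" using i by (auto simp: I_def indicator_def)
        finally show "P2 False C (\<mu>(j := i)) \<le> ?bad i C" .
      qed
      also have "(\<Sum>i\<in>{..<n} - I. ?bad i C) \<le> (\<Sum>i<n. ?bad i C)" by (intro sum_mono2) auto
      finally have le1: "(\<Sum>i\<in>{..<n} - I. P2 False C (\<mu>(j := i))) \<le> (\<Sum>i<n. ?bad i C)" .
      have "(\<Sum>i\<in>I. P2 False C (\<mu>(j := i))) = (\<integral>\<^sup>+w. (\<Sum>i\<in>I. P3 False C (\<mu>(j := i)) w) \<partial>?W)"
        unfolding P2_def using \<mu>s by (intro nn_integral_sum[symmetric] P3C C) (auto simp: I_def)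
      also have "\<dots> \<le> (\<integral>\<^sup>+w. ennreal F \<partial>?W)"
      proof (intro nn_integral_mono)
        fix w
        show "(\<Sum>i\<in>I. P3 False C (\<mu>(j := i)) w) \<le> ennreal F"
          using success_sum_le[where g=g and \<mu>=\<mu> and w=w, OF n E K j t pos g(2) h C \<mu> I_def]
          by (simp add: P3_def F_def)
      qed
      also have "\<dots> = ennreal F" using W.emeasure_space_1 by simp
      finally have le2: "(\<Sum>i\<in>I. P2 False C (\<mu>(j := i))) \<le> ennreal F" .
      show "(\<Sum>i<n. P2 False C (\<mu>(j := i))) \<le> (\<Sum>i<n. ?bad i C) + ennreal F"
        unfolding split by (rule add_mono[OF le1 le2])
    qed auto
    also have "\<dots> = ennreal (1 / real n) * ((\<Sum>i<n. ?bad i C) + ennreal F)"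
      using M0.emeasure_space_1 by simp
    finally show ?thesis .
  qed
  hence "(\<integral>\<^sup>+C. (\<integral>\<^sup>+\<mu>. P2 False C \<mu> \<partial>?M) \<partial>?C) \<le> (\<integral>\<^sup>+C. ennreal (1 / real n) * ((\<Sum>i<n. ?bad i C) + ennreal F) \<partial>?C)"
    by (intro nn_integral_mono)
  also have "\<dots> = ennreal (1 / real n) * ((\<Sum>i<n. \<integral>\<^sup>+C. ?bad i C \<partial>?C) + ennreal F)"
  proof -
    have bm: "?bad i \<in> borel_measurable ?C" if "i < n" for i
    proof -
      have [measurable]: "(\<lambda>C. C (j, i, k)) \<in> borel_measurable ?C" if "k < K" for k
        unfolding codebooks_def using that \<open>i < n\<close> j
        by (intro measurable_component_cn[OF _ measurable_ident_sets[OF refl]]) auto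
      show ?thesis unfolding energy_def by measurable
    qed
    have "(\<integral>\<^sup>+C. (\<Sum>i<n. ?bad i C) \<partial>?C) = (\<Sum>i<n. \<integral>\<^sup>+C. ?bad i C \<partial>?C)"
      using bm by (intro nn_integral_sum) auto
    thus ?thesis using C.emeasure_space_1 bm
      by (subst nn_integral_cmult) (auto simp: nn_integral_add)
  qed
  also have "\<dots> \<le> ennreal (1 / real n) * ((\<Sum>i<n. ennreal (1 / 4)) + ennreal F)"
    using j by (intro mult_left_mono add_mono sum_mono codeword_energy_tail E K) auto
  also have "\<dots> = ennreal (1 / 4 + F / real n)"
  proof -
    have "(\<Sum>i<n. ennreal (1 / 4)) + ennreal F = ennreal (real n * (1 / 4) + F)"
      using F by (simp add: ennreal_of_nat_eq_real_of_nat ennreal_mult'[symmetric])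
    hence "ennreal (1 / real n) * ((\<Sum>i<n. ennreal (1 / 4)) + ennreal F) = ennreal (1 / real n * (real n * (1 / 4) + F))"
      using F by (simp only:) (rule ennreal_mult[symmetric], auto)
    also have "1 / real n * (real n * (1 / 4) + F) = 1 / 4 + F / real n" using n by (simp add: field_simps)
    finally show ?thesis .
  qed
  finally have "ennreal (1 - (1 / 4 + F / real n)) \<le> (\<integral>\<^sup>+C. (\<integral>\<^sup>+\<mu>. P2 True C \<mu> \<partial>?M) \<partial>?C)"
    using F by (intro ennreal_ge_diff_of_add_eq_1[OF one0]) auto
  thus ?thesis by (simp add: P2_def P3_def F_def)
qed

text \<open>The bound of \<open>conditional_error_ge\<close>, integrated over the outage event. A
  negative second factor is treated apart because \<open>ennreal\<close> would replace it by
  0.\<close>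

lemma cma_error_prob_ge:
  assumes n: "n > 0" and E: "E > 0" and L: "L > 0" and j: "j < N" and t: "0 < t" "t \<le> 1" and pos: "A > 0" "s > 0"
  shows "(t / (pi * exp 1)) ^ N * (3 / 4 - conv_base (t * E / \<sigma>v2) A s ^ K / real n)
    \<le> cma_error_prob N L n \<sigma>v2 \<sigma>w2 E a b j"
proof (cases "3 / 4 - conv_base (t * E / \<sigma>v2) A s ^ K / real n \<ge> 0")
  case True
  define c where "c = 3 / 4 - conv_base (t * E / \<sigma>v2) A s ^ K / real n"
  have K: "K > 0" using N L by (simp add: frames_def)
  interpret H: prob_space "source_gains N" by (rule prob_space_source_gains)
  let ?A = "{..<N} \<rightarrow>\<^sub>E {z. (cmod z)\<^sup>2 \<le> t}"
  have A: "?A \<in> sets (dest_gains N)"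
    unfolding dest_gains_def by (intro sets_PiM_I_finite) auto
  have "ennreal ((t / (pi * exp 1)) ^ N * c) = ennreal ((t / (pi * exp 1)) ^ N) * ennreal c"
    using t by (intro ennreal_mult') auto
  also have "\<dots> \<le> emeasure (dest_gains N) ?A * ennreal c"
    by (intro mult_right_mono emeasure_small_gains_ge t) auto
  also have "\<dots> = (\<integral>\<^sup>+g. ennreal c * indicator ?A g \<partial>dest_gains N)"
    using A by (simp add: nn_integral_cmult_indicator mult.commute)
  also have "\<dots> \<le> (\<integral>\<^sup>+g. (\<integral>\<^sup>+h. (\<integral>\<^sup>+C. (\<integral>\<^sup>+\<mu>. (\<integral>\<^sup>+w. (\<integral>\<^sup>+v. indicator {v. ml_error n j g h C \<mu> w v} v
      \<partial>frame_noise N L \<sigma>v2) \<partial>frame_noise N L \<sigma>w2) \<partial>messages N n) \<partial>codebooks N L n E)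
      \<partial>source_gains N) \<partial>dest_gains N)"
  proof (intro nn_integral_mono)
    fix g assume g: "g \<in> space (dest_gains N)"
    show "ennreal c * indicator ?A g \<le> (\<integral>\<^sup>+h. (\<integral>\<^sup>+C. (\<integral>\<^sup>+\<mu>. (\<integral>\<^sup>+w. (\<integral>\<^sup>+v. indicator {v. ml_error n j g h C \<mu> w v} v
      \<partial>frame_noise N L \<sigma>v2) \<partial>frame_noise N L \<sigma>w2) \<partial>messages N n) \<partial>codebooks N L n E)
      \<partial>source_gains N)"
    proof (cases "g \<in> ?A")
      case True
      hence gt: "(cmod (g m))\<^sup>2 \<le> t" if "m < N" for m using that by (auto simp: PiE_def Pi_def)
      have "ennreal c = (\<integral>\<^sup>+h. ennreal c \<partial>source_gains N)" using H.emeasure_space_1 by simp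
      also have "\<dots> \<le> (\<integral>\<^sup>+h. (\<integral>\<^sup>+C. (\<integral>\<^sup>+\<mu>. (\<integral>\<^sup>+w. (\<integral>\<^sup>+v. indicator {v. ml_error n j g h C \<mu> w v} v
        \<partial>frame_noise N L \<sigma>v2) \<partial>frame_noise N L \<sigma>w2) \<partial>messages N n) \<partial>codebooks N L n E)
        \<partial>source_gains N)"
        unfolding c_def by (intro nn_integral_mono conditional_error_ge n E K j t pos g gt)
      finally show ?thesis using True by simp
    qed simp
  qed
  also have "\<dots> = ennreal (cma_error_prob N L n \<sigma>v2 \<sigma>w2 E a b j)"
    by (rule cma_error_prob_eq[OF n E j, symmetric])
  finally show ?thesis
    unfolding c_def by (subst (asm) ennreal_le_iff) (simp_all add: cma_error_prob_def Let_def)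
next
  case False
  hence "(t / (pi * exp 1)) ^ N * (3 / 4 - conv_base (t * E / \<sigma>v2) A s ^ K / real n) \<le> 0"
    using t by (intro mult_nonneg_nonpos) auto
  also have "0 \<le> cma_error_prob N L n \<sigma>v2 \<sigma>w2 E a b j" by (simp add: cma_error_prob_def Let_def)
  finally show ?thesis .
qed

end

section \<open>Codes for the point-to-point system\<close>

definition miso_signal :: "nat \<Rightarrow> (nat \<Rightarrow> nat \<Rightarrow> nat \<Rightarrow> complex) \<Rightarrow> (nat \<Rightarrow> complex) \<Rightarrow> nat \<Rightarrow> nat \<Rightarrow> complex" where
  "miso_signal N X g \<mu> t = (\<Sum>i<N. g i * X \<mu> t i)"

lemma measurable_dest_gains_component [measurable]:
  "i < N \<Longrightarrow> (\<lambda>g. g i) \<in> borel_measurable (dest_gains N)"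
  unfolding dest_gains_def
  using measurable_component_singleton[of i "{..<N}" "\<lambda>_. cn 1"] by (simp add: measurable_cong_sets[OF refl sets_cn])

lemma miso_error_prob_eq:
  assumes n: "n > 0" and s: "\<sigma>2 > 0"
    and D: "D \<in> measurable (dest_gains N \<Otimes>\<^sub>M PiM {..<T} (\<lambda>_. borel)) (count_space UNIV)"
  shows "ennreal (miso_error_prob N \<sigma>2 T n X D) = (\<integral>\<^sup>+g. ennreal (1 / real n) * (\<Sum>\<mu><n.
      (\<integral>\<^sup>+v. indicator {v. D (g, \<lambda>t\<in>{..<T}. miso_signal N X g \<mu> t + v t) \<noteq> \<mu>} v \<partial>PiM {..<T} (\<lambda>_. cn \<sigma>2)))
      \<partial>dest_gains N)"
    and "\<And>g \<mu>. g \<in> space (dest_gains N) \<Longrightarrow> \<mu> < n \<Longrightarrow>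
      Measurable.pred (PiM {..<T} (\<lambda>_. cn \<sigma>2)) (\<lambda>v. D (g, \<lambda>t\<in>{..<T}. miso_signal N X g \<mu> t + v t) \<noteq> \<mu>)"
proof -
  let ?V = "PiM {..<T} (\<lambda>_. cn \<sigma>2)" let ?U = "uniform_count_measure {..<n}"
  let ?\<Omega> = "dest_gains N \<Otimes>\<^sub>M ?U \<Otimes>\<^sub>M ?V"
  have pU: "prob_space ?U" using n by (intro prob_space_uniform_count_measure) auto
  have pV: "prob_space ?V" by (rule prob_space_PiM_cn[OF s])
  have pUV: "prob_space (?U \<Otimes>\<^sub>M ?V)" by (intro prob_space_pair pU pV)
  interpret \<Omega>: prob_space ?\<Omega> by (intro prob_space_pair pUV prob_space_dest_gains)
  let ?err = "\<lambda>z. D (fst z, \<lambda>t\<in>{..<T}. miso_signal N X (fst z) (fst (snd z)) t + snd (snd z) t) \<noteq> fst (snd z)"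
  have vm [measurable]: "(\<lambda>v. v t) \<in> borel_measurable ?V" if "t < T" for t
    using measurable_component_singleton[of t "{..<T}" "\<lambda>_. cn \<sigma>2"] that by (simp add: measurable_cong_sets[OF refl sets_cn])
  have \<mu>m [measurable]: "(\<lambda>\<mu>. f \<mu>) \<in> borel_measurable ?U" for f :: "nat \<Rightarrow> complex"
    by (simp add: measurable_cong_sets[OF sets_uniform_count_measure_count_space refl])
  have \<mu>n [measurable]: "(\<lambda>\<mu>. \<mu>) \<in> measurable ?U (count_space UNIV)"
    by (simp add: measurable_cong_sets[OF sets_uniform_count_measure_count_space refl])
  have [measurable]: "(\<lambda>z. (fst z, \<lambda>t\<in>{..<T}. miso_signal N X (fst z) (fst (snd z)) t + snd (snd z) t))
      \<in> measurable ?\<Omega> (dest_gains N \<Otimes>\<^sub>M PiM {..<T} (\<lambda>_. borel))"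
    unfolding miso_signal_def by measurable
  have Dm [measurable]: "(\<lambda>z. D (fst z, \<lambda>t\<in>{..<T}. miso_signal N X (fst z) (fst (snd z)) t + snd (snd z) t))
      \<in> measurable ?\<Omega> (count_space UNIV)"
    by (rule measurable_compose[OF _ D]) measurable
  have [measurable]: "(\<lambda>z. fst (snd z)) \<in> measurable ?\<Omega> (count_space UNIV)"
    by (rule measurable_compose[OF _ \<mu>n]) simp
  \<comment> \<open>That two random naturals differ is expressed by a countable quantifier, for
    which measurability is immediate.\<close>
  have "Measurable.pred ?\<Omega> (\<lambda>z. \<not> (\<exists>i. fst (snd z) = i \<and> D (fst z, \<lambda>t\<in>{..<T}. miso_signal N X (fst z) (fst (snd z)) t + snd (snd z) t) = i))"
    by measurable
  hence err [measurable]: "Measurable.pred ?\<Omega> ?err" by simp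
  define f :: "_ \<Rightarrow> ennreal" where "f z = indicator {z. ?err z} z" for z
  have fm: "f \<in> borel_measurable ?\<Omega>" unfolding f_def indicator_def mem_Collect_eq by measurable
  have set: "{(g, \<mu>, v) \<in> space ?\<Omega>. D (g, \<lambda>t\<in>{..<T}. (\<Sum>i<N. g i * X \<mu> t i) + v t) \<noteq> \<mu>} = {z \<in> space ?\<Omega>. ?err z}"
    by (auto simp: miso_signal_def)
  have "ennreal (miso_error_prob N \<sigma>2 T n X D) = emeasure ?\<Omega> {z \<in> space ?\<Omega>. ?err z}"
    unfolding miso_error_prob_def Let_def set by (simp add: \<Omega>.emeasure_eq_measure)
  also have "\<dots> = (\<integral>\<^sup>+z. indicator {z \<in> space ?\<Omega>. ?err z} z \<partial>?\<Omega>)"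
    by (intro nn_integral_indicator[symmetric]) measurable
  also have "\<dots> = (\<integral>\<^sup>+z. f z \<partial>?\<Omega>)"
    by (intro nn_integral_cong) (auto simp: f_def indicator_def)
  also have "\<dots> = (\<integral>\<^sup>+g. (\<integral>\<^sup>+z. f (g, z) \<partial>(?U \<Otimes>\<^sub>M ?V)) \<partial>dest_gains N)"
    by (rule nn_integral_pair_iterate[OF pUV fm])
  also have "\<dots> = (\<integral>\<^sup>+g. (\<integral>\<^sup>+\<mu>. (\<integral>\<^sup>+v. f (g, \<mu>, v) \<partial>?V) \<partial>?U) \<partial>dest_gains N)"
    by (intro nn_integral_cong nn_integral_pair_iterate[OF pV] measurable_section[OF fm])
  also have "\<dots> = (\<integral>\<^sup>+g. ennreal (1 / real n) * (\<Sum>\<mu><n. (\<integral>\<^sup>+v. f (g, \<mu>, v) \<partial>?V)) \<partial>dest_gains N)"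
    using n by (subst nn_integral_uniform_count_measure) auto
  finally show "ennreal (miso_error_prob N \<sigma>2 T n X D) = (\<integral>\<^sup>+g. ennreal (1 / real n) * (\<Sum>\<mu><n.
      (\<integral>\<^sup>+v. indicator {v. D (g, \<lambda>t\<in>{..<T}. miso_signal N X g \<mu> t + v t) \<noteq> \<mu>} v \<partial>?V)) \<partial>dest_gains N)"
    by (simp add: f_def indicator_def)
  fix g \<mu> assume "g \<in> space (dest_gains N)" and "\<mu> < n"
  hence "(\<lambda>v. (g, \<mu>, v)) \<in> measurable ?V ?\<Omega>"
    by (intro measurable_Pair measurable_const) (auto simp: space_uniform_count_measure)
  from measurable_compose[OF this err]
  show "Measurable.pred ?V (\<lambda>v. D (g, \<lambda>t\<in>{..<T}. miso_signal N X g \<mu> t + v t) \<noteq> \<mu>)" by simp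
qed

text \<open>The strong converse is applied with the identity map to the noiseless outputs, not to
  the antenna inputs. By Cauchy-Schwarz their energy is at most \<open>N * t\<close> times the total
  energy of the \<open>N\<close> antennas, which explains \<open>(real N)\<^sup>2\<close>.\<close>

lemma miso_error_prob_ge:
  assumes N: "N > 0" and code: "miso_code N E T n X D" and E: "E > 0" and \<sigma>2: "\<sigma>2 > 0"
    and t: "0 < t" "t \<le> 1" and pos: "A > 0" "s > 0"
  shows "(t / (pi * exp 1)) ^ N * (3 / 4 - conv_base ((real N)\<^sup>2 * t * E / \<sigma>2) A s ^ T / real n)
    \<le> miso_error_prob N \<sigma>2 T n X D"
proof (cases "3 / 4 - conv_base ((real N)\<^sup>2 * t * E / \<sigma>2) A s ^ T / real n \<ge> 0")
  case c0: True
  define F where "F = conv_base ((real N)\<^sup>2 * t * E / \<sigma>2) A s ^ T"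
  define c where "c = 3 / 4 - F / real n"
  have Tn: "T > 0" "n > 0" and power: "\<And>i. i < N \<Longrightarrow> (\<Sum>\<mu><n. \<Sum>t<T. (cmod (X \<mu> t i))\<^sup>2) / (real n * real T) \<le> E"
    and D: "D \<in> measurable (dest_gains N \<Otimes>\<^sub>M PiM {..<T} (\<lambda>_. borel)) (count_space UNIV)"
    using code by (auto simp: miso_code_def)
  have F: "F \<ge> 0" unfolding F_def using N t E \<sigma>2 pos by (intro zero_le_power less_imp_le[OF conv_base_pos]) auto
  let ?V = "PiM {..<T} (\<lambda>_. cn \<sigma>2)"
  interpret V: prob_space ?V by (rule prob_space_PiM_cn[OF \<sigma>2])
  let ?A = "{..<N} \<rightarrow>\<^sub>E {z. (cmod z)\<^sup>2 \<le> t}"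
  have A: "?A \<in> sets (dest_gains N)"
    unfolding dest_gains_def by (intro sets_PiM_I_finite) auto
  define err where "err g \<mu> = (\<integral>\<^sup>+v. indicator {v. D (g, \<lambda>t\<in>{..<T}. miso_signal N X g \<mu> t + v t) \<noteq> \<mu>} v \<partial>?V)" for g \<mu>
  define suc where "suc g \<mu> = (\<integral>\<^sup>+v. indicator {v. D (g, \<lambda>t\<in>{..<T}. miso_signal N X g \<mu> t + v t) = \<mu>} v \<partial>?V)" for g \<mu>
  have es: "err g \<mu> + suc g \<mu> = 1" if "g \<in> space (dest_gains N)" "\<mu> < n" for g \<mu>
  proof -
    note p1 [measurable] = miso_error_prob_eq(2)[OF Tn(2) \<sigma>2 D that, of X]
    have "Measurable.pred ?V (\<lambda>v. \<not> (D (g, \<lambda>t\<in>{..<T}. miso_signal N X g \<mu> t + v t) \<noteq> \<mu>))" by measurable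
    hence p2: "Measurable.pred ?V (\<lambda>v. D (g, \<lambda>t\<in>{..<T}. miso_signal N X g \<mu> t + v t) = \<mu>)" by simp
    have m: "(\<lambda>v. indicator {v. P v} v :: ennreal) \<in> borel_measurable ?V" if "Measurable.pred ?V P" for P
      using that unfolding indicator_def mem_Collect_eq by measurable
    have "err g \<mu> + suc g \<mu> = (\<integral>\<^sup>+v. indicator {v. D (g, \<lambda>t\<in>{..<T}. miso_signal N X g \<mu> t + v t) \<noteq> \<mu>} v
        + indicator {v. D (g, \<lambda>t\<in>{..<T}. miso_signal N X g \<mu> t + v t) = \<mu>} v \<partial>?V)"
      unfolding err_def suc_def by (intro nn_integral_add[symmetric] m p1 p2)
    also have "\<dots> = (\<integral>\<^sup>+v. 1 \<partial>?V)" by (intro nn_integral_cong) (simp add: indicator_def)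
    finally show ?thesis using V.emeasure_space_1 by simp
  qed
  have bad: "ennreal c \<le> ennreal (1 / real n) * (\<Sum>\<mu><n. err g \<mu>)" if g: "g \<in> ?A" for g
  proof -
    have gs: "g \<in> space (dest_gains N)" using g by (auto simp: dest_gains_def space_PiM PiE_def)
    have gt: "(cmod (g i))\<^sup>2 \<le> t" if "i < N" for i using g that by (auto simp: PiE_def Pi_def)
    define \<tau> where "\<tau> = (real N)\<^sup>2 * t * E * A"
    define B where "B = 16 * real T * ((real N)\<^sup>2 * t * E)"
    have \<tau>: "\<tau> > 0" and B: "B > 0" using N t E pos Tn by (auto simp: \<tau>_def B_def)
    define x where "x \<mu> = miso_signal N X g \<mu>" for \<mu>
    define I where "I = {\<mu>. \<mu> < n \<and> energy {..<T} (x \<mu>) \<le> B}"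
    have xe: "energy {..<T} (x \<mu>) \<le> real N * t * (\<Sum>i<N. \<Sum>k<T. (cmod (X \<mu> k i))\<^sup>2)" for \<mu>
    proof -
      have "(cmod (x \<mu> k))\<^sup>2 \<le> real N * t * (\<Sum>i<N. (cmod (X \<mu> k i))\<^sup>2)" for k
      proof -
        have "(cmod (x \<mu> k))\<^sup>2 \<le> energy {..<N} g * energy {..<N} (X \<mu> k)"
          unfolding x_def miso_signal_def by (rule cmod_sum_mult_square_le)
        also have "energy {..<N} g \<le> (\<Sum>i<N. t)"
          unfolding energy_def by (intro sum_mono gt) auto
        finally show ?thesis by (simp add: energy_def mult_right_mono sum_nonneg)
      qed
      hence "energy {..<T} (x \<mu>) \<le> (\<Sum>k<T. real N * t * (\<Sum>i<N. (cmod (X \<mu> k i))\<^sup>2))"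
        unfolding energy_def by (intro sum_mono)
      also have "\<dots> = real N * t * (\<Sum>k<T. \<Sum>i<N. (cmod (X \<mu> k i))\<^sup>2)" by (simp only: sum_distrib_left)
      also have "(\<Sum>k<T. \<Sum>i<N. (cmod (X \<mu> k i))\<^sup>2) = (\<Sum>i<N. \<Sum>k<T. (cmod (X \<mu> k i))\<^sup>2)" by (rule sum.swap)
      finally show ?thesis .
    qed
    \<comment> \<open>Markov's inequality over the messages: the budget \<open>B\<close> is 16 times
      the bound for the average energy.\<close>
    have cardI: "real (card ({..<n} - I)) \<le> real n / 16"
    proof -
      have "real (card ({..<n} - I)) * B = (\<Sum>\<mu>\<in>{..<n} - I. B)" by simp
      also have "\<dots> \<le> (\<Sum>\<mu>\<in>{..<n} - I. energy {..<T} (x \<mu>))"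
        by (intro sum_mono) (auto simp: I_def)
      also have "\<dots> \<le> (\<Sum>\<mu><n. energy {..<T} (x \<mu>))" by (intro sum_mono2) auto
      also have "\<dots> \<le> (\<Sum>\<mu><n. real N * t * (\<Sum>i<N. \<Sum>k<T. (cmod (X \<mu> k i))\<^sup>2))" by (intro sum_mono xe)
      also have "\<dots> = real N * t * (\<Sum>i<N. \<Sum>\<mu><n. \<Sum>k<T. (cmod (X \<mu> k i))\<^sup>2)"
        unfolding sum_distrib_left by (rule sum.swap)
      also have "\<dots> \<le> real N * t * (\<Sum>i<N. E * (real n * real T))"
        using power Tn t by (intro mult_left_mono sum_mono) (auto simp: divide_le_eq)
      also have "\<dots> = real n / 16 * B" by (simp add: B_def power2_eq_square)
      finally show ?thesis using B by simp
    qed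
    have "(\<Sum>\<mu>\<in>I. suc g \<mu>) \<le> ennreal F"
    proof -
      define Dm where "Dm \<mu> = {y \<in> space (PiM {..<T} (\<lambda>_. borel)). D (g, y) = \<mu>}" for \<mu>
      have Dg: "(\<lambda>y. D (g, y)) \<in> measurable (PiM {..<T} (\<lambda>_. borel)) (count_space UNIV)"
        by (rule measurable_section[OF D gs])
      have Dms: "Dm \<mu> \<in> sets (PiM {..<T} (\<lambda>_. borel))" for \<mu>
        unfolding Dm_def using Dg by measurable
      have "suc g \<mu> = (\<integral>\<^sup>+v. indicator (Dm \<mu>) (\<lambda>k\<in>{..<T}. 0 + x \<mu> k + v k) \<partial>?V)" for \<mu>
        unfolding suc_def by (intro nn_integral_cong) (auto simp: indicator_def Dm_def x_def space_PiM)
      hence "(\<Sum>\<mu>\<in>I. suc g \<mu>) = (\<Sum>\<mu>\<in>I. \<integral>\<^sup>+v. indicator (Dm \<mu>) (\<lambda>k\<in>{..<T}. 0 + x \<mu> k + v k) \<partial>?V)" by simp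
      also have "\<dots> \<le> ennreal ((1 + 1 * \<tau> / \<sigma>2) ^ card {..<T} * ((1 + s) ^ card {..<T} * exp (B / (\<tau> * s))))"
        by (rule gaussian_converse[where H="\<lambda>u. u", OF _ _ \<sigma>2 \<tau> pos(2)])
          (auto simp: I_def disjoint_family_on_def Dm_def intro: Dms[unfolded Dm_def])
      also have "(1 + 1 * \<tau> / \<sigma>2) ^ card {..<T} * ((1 + s) ^ card {..<T} * exp (B / (\<tau> * s))) = F"
      proof -
        have "B / (\<tau> * s) = real T * (16 / (A * s))" using N t E by (simp add: B_def \<tau>_def)
        thus ?thesis by (simp add: F_def \<tau>_def conv_base_def power_mult_distrib exp_of_nat_mult[symmetric] mult_ac)
      qed
      finally show ?thesis .
    qed
    moreover have "(\<Sum>\<mu>\<in>{..<n} - I. suc g \<mu>) \<le> ennreal (real n / 16)"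
    proof -
      have "(\<Sum>\<mu>\<in>{..<n} - I. suc g \<mu>) \<le> (\<Sum>\<mu>\<in>{..<n} - I. 1)"
      proof (rule sum_mono)
        fix \<mu> assume "\<mu> \<in> {..<n} - I"
        hence "err g \<mu> + suc g \<mu> = 1" using es gs by auto
        thus "suc g \<mu> \<le> 1" by (metis le_iff_add add.commute)
      qed
      also have "\<dots> = ennreal (real (card ({..<n} - I)))" by (simp add: ennreal_of_nat_eq_real_of_nat)
      also have "\<dots> \<le> ennreal (real n / 16)" by (rule ennreal_leI[OF cardI])
      finally show ?thesis .
    qed
    moreover have "(\<Sum>\<mu><n. suc g \<mu>) = (\<Sum>\<mu>\<in>{..<n} - I. suc g \<mu>) + (\<Sum>\<mu>\<in>I. suc g \<mu>)"
      by (rule sum.subset_diff) (auto simp: I_def)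
    ultimately have "(\<Sum>\<mu><n. suc g \<mu>) \<le> ennreal (real n / 16) + ennreal F" by (simp add: add_mono)
    hence "ennreal (1 / real n) * (\<Sum>\<mu><n. suc g \<mu>) \<le> ennreal (1 / real n) * ennreal (real n / 16 + F)"
      using F by (intro mult_left_mono) auto
    also have "\<dots> = ennreal (1 / real n * (real n / 16 + F))" using F by (intro ennreal_mult[symmetric]) auto
    also have "\<dots> \<le> ennreal (1 / 4 + F / real n)"
      using Tn by (intro ennreal_leI) (simp add: field_simps)
    finally have S: "ennreal (1 / real n) * (\<Sum>\<mu><n. suc g \<mu>) \<le> ennreal (1 / 4 + F / real n)" .
    have "ennreal (1 / real n) * (\<Sum>\<mu><n. err g \<mu>) + ennreal (1 / real n) * (\<Sum>\<mu><n. suc g \<mu>)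
        = ennreal (1 / real n) * (\<Sum>\<mu><n. 1)"
      using es gs by (simp add: distrib_left[symmetric] sum.distrib[symmetric])
    also have "\<dots> = 1" using Tn by (simp add: ennreal_of_nat_eq_real_of_nat ennreal_mult'[symmetric])
    finally have "ennreal (1 - (1 / 4 + F / real n)) \<le> ennreal (1 / real n) * (\<Sum>\<mu><n. err g \<mu>)"
      using F by (intro ennreal_ge_diff_of_add_eq_1[OF _ S]) auto
    thus ?thesis by (simp add: c_def)
  qed
  have "ennreal ((t / (pi * exp 1)) ^ N * c) = ennreal ((t / (pi * exp 1)) ^ N) * ennreal c"
    using t by (intro ennreal_mult') auto
  also have "\<dots> \<le> emeasure (dest_gains N) ?A * ennreal c"
    by (intro mult_right_mono emeasure_small_gains_ge t) auto
  also have "\<dots> = (\<integral>\<^sup>+g. ennreal c * indicator ?A g \<partial>dest_gains N)"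
    using A by (simp add: nn_integral_cmult_indicator mult.commute)
  also have "\<dots> \<le> (\<integral>\<^sup>+g. ennreal (1 / real n) * (\<Sum>\<mu><n. err g \<mu>) \<partial>dest_gains N)"
    by (intro nn_integral_mono) (use bad in \<open>auto simp: indicator_def\<close>)
  also have "\<dots> = ennreal (miso_error_prob N \<sigma>2 T n X D)"
    unfolding err_def by (rule miso_error_prob_eq(1)[OF Tn(2) \<sigma>2 D, symmetric])
  finally show ?thesis
    unfolding c_def F_def by (subst (asm) ennreal_le_iff) (simp_all add: miso_error_prob_def Let_def)
next
  case False
  hence "(t / (pi * exp 1)) ^ N * (3 / 4 - conv_base ((real N)\<^sup>2 * t * E / \<sigma>2) A s ^ T / real n) \<le> 0"
    using t by (intro mult_nonneg_nonpos) auto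
  also have "0 \<le> miso_error_prob N \<sigma>2 T n X D" by (simp add: miso_error_prob_def Let_def)
  finally show ?thesis .
qed

section \<open>Minimum-distance decoding of a random cyclic code\<close>

lemma miso_pairwise_error:
  fixes T :: nat
  assumes \<sigma>2: "\<sigma>2 > 0"
  shows "(\<integral>\<^sup>+v. indicator {v. energy {..<T} (\<lambda>t. x t + v t - x' t) \<le> energy {..<T} v} v \<partial>PiM {..<T} (\<lambda>_. cn \<sigma>2))
    \<le> ennreal (exp (- energy {..<T} (\<lambda>t. x t - x' t) / (4 * \<sigma>2)))"
proof -
  define d where "d t = x t - x' t" for t
  let ?e = "energy {..<T} d"
  have exp: "energy {..<T} (\<lambda>t. x t + v t - x' t) = energy {..<T} v + ?e - 2 * Re (\<Sum>t<T. - cnj (d t) * v t)" for v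
  proof -
    have "(cmod (x t + v t - x' t))\<^sup>2 = (cmod (v t))\<^sup>2 + (cmod (d t))\<^sup>2 - 2 * Re (- cnj (d t) * v t)" for t
      by (simp only: cmod_power2) (simp add: d_def power2_eq_square algebra_simps)
    thus ?thesis by (simp add: energy_def sum.distrib sum_subtractf sum_distrib_left)
  qed
  have "(\<integral>\<^sup>+v. indicator {v. energy {..<T} (\<lambda>t. x t + v t - x' t) \<le> energy {..<T} v} v \<partial>PiM {..<T} (\<lambda>_. cn \<sigma>2))
      = (\<integral>\<^sup>+v. indicator {v. ?e / 2 \<le> 0 + Re (\<Sum>t<T. - cnj (d t) * v t)} v \<partial>PiM {..<T} (\<lambda>_. cn \<sigma>2))"
    unfolding exp by (intro nn_integral_cong) (auto simp: indicator_def)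
  \<comment> \<open>Chernoff's parameter is 1 / \<sigma>2; for energy e of the difference it gives -
    e / (2 * \<sigma>2) + e / (4 * \<sigma>2).\<close>
  also have "\<dots> \<le> ennreal (exp ((1 / \<sigma>2) * (0 - ?e / 2) + (1 / \<sigma>2)\<^sup>2 * (\<sigma>2 * energy {..<T} (\<lambda>t. - cnj (d t))) / 4))"
    using \<sigma>2 by (intro gaussian_linear_tail) auto
  also have "energy {..<T} (\<lambda>t. - cnj (d t)) = ?e" by (simp add: energy_def)
  also have "(1 / \<sigma>2) * (0 - ?e / 2) + (1 / \<sigma>2)\<^sup>2 * (\<sigma>2 * ?e) / 4 = - ?e / (4 * \<sigma>2)"
    using \<sigma>2 by (simp add: power2_eq_square field_simps)
  finally show ?thesis by (simp only: d_def[abs_def])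
qed

definition cyclic_code :: "nat \<Rightarrow> (nat \<times> nat \<Rightarrow> complex) \<Rightarrow> nat \<Rightarrow> nat \<Rightarrow> nat \<Rightarrow> complex" where
  "cyclic_code N Y \<mu> t i = (if t mod N = i then Y (\<mu>, t) else 0)"

lemma miso_signal_cyclic: "N > 0 \<Longrightarrow> miso_signal N (cyclic_code N Y) g \<mu> t = g (t mod N) * Y (\<mu>, t)"
  by (simp add: miso_signal_def cyclic_code_def if_distrib[of "\<lambda>z. _ * z"] cong: if_cong)

text \<open>\<open>LEAST\<close> breaks ties in a measurable way.\<close>

definition min_dist_decoder where
  "min_dist_decoder N T n X = (\<lambda>(g, y). LEAST \<mu>. \<mu> < n \<and> (\<forall>\<mu>'<n. energy {..<T} (\<lambda>t. y t - miso_signal N X g \<mu> t)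
     \<le> energy {..<T} (\<lambda>t. y t - miso_signal N X g \<mu>' t)))"

lemma measurable_min_dist_decoder:
  "min_dist_decoder N T n X \<in> measurable (dest_gains N \<Otimes>\<^sub>M PiM {..<T} (\<lambda>_. borel)) (count_space UNIV)"
proof -
  have [measurable]: "(\<lambda>z. energy {..<T} (\<lambda>t. snd z t - miso_signal N X (fst z) \<mu> t))
      \<in> borel_measurable (dest_gains N \<Otimes>\<^sub>M PiM {..<T} (\<lambda>_. borel))" for \<mu>
    unfolding miso_signal_def energy_def by measurable
  have [measurable]: "Measurable.pred (dest_gains N \<Otimes>\<^sub>M PiM {..<T} (\<lambda>_. borel)) (\<lambda>z. \<mu> < n \<and> (\<forall>\<mu>'<n.
      energy {..<T} (\<lambda>t. snd z t - miso_signal N X (fst z) \<mu> t) \<le> energy {..<T} (\<lambda>t. snd z t - miso_signal N X (fst z) \<mu>' t)))" for \<mu>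
    by measurable
  show ?thesis unfolding min_dist_decoder_def case_prod_unfold by (rule measurable_Least) measurable
qed

lemma min_dist_decoder_error:
  assumes n: "n > 0" and err: "min_dist_decoder N T n X (g, \<lambda>t\<in>{..<T}. miso_signal N X g \<mu> t + v t) \<noteq> \<mu>" and \<mu>: "\<mu> < n"
  shows "\<exists>\<mu>'\<in>{..<n} - {\<mu>}. energy {..<T} (\<lambda>t. miso_signal N X g \<mu> t + v t - miso_signal N X g \<mu>' t) \<le> energy {..<T} v"
proof -
  let ?y = "\<lambda>t\<in>{..<T}. miso_signal N X g \<mu> t + v t"
  define f where "f \<mu> = energy {..<T} (\<lambda>t. ?y t - miso_signal N X g \<mu> t)" for \<mu>
  have "Min (f ` {..<n}) \<in> f ` {..<n}" using n by (intro Min_in) auto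
  then obtain m where "m < n" "f m = Min (f ` {..<n})" by auto
  hence ex: "m < n \<and> (\<forall>\<mu>'<n. f m \<le> f \<mu>')" by simp
  define \<mu>' where "\<mu>' = min_dist_decoder N T n X (g, ?y)"
  have "\<mu>' < n \<and> (\<forall>\<mu>''<n. f \<mu>' \<le> f \<mu>'')"
    unfolding \<mu>'_def min_dist_decoder_def prod.case f_def by (rule LeastI, rule ex[unfolded f_def])
  moreover have "\<mu>' \<noteq> \<mu>" using err by (simp add: \<mu>'_def)
  moreover have "f \<mu> = energy {..<T} v" unfolding f_def by (intro energy_cong) auto
  moreover have "f \<mu>' = energy {..<T} (\<lambda>t. miso_signal N X g \<mu> t + v t - miso_signal N X g \<mu>' t)"
    unfolding f_def by (intro energy_cong) auto
  ultimately show ?thesis using \<mu> by (intro bexI[of _ \<mu>']) auto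
qed

lemma prob_trunc_gain_small:
  assumes "0 < p" "0 < \<epsilon>"
  shows "(\<integral>\<^sup>+g. indicator {g. trunc_gain {..<N} g < \<epsilon>} g \<partial>dest_gains N)
    \<le> ennreal (\<epsilon> powr p) * (\<integral>\<^sup>+z. inv_weight p z \<partial>cn 1) ^ N"
proof -
  have "(\<integral>\<^sup>+g. indicator {g. trunc_gain {..<N} g < \<epsilon>} g \<partial>dest_gains N)
      \<le> (\<integral>\<^sup>+g. ennreal (\<epsilon> powr p) * (\<Prod>i<N. inv_weight p (g i)) \<partial>dest_gains N)"
  proof (intro nn_integral_mono)
    fix g :: "nat \<Rightarrow> complex"
    show "indicator {g. trunc_gain {..<N} g < \<epsilon>} g \<le> ennreal (\<epsilon> powr p) * (\<Prod>i<N. inv_weight p (g i))"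
      \<comment> \<open>With the second index set empty, its truncated gain is the empty product
        1.\<close>
      using trunc_gain_indicator_le[of "{..<N}" "{} :: nat set" p \<epsilon> g undefined] assms
      by (simp add: trunc_gain_def indicator_def)
  qed
  also have "\<dots> = ennreal (\<epsilon> powr p) * (\<integral>\<^sup>+g. (\<Prod>i<N. inv_weight p (g i)) \<partial>dest_gains N)"
    by (intro nn_integral_cmult borel_measurable_prod_ennreal) (simp add: measurable_compose[OF measurable_dest_gains_component])
  also have "(\<integral>\<^sup>+g. (\<Prod>i<N. inv_weight p (g i)) \<partial>dest_gains N) = (\<integral>\<^sup>+z. inv_weight p z \<partial>cn 1) ^ N"
    unfolding dest_gains_def by (simp add: nn_integral_prod_inv_weight)
  finally show ?thesis .
qed

text \<open>Each block of \<open>N\<close> symbols uses every antenna once and so collects the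
  product of all gains, which is the only quantity that the outage threshold controls.\<close>

lemma prod_cyclic_le:
  fixes \<gamma> :: "nat \<Rightarrow> real"
  assumes N: "N > 0" and \<kappa>: "\<kappa> > 0" and \<gamma>: "\<And>m. m < N \<Longrightarrow> \<gamma> m > 0" and \<epsilon>: "0 < \<epsilon>" "\<epsilon> \<le> (\<Prod>m<N. \<gamma> m)"
  shows "(\<Prod>t<N * M. min 1 (1 / (\<kappa> * \<gamma> (t mod N)))) \<le> (1 / (\<kappa> ^ N * \<epsilon>)) ^ M"
proof -
  let ?f = "\<lambda>t. min 1 (1 / (\<kappa> * \<gamma> (t mod N)))"
  have f0: "?f t \<ge> 0" for t using \<kappa> \<gamma>[of "t mod N"] N by simp
  have "(\<Prod>t<N * M. ?f t) = (\<Prod>i<M. \<Prod>t\<in>{i * N..<i * N + N}. ?f t)"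
    by (subst prod.nat_group) (simp add: mult.commute)
  also have "\<dots> \<le> (\<Prod>i<M. 1 / (\<kappa> ^ N * \<epsilon>))"
  proof (intro prod_mono conjI prod_nonneg ballI f0)
    fix i
    have "(\<Prod>t\<in>{i * N..<i * N + N}. ?f t) = (\<Prod>m<N. ?f (i * N + m))"
      using prod.shift_bounds_nat_ivl[of ?f 0 "i * N" N] by (simp add: atLeast0LessThan add.commute)
    also have "\<dots> = (\<Prod>m<N. ?f m)" by (intro prod.cong) auto
    also have "\<dots> \<le> (\<Prod>m<N. 1 / (\<kappa> * \<gamma> m))"
      using \<kappa> \<gamma> by (intro prod_mono) (auto simp: less_imp_le)
    also have "\<dots> = 1 / (\<kappa> ^ N * (\<Prod>m<N. \<gamma> m))" by (simp add: prod_dividef prod.distrib)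
    also have "\<dots> \<le> 1 / (\<kappa> ^ N * \<epsilon>)" using \<kappa> \<epsilon> by (intro frac_le) auto
    finally show "(\<Prod>t\<in>{i * N..<i * N + N}. ?f t) \<le> 1 / (\<kappa> ^ N * \<epsilon>)" .
  qed
  finally show ?thesis by simp
qed

text \<open>Outage is split off with the trivial bound 1, since averaging over random codes helps
  only for gains above the threshold.\<close>

lemma min_dist_error_le:
  assumes n: "n > 0" and \<sigma>2: "\<sigma>2 > 0" and N: "N > 0"
  shows "ennreal (miso_error_prob N \<sigma>2 T n (cyclic_code N Y) (min_dist_decoder N T n (cyclic_code N Y)))
    \<le> (\<integral>\<^sup>+g. indicator {g. trunc_gain {..<N} g < \<epsilon>} g + ennreal (1 / real n) * (\<Sum>\<mu><n. \<Sum>\<mu>'\<in>{..<n} - {\<mu>}.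
      indicator {g. \<epsilon> \<le> trunc_gain {..<N} g} g *
      ennreal (exp (- (\<Sum>t<T. (cmod (g (t mod N) * (Y (\<mu>, t) - Y (\<mu>', t))))\<^sup>2) / (4 * \<sigma>2)))) \<partial>dest_gains N)"
  unfolding miso_error_prob_eq(1)[OF n \<sigma>2 measurable_min_dist_decoder]
proof (intro nn_integral_mono)
  fix g
  let ?V = "PiM {..<T} (\<lambda>_. cn \<sigma>2)" and ?X = "cyclic_code N Y"
  interpret V: prob_space ?V by (rule prob_space_PiM_cn[OF \<sigma>2])
  define err where "err \<mu> = (\<integral>\<^sup>+v. indicator {v. min_dist_decoder N T n ?X (g, \<lambda>t\<in>{..<T}. miso_signal N ?X g \<mu> t + v t) \<noteq> \<mu>} v \<partial>?V)" for \<mu>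
  define e where "e \<mu> \<mu>' = ennreal (exp (- (\<Sum>t<T. (cmod (g (t mod N) * (Y (\<mu>, t) - Y (\<mu>', t))))\<^sup>2) / (4 * \<sigma>2)))" for \<mu> \<mu>'
  show "ennreal (1 / real n) * (\<Sum>\<mu><n. err \<mu>) \<le> indicator {g. trunc_gain {..<N} g < \<epsilon>} g
      + ennreal (1 / real n) * (\<Sum>\<mu><n. \<Sum>\<mu>'\<in>{..<n} - {\<mu>}. indicator {g. \<epsilon> \<le> trunc_gain {..<N} g} g * e \<mu> \<mu>')"
  proof (cases "trunc_gain {..<N} g < \<epsilon>")
    case True
    have "err \<mu> \<le> 1" for \<mu>
    proof -
      have "err \<mu> \<le> (\<integral>\<^sup>+v. 1 \<partial>?V)" unfolding err_def by (intro nn_integral_mono) (simp add: indicator_def)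
      thus ?thesis using V.emeasure_space_1 by simp
    qed
    hence "ennreal (1 / real n) * (\<Sum>\<mu><n. err \<mu>) \<le> ennreal (1 / real n) * (\<Sum>\<mu><n. 1)"
      by (intro mult_left_mono sum_mono) auto
    also have "\<dots> = 1" using n by (simp add: ennreal_of_nat_eq_real_of_nat ennreal_mult'[symmetric])
    finally show ?thesis using True by (simp add: add_increasing2)
  next
    case False
    have "err \<mu> \<le> (\<Sum>\<mu>'\<in>{..<n} - {\<mu>}. e \<mu> \<mu>')" if \<mu>: "\<mu> < n" for \<mu>
    proof -
      define ev where "ev \<mu>' v \<longleftrightarrow> energy {..<T} (\<lambda>t. miso_signal N ?X g \<mu> t + v t - miso_signal N ?X g \<mu>' t) \<le> energy {..<T} v" for \<mu>' v
      have m: "(\<lambda>v. indicator {v. ev \<mu>' v} v :: ennreal) \<in> borel_measurable ?V" for \<mu>'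
      proof -
        have vm: "(\<lambda>v. v t) \<in> borel_measurable ?V" if "t < T" for t
          using measurable_component_singleton[of t "{..<T}" "\<lambda>_. cn \<sigma>2"] that by (simp add: measurable_cong_sets[OF refl sets_cn])
        have [measurable]: "Measurable.pred ?V (ev \<mu>')"
          unfolding ev_def pred_def
          by (intro borel_measurable_le measurable_energy borel_measurable_diff borel_measurable_add borel_measurable_const vm) auto
        show ?thesis unfolding indicator_def mem_Collect_eq by measurable
      qed
      have "err \<mu> \<le> (\<integral>\<^sup>+v. (\<Sum>\<mu>'\<in>{..<n} - {\<mu>}. indicator {v. ev \<mu>' v} v) \<partial>?V)"
        unfolding err_def
      proof (intro nn_integral_mono)
        fix v
        show "indicator {v. min_dist_decoder N T n ?X (g, \<lambda>t\<in>{..<T}. miso_signal N ?X g \<mu> t + v t) \<noteq> \<mu>} v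
            \<le> (\<Sum>\<mu>'\<in>{..<n} - {\<mu>}. indicator {v. ev \<mu>' v} v :: ennreal)"
        proof (cases "min_dist_decoder N T n ?X (g, \<lambda>t\<in>{..<T}. miso_signal N ?X g \<mu> t + v t) \<noteq> \<mu>")
          case True
          from min_dist_decoder_error[OF n this \<mu>] obtain \<mu>' where \<mu>': "\<mu>' \<in> {..<n} - {\<mu>}" "ev \<mu>' v"
            by (auto simp: ev_def)
          have "indicator {v. ev \<mu>' v} v \<le> (\<Sum>\<mu>'\<in>{..<n} - {\<mu>}. indicator {v. ev \<mu>' v} v :: ennreal)"
            using \<mu>'(1) by (intro member_le_sum) auto
          thus ?thesis using \<mu>'(2) True by simp
        qed simp
      qed
      also have "\<dots> = (\<Sum>\<mu>'\<in>{..<n} - {\<mu>}. \<integral>\<^sup>+v. indicator {v. ev \<mu>' v} v \<partial>?V)"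
        by (intro nn_integral_sum m)
      also have "\<dots> \<le> (\<Sum>\<mu>'\<in>{..<n} - {\<mu>}. e \<mu> \<mu>')"
      proof (rule sum_mono)
        fix \<mu>'
        have "energy {..<T} (\<lambda>t. miso_signal N ?X g \<mu> t - miso_signal N ?X g \<mu>' t)
            = (\<Sum>t<T. (cmod (g (t mod N) * (Y (\<mu>, t) - Y (\<mu>', t))))\<^sup>2)"
          by (simp add: energy_def miso_signal_cyclic[OF N] right_diff_distrib)
        thus "(\<integral>\<^sup>+v. indicator {v. ev \<mu>' v} v \<partial>?V) \<le> e \<mu> \<mu>'"
          using miso_pairwise_error[OF \<sigma>2, of T "miso_signal N ?X g \<mu>" "miso_signal N ?X g \<mu>'"]
          by (simp add: ev_def e_def)
      qed
      finally show ?thesis .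
    qed
    hence "ennreal (1 / real n) * (\<Sum>\<mu><n. err \<mu>) \<le> ennreal (1 / real n) * (\<Sum>\<mu><n. \<Sum>\<mu>'\<in>{..<n} - {\<mu>}. e \<mu> \<mu>')"
      by (intro mult_left_mono sum_mono) auto
    thus ?thesis using False by simp
  qed
qed

text \<open>One code has to meet the power constraint and the error bound at once. A single random
  quantity with mean below 1 controls both.\<close>

lemma miso_code_exists:
  assumes N: "N > 0" and n: "n > 0" and M: "M > 0" and E: "E > 0" and \<sigma>2: "\<sigma>2 > 0" and \<epsilon>: "\<epsilon> > 0" and p: "0 < p" "p < 1"
    and \<kappa>: "\<kappa> = E / (64 * \<sigma>2)"
    and B: "B = \<epsilon> powr p * enn2real (\<integral>\<^sup>+z. inv_weight p z \<partial>cn 1) ^ N + real n * (1 / (\<kappa> ^ N * \<epsilon>)) ^ M"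
  shows "\<exists>X D. miso_code N E (N * M) n X D \<and> miso_error_prob N \<sigma>2 (N * M) n X D \<le> 4 * B"
proof -
  define T where "T = N * M"
  \<comment> \<open>With variance E / 16 the bound \<open>4 * s\<close> for the second moment is a
    quarter of the allowed energy, and \<open>\<kappa>\<close> is s / (4 * \<sigma>2).\<close>
  define s where "s = E / 16"
  define R where "R = (1 / (\<kappa> ^ N * \<epsilon>)) ^ M"
  have s: "s > 0" using E by (simp add: s_def)
  have T: "T > 0" using N M by (simp add: T_def)
  have \<kappa>0: "\<kappa> > 0" using E \<sigma>2 by (simp add: \<kappa>)
  have R: "R > 0" using \<kappa>0 \<epsilon> by (simp add: R_def)
  let ?I = "{..<n} \<times> {..<T}"
  let ?C = "PiM ?I (\<lambda>_. cn s)" and ?G = "dest_gains N"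
  interpret C: prob_space ?C by (rule prob_space_PiM_cn[OF s])
  interpret G: prob_space ?G by (rule prob_space_dest_gains)
  interpret CG: pair_sigma_finite ?C ?G
    by (intro pair_sigma_finite.intro C.sigma_finite_measure_axioms G.sigma_finite_measure_axioms)
  have Ym [measurable]: "(\<lambda>Y. Y (\<mu>, t)) \<in> borel_measurable ?C" if "\<mu> < n" "t < T" for \<mu> t
    using measurable_component_singleton[of "(\<mu>, t)" ?I "\<lambda>_. cn s"] that by (simp add: measurable_cong_sets[OF refl sets_cn])
  have gm [measurable]: "(\<lambda>g. g (t mod N)) \<in> borel_measurable ?G" for t
    using N by (intro measurable_dest_gains_component) simp
  have tg [measurable]: "trunc_gain {..<N} \<in> borel_measurable ?G"
    using measurable_trunc_gain[of "{..<N}"] by (simp add: dest_gains_def measurable_cong_sets[OF sets_PiM_cn refl])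
  define e where "e \<mu> \<mu>' Y g = indicator {g. \<epsilon> \<le> trunc_gain {..<N} g} g *
      ennreal (exp (- (\<Sum>t<T. (cmod (g (t mod N) * (Y (\<mu>, t) - Y (\<mu>', t))))\<^sup>2) / (4 * \<sigma>2)))" for \<mu> \<mu>' :: nat and Y g
  have em: "(\<lambda>z. e \<mu> \<mu>' (fst z) (snd z)) \<in> borel_measurable (?C \<Otimes>\<^sub>M ?G)" if [simp]: "\<mu> < n" "\<mu>' < n" for \<mu> \<mu>'
    unfolding e_def indicator_def mem_Collect_eq by measurable
  have eG: "(\<lambda>Y. \<integral>\<^sup>+g. e \<mu> \<mu>' Y g \<partial>?G) \<in> borel_measurable ?C" if "\<mu> < n" "\<mu>' < n" for \<mu> \<mu>'
    using G.borel_measurable_nn_integral[of "e \<mu> \<mu>'" ?C] em[OF that] by (simp add: case_prod_unfold)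
  have eg: "e \<mu> \<mu>' Y \<in> borel_measurable ?G" for \<mu> \<mu>' Y
    unfolding e_def[abs_def] indicator_def mem_Collect_eq by measurable
  define P0 where "P0 = (\<integral>\<^sup>+g. indicator {g. trunc_gain {..<N} g < \<epsilon>} g \<partial>?G)"
  define U where "U Y = P0 + ennreal (1 / real n) * (\<Sum>\<mu><n. \<Sum>\<mu>'\<in>{..<n} - {\<mu>}. \<integral>\<^sup>+g. e \<mu> \<mu>' Y g \<partial>?G)" for Y
  have err: "ennreal (miso_error_prob N \<sigma>2 T n (cyclic_code N Y) (min_dist_decoder N T n (cyclic_code N Y))) \<le> U Y" for Y
  proof -
    have i0: "(\<lambda>g. indicator {g. trunc_gain {..<N} g < \<epsilon>} g :: ennreal) \<in> borel_measurable ?G"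
      unfolding indicator_def mem_Collect_eq by measurable
    have "ennreal (miso_error_prob N \<sigma>2 T n (cyclic_code N Y) (min_dist_decoder N T n (cyclic_code N Y)))
        \<le> (\<integral>\<^sup>+g. indicator {g. trunc_gain {..<N} g < \<epsilon>} g + ennreal (1 / real n) * (\<Sum>\<mu><n. \<Sum>\<mu>'\<in>{..<n} - {\<mu>}. e \<mu> \<mu>' Y g) \<partial>?G)"
      unfolding e_def by (rule min_dist_error_le[OF n \<sigma>2 N])
    also have "\<dots> = P0 + (\<integral>\<^sup>+g. ennreal (1 / real n) * (\<Sum>\<mu><n. \<Sum>\<mu>'\<in>{..<n} - {\<mu>}. e \<mu> \<mu>' Y g) \<partial>?G)"
      unfolding P0_def by (intro nn_integral_add i0 borel_measurable_times_ennreal borel_measurable_sum eg) auto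
    also have "(\<integral>\<^sup>+g. ennreal (1 / real n) * (\<Sum>\<mu><n. \<Sum>\<mu>'\<in>{..<n} - {\<mu>}. e \<mu> \<mu>' Y g) \<partial>?G)
        = ennreal (1 / real n) * (\<Sum>\<mu><n. \<Sum>\<mu>'\<in>{..<n} - {\<mu>}. \<integral>\<^sup>+g. e \<mu> \<mu>' Y g \<partial>?G)"
      using eg by (simp add: nn_integral_cmult nn_integral_sum borel_measurable_sum)
    finally show ?thesis by (simp add: U_def)
  qed
  have avg: "(\<integral>\<^sup>+Y. (\<integral>\<^sup>+g. e \<mu> \<mu>' Y g \<partial>?G) \<partial>?C) \<le> ennreal R" if \<mu>: "\<mu> < n" "\<mu>' < n" "\<mu>' \<noteq> \<mu>" for \<mu> \<mu>'
  proof -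
    have "(\<integral>\<^sup>+Y. (\<integral>\<^sup>+g. e \<mu> \<mu>' Y g \<partial>?G) \<partial>?C) = (\<integral>\<^sup>+g. (\<integral>\<^sup>+Y. e \<mu> \<mu>' Y g \<partial>?C) \<partial>?G)"
      using em[OF \<mu>(1,2)] by (intro CG.Fubini'[symmetric]) (simp add: case_prod_unfold)
    also have "\<dots> \<le> (\<integral>\<^sup>+g. ennreal R \<partial>?G)"
    proof (intro nn_integral_mono)
      fix g
      show "(\<integral>\<^sup>+Y. e \<mu> \<mu>' Y g \<partial>?C) \<le> ennreal R"
      proof (cases "\<epsilon> \<le> trunc_gain {..<N} g")
        case True
        have gne: "g m \<noteq> 0" if "m < N" for m
        proof
          assume "g m = 0"
          hence "trunc_gain {..<N} g = 0" using that by (auto simp: trunc_gain_def intro!: bexI[of _ m])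
          thus False using True \<epsilon> by simp
        qed
        \<comment> \<open>Only the codeword of \<open>\<mu>'\<close> is integrated. That of
          \<open>\<mu>\<close> is an offset, so any injective order of integration will do.\<close>
        let ?J = "(\<lambda>t. (\<mu>', t)) ` {..<T}"
        define c where "c i = (cmod (g (snd i mod N)))\<^sup>2 / (4 * \<sigma>2)" for i :: "nat \<times> nat"
        have c: "c i > 0" for i using gne[of "snd i mod N"] N \<sigma>2 by (simp add: c_def)
        have inj: "inj_on (\<lambda>t. (\<mu>', t)) {..<T}" by (auto simp: inj_on_def)
        have "(\<integral>\<^sup>+Y. e \<mu> \<mu>' Y g \<partial>?C) = (\<integral>\<^sup>+Y. (\<Prod>i\<in>?J. ennreal (exp (- c i * (cmod (1 * Y i + - Y (\<mu>, snd i)))\<^sup>2))) \<partial>?C)"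
        proof (intro nn_integral_cong)
          fix Y :: "nat \<times> nat \<Rightarrow> complex"
          have "(\<Prod>i\<in>?J. ennreal (exp (- c i * (cmod (1 * Y i + - Y (\<mu>, snd i)))\<^sup>2)))
              = (\<Prod>t<T. ennreal (exp (- ((cmod (g (t mod N) * (Y (\<mu>, t) - Y (\<mu>', t))))\<^sup>2) / (4 * \<sigma>2))))"
            by (simp add: prod.reindex[OF inj] c_def norm_mult power_mult_distrib norm_minus_commute)
          also have "\<dots> = e \<mu> \<mu>' Y g"
            using True by (simp add: e_def prod_ennreal sum_divide_distrib sum_negf flip: exp_sum)
          finally show "e \<mu> \<mu>' Y g = (\<Prod>i\<in>?J. ennreal (exp (- c i * (cmod (1 * Y i + - Y (\<mu>, snd i)))\<^sup>2)))" by simp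
        qed
        also have "\<dots> \<le> (\<Prod>i\<in>?J. ennreal (min 1 (1 / (c i * (cmod 1)\<^sup>2 * s))))"
        proof (rule nn_integral_triangular_le[where time=snd, OF _ _ s])
          show "(\<lambda>Y. - Y (\<mu>, snd i) :: complex) \<in> borel_measurable (PiM ?I (\<lambda>_. borel))" if "i \<in> ?J" for i
          proof -
            have "(\<mu>, snd i) \<in> ?I" using \<mu> that by auto
            hence "(\<lambda>Y. Y (\<mu>, snd i)) \<in> borel_measurable (PiM ?I (\<lambda>_. borel :: complex measure))"
              by (rule measurable_component_singleton)
            thus ?thesis by simp
          qed
          show "- (x(j := y)) (\<mu>, snd i) = - x (\<mu>, snd i)" if "i \<in> ?J" "j \<in> ?J"
            for i j and x :: "nat \<times> nat \<Rightarrow> complex" and y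
            using that \<mu>(3) by auto
        qed (use \<mu> c in \<open>auto simp: inj_on_def\<close>)
        also have "\<dots> = ennreal (\<Prod>t<T. min 1 (1 / ((cmod (g (t mod N)))\<^sup>2 / (4 * \<sigma>2) * s)))"
        proof -
          have "(\<Prod>i\<in>?J. ennreal (min 1 (1 / (c i * (cmod 1)\<^sup>2 * s))))
              = (\<Prod>t<T. ennreal (min 1 (1 / ((cmod (g (t mod N)))\<^sup>2 / (4 * \<sigma>2) * s))))"
            by (simp add: prod.reindex[OF inj] c_def)
          also have "\<dots> = ennreal (\<Prod>t<T. min 1 (1 / ((cmod (g (t mod N)))\<^sup>2 / (4 * \<sigma>2) * s)))"
            using s \<sigma>2 by (intro prod_ennreal) auto
          finally show ?thesis .
        qed
        also have "\<dots> \<le> ennreal R"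
        proof (rule ennreal_leI)
          define \<gamma> where "\<gamma> m = min 1 ((cmod (g m))\<^sup>2)" for m
          have \<gamma>: "\<gamma> m > 0" if "m < N" for m using gne[OF that] by (simp add: \<gamma>_def)
          have "(\<Prod>t<T. min 1 (1 / ((cmod (g (t mod N)))\<^sup>2 / (4 * \<sigma>2) * s))) \<le> (\<Prod>t<T. min 1 (1 / (\<kappa> * \<gamma> (t mod N))))"
          proof (intro prod_mono conjI)
            fix t
            have "\<gamma> (t mod N) > 0" using \<gamma> N by simp
            moreover have "\<kappa> * \<gamma> (t mod N) \<le> (cmod (g (t mod N)))\<^sup>2 / (4 * \<sigma>2) * s"
            proof -
              have "(cmod (g (t mod N)))\<^sup>2 / (4 * \<sigma>2) * s = \<kappa> * (cmod (g (t mod N)))\<^sup>2"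
                by (simp add: \<kappa> s_def)
              thus ?thesis using \<kappa>0 by (simp add: \<gamma>_def)
            qed
            ultimately have "1 / ((cmod (g (t mod N)))\<^sup>2 / (4 * \<sigma>2) * s) \<le> 1 / (\<kappa> * \<gamma> (t mod N))"
              using \<kappa>0 by (intro frac_le) auto
            thus "min 1 (1 / ((cmod (g (t mod N)))\<^sup>2 / (4 * \<sigma>2) * s)) \<le> min 1 (1 / (\<kappa> * \<gamma> (t mod N)))"
              by (intro min.mono) auto
            show "0 \<le> min 1 (1 / ((cmod (g (t mod N)))\<^sup>2 / (4 * \<sigma>2) * s))" using s \<sigma>2 by simp
          qed
          also have "\<dots> \<le> R"
            unfolding R_def T_def using True by (intro prod_cyclic_le N \<kappa>0 \<gamma> \<epsilon>) (auto simp: trunc_gain_def \<gamma>_def)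
          finally show "(\<Prod>t<T. min 1 (1 / ((cmod (g (t mod N)))\<^sup>2 / (4 * \<sigma>2) * s))) \<le> R" .
        qed
        finally show ?thesis .
      qed (simp add: e_def)
    qed
    also have "\<dots> = ennreal R" using G.emeasure_space_1 by simp
    finally show ?thesis .
  qed
  define m where "m = enn2real (\<integral>\<^sup>+z. inv_weight p z \<partial>cn 1)"
  have m: "ennreal m = (\<integral>\<^sup>+z. inv_weight p z \<partial>cn 1)"
    using inv_weight_moment_finite[OF p] by (simp add: m_def)
  have m0: "m \<ge> 0" by (simp add: m_def)
  have BR: "B = \<epsilon> powr p * m ^ N + real n * R" by (simp add: B m_def R_def)
  have B0: "B > 0" unfolding BR using m0 n R by (intro add_nonneg_pos) auto
  have P0: "P0 \<le> ennreal (\<epsilon> powr p * m ^ N)"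
    using prob_trunc_gain_small[OF p(1) \<epsilon>, of N] m0 by (simp add: P0_def m[symmetric] ennreal_mult ennreal_power)
  have UC: "(\<integral>\<^sup>+Y. U Y \<partial>?C) \<le> ennreal B"
  proof -
    have Um: "(\<lambda>Y. \<Sum>\<mu>'\<in>{..<n} - {\<mu>}. \<integral>\<^sup>+g. e \<mu> \<mu>' Y g \<partial>?G) \<in> borel_measurable ?C" if "\<mu> < n" for \<mu>
      using that by (intro borel_measurable_sum eG) auto
    have "(\<integral>\<^sup>+Y. U Y \<partial>?C) = P0 + ennreal (1 / real n) * (\<Sum>\<mu><n. \<integral>\<^sup>+Y. (\<Sum>\<mu>'\<in>{..<n} - {\<mu>}. \<integral>\<^sup>+g. e \<mu> \<mu>' Y g \<partial>?G) \<partial>?C)"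
    proof -
      have sw: "(\<integral>\<^sup>+Y. (\<Sum>\<mu><n. \<Sum>\<mu>'\<in>{..<n} - {\<mu>}. \<integral>\<^sup>+g. e \<mu> \<mu>' Y g \<partial>?G) \<partial>?C)
          = (\<Sum>\<mu><n. \<integral>\<^sup>+Y. (\<Sum>\<mu>'\<in>{..<n} - {\<mu>}. \<integral>\<^sup>+g. e \<mu> \<mu>' Y g \<partial>?G) \<partial>?C)"
        using Um by (intro nn_integral_sum) auto
      show ?thesis unfolding U_def using Um C.emeasure_space_1
        by (subst nn_integral_add) (auto simp: nn_integral_cmult sw borel_measurable_sum)
    qed
    also have "(\<Sum>\<mu><n. \<integral>\<^sup>+Y. (\<Sum>\<mu>'\<in>{..<n} - {\<mu>}. \<integral>\<^sup>+g. e \<mu> \<mu>' Y g \<partial>?G) \<partial>?C)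
        = (\<Sum>\<mu><n. \<Sum>\<mu>'\<in>{..<n} - {\<mu>}. \<integral>\<^sup>+Y. (\<integral>\<^sup>+g. e \<mu> \<mu>' Y g \<partial>?G) \<partial>?C)"
      using eG by (intro sum.cong refl nn_integral_sum) auto
    also have "P0 + ennreal (1 / real n) * \<dots> \<le> ennreal (\<epsilon> powr p * m ^ N) + ennreal (1 / real n) * (\<Sum>\<mu><n. \<Sum>\<mu>'\<in>{..<n}. ennreal R)"
    proof (intro add_mono P0 mult_left_mono sum_mono)
      fix \<mu> assume "\<mu> \<in> {..<n}"
      hence "(\<Sum>\<mu>'\<in>{..<n} - {\<mu>}. \<integral>\<^sup>+Y. (\<integral>\<^sup>+g. e \<mu> \<mu>' Y g \<partial>?G) \<partial>?C) \<le> (\<Sum>\<mu>'\<in>{..<n} - {\<mu>}. ennreal R)"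
        by (intro sum_mono avg) auto
      also have "\<dots> \<le> (\<Sum>\<mu>'\<in>{..<n}. ennreal R)" by (intro sum_mono2) auto
      finally show "(\<Sum>\<mu>'\<in>{..<n} - {\<mu>}. \<integral>\<^sup>+Y. (\<integral>\<^sup>+g. e \<mu> \<mu>' Y g \<partial>?G) \<partial>?C) \<le> (\<Sum>\<mu>'\<in>{..<n}. ennreal R)" .
    qed auto
    also have "(\<Sum>\<mu><n. \<Sum>\<mu>'\<in>{..<n}. ennreal R) = ennreal (real n * (real n * R))"
      using R by (simp add: ennreal_of_nat_eq_real_of_nat ennreal_mult'[symmetric])
    also have "ennreal (1 / real n) * ennreal (real n * (real n * R)) = ennreal (real n * R)"
      using n R by (subst ennreal_mult[symmetric]) auto
    also have "ennreal (\<epsilon> powr p * m ^ N) + ennreal (real n * R) = ennreal B"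
      using m0 R by (simp add: BR)
    finally show ?thesis .
  qed
  \<comment> \<open>Each summand has mean at most 1 / 4. A \<open>Y\<close> with
    \<open>\<Phi> Y < 1\<close> has error at most \<open>4 * B\<close> and average energy at most
    \<open>E\<close>.\<close>
  define \<Phi> where "\<Phi> Y = ennreal (1 / (4 * B)) * U Y + ennreal (1 / (real n * real T * E)) * (\<Sum>i\<in>?I. ennreal ((cmod (Y i))\<^sup>2))" for Y
  have Ui: "U \<in> borel_measurable ?C"
    unfolding U_def[abs_def] using eG
    by (intro borel_measurable_add borel_measurable_const borel_measurable_times_ennreal borel_measurable_sum) auto
  have Yi: "(\<lambda>Y. ennreal ((cmod (Y i))\<^sup>2)) \<in> borel_measurable ?C" if "i \<in> ?I" for i
  proof -
    have "(\<lambda>Y. Y i) \<in> borel_measurable ?C" using Ym[of "fst i" "snd i"] that by auto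
    thus ?thesis by measurable
  qed
  have "(\<integral>\<^sup>+Y. \<Phi> Y \<partial>?C) = ennreal (1 / (4 * B)) * (\<integral>\<^sup>+Y. U Y \<partial>?C)
      + ennreal (1 / (real n * real T * E)) * (\<Sum>i\<in>?I. \<integral>\<^sup>+Y. ennreal ((cmod (Y i))\<^sup>2) \<partial>?C)"
  proof -
    have "(\<integral>\<^sup>+Y. (\<Sum>i\<in>?I. ennreal ((cmod (Y i))\<^sup>2)) \<partial>?C) = (\<Sum>i\<in>?I. \<integral>\<^sup>+Y. ennreal ((cmod (Y i))\<^sup>2) \<partial>?C)"
      by (intro nn_integral_sum Yi)
    moreover have S: "(\<lambda>Y. \<Sum>i\<in>?I. ennreal ((cmod (Y i))\<^sup>2)) \<in> borel_measurable ?C"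
      by (intro borel_measurable_sum Yi)
    ultimately show ?thesis unfolding \<Phi>_def using Ui
      by (subst nn_integral_add) (simp_all only: nn_integral_cmult borel_measurable_times_ennreal borel_measurable_const)
  qed
  also have "\<dots> \<le> ennreal (1 / (4 * B)) * ennreal B + ennreal (1 / (real n * real T * E)) * (\<Sum>i\<in>?I. ennreal (4 * s))"
  proof (intro add_mono mult_left_mono UC sum_mono)
    fix i assume "i \<in> ?I"
    hence "(\<integral>\<^sup>+Y. ennreal ((cmod (Y i))\<^sup>2) \<partial>?C) = (\<integral>\<^sup>+z. ennreal ((cmod z)\<^sup>2) \<partial>cn s)"
      using s by (intro nn_integral_PiM_cn_component[where f="\<lambda>z. ennreal ((cmod z)\<^sup>2)"]) auto
    also have "\<dots> \<le> ennreal (4 * s)" by (rule nn_integral_cn_cmod_square_le[OF s])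
    finally show "(\<integral>\<^sup>+Y. ennreal ((cmod (Y i))\<^sup>2) \<partial>?C) \<le> ennreal (4 * s)" .
  qed auto
  also have "(\<Sum>i\<in>?I. ennreal (4 * s)) = ennreal (real (n * T) * (4 * s))"
    using s by (subst sum_ennreal) auto
  also have "ennreal (1 / (4 * B)) * ennreal B = ennreal (1 / 4)"
    using B0 by (subst ennreal_mult[symmetric]) auto
  also have "ennreal (1 / (real n * real T * E)) * ennreal (real (n * T) * (4 * s)) = ennreal (1 / 4)"
    using n T E s by (subst ennreal_mult[symmetric]) (auto simp: s_def)
  also have "ennreal (1 / 4) + ennreal (1 / 4) = ennreal (1 / 2)" by (subst ennreal_plus[symmetric]) auto
  finally have "(\<integral>\<^sup>+Y. \<Phi> Y \<partial>?C) \<le> ennreal (1 / 2)" .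
  moreover have "ennreal (1 / 2) < 1" by (subst ennreal_1[symmetric], subst ennreal_less_iff) auto
  ultimately have "(\<integral>\<^sup>+Y. \<Phi> Y \<partial>?C) < 1" by (rule le_less_trans)
  hence "\<exists>Y. \<Phi> Y < 1"
  proof (rule contrapos_pp)
    assume "\<nexists>Y. \<Phi> Y < 1"
    hence "(\<integral>\<^sup>+Y. 1 \<partial>?C) \<le> (\<integral>\<^sup>+Y. \<Phi> Y \<partial>?C)" by (intro nn_integral_mono) (simp add: not_less)
    thus "\<not> (\<integral>\<^sup>+Y. \<Phi> Y \<partial>?C) < 1" using C.emeasure_space_1 by (simp add: not_less)
  qed
  then obtain Y where Y: "\<Phi> Y < 1" by blast
  let ?X = "cyclic_code N Y" and ?D = "min_dist_decoder N T n (cyclic_code N Y)"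
  have "ennreal (miso_error_prob N \<sigma>2 T n ?X ?D) \<le> ennreal (4 * B)"
  proof -
    have "ennreal (1 / (4 * B)) * U Y \<le> \<Phi> Y" unfolding \<Phi>_def by simp
    hence "ennreal (1 / (4 * B)) * U Y \<le> 1" using Y by (meson le_less_trans less_imp_le)
    hence "ennreal (4 * B) * (ennreal (1 / (4 * B)) * U Y) \<le> ennreal (4 * B) * 1" by (intro mult_left_mono) auto
    moreover have "ennreal (4 * B) * ennreal (1 / (4 * B)) = 1" using B0 by (subst ennreal_mult[symmetric]) auto
    ultimately have "U Y \<le> ennreal (4 * B)" by (simp add: mult.assoc[symmetric])
    thus ?thesis using err[of Y] by (rule order_trans[rotated])
  qed
  hence 1: "miso_error_prob N \<sigma>2 T n ?X ?D \<le> 4 * B" using B0 by (subst (asm) ennreal_le_iff) auto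
  have "ennreal (energy ?I Y / (real n * real T * E)) \<le> \<Phi> Y"
  proof -
    have "ennreal (energy ?I Y / (real n * real T * E)) = ennreal (1 / (real n * real T * E)) * ennreal (energy ?I Y)"
      using E by (subst ennreal_mult[symmetric]) auto
    also have "ennreal (energy ?I Y) = (\<Sum>i\<in>?I. ennreal ((cmod (Y i))\<^sup>2))"
      unfolding energy_def by (rule sum_ennreal[symmetric]) simp
    finally show ?thesis by (simp add: \<Phi>_def)
  qed
  hence "ennreal (energy ?I Y / (real n * real T * E)) < 1" using Y by (rule le_less_trans)
  hence "energy ?I Y / (real n * real T * E) < 1" by (simp only: ennreal_less_one_iff)
  hence en: "energy ?I Y / (real n * real T) \<le> E" using n T E by (simp add: field_simps)
  have "miso_code N E T n ?X ?D"
    unfolding miso_code_def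
  proof (intro conjI allI impI T n measurable_min_dist_decoder)
    fix i assume "i < N"
    have "(\<Sum>\<mu><n. \<Sum>t<T. (cmod (?X \<mu> t i))\<^sup>2) \<le> (\<Sum>\<mu><n. \<Sum>t<T. (cmod (Y (\<mu>, t)))\<^sup>2)"
      by (intro sum_mono) (simp add: cyclic_code_def)
    also have "\<dots> = energy ?I Y" by (simp add: energy_def sum.cartesian_product case_prod_unfold)
    finally have "(\<Sum>\<mu><n. \<Sum>t<T. (cmod (?X \<mu> t i))\<^sup>2) / (real n * real T) \<le> energy ?I Y / (real n * real T)"
      by (intro divide_right_mono) auto
    thus "(\<Sum>\<mu><n. \<Sum>t<T. (cmod (?X \<mu> t i))\<^sup>2) / (real n * real T) \<le> E" using en by simp
  qed
  with 1 show ?thesis unfolding T_def by blast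
qed

section \<open>Asymptotics\<close>

lemma neg_ln_div_le:
  fixes \<rho> :: real
  assumes "c > 0" "\<rho> > 1" "c * \<rho> powr (- x) \<le> P"
  shows "- ln P / ln \<rho> \<le> x - ln c / ln \<rho>"
proof -
  have "ln (c * \<rho> powr (- x)) \<le> ln P" using assms by (intro ln_mono) auto
  also have "ln (c * \<rho> powr (- x)) = ln c - x * ln \<rho>" using assms by (simp add: ln_mult ln_powr)
  finally have "- ln P \<le> x * ln \<rho> - ln c" by simp
  hence "- ln P / ln \<rho> \<le> (x * ln \<rho> - ln c) / ln \<rho>" using assms by (intro divide_right_mono) auto
  thus ?thesis using assms by (simp add: diff_divide_distrib)
qed

lemma neg_ln_div_ge:
  fixes \<rho> :: real
  assumes "C > 0" "\<rho> > 1" "P > 0" "P \<le> C * \<rho> powr (- x)"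
  shows "x - ln C / ln \<rho> \<le> - ln P / ln \<rho>"
proof -
  have "ln P \<le> ln (C * \<rho> powr (- x))" using assms by (intro ln_mono) auto
  also have "ln (C * \<rho> powr (- x)) = ln C - x * ln \<rho>" using assms by (simp add: ln_mult ln_powr)
  finally have "x * ln \<rho> - ln C \<le> - ln P" by simp
  hence "(x * ln \<rho> - ln C) / ln \<rho> \<le> - ln P / ln \<rho>" using assms by (intro divide_right_mono) auto
  thus ?thesis using assms by (simp add: diff_divide_distrib)
qed

lemma ln_const_over_ln_tendsto_0:
  assumes "filterlim \<rho> at_top F"
  shows "((\<lambda>x. ln c / ln (\<rho> x :: real)) \<longlongrightarrow> 0) F"
proof -
  have "((\<lambda>y::real. ln c / ln y) \<longlongrightarrow> 0) at_top" by real_asymp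
  thus ?thesis using assms by (rule filterlim_compose)
qed

text \<open>Polynomial bounds with arbitrarily small loss pin down the exponent, as constants vanish
  on division by \<open>ln \<rho>\<close>. The lower bound also keeps \<open>P\<close> positive,
  away from the infinite value of \<open>error_exponent\<close>. The filter is general so as to
  cover both the joint limit with \<open>L\<close> and the limit in \<open>\<rho>\<close>
  alone.\<close>

lemma error_exponent_tendsto:
  assumes lim: "filterlim \<rho> at_top F"
    and lower: "\<And>\<epsilon>. \<epsilon> > 0 \<Longrightarrow> \<exists>c>0. \<forall>\<^sub>F x in F. c * \<rho> x powr (- (d + \<epsilon>)) \<le> P x"
    and upper: "\<And>\<epsilon>. \<epsilon> > 0 \<Longrightarrow> \<exists>C>0. \<forall>\<^sub>F x in F. P x \<le> C * \<rho> x powr (- (d - \<epsilon>))"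
  shows "((\<lambda>x. error_exponent (\<rho> x) (P x)) \<longlongrightarrow> ereal d) F"
proof -
  have \<rho>1: "\<forall>\<^sub>F x in F. \<rho> x > 1" using lim by (simp add: filterlim_at_top_dense)
  obtain c1 where c1: "c1 > 0" "\<forall>\<^sub>F x in F. c1 * \<rho> x powr (- (d + 1)) \<le> P x" using lower[of 1] by auto
  have pos: "\<forall>\<^sub>F x in F. P x > 0"
    using c1(2) \<rho>1 by eventually_elim (use c1(1) in \<open>auto intro: less_le_trans[rotated]\<close>)
  have "((\<lambda>x. - ln (P x) / ln (\<rho> x)) \<longlongrightarrow> d) F"
  proof (rule tendstoI)
    fix e :: real assume e: "e > 0"
    obtain c where c: "c > 0" "\<forall>\<^sub>F x in F. c * \<rho> x powr (- (d + e / 2)) \<le> P x" using lower[of "e / 2"] e by auto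
    obtain C where C: "C > 0" "\<forall>\<^sub>F x in F. P x \<le> C * \<rho> x powr (- (d - e / 2))" using upper[of "e / 2"] e by auto
    have "\<forall>\<^sub>F x in F. \<bar>ln c / ln (\<rho> x)\<bar> < e / 2" "\<forall>\<^sub>F x in F. \<bar>ln C / ln (\<rho> x)\<bar> < e / 2"
      using tendstoD[OF ln_const_over_ln_tendsto_0[OF lim], of "e / 2"] e by (auto simp: dist_real_def)
    with pos \<rho>1 c(2) C(2) show "\<forall>\<^sub>F x in F. dist (- ln (P x) / ln (\<rho> x)) d < e"
    proof eventually_elim
      case (elim x)
      have "- ln (P x) / ln (\<rho> x) \<le> d + e / 2 - ln c / ln (\<rho> x)"
        by (rule neg_ln_div_le[OF c(1)]) (use elim in auto)
      moreover have "d - e / 2 - ln C / ln (\<rho> x) \<le> - ln (P x) / ln (\<rho> x)"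
        by (rule neg_ln_div_ge[OF C(1)]) (use elim in auto)
      ultimately show ?case using elim(5,6) unfolding dist_real_def by linarith
    qed
  qed
  hence "((\<lambda>x. ereal (- ln (P x) / ln (\<rho> x))) \<longlongrightarrow> ereal d) F" by simp
  thus ?thesis
    by (rule Lim_transform_eventually) (use pos in eventually_elim, simp add: error_exponent_def)
qed

lemma error_exponent_limit_le:
  assumes lim: "((\<lambda>\<rho>. error_exponent \<rho> (P \<rho>)) \<longlongrightarrow> d) at_top"
    and c: "c > 0" "\<forall>\<^sub>F \<rho> in at_top. c * \<rho> powr (- x) \<le> P \<rho>"
  shows "d \<le> ereal x"
proof -
  have "((\<lambda>\<rho>::real. x - ln c / ln \<rho>) \<longlongrightarrow> x - 0) at_top"
    by (intro tendsto_diff tendsto_const ln_const_over_ln_tendsto_0 filterlim_ident)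
  hence "((\<lambda>\<rho>::real. ereal (x - ln c / ln \<rho>)) \<longlongrightarrow> ereal x) at_top" by simp
  moreover have "\<forall>\<^sub>F \<rho> in at_top. error_exponent \<rho> (P \<rho>) \<le> ereal (x - ln c / ln \<rho>)"
    using c(2) eventually_gt_at_top[of "1::real"]
  proof eventually_elim
    case (elim \<rho>)
    hence "0 < c * \<rho> powr (- x)" using c(1) by simp
    hence "P \<rho> > 0" using elim by linarith
    thus ?case using neg_ln_div_le[OF c(1) elim(2,1)] by (simp add: error_exponent_def)
  qed
  ultimately show ?thesis using lim by (intro tendsto_le[of at_top]) auto
qed

lemma multiplexing_gain_bounds:
  assumes R: "has_multiplexing_gain R r" and \<delta>: "\<delta> > 0"
  shows "\<forall>\<^sub>F \<rho> in at_top. (r - \<delta>) * ln \<rho> \<le> R \<rho> * ln 2 \<and> R \<rho> * ln 2 \<le> (r + \<delta>) * ln \<rho>"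
proof -
  have "((\<lambda>\<rho>. R \<rho> / log 2 \<rho>) \<longlongrightarrow> r) at_top" using R by (simp add: has_multiplexing_gain_def)
  from tendstoD[OF this \<delta>] eventually_gt_at_top[of "1::real"] show ?thesis
  proof eventually_elim
    case (elim \<rho>)
    have l: "log 2 \<rho> > 0" "log 2 \<rho> * ln 2 = ln \<rho>" using elim by (auto simp: log_def)
    have "r - \<delta> \<le> R \<rho> / log 2 \<rho>" "R \<rho> / log 2 \<rho> \<le> r + \<delta>" using elim by (auto simp: dist_real_def abs_if split: if_splits)
    hence "(r - \<delta>) * log 2 \<rho> \<le> R \<rho>" "R \<rho> \<le> (r + \<delta>) * log 2 \<rho>" using l by (auto simp: field_simps)
    hence "(r - \<delta>) * log 2 \<rho> * ln 2 \<le> R \<rho> * ln 2" "R \<rho> * ln 2 \<le> (r + \<delta>) * log 2 \<rho> * ln 2"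
      by (auto intro: mult_right_mono)
    thus ?case by (simp only: mult.assoc l(2))
  qed
qed

text \<open>Two regimes of the received signal-to-noise ratio. If r = 0 it tends to 0 and the base
  tends to 1, so even a constant positive rate wins. If r > 0 it grows, and the base is of its
  order. The constant 18 / 25 lies between 1 / sqrt 2, which arises for two messages, and the 3 / 4
  of the converse.\<close>

lemma conv_base_asymp:
  assumes R: "has_multiplexing_gain R r" and c0: "c0 > 0" and \<epsilon>: "\<epsilon> > 0" and r: "r = 0 \<or> 0 < r \<and> \<epsilon> < r"
  shows "\<exists>q. 0 < q \<and> q < 1 \<and> (\<forall>\<^sub>F \<rho> in at_top. \<exists>A>0. \<exists>s>0. conv_base (c0 * \<rho> powr (r - \<epsilon>)) A s \<le> 2 powr (q * R \<rho>))
    \<and> (\<forall>\<^sub>F \<rho> in at_top. \<forall>x\<ge>1. 1 \<le> R \<rho> * x \<longrightarrow> 2 powr (- (1 - q) * (R \<rho> * x)) \<le> 18 / 25)"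
proof (cases "r = 0")
  case True
  obtain c where c: "c > 0" "\<forall>\<^sub>F \<rho> in at_top. c \<le> R \<rho>" using R by (auto simp: has_multiplexing_gain_def)
  \<comment> \<open>For \<open>A = \<eta> powr (- (1/2))\<close> and
    \<open>s = \<eta> powr (1/4)\<close> all of \<open>\<eta> * A\<close>, \<open>s\<close> and
    \<open>1 / (A * s)\<close> tend to 0 with \<open>\<eta>\<close>.\<close>
  have lim: "((\<lambda>\<eta>::real. (1 + \<eta> powr (1/2)) * (1 + \<eta> powr (1/4)) * exp (16 * \<eta> powr (1/4))) \<longlongrightarrow> 1) (at_right 0)"
    by real_asymp
  have \<eta>lim: "filterlim (\<lambda>\<rho>. c0 * \<rho> powr (- \<epsilon>)) (at_right 0) at_top"
    using c0 \<epsilon> by real_asymp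
  have "1 < (2::real) powr (c / 2)" using c by simp
  from order_tendstoD(2)[OF filterlim_compose[OF lim \<eta>lim] this]
  have 1: "\<forall>\<^sub>F \<rho> in at_top. \<exists>A>0. \<exists>s>0. conv_base (c0 * \<rho> powr (r - \<epsilon>)) A s \<le> 2 powr (1 / 2 * R \<rho>)"
    using c(2) eventually_gt_at_top[of "0::real"]
  proof eventually_elim
    case (elim \<rho>)
    define \<eta> where "\<eta> = c0 * \<rho> powr (- \<epsilon>)"
    have \<eta>: "\<eta> > 0" using c0 elim by (simp add: \<eta>_def)
    have e1: "\<eta> * \<eta> powr (- (1/2)) = \<eta> powr (1/2)" using \<eta> powr_add[of \<eta> 1 "- (1/2)"] by simp
    have e2: "\<eta> powr (- (1/2)) * \<eta> powr (1/4) = 1 / \<eta> powr (1/4)"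
      using \<eta> by (simp add: powr_add[symmetric] powr_minus_divide[symmetric])
    have "conv_base \<eta> (\<eta> powr (- (1/2))) (\<eta> powr (1/4)) = (1 + \<eta> powr (1/2)) * (1 + \<eta> powr (1/4)) * exp (16 * \<eta> powr (1/4))"
      unfolding conv_base_def e1 e2 by simp
    also have "\<dots> \<le> 2 powr (c / 2)" using elim(1) by (simp add: \<eta>_def)
    also have "\<dots> \<le> 2 powr (1 / 2 * R \<rho>)" using elim(2) by (intro powr_mono) auto
    finally have "conv_base (c0 * \<rho> powr (r - \<epsilon>)) (\<eta> powr (- (1/2))) (\<eta> powr (1/4)) \<le> 2 powr (1 / 2 * R \<rho>)"
      by (simp add: \<eta>_def True)
    moreover have "\<eta> powr (- (1/2)) > 0" "\<eta> powr (1/4) > 0" using \<eta> by auto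
    ultimately show ?case by blast
  qed
  have sq: "2 powr (- (1 / 2)) \<le> (18 / 25 :: real)"
  proof -
    have "(25 / 18 :: real) \<le> sqrt 2" by (rule real_le_rsqrt) (simp add: power2_eq_square)
    thus ?thesis by (simp add: powr_minus powr_half_sqrt divide_simps)
  qed
  have "\<forall>\<^sub>F \<rho> in at_top. \<forall>x\<ge>1. 1 \<le> R \<rho> * x \<longrightarrow> 2 powr (- (1 - 1 / 2) * (R \<rho> * x)) \<le> 18 / 25"
  proof (intro always_eventually allI impI)
    fix \<rho> x assume "1 \<le> R \<rho> * x"
    hence "2 powr (- (1 - 1 / 2) * (R \<rho> * x)) \<le> 2 powr (- (1 / 2 :: real))" by (intro powr_mono) auto
    thus "2 powr (- (1 - 1 / 2) * (R \<rho> * x)) \<le> 18 / 25" using sq by linarith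
  qed
  thus ?thesis using 1 by (intro exI[of _ "1/2"] conjI) auto
next
  case False
  hence r: "0 < r" "\<epsilon> < r" using r by auto
  \<comment> \<open>With this \<open>q\<close> the product \<open>q * (r - \<epsilon> / 4)\<close>
    is still at least \<open>r - \<epsilon> / 2\<close>, above the exponent
    \<open>r - \<epsilon>\<close> of the base.\<close>
  define q where "q = 1 - \<epsilon> / (4 * r)"
  have q: "0 < q" "q < 1" using r \<epsilon> by (auto simp: q_def field_simps)
  have qr: "q * (r - \<epsilon> / 4) \<ge> r - \<epsilon> / 2"
  proof -
    have "q * (r - \<epsilon> / 4) = r - \<epsilon> / 2 + \<epsilon>\<^sup>2 / (16 * r)"
      using r by (simp add: q_def field_simps power2_eq_square)
    thus ?thesis using r by simp
  qed
  have b: "\<forall>\<^sub>F \<rho> in at_top. (r - \<epsilon> / 4) * ln \<rho> \<le> R \<rho> * ln 2 \<and> R \<rho> * ln 2 \<le> (r + \<epsilon> / 4) * ln \<rho>"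
    using \<epsilon> by (intro multiplexing_gain_bounds[OF R]) auto
  have e1: "\<forall>\<^sub>F \<rho> in at_top. 4 * exp 16 * (c0 * \<rho> powr (r - \<epsilon>)) \<le> \<rho> powr (r - \<epsilon> / 2)"
    using c0 \<epsilon> r by real_asymp
  have e2: "\<forall>\<^sub>F \<rho> in at_top. 1 \<le> c0 * \<rho> powr (r - \<epsilon>)"
    using c0 \<epsilon> r by real_asymp
  have 1: "\<forall>\<^sub>F \<rho> in at_top. \<exists>A>0. \<exists>s>0. conv_base (c0 * \<rho> powr (r - \<epsilon>)) A s \<le> 2 powr (q * R \<rho>)"
    using b e1 e2 eventually_gt_at_top[of "1::real"]
  proof eventually_elim
    case (elim \<rho>)
    define \<eta> where "\<eta> = c0 * \<rho> powr (r - \<epsilon>)"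
    have \<eta>: "\<eta> \<ge> 1" using elim by (simp add: \<eta>_def)
    \<comment> \<open>\<open>A = 1 / \<eta>\<close> and \<open>s = \<eta>\<close> keep both
      \<open>\<eta> * A\<close> and \<open>A * s\<close> equal to 1.\<close>
    have "conv_base \<eta> (1 / \<eta>) \<eta> = 2 * (1 + \<eta>) * exp 16" using \<eta> by (simp add: conv_base_def)
    also have "\<dots> \<le> 4 * exp 16 * \<eta>" using \<eta> by simp
    also have "\<dots> \<le> \<rho> powr (r - \<epsilon> / 2)" using elim by (simp add: \<eta>_def)
    also have "\<dots> \<le> \<rho> powr (q * (r - \<epsilon> / 4))" using qr elim by (intro powr_mono) auto
    also have "\<dots> = exp (q * ((r - \<epsilon> / 4) * ln \<rho>))" using elim by (simp add: powr_def)
    also have "\<dots> \<le> exp (q * (R \<rho> * ln 2))" using elim q by simp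
    also have "\<dots> = 2 powr (q * R \<rho>)" by (simp add: powr_def)
    finally have "conv_base (c0 * \<rho> powr (r - \<epsilon>)) (1 / \<eta>) \<eta> \<le> 2 powr (q * R \<rho>)" by (simp add: \<eta>_def)
    moreover have "1 / \<eta> > 0" "\<eta> > 0" using \<eta> by auto
    ultimately show ?case by blast
  qed
  have e3: "\<forall>\<^sub>F \<rho> in at_top. 1 / (1 - q) * ln 2 \<le> (r - \<epsilon> / 4) * ln \<rho>"
    using q r \<epsilon> by real_asymp
  have 2: "\<forall>\<^sub>F \<rho> in at_top. \<forall>x\<ge>1. 1 \<le> R \<rho> * x \<longrightarrow> 2 powr (- (1 - q) * (R \<rho> * x)) \<le> 18 / 25"
    using b e3
  proof eventually_elim
    case (elim \<rho>)
    have "1 / (1 - q) * ln 2 \<le> R \<rho> * ln 2" using elim by linarith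
    hence R1: "1 / (1 - q) \<le> R \<rho>" by (rule mult_right_le_imp_le) simp
    show ?case
    proof (intro allI impI)
      fix x :: real assume x: "x \<ge> 1"
      have "0 < 1 / (1 - q)" using q by simp
      hence "R \<rho> * 1 \<le> R \<rho> * x" using R1 x by (intro mult_left_mono) linarith+
      hence "1 / (1 - q) \<le> R \<rho> * x" using R1 by linarith
      hence "1 \<le> (1 - q) * (R \<rho> * x)" using q by (simp add: field_simps)
      hence "2 powr (- (1 - q) * (R \<rho> * x)) \<le> 2 powr (-1 :: real)"
        by (intro powr_mono) (auto simp only: mult_minus_left intro: le_imp_neg_le)
      also have "\<dots> \<le> (18 / 25 :: real)" by (simp add: powr_minus)
      finally show "2 powr (- (1 - q) * (R \<rho> * x)) \<le> 18 / 25" .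
    qed
  qed
  show ?thesis using q 1 2 by blast
qed

text \<open>Chord bound for a convex function on the unit interval; it makes the union bound linear
  in the small quantity \<open>x\<close>.\<close>

lemma power_one_plus_le:
  fixes x :: real
  assumes "0 \<le> x" "x \<le> 1"
  shows "(1 + x) ^ N - 1 \<le> (2 ^ N - 1) * x"
proof (induction N)
  case (Suc N)
  have "(2 ^ N - 1) * x * x \<le> (2 ^ N - 1) * x * 1" using assms by (intro mult_left_mono) auto
  moreover have "(1 + x) ^ Suc N - 1 = (1 + x) * ((1 + x) ^ N - 1) + x" by (simp add: algebra_simps)
  moreover have "(1 + x) * ((1 + x) ^ N - 1) \<le> (1 + x) * ((2 ^ N - 1) * x)"
    using Suc assms by (intro mult_left_mono) auto
  ultimately show ?case by (simp add: algebra_simps)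
qed simp

section \<open>Upper bounds for the error probability and for the power of the signals\<close>

context cma
begin

text \<open>\<open>\<epsilon>\<close> is the threshold for the product of all truncated gains. Below
  it the error is bounded by 1, and the moments give the probability of this event; above it the
  union bound applies, which decreases in the product.\<close>

lemma cma_error_prob_le:
  assumes b: "\<And>m c. b m c = complex_of_real (1 / (9 * real N * max 1 (cmod c)))"
    and n: "n > 0" and E: "E > 0" and L: "L > 0" and j: "j < N" and p: "0 < p" "p < 1" and \<epsilon>: "\<epsilon> > 0"
    and \<kappa>: "\<kappa> = err_const / 81 * E * (1 / (81 * (real N)\<^sup>2))"
    and r: "r = exp (real (L - 1) * (real (N - 1) / real N) * (- real N * ln \<kappa> - ln \<epsilon>))"
  shows "cma_error_prob N L n \<sigma>v2 \<sigma>w2 E a b j \<le>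
    \<epsilon> powr p * (enn2real (\<integral>\<^sup>+z. inv_weight p z \<partial>cn 1) ^ N *
      enn2real (\<integral>\<^sup>+z. inv_weight p z \<partial>cn 1) ^ card {(j, i). j < N \<and> i < N \<and> j \<noteq> i}) + 2 * ((1 + (real n - 1) * r) ^ N - 1)"
proof -
  let ?O = "{(j, i). j < N \<and> i < N \<and> j \<noteq> (i::nat)}"
  have finO: "finite ?O" by (rule finite_subset[of _ "{..<N} \<times> {..<N}"]) auto
  define m where "m = enn2real (\<integral>\<^sup>+z. inv_weight p z \<partial>cn 1)"
  have m: "(\<integral>\<^sup>+z. inv_weight p z \<partial>cn 1) = ennreal m"
    using inv_weight_moment_finite[OF p] by (simp add: m_def)
  have m0: "m \<ge> 0" by (simp add: m_def)
  define rest where "rest = 2 * ((1 + (real n - 1) * r) ^ N - 1)"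
  have r0: "r \<ge> 0" by (simp add: r)
  have base: "1 \<le> (1 + (real n - 1) * r) ^ N" using n r0 by (intro one_le_power) auto
  have rest: "rest \<ge> 0" using base by (simp add: rest_def)
  interpret G: prob_space "dest_gains N" by (rule prob_space_dest_gains)
  interpret H: prob_space "source_gains N" by (rule prob_space_source_gains)
  interpret C: prob_space "codebooks N L n E" by (rule prob_space_codebooks[OF E])
  interpret M: prob_space "messages N n" by (rule prob_space_messages[OF n])
  interpret W: prob_space "frame_noise N L \<sigma>w2" by (rule prob_space_frame_noise[OF \<sigma>w2])
  interpret V: prob_space "frame_noise N L \<sigma>v2" by (rule prob_space_frame_noise[OF \<sigma>v2])
  define Pe where "Pe g h = (\<integral>\<^sup>+C. (\<integral>\<^sup>+\<mu>. (\<integral>\<^sup>+w. (\<integral>\<^sup>+v. indicator {v. ml_error n j g h C \<mu> w v} v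
      \<partial>frame_noise N L \<sigma>v2) \<partial>frame_noise N L \<sigma>w2) \<partial>messages N n) \<partial>codebooks N L n E)" for g h
  let ?w = "\<lambda>g h. ennreal (\<epsilon> powr p) * ((\<Prod>i<N. inv_weight p (g i)) * (\<Prod>i\<in>?O. inv_weight p (h i)))"
  have pt: "Pe g h \<le> ?w g h + ennreal rest" if g: "g \<in> space (dest_gains N)" and h: "h \<in> space (source_gains N)" for g h
  proof (cases "trunc_gain {..<N} g * trunc_gain ?O h < \<epsilon>")
    case True
    have "Pe g h \<le> (\<integral>\<^sup>+C. (\<integral>\<^sup>+\<mu>. (\<integral>\<^sup>+w. (\<integral>\<^sup>+v. 1
      \<partial>frame_noise N L \<sigma>v2) \<partial>frame_noise N L \<sigma>w2) \<partial>messages N n) \<partial>codebooks N L n E)"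
      unfolding Pe_def by (intro nn_integral_mono) (simp add: indicator_def)
    also have "\<dots> = 1"
      using V.emeasure_space_1 W.emeasure_space_1 M.emeasure_space_1 C.emeasure_space_1 by simp
    also have "1 \<le> ?w g h"
      using trunc_gain_indicator_le[OF finite_lessThan[of N] finO p(1) \<epsilon>, of g h] True by simp
    finally show ?thesis by (simp add: add_increasing2)
  next
    case False
    define Q where "Q = trunc_gain {..<N} g * trunc_gain ?O h"
    have Q: "\<epsilon> \<le> Q" using False by (simp add: Q_def)
    define r' where "r' = exp (real (L - 1) * (real (N - 1) / real N) * (- real N * ln \<kappa> - ln Q))"
    have "r' \<le> r" unfolding r r'_def using Q \<epsilon> by (intro exp_le_cancel_iff[THEN iffD2] mult_left_mono) auto
    moreover have "0 \<le> r'" by (simp add: r'_def)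
    ultimately have "(1 + (real n - 1) * r') ^ N \<le> (1 + (real n - 1) * r) ^ N"
      using n by (intro power_mono add_left_mono mult_left_mono) auto
    hence "2 * ((1 + (real n - 1) * r') ^ N - 1) \<le> rest" by (simp add: rest_def)
    hence "ennreal (2 * ((1 + (real n - 1) * r') ^ N - 1)) \<le> ennreal rest" by (rule ennreal_leI)
    moreover have "Pe g h \<le> 2 * ennreal ((1 + (real n - 1) * r') ^ N - 1)"
      unfolding Pe_def using Q \<epsilon> by (intro conditional_error_le[OF b n E L j g h Q_def _ \<kappa> r'_def]) auto
    moreover have "2 * ennreal ((1 + (real n - 1) * r') ^ N - 1) = ennreal (2 * ((1 + (real n - 1) * r') ^ N - 1))"
      by (subst ennreal_mult') (simp_all only: ennreal_numeral zero_le_numeral)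
    ultimately have "Pe g h \<le> ennreal rest" by simp
    thus ?thesis by (simp add: add_increasing)
  qed
  have hm: "(\<lambda>h. \<Prod>i\<in>?O. inv_weight p (h i)) \<in> borel_measurable (source_gains N)"
    unfolding source_gains_def
    by (intro borel_measurable_prod_ennreal measurable_compose[OF _ measurable_inv_weight]
      measurable_component_cn[OF _ measurable_ident_sets[OF refl]])
  have gm: "(\<lambda>g. \<Prod>i<N. inv_weight p (g i)) \<in> borel_measurable (dest_gains N)"
    unfolding dest_gains_def
    by (intro borel_measurable_prod_ennreal measurable_compose[OF _ measurable_inv_weight]
      measurable_component_cn[OF _ measurable_ident_sets[OF refl]])
  have "ennreal (cma_error_prob N L n \<sigma>v2 \<sigma>w2 E a b j) = (\<integral>\<^sup>+g. (\<integral>\<^sup>+h. Pe g h \<partial>source_gains N) \<partial>dest_gains N)"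
    unfolding Pe_def by (rule cma_error_prob_eq[OF n E j])
  also have "\<dots> \<le> (\<integral>\<^sup>+g. (\<integral>\<^sup>+h. ?w g h + ennreal rest \<partial>source_gains N) \<partial>dest_gains N)"
    by (intro nn_integral_mono pt)
  also have "\<dots> = (\<integral>\<^sup>+g. ennreal (\<epsilon> powr p) * ((\<Prod>i<N. inv_weight p (g i)) * ennreal (m ^ card ?O)) + ennreal rest \<partial>dest_gains N)"
  proof (intro nn_integral_cong)
    fix g
    have "(\<integral>\<^sup>+h. (\<Prod>i\<in>?O. inv_weight p (h i)) \<partial>source_gains N) = ennreal (m ^ card ?O)"
      unfolding source_gains_def using m0 by (subst nn_integral_prod_inv_weight[OF finO]) (simp add: m ennreal_power)
    thus "(\<integral>\<^sup>+h. ?w g h + ennreal rest \<partial>source_gains N) = ennreal (\<epsilon> powr p) * ((\<Prod>i<N. inv_weight p (g i)) * ennreal (m ^ card ?O)) + ennreal rest"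
      using hm H.emeasure_space_1 by (subst nn_integral_add) (auto simp: nn_integral_cmult)
  qed
  also have "\<dots> = ennreal (\<epsilon> powr p) * (ennreal (m ^ N) * ennreal (m ^ card ?O)) + ennreal rest"
  proof -
    have "(\<integral>\<^sup>+g. (\<Prod>i<N. inv_weight p (g i)) \<partial>dest_gains N) = ennreal (m ^ N)"
      unfolding dest_gains_def using m0 by (subst nn_integral_prod_inv_weight) (auto simp: m ennreal_power)
    thus ?thesis using gm G.emeasure_space_1
      by (subst nn_integral_add) (auto simp: nn_integral_cmult nn_integral_multc)
  qed
  also have "\<dots> = ennreal (\<epsilon> powr p * (m ^ N * m ^ card ?O) + rest)"
    using m0 rest by (simp add: ennreal_mult ennreal_plus)
  finally show ?thesis
    using m0 rest by (subst (asm) ennreal_le_iff) (auto simp: m_def rest_def)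
qed

lemma cma_error_prob_le_1:
  assumes n: "n > 0" and E: "E > 0" and j: "j < N"
  shows "cma_error_prob N L n \<sigma>v2 \<sigma>w2 E a b j \<le> 1"
proof -
  interpret G: prob_space "dest_gains N" by (rule prob_space_dest_gains)
  interpret H: prob_space "source_gains N" by (rule prob_space_source_gains)
  interpret C: prob_space "codebooks N L n E" by (rule prob_space_codebooks[OF E])
  interpret M: prob_space "messages N n" by (rule prob_space_messages[OF n])
  interpret W: prob_space "frame_noise N L \<sigma>w2" by (rule prob_space_frame_noise[OF \<sigma>w2])
  interpret V: prob_space "frame_noise N L \<sigma>v2" by (rule prob_space_frame_noise[OF \<sigma>v2])
  have "ennreal (cma_error_prob N L n \<sigma>v2 \<sigma>w2 E a b j) \<le> (\<integral>\<^sup>+g. (\<integral>\<^sup>+h. (\<integral>\<^sup>+C. (\<integral>\<^sup>+\<mu>. (\<integral>\<^sup>+w. (\<integral>\<^sup>+v. 1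
      \<partial>frame_noise N L \<sigma>v2) \<partial>frame_noise N L \<sigma>w2) \<partial>messages N n) \<partial>codebooks N L n E)
      \<partial>source_gains N) \<partial>dest_gains N)"
    unfolding cma_error_prob_eq[OF n E j] by (intro nn_integral_mono) (simp add: indicator_def)
  also have "\<dots> = 1"
    using V.emeasure_space_1 W.emeasure_space_1 M.emeasure_space_1 C.emeasure_space_1 H.emeasure_space_1 G.emeasure_space_1
    by simp
  finally show ?thesis by simp
qed

text \<open>Induction along the chain of repetitions, for every fixed \<open>h\<close>: the gains
  are so small that own symbol, repeated signal and forwarded noise together stay within
  \<open>E\<close>.\<close>

lemma signal_power_le:
  assumes n: "n > 0" and E: "E > 0" and j: "j < N" and k: "k < K"
    and off: "\<sigma>w2 \<le> E \<or> (\<forall>m c. b m c = 0)"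
  shows "(\<integral>\<^sup>+(C, \<mu>, w). ennreal ((cmod (T h (code_symbols C \<mu>) w j k))\<^sup>2)
      \<partial>(codebooks N L n E \<Otimes>\<^sub>M messages N n \<Otimes>\<^sub>M frame_noise N L \<sigma>w2)) \<le> ennreal E"
  using N j k
proof (induction rule: cma_induct[where L=L and k=k])
  case (step m k)
  let ?C = "codebooks N L n E" let ?M = "messages N n" let ?W = "frame_noise N L \<sigma>w2"
  let ?\<Omega> = "?C \<Otimes>\<^sub>M ?M \<Otimes>\<^sub>M ?W"
  note ps = prob_space_codebooks[OF E, of n] prob_space_messages[OF n, of N] prob_space_frame_noise[OF \<sigma>w2]
  have pMW: "prob_space (?M \<Otimes>\<^sub>M ?W)" by (intro prob_space_pair ps)
  interpret C: prob_space ?C by (rule ps)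
  interpret M: prob_space ?M by (rule ps)
  interpret MW: prob_space "?M \<Otimes>\<^sub>M ?W" by (rule pMW)
  interpret CMW: pair_sigma_finite ?C "?M \<Otimes>\<^sub>M ?W"
    by (intro pair_sigma_finite.intro C.sigma_finite_measure_axioms MW.sigma_finite_measure_axioms)
  have Cm: "(\<lambda>z. fst z (p, i, l)) \<in> borel_measurable ?\<Omega>" if "p < N" "i < n" "l < K" for p i l
    using that unfolding codebooks_def by (intro measurable_component_cn[of "(p, i, l)" "{..<N} \<times> {..<n} \<times> {..<K}", where s=E]) auto
  have wm: "(\<lambda>z. snd (snd z) (p, l)) \<in> borel_measurable ?\<Omega>" if "p < N" "l < K" for p l
    using that unfolding frame_noise_def by (intro measurable_component_cn[of "(p, l)" "{..<N} \<times> {..<K}", where s=\<sigma>w2]) auto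
  have xm: "(\<lambda>z. code_symbols (fst z) (fst (snd z)) (p, l)) \<in> borel_measurable ?\<Omega>" if "p < N" "l < K" for p l
    using that by (intro measurable_message_symbol[where C=fst and \<mu>="\<lambda>z. fst (snd z)" and n=n] Cm) measurable
  have Tm: "(\<lambda>z. T h (code_symbols (fst z) (fst (snd z))) (snd (snd z)) p l) \<in> borel_measurable ?\<Omega>" if "p < N" "l < K" for p l
    using that by (intro measurable_T xm wm) auto
  have sqm: "(\<lambda>z. ennreal ((cmod (f z))\<^sup>2)) \<in> borel_measurable ?\<Omega>" if "f \<in> borel_measurable ?\<Omega>" for f
    using that by measurable
  have X: "(\<integral>\<^sup>+z. ennreal ((cmod (code_symbols (fst z) (fst (snd z)) (m, k)))\<^sup>2) \<partial>?\<Omega>) \<le> ennreal (4 * E)"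
  proof -
    have fm: "(\<lambda>z. ennreal ((cmod (code_symbols (fst z) (fst (snd z)) (m, k)))\<^sup>2)) \<in> borel_measurable ?\<Omega>"
      by (intro sqm xm step)
    have "(\<integral>\<^sup>+z. ennreal ((cmod (code_symbols (fst z) (fst (snd z)) (m, k)))\<^sup>2) \<partial>?\<Omega>)
        = (\<integral>\<^sup>+C. (\<integral>\<^sup>+y. ennreal ((cmod (code_symbols C (fst y) (m, k)))\<^sup>2) \<partial>(?M \<Otimes>\<^sub>M ?W)) \<partial>?C)"
      using nn_integral_pair_iterate[OF pMW fm] by simp
    also have "\<dots> = (\<integral>\<^sup>+y. (\<integral>\<^sup>+C. ennreal ((cmod (code_symbols C (fst y) (m, k)))\<^sup>2) \<partial>?C) \<partial>(?M \<Otimes>\<^sub>M ?W))"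
      using fm by (intro CMW.Fubini'[symmetric]) (simp add: case_prod_unfold)
    also have "\<dots> \<le> (\<integral>\<^sup>+y. ennreal (4 * E) \<partial>(?M \<Otimes>\<^sub>M ?W))"
    proof (intro nn_integral_mono)
      fix y assume "y \<in> space (?M \<Otimes>\<^sub>M ?W)"
      hence "fst y \<in> space ?M" by (auto simp: space_pair_measure)
      hence "fst y m < n" using step.hyps by (auto simp: messages_def space_PiM space_uniform_count_measure PiE_def Pi_def)
      hence "(\<integral>\<^sup>+C. ennreal ((cmod (code_symbols C (fst y) (m, k)))\<^sup>2) \<partial>?C) = (\<integral>\<^sup>+z. ennreal ((cmod z)\<^sup>2) \<partial>cn E)"
        unfolding codebooks_def code_symbols_def prod.case using step E
        by (intro nn_integral_PiM_cn_component[where f="\<lambda>z. ennreal ((cmod z)\<^sup>2)"]) auto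
      thus "(\<integral>\<^sup>+C. ennreal ((cmod (code_symbols C (fst y) (m, k)))\<^sup>2) \<partial>?C) \<le> ennreal (4 * E)"
        using nn_integral_cn_cmod_square_le[OF E] by simp
    qed
    also have "\<dots> = ennreal (4 * E)" using MW.emeasure_space_1 by simp
    finally show ?thesis .
  qed
  have Wb: "(\<integral>\<^sup>+z. ennreal ((cmod (snd (snd z) (m, l)))\<^sup>2) \<partial>?\<Omega>) \<le> ennreal (4 * \<sigma>w2)" if l: "l < K" for l
  proof -
    have fm: "(\<lambda>z. ennreal ((cmod (snd (snd z) (m, l)))\<^sup>2)) \<in> borel_measurable ?\<Omega>"
      by (intro sqm wm step l)
    have "(\<lambda>w. w (m, l)) \<in> borel_measurable ?W"
      unfolding frame_noise_def using step l by (intro measurable_component_cn[OF _ measurable_ident_sets[OF refl]]) auto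
    hence fm2: "(\<lambda>y. ennreal ((cmod (snd y (m, l)))\<^sup>2)) \<in> borel_measurable (?M \<Otimes>\<^sub>M ?W)"
      by measurable
    have "(\<integral>\<^sup>+z. ennreal ((cmod (snd (snd z) (m, l)))\<^sup>2) \<partial>?\<Omega>)
        = (\<integral>\<^sup>+C. (\<integral>\<^sup>+\<mu>. (\<integral>\<^sup>+w. ennreal ((cmod (w (m, l)))\<^sup>2) \<partial>?W) \<partial>?M) \<partial>?C)"
      using nn_integral_pair_iterate[OF pMW fm] nn_integral_pair_iterate[OF ps(3) fm2] by simp
    also have "(\<integral>\<^sup>+w. ennreal ((cmod (w (m, l)))\<^sup>2) \<partial>?W) = (\<integral>\<^sup>+z. ennreal ((cmod z)\<^sup>2) \<partial>cn \<sigma>w2)"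
      unfolding frame_noise_def using step l \<sigma>w2
      by (intro nn_integral_PiM_cn_component[where f="\<lambda>z. ennreal ((cmod z)\<^sup>2)"]) auto
    also have "(\<integral>\<^sup>+C. (\<integral>\<^sup>+\<mu>. (\<integral>\<^sup>+z. ennreal ((cmod z)\<^sup>2) \<partial>cn \<sigma>w2) \<partial>?M) \<partial>?C) \<le> ennreal (4 * \<sigma>w2)"
      using nn_integral_cn_cmod_square_le[OF \<sigma>w2] M.emeasure_space_1 C.emeasure_space_1 by simp
    finally show ?thesis .
  qed
  let ?x = "\<lambda>z. code_symbols (fst z) (fst (snd z))"
  have ax: "(cmod (a m * ?x z (m, k)))\<^sup>2 = (1 / 81) * (cmod (?x z (m, k)))\<^sup>2" for z
    by (simp add: a norm_mult power_mult_distrib norm_divide power_divide)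
  show ?case
  proof (cases "cma_prev N L m k = None \<or> (\<forall>m c. b m c = 0)")
    case True
    have T: "T h (?x z) (snd (snd z)) m k = a m * ?x z (m, k)" for z
      using True by (subst cma_signal_eq) (auto simp: cma_relayed_def split: option.splits)
    have "(\<integral>\<^sup>+(C, \<mu>, w). ennreal ((cmod (T h (code_symbols C \<mu>) w m k))\<^sup>2) \<partial>?\<Omega>)
        \<le> (\<integral>\<^sup>+z. ennreal (1 / 81) * ennreal ((cmod (?x z (m, k)))\<^sup>2) \<partial>?\<Omega>)"
      unfolding case_prod_unfold T ax by (intro nn_integral_mono) (simp add: ennreal_mult'[symmetric])
    also have "\<dots> \<le> ennreal (1 / 81) * ennreal (4 * E)"
      using X by (subst nn_integral_cmult[OF sqm[OF xm[OF step.hyps step.prems]]]) (intro mult_left_mono, auto)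
    also have "\<dots> = ennreal (1 / 81 * (4 * E))" using E by (intro ennreal_mult[symmetric]) auto
    also have "\<dots> \<le> ennreal E" using E by (intro ennreal_leI) simp
    finally show ?thesis .
  next
    case False
    then obtain p l where prev: "cma_prev N L m k = Some (p, l)" by auto
    note d = cma_prevD[OF N step.hyps prev]
    have l: "l < K" using d step.prems by auto
    have wE: "\<sigma>w2 \<le> E" using False off by auto
    let ?c = "h (m, p)"
    \<comment> \<open>\<open>N \<ge> 2\<close> bounds the repetition gain by 1 / 18, with square 1 /
      324. With the factor 3 from squaring three terms, the total is at most 4 / 27 + 1 / 108 + 4 /
      108 times \<open>E\<close>.\<close>
    have "1 / (9 * real N) \<le> 1 / 18" using N by (intro frac_le) auto
    hence b1: "cmod (b m ?c * ?c) \<le> 1 / 18" "cmod (b m ?c) \<le> 1 / 18"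
      using b_bounds(1)[of m ?c] b_bounds(2)[of m ?c] by linarith+
    have b2: "(cmod (b m ?c * ?c))\<^sup>2 \<le> 1 / 324" "(cmod (b m ?c))\<^sup>2 \<le> 1 / 324"
      using power_mono[OF b1(1), of 2] power_mono[OF b1(2), of 2] by (auto simp: power_divide)
    let ?T = "\<lambda>z. T h (?x z) (snd (snd z)) p l"
    have le: "(cmod (T h (?x z) (snd (snd z)) m k))\<^sup>2
        \<le> (1 / 27) * (cmod (?x z (m, k)))\<^sup>2 + (1 / 108) * (cmod (?T z))\<^sup>2 + (1 / 108) * (cmod (snd (snd z) (m, l)))\<^sup>2" for z
    proof -
      let ?u = "a m * ?x z (m, k)" and ?v = "b m ?c * ?c * ?T z" and ?w = "b m ?c * snd (snd z) (m, l)"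
      have eq: "T h (?x z) (snd (snd z)) m k = ?u + (?v + ?w)"
        by (subst cma_signal_eq) (simp add: cma_relayed_def prev algebra_simps)
      have "cmod (?u + (?v + ?w)) \<le> cmod ?u + cmod ?v + cmod ?w"
        using norm_triangle_ineq[of ?u "?v + ?w"] norm_triangle_ineq[of ?v ?w] by simp
      hence "(cmod (?u + (?v + ?w)))\<^sup>2 \<le> (cmod ?u + cmod ?v + cmod ?w)\<^sup>2" by (intro power_mono) auto
      also have "\<dots> \<le> 3 * ((cmod ?u)\<^sup>2 + (cmod ?v)\<^sup>2 + (cmod ?w)\<^sup>2)"
        using sum_squares_bound[of "cmod ?u" "cmod ?v"] sum_squares_bound[of "cmod ?u" "cmod ?w"]
          sum_squares_bound[of "cmod ?v" "cmod ?w"] by (simp add: power2_eq_square algebra_simps)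
      finally have 1: "(cmod (?u + (?v + ?w)))\<^sup>2 \<le> 3 * ((cmod ?u)\<^sup>2 + (cmod ?v)\<^sup>2 + (cmod ?w)\<^sup>2)" .
      have 2: "(cmod ?v)\<^sup>2 \<le> 1 / 324 * (cmod (?T z))\<^sup>2"
        unfolding norm_mult[of "b m ?c * ?c"] power_mult_distrib using b2(1) by (intro mult_right_mono) auto
      have 3: "(cmod ?w)\<^sup>2 \<le> 1 / 324 * (cmod (snd (snd z) (m, l)))\<^sup>2"
        unfolding norm_mult power_mult_distrib using b2(2) by (intro mult_right_mono) auto
      have arith: "y \<le> 3 * (u + v + w) \<Longrightarrow> v \<le> 1 / 324 * v' \<Longrightarrow> w \<le> 1 / 324 * w' \<Longrightarrow> u = 1 / 81 * u' \<Longrightarrow>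
        y \<le> 1 / 27 * u' + 1 / 108 * v' + 1 / 108 * w'" for y u v w u' v' w' :: real
        by (simp add: field_simps)
      show ?thesis unfolding eq by (rule arith[OF 1 2 3 ax])
    qed
    have "(\<integral>\<^sup>+(C, \<mu>, w). ennreal ((cmod (T h (code_symbols C \<mu>) w m k))\<^sup>2) \<partial>?\<Omega>)
        \<le> (\<integral>\<^sup>+z. ennreal (1 / 27) * ennreal ((cmod (?x z (m, k)))\<^sup>2) + ennreal (1 / 108) * ennreal ((cmod (?T z))\<^sup>2)
          + ennreal (1 / 108) * ennreal ((cmod (snd (snd z) (m, l)))\<^sup>2) \<partial>?\<Omega>)"
      unfolding case_prod_unfold
    proof (intro nn_integral_mono)
      fix z
      show "ennreal ((cmod (T h (?x z) (snd (snd z)) m k))\<^sup>2) \<le> ennreal (1 / 27) * ennreal ((cmod (?x z (m, k)))\<^sup>2)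
          + ennreal (1 / 108) * ennreal ((cmod (?T z))\<^sup>2) + ennreal (1 / 108) * ennreal ((cmod (snd (snd z) (m, l)))\<^sup>2)"
        using ennreal_leI[OF le[of z]] by (simp add: ennreal_plus ennreal_mult'[symmetric])
    qed
    also have "\<dots> = ennreal (1 / 27) * (\<integral>\<^sup>+z. ennreal ((cmod (?x z (m, k)))\<^sup>2) \<partial>?\<Omega>)
        + ennreal (1 / 108) * (\<integral>\<^sup>+z. ennreal ((cmod (?T z))\<^sup>2) \<partial>?\<Omega>)
        + ennreal (1 / 108) * (\<integral>\<^sup>+z. ennreal ((cmod (snd (snd z) (m, l)))\<^sup>2) \<partial>?\<Omega>)"
      using sqm[OF xm[OF step.hyps step.prems]] sqm[OF Tm[OF d(1) l]] sqm[OF wm[OF step.hyps l]]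
      by (simp only: nn_integral_add nn_integral_cmult borel_measurable_add borel_measurable_times_ennreal borel_measurable_const)
    also have "\<dots> \<le> ennreal (1 / 27) * ennreal (4 * E) + ennreal (1 / 108) * ennreal E + ennreal (1 / 108) * ennreal (4 * \<sigma>w2)"
      using X Wb[OF l] step.IH[OF prev] l by (intro add_mono mult_left_mono) (auto simp: case_prod_unfold)
    also have "\<dots> = ennreal (1 / 27 * (4 * E) + 1 / 108 * E + 1 / 108 * (4 * \<sigma>w2))"
      using E \<sigma>w2 by (simp add: ennreal_mult'[symmetric] ennreal_plus[symmetric] del: ennreal_plus)
    also have "\<dots> \<le> ennreal E" using E wE by (intro ennreal_leI) simp
    finally show ?thesis .
  qed
qed

end

text \<open>
  The repetitions are switched off when the noise of the sources exceeds the energy constraint,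
  which otherwise could not be met.
\<close>

definition rep_gain :: "nat \<Rightarrow> real \<Rightarrow> real \<Rightarrow> real \<Rightarrow> nat \<Rightarrow> complex \<Rightarrow> complex" where
  "rep_gain N \<sigma>v2 \<sigma>w2 \<rho> m c =
     (if \<sigma>w2 \<le> \<rho> * \<sigma>v2 then complex_of_real (1 / (9 * real N * max 1 (cmod c))) else 0)"

lemma cma_rep_gain:
  assumes "N \<ge> 2" "\<sigma>v2 > 0" "\<sigma>w2 > 0"
  shows "cma N \<sigma>v2 \<sigma>w2 (\<lambda>m. 1 / 9) (rep_gain N \<sigma>v2 \<sigma>w2 \<rho>)"
proof (unfold_locales)
  fix m c
  show "rep_gain N \<sigma>v2 \<sigma>w2 \<rho> m \<in> borel_measurable borel"
    unfolding rep_gain_def[abs_def] by measurable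
  define M where "M = max 1 (cmod c)"
  have M: "M \<ge> 1" "cmod c \<le> M" by (auto simp: M_def)
  have N: "real N > 0" using assms by simp
  have n: "cmod (complex_of_real (1 / (9 * real N * M))) = 1 / (9 * real N * M)"
    unfolding norm_of_real using N M by simp
  have "1 / (9 * real N * M) \<le> 1 / (9 * real N)" using N M by (intro frac_le) auto
  thus "cmod (rep_gain N \<sigma>v2 \<sigma>w2 \<rho> m c) \<le> 1 / (9 * real N)"
    using n N by (simp add: rep_gain_def M_def[symmetric])
  have "1 / (9 * real N * M) * cmod c \<le> 1 / (9 * real N * M) * M" using N M by (intro mult_left_mono) auto
  also have "\<dots> = 1 / (9 * real N)" using M by simp
  finally show "cmod (rep_gain N \<sigma>v2 \<sigma>w2 \<rho> m c * c) \<le> 1 / (9 * real N)"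
    using n N by (simp add: rep_gain_def M_def[symmetric] norm_mult del: of_real_divide of_real_mult)
qed (use assms in auto)

lemma cma_gains_rep_gain:
  assumes "N \<ge> 2" "\<sigma>v2 > 0" "\<sigma>w2 > 0"
  shows "cma_gains N \<sigma>v2 \<sigma>w2 (\<lambda>\<rho> m. 1 / 9) (rep_gain N \<sigma>v2 \<sigma>w2)"
  unfolding cma_gains_def cma_power_constraint_def
proof (intro conjI allI impI)
  fix \<rho> j show "rep_gain N \<sigma>v2 \<sigma>w2 \<rho> j \<in> borel_measurable borel"
    by (rule cma.b_measurable[OF cma_rep_gain[OF assms]])
next
  fix \<rho> :: real and L n :: nat and h j k
  assume *: "\<rho> > 0" "n > 0" "j < N" "k < frames N L"
  interpret cma N L \<sigma>v2 \<sigma>w2 "\<lambda>m. 1 / 9" "rep_gain N \<sigma>v2 \<sigma>w2 \<rho>" by (rule cma_rep_gain[OF assms])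
  show "(\<integral>\<^sup>+(C, \<mu>, w). ennreal ((cmod (cma_signal N L (\<lambda>m. 1 / 9) (rep_gain N \<sigma>v2 \<sigma>w2 \<rho>) h (code_symbols C \<mu>) w j k))\<^sup>2)
      \<partial>(codebooks N L n (\<rho> * \<sigma>v2) \<Otimes>\<^sub>M messages N n \<Otimes>\<^sub>M frame_noise N L \<sigma>w2)) \<le> ennreal (\<rho> * \<sigma>v2)"
    using * assms by (intro signal_power_le) (auto simp: rep_gain_def)
qed

lemma num_messages_le: "real (num_messages l R) \<le> 2 powr (real l * R)"
  by (simp add: num_messages_def)

lemma num_messages_ge:
  assumes "1 \<le> real l * R"
  shows "2 powr (real l * R) / 2 \<le> real (num_messages l R)"
proof -
  have "2 powr 1 \<le> (2 :: real) powr (real l * R)" using assms by (intro powr_mono) auto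
  hence y: "2 \<le> (2 :: real) powr (real l * R)" by simp
  have "real (num_messages l R) = of_int \<lfloor>2 powr (real l * R)\<rfloor>" by (simp add: num_messages_def)
  thus ?thesis using y by linarith
qed

lemma num_messages_pos:
  assumes "0 \<le> R"
  shows "num_messages l R > 0"
proof -
  have "1 \<le> (2 :: real) powr (real l * R)" using assms by (intro ge_one_powr_ge_zero) auto
  thus ?thesis by (simp add: num_messages_def)
qed

text \<open>With gains this small the received signal-to-noise ratio has order
  \<open>\<rho> powr (r - \<epsilon>)\<close>, slightly too little for multiplexing gain
  \<open>r\<close>. The price \<open>N * \<epsilon>\<close> in the exponent is covered by
  \<open>e\<close>.\<close>

lemma outage_gain:
  fixes \<rho> :: real
  assumes \<rho>: "\<rho> \<ge> 1" and r: "r \<le> 1" "\<epsilon> \<ge> 0" and e: "real N * \<epsilon> \<le> e" and t: "t = \<rho> powr (- (1 - r) - \<epsilon>)"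
  shows "0 < t" "t \<le> 1" "t * \<rho> = \<rho> powr (r - \<epsilon>)"
    "(1 / (pi * exp 1)) ^ N * \<rho> powr (- (real N * (1 - r) + e)) \<le> (t / (pi * exp 1)) ^ N"
proof -
  show "0 < t" using \<rho> by (simp add: t)
  have "t \<le> \<rho> powr 0" unfolding t using \<rho> r by (intro powr_mono) auto
  thus "t \<le> 1" using \<rho> by simp
  have "t * \<rho> = \<rho> * \<rho> powr (- (1 - r) - \<epsilon>)" by (simp add: t)
  also have "\<dots> = \<rho> powr (1 + (- (1 - r) - \<epsilon>))" using \<rho> by (intro powr_mult_base) auto
  also have "1 + (- (1 - r) - \<epsilon>) = r - \<epsilon>" by simp
  finally show "t * \<rho> = \<rho> powr (r - \<epsilon>)" .
  have "\<rho> powr (- (real N * (1 - r) + e)) \<le> \<rho> powr (real N * (- (1 - r) - \<epsilon>))"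
    using \<rho> e by (intro powr_mono) (auto simp: algebra_simps)
  also have "\<dots> = t ^ N" unfolding t using \<rho> by (simp add: powr_power mult.commute)
  finally have "(1 / (pi * exp 1)) ^ N * \<rho> powr (- (real N * (1 - r) + e)) \<le> (1 / (pi * exp 1)) ^ N * t ^ N"
    by (intro mult_left_mono) auto
  thus "(1 / (pi * exp 1)) ^ N * \<rho> powr (- (real N * (1 - r) + e)) \<le> (t / (pi * exp 1)) ^ N"
    by (simp add: power_mult_distrib[symmetric])
qed

text \<open>\<open>\<epsilon> < r\<close> for positive \<open>r\<close> keeps
  \<open>\<rho> powr (r - \<epsilon>)\<close> growing, as the second regime of
  \<open>conv_base_asymp\<close> requires.\<close>

lemma obtain_back_off:
  fixes r e :: real
  assumes "0 \<le> r" "e > 0" "N > 0"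
  obtains \<epsilon> where "\<epsilon> > 0" "real N * \<epsilon> \<le> e" "r = 0 \<or> 0 < r \<and> \<epsilon> < r"
proof (rule that[of "if r = 0 then e / real N else min (e / real N) (r / 2)"])
  show "real N * (if r = 0 then e / real N else min (e / real N) (r / 2)) \<le> e"
  proof -
    have "(if r = 0 then e / real N else min (e / real N) (r / 2)) \<le> e / real N" by auto
    thus ?thesis using assms by (simp add: field_simps)
  qed
qed (use assms in auto)

text \<open>Source of the moment order p = (d - e) / (d - e / 2), which is below 1: together with an
  outage threshold of exponent d - e / 2 it gives the exponent d - e.\<close>

lemma back_off_quotient:
  fixes d e :: real
  assumes "\<not> d \<le> e" "e > 0"
  shows "(d - e / 2) * ((d - e) / (d - e / 2)) = d - e"
proof -
  have "d - e / 2 \<noteq> 0" using assms by linarith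
  thus ?thesis by (metis nonzero_mult_div_cancel_left times_divide_eq_right)
qed

section \<open>The diversity of the protocol\<close>

context
  fixes N :: nat and \<sigma>v2 \<sigma>w2 r :: real and R :: "real \<Rightarrow> real"
  assumes N: "N \<ge> 2" and \<sigma>: "\<sigma>v2 > 0" "\<sigma>w2 > 0" and r: "0 \<le> r" "r \<le> 1" and R: "has_multiplexing_gain R r"
begin

abbreviation "naf_error \<equiv> cma_naf_error N \<sigma>v2 \<sigma>w2 (\<lambda>\<rho> m. 1 / 9) (rep_gain N \<sigma>v2 \<sigma>w2) R"

lemma naf_error_lower:
  assumes j: "j < N" and e: "e > 0"
  shows "\<exists>c>0. \<forall>\<^sub>F x in at_top \<times>\<^sub>F at_top. c * fst x powr (- (real N * (1 - r) + e)) \<le> naf_error j (fst x) (snd x)"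
proof -
  have "N > 0" using N by simp
  from obtain_back_off[OF r(1) e this] obtain \<epsilon> where \<epsilon>: "\<epsilon> > 0" "real N * \<epsilon> \<le> e" "r = 0 \<or> 0 < r \<and> \<epsilon> < r" by blast
  obtain q where q: "0 < q" "q < 1"
    and base: "\<forall>\<^sub>F \<rho> in at_top. \<exists>A>0. \<exists>s>0. conv_base (1 * \<rho> powr (r - \<epsilon>)) A s \<le> 2 powr (q * R \<rho>)"
    using conv_base_asymp[OF R zero_less_one \<epsilon>(1,3)] by blast
  obtain c where c: "c > 0" "\<forall>\<^sub>F \<rho> in at_top. c \<le> R \<rho>" using R by (auto simp: has_multiplexing_gain_def)
  have "\<forall>\<^sub>F \<rho> in at_top. \<rho> > 1 \<and> c \<le> R \<rho> \<and> (\<exists>A>0. \<exists>s>0. conv_base (1 * \<rho> powr (r - \<epsilon>)) A s \<le> 2 powr (q * R \<rho>))"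
    using base c(2) eventually_gt_at_top[of "1::real"] by eventually_elim blast
  hence ev1: "\<forall>\<^sub>F x in at_top \<times>\<^sub>F (at_top :: nat filter). fst x > 1 \<and> c \<le> R (fst x) \<and>
      (\<exists>A>0. \<exists>s>0. conv_base (1 * fst x powr (r - \<epsilon>)) A s \<le> 2 powr (q * R (fst x)))"
    by (rule eventually_compose_filterlim[OF _ filterlim_fst])
  \<comment> \<open>From this \<open>L\<close> on, \<open>(1 - q) * y \<ge> 2\<close>, where
    \<open>2 powr y\<close> is the number of messages before rounding. That gains a factor 1 / 4,
    rounding down loses at most 2, so the success term is at most 1 / 2. The threshold does not
    depend on \<open>\<rho>\<close>.\<close>
  have "\<forall>\<^sub>F L in at_top. L \<ge> nat \<lceil>2 / ((1 - q) * c)\<rceil> + 1" by (rule eventually_ge_at_top)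
  hence ev2: "\<forall>\<^sub>F x in (at_top :: real filter) \<times>\<^sub>F at_top. snd x \<ge> nat \<lceil>2 / ((1 - q) * c)\<rceil> + 1"
    by (rule eventually_compose_filterlim[OF _ filterlim_snd])
  have "\<forall>\<^sub>F x in at_top \<times>\<^sub>F at_top. (1 / (pi * exp 1)) ^ N / 4 * fst x powr (- (real N * (1 - r) + e)) \<le> naf_error j (fst x) (snd x)"
    using ev1 ev2
  proof eventually_elim
    case (elim x)
    define \<rho> L where "\<rho> = fst x" and "L = snd x"
    obtain A s where As: "A > 0" "s > 0" "conv_base (\<rho> powr (r - \<epsilon>)) A s \<le> 2 powr (q * R \<rho>)"
      using elim(1) by (auto simp: \<rho>_def)
    have \<rho>: "\<rho> > 1" and cR: "c \<le> R \<rho>" using elim by (auto simp: \<rho>_def)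
    have L0: "L > 0" and L: "2 / ((1 - q) * c) \<le> real L" using elim(2) unfolding L_def by linarith+
    interpret cma N L \<sigma>v2 \<sigma>w2 "\<lambda>m. 1 / 9" "rep_gain N \<sigma>v2 \<sigma>w2 \<rho>" by (rule cma_rep_gain[OF N \<sigma>])
    define n where "n = num_messages (frames N L) (R \<rho>)"
    define y where "y = real (frames N L) * R \<rho>"
    have "real L * 1 \<le> real L * real (N - 1)" using N by (intro mult_left_mono) auto
    hence "real L \<le> real (frames N L)" by (simp add: frames_def mult.commute)
    hence "(1 - q) * (real L * c) \<le> (1 - q) * y"
      unfolding y_def using q c(1) cR by (intro mult_left_mono mult_mono) auto
    moreover have "2 \<le> (1 - q) * (real L * c)" using L q c(1) by (simp add: field_simps)
    ultimately have y2: "2 \<le> (1 - q) * y" by linarith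
    have y0: "0 \<le> y" using c(1) cR by (simp add: y_def)
    have "(1 - q) * y \<le> 1 * y" using q y0 by (intro mult_right_mono) auto
    hence y1: "1 \<le> y" using y2 by linarith
    have n: "2 powr y / 2 \<le> real n" unfolding n_def y_def by (rule num_messages_ge) (use y1 in \<open>simp add: y_def\<close>)
    have n0: "n > 0" using n by (rule contrapos_pp) simp
    define t where "t = \<rho> powr (- (1 - r) - \<epsilon>)"
    note t = outage_gain[OF less_imp_le[OF \<rho>] r(2) less_imp_le[OF \<epsilon>(1)] \<epsilon>(2) t_def]
    define F where "F = conv_base (\<rho> powr (r - \<epsilon>)) A s"
    have F0: "F > 0" unfolding F_def using \<rho> As by (intro conv_base_pos) auto
    have "F ^ frames N L \<le> (2 powr (q * R \<rho>)) ^ frames N L" using As F0 by (intro power_mono) (auto simp: F_def)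
    also have "\<dots> = 2 powr (q * y)" by (simp add: powr_power y_def mult_ac)
    also have "\<dots> = 2 powr y * 2 powr (- ((1 - q) * y))" by (simp add: powr_add[symmetric] algebra_simps)
    also have "\<dots> \<le> 2 powr y * 2 powr (- 2)" using y2 by (intro mult_left_mono powr_mono) auto
    also have "\<dots> = 1 / 2 * (2 powr y / 2)" by (simp add: powr_minus)
    also have "\<dots> \<le> 1 / 2 * real n" using n by (intro mult_left_mono) auto
    finally have "F ^ frames N L / real n \<le> 1 / 2" using n0 by (simp add: field_simps)
    hence F4: "1 / 4 \<le> 3 / 4 - F ^ frames N L / real n" by linarith
    have tE: "t * (\<rho> * \<sigma>v2) / \<sigma>v2 = \<rho> powr (r - \<epsilon>)" using \<sigma> t(3) by simp
    have "(1 / (pi * exp 1)) ^ N / 4 * \<rho> powr (- (real N * (1 - r) + e)) = (1 / (pi * exp 1)) ^ N * \<rho> powr (- (real N * (1 - r) + e)) * (1 / 4)"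
      by simp
    also have "\<dots> \<le> (t / (pi * exp 1)) ^ N * (3 / 4 - F ^ frames N L / real n)"
      using t(1) F4 by (intro mult_mono t(4)) auto
    also have "\<dots> \<le> cma_error_prob N L n \<sigma>v2 \<sigma>w2 (\<rho> * \<sigma>v2) (\<lambda>m. 1 / 9) (rep_gain N \<sigma>v2 \<sigma>w2 \<rho>) j"
      using cma_error_prob_ge[OF n0 _ L0 j t(1,2) As(1,2), of "\<rho> * \<sigma>v2"] \<rho> \<sigma> by (simp add: tE F_def)
    finally show ?case by (simp add: cma_naf_error_def \<rho>_def L_def n_def)
  qed
  moreover have "(1 / (pi * exp 1)) ^ N / 4 > (0 :: real)" by simp
  ultimately show ?thesis by blast
qed

lemma naf_error_upper:
  assumes j: "j < N" and e: "e > 0"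
  shows "\<exists>C>0. \<forall>\<^sub>F x in at_top \<times>\<^sub>F at_top. naf_error j (fst x) (snd x) \<le> C * fst x powr (- (real N * (1 - r) - e))"
proof -
  obtain c where c: "c > 0" "\<forall>\<^sub>F \<rho> in at_top. c \<le> R \<rho>" using R by (auto simp: has_multiplexing_gain_def)
  define d where "d = real N * (1 - r)"
  show ?thesis
  proof (cases "d \<le> e")
    \<comment> \<open>The claimed exponent d - e is not positive, so the trivial bound 1
      suffices.\<close>
    case True
    have "\<forall>\<^sub>F \<rho> in at_top. \<rho> > 1 \<and> c \<le> R \<rho>"
      using c(2) eventually_gt_at_top[of "1::real"] by eventually_elim blast
    hence "\<forall>\<^sub>F x in at_top \<times>\<^sub>F (at_top :: nat filter). fst x > 1 \<and> c \<le> R (fst x)"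
      by (rule eventually_compose_filterlim[OF _ filterlim_fst])
    hence "\<forall>\<^sub>F x in at_top \<times>\<^sub>F at_top. naf_error j (fst x) (snd x) \<le> 1 * fst x powr (- (real N * (1 - r) - e))"
    proof eventually_elim
      case (elim x)
      interpret cma N "snd x" \<sigma>v2 \<sigma>w2 "\<lambda>m. 1 / 9" "rep_gain N \<sigma>v2 \<sigma>w2 (fst x)" by (rule cma_rep_gain[OF N \<sigma>])
      have "naf_error j (fst x) (snd x) \<le> 1"
        unfolding cma_naf_error_def using elim c(1) \<sigma> by (intro cma_error_prob_le_1 num_messages_pos j) auto
      also have "1 \<le> fst x powr (- (d - e))" using elim True by (intro ge_one_powr_ge_zero) auto
      finally show ?case by (simp add: d_def)
    qed
    thus ?thesis using zero_less_one by blast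
  next
    case False
    define \<epsilon> where "\<epsilon> = e / (2 * real N)"
    have N0: "real N > 0" using N by simp
    have \<epsilon>: "\<epsilon> > 0" using e N0 by (simp add: \<epsilon>_def)
    have N\<epsilon>: "real N * \<epsilon> = e / 2" using N0 by (simp add: \<epsilon>_def)
    define p where "p = (d - e) / (d - e / 2)"
    have p: "0 < p" "p < 1" using False e by (auto simp: p_def field_simps)
    \<comment> \<open>The part of \<open>\<kappa>\<close> that does not grow with
      \<open>\<rho>\<close>; its logarithm is absorbed by
      \<open>\<epsilon> / 4 * ln \<rho>\<close>.\<close>
    define \<kappa>0 where "\<kappa>0 = 1 / (12 * (\<sigma>v2 + \<sigma>w2)) / 81 * \<sigma>v2 * (1 / (81 * (real N)\<^sup>2))"
    have \<kappa>0: "\<kappa>0 > 0" using \<sigma> N0 by (simp add: \<kappa>0_def)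
    define m where "m = enn2real (\<integral>\<^sup>+z. inv_weight p z \<partial>cn 1)"
    define c1 where "c1 = m ^ N * m ^ card {(j, i). j < N \<and> i < N \<and> j \<noteq> i}"
    have c1: "c1 \<ge> 0" by (simp add: c1_def m_def)
    have "\<forall>\<^sub>F \<rho> in at_top. - ln \<kappa>0 \<le> \<epsilon> / 4 * ln \<rho>" using \<epsilon> by real_asymp
    moreover have "\<forall>\<^sub>F \<rho> in at_top. \<sigma>w2 \<le> \<rho> * \<sigma>v2" using \<sigma> by real_asymp
    moreover have "\<forall>\<^sub>F \<rho> in at_top. (r - \<epsilon> / 4) * ln \<rho> \<le> R \<rho> * ln 2 \<and> R \<rho> * ln 2 \<le> (r + \<epsilon> / 4) * ln \<rho>"
      using \<epsilon> by (intro multiplexing_gain_bounds[OF R]) auto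
    ultimately have "\<forall>\<^sub>F \<rho> in at_top. \<rho> > 1 \<and> c \<le> R \<rho> \<and> - ln \<kappa>0 \<le> \<epsilon> / 4 * ln \<rho> \<and> \<sigma>w2 \<le> \<rho> * \<sigma>v2
        \<and> R \<rho> * ln 2 \<le> (r + \<epsilon> / 4) * ln \<rho>"
      using c(2) eventually_gt_at_top[of "1::real"] by eventually_elim blast
    hence ev1: "\<forall>\<^sub>F x in at_top \<times>\<^sub>F (at_top :: nat filter). fst x > 1 \<and> c \<le> R (fst x) \<and> - ln \<kappa>0 \<le> \<epsilon> / 4 * ln (fst x)
        \<and> \<sigma>w2 \<le> fst x * \<sigma>v2 \<and> R (fst x) * ln 2 \<le> (r + \<epsilon> / 4) * ln (fst x)"
      by (rule eventually_compose_filterlim[OF _ filterlim_fst])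
    \<comment> \<open>Pairwise errors decay over \<open>L - 1\<close> frames per super-frame, while
      the rate counts all \<open>L\<close>. The missing frame costs r + \<epsilon> / 4, every other
      frame gains \<epsilon> / 2, and the surplus \<open>N\<close> makes the union bound smaller
      than the outage term.\<close>
    have "\<forall>\<^sub>F L in at_top. L \<ge> nat \<lceil>(r + \<epsilon> / 4 + real N) / (\<epsilon> / 2)\<rceil> + 1" by (rule eventually_ge_at_top)
    hence ev2: "\<forall>\<^sub>F x in (at_top :: real filter) \<times>\<^sub>F at_top. snd x \<ge> nat \<lceil>(r + \<epsilon> / 4 + real N) / (\<epsilon> / 2)\<rceil> + 1"
      by (rule eventually_compose_filterlim[OF _ filterlim_snd])
    have "\<forall>\<^sub>F x in at_top \<times>\<^sub>F at_top. naf_error j (fst x) (snd x) \<le> (c1 + 2 * 2 ^ N) * fst x powr (- (real N * (1 - r) - e))"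
      using ev1 ev2
    proof eventually_elim
      case (elim x)
      define \<rho> L where "\<rho> = fst x" and "L = snd x"
      have \<rho>: "\<rho> > 1" and cR: "c \<le> R \<rho>" and \<kappa>\<rho>: "- ln \<kappa>0 \<le> \<epsilon> / 4 * ln \<rho>" and \<sigma>w\<rho>: "\<sigma>w2 \<le> \<rho> * \<sigma>v2"
        and R\<rho>: "R \<rho> * ln 2 \<le> (r + \<epsilon> / 4) * ln \<rho>" using elim(1) by (auto simp: \<rho>_def)
      define l where "l = ln \<rho>"
      have l: "l > 0" using \<rho> by (simp add: l_def)
      have L0: "L > 0" and L: "(r + \<epsilon> / 4 + real N) / (\<epsilon> / 2) \<le> real (L - 1)"
        using elim(2) unfolding L_def by linarith+
      have L': "r + \<epsilon> / 4 + real N \<le> real (L - 1) * (\<epsilon> / 2)" using L \<epsilon> by (simp add: field_simps)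
      interpret cma N L \<sigma>v2 \<sigma>w2 "\<lambda>m. 1 / 9" "rep_gain N \<sigma>v2 \<sigma>w2 \<rho>" by (rule cma_rep_gain[OF N \<sigma>])
      define n where "n = num_messages (frames N L) (R \<rho>)"
      have n0: "n > 0" unfolding n_def using cR c(1) by (intro num_messages_pos) auto
      \<comment> \<open>Slightly above the outage value \<open>\<rho> powr (- d)\<close>, which
        gives the union bound the slack e / 2 = N * \<epsilon>.\<close>
      define thr where "thr = \<rho> powr (- (d - e / 2))"
      have thr0: "thr > 0" using \<rho> by (simp add: thr_def)
      have lnthr: "ln thr = - (d - e / 2) * l" using \<rho> by (simp add: thr_def l_def ln_powr)
      have thrp: "thr powr p = \<rho> powr (- (d - e))"
        unfolding thr_def powr_powr mult_minus_left back_off_quotient[OF False e, folded p_def] ..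
      define \<kappa> where "\<kappa> = err_const / 81 * (\<rho> * \<sigma>v2) * (1 / (81 * (real N)\<^sup>2))"
      have \<kappa>: "\<kappa> = \<kappa>0 * \<rho>" by (simp add: \<kappa>_def \<kappa>0_def err_const_def)
      have ln\<kappa>: "ln \<kappa> = ln \<kappa>0 + l" using \<kappa>0 \<rho> by (simp add: \<kappa> ln_mult l_def)
      define s where "s = exp (real (L - 1) * (real (N - 1) / real N) * (- real N * ln \<kappa> - ln thr))"
      have "- real N * ln \<kappa> - ln thr = real N * (- ln \<kappa>0) - (real N * r + real N * \<epsilon>) * l"
        unfolding ln\<kappa> lnthr N\<epsilon> by (simp add: d_def algebra_simps)
      also have "\<dots> \<le> real N * (\<epsilon> / 4 * l) - (real N * r + real N * \<epsilon>) * l"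
        using \<kappa>\<rho> by (intro diff_right_mono mult_left_mono) (auto simp: l_def)
      also have "\<dots> = - (real N * ((r + 3 / 4 * \<epsilon>) * l))" by (simp add: algebra_simps)
      finally have "real (L - 1) * (real (N - 1) / real N) * (- real N * ln \<kappa> - ln thr)
          \<le> real (L - 1) * (real (N - 1) / real N) * (- (real N * ((r + 3 / 4 * \<epsilon>) * l)))"
        by (intro mult_left_mono) auto
      also have "\<dots> = - (real (L - 1) * real (N - 1) * ((r + 3 / 4 * \<epsilon>) * l))" using N0 by simp
      finally have s: "s \<le> exp (- (real (L - 1) * real (N - 1) * ((r + 3 / 4 * \<epsilon>) * l)))" by (simp add: s_def)
      have s0: "s > 0" by (simp add: s_def)
      have "real n \<le> 2 powr (real (frames N L) * R \<rho>)" unfolding n_def by (rule num_messages_le)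
      also have "\<dots> = exp (real (frames N L) * (R \<rho> * ln 2))" by (simp add: powr_def mult_ac)
      also have "\<dots> \<le> exp (real (frames N L) * ((r + \<epsilon> / 4) * l))"
        using R\<rho> unfolding exp_le_cancel_iff l_def by (intro mult_left_mono) auto
      finally have nle: "real n \<le> exp (real (frames N L) * ((r + \<epsilon> / 4) * l))" .
      have Lr: "real L = real (L - 1) + 1" using L0 by (simp add: of_nat_diff)
      have "real n * s \<le> exp (real (frames N L) * ((r + \<epsilon> / 4) * l)) * exp (- (real (L - 1) * real (N - 1) * ((r + 3 / 4 * \<epsilon>) * l)))"
        using nle s s0 by (intro mult_mono) auto
      also have "\<dots> = exp (real (N - 1) * l * (r + \<epsilon> / 4 - real (L - 1) * (\<epsilon> / 2)))"
        unfolding exp_add[symmetric] frames_def of_nat_mult Lr by (rule arg_cong[where f=exp]) (simp only: algebra_simps, simp)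
      also have "\<dots> \<le> exp (- real N * l)"
      proof -
        have "real (N - 1) * l * (r + \<epsilon> / 4 - real (L - 1) * (\<epsilon> / 2)) \<le> real (N - 1) * l * (- real N)"
          using L' l by (intro mult_left_mono) auto
        also have "\<dots> \<le> 1 * l * (- real N)"
          using N l by (intro mult_right_mono_neg mult_right_mono) auto
        finally show ?thesis by (simp add: mult_ac)
      qed
      also have "\<dots> = \<rho> powr (- real N)" using \<rho> by (simp add: powr_def l_def)
      finally have ns: "real n * s \<le> \<rho> powr (- real N)" .
      have "\<rho> powr (- real N) \<le> \<rho> powr 0" using \<rho> by (intro powr_mono) auto
      hence \<rho>N1: "\<rho> powr (- real N) \<le> 1" using \<rho> by simp
      define z where "z = (real n - 1) * s"
      have z0: "z \<ge> 0" using n0 s0 by (simp add: z_def)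
      have "z \<le> real n * s" unfolding z_def using s0 by (intro mult_right_mono) auto
      hence z: "z \<le> \<rho> powr (- real N)" using ns by linarith
      have "(1 + z) ^ N - 1 \<le> (2 ^ N - 1) * z" using z0 z \<rho>N1 by (intro power_one_plus_le) auto
      also have "\<dots> \<le> 2 ^ N * \<rho> powr (- real N)" using z z0 by (intro mult_mono) auto
      also have "\<dots> \<le> 2 ^ N * \<rho> powr (- (d - e))"
      proof -
        have "real N * (1 - r) \<le> real N * 1" using r by (intro mult_left_mono) auto
        thus ?thesis using \<rho> e by (intro mult_left_mono powr_mono) (auto simp: d_def)
      qed
      finally have fin: "(1 + z) ^ N - 1 \<le> 2 ^ N * \<rho> powr (- (d - e))" .
      have "cma_error_prob N L n \<sigma>v2 \<sigma>w2 (\<rho> * \<sigma>v2) (\<lambda>m. 1 / 9) (rep_gain N \<sigma>v2 \<sigma>w2 \<rho>) j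
          \<le> thr powr p * c1 + 2 * ((1 + z) ^ N - 1)"
        unfolding c1_def m_def z_def
        using \<rho> \<sigma> \<sigma>w\<rho> by (intro cma_error_prob_le[OF _ n0 _ L0 j p thr0 \<kappa>_def s_def]) (auto simp: rep_gain_def)
      also have "\<dots> \<le> \<rho> powr (- (d - e)) * c1 + 2 * (2 ^ N * \<rho> powr (- (d - e)))"
        using fin by (simp add: thrp)
      also have "\<dots> = (c1 + 2 * 2 ^ N) * \<rho> powr (- (real N * (1 - r) - e))" by (simp add: d_def algebra_simps)
      finally show ?case by (simp add: cma_naf_error_def \<rho>_def L_def n_def)
    qed
    moreover have "c1 + 2 * 2 ^ N > 0" using c1 by (intro add_nonneg_pos) auto
    ultimately show ?thesis by blast
  qed
qed

lemma naf_overall_diversity: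
  "has_overall_diversity_gain N naf_error (ereal (real N * (1 - r)))"
  unfolding has_overall_diversity_gain_def
proof (intro exI[of _ "\<lambda>_. ereal (real N * (1 - r))"] conjI allI impI)
  fix j assume j: "j < N"
  show "has_diversity_gain (naf_error j) (ereal (real N * (1 - r)))"
    unfolding has_diversity_gain_def case_prod_unfold
    by (intro error_exponent_tendsto[OF filterlim_fst] naf_error_lower naf_error_upper j)
next
  have "{..<N} \<noteq> {}" using N by (auto simp: lessThan_empty_iff)
  hence "(\<lambda>_. ereal (real N * (1 - r))) ` {..<N} = {ereal (real N * (1 - r))}" by auto
  thus "ereal (real N * (1 - r)) = Min ((\<lambda>_. ereal (real N * (1 - r))) ` {..<N})" by simp
qed

end

section \<open>The diversity of the point-to-point system\<close>

lemma miso_error_lower: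
  assumes N: "N > 0" and \<sigma>2: "\<sigma>2 > 0" and r: "0 \<le> r" "r \<le> 1" and e: "e > 0"
    and code: "\<And>\<rho>. \<rho> > 0 \<Longrightarrow> miso_code N (\<rho> * \<sigma>2) (T \<rho>) (n \<rho>) (X \<rho>) (D \<rho>)"
    and R: "has_multiplexing_gain (\<lambda>\<rho>. log 2 (real (n \<rho>)) / real (T \<rho>)) r"
  shows "\<exists>c>0. \<forall>\<^sub>F \<rho> in at_top. c * \<rho> powr (- (real N * (1 - r) + e)) \<le> miso_error_prob N \<sigma>2 (T \<rho>) (n \<rho>) (X \<rho>) (D \<rho>)"
proof -
  define R' where "R' \<rho> = log 2 (real (n \<rho>)) / real (T \<rho>)" for \<rho>
  have R': "has_multiplexing_gain R' r" using R by (simp add: R'_def[abs_def])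
  obtain \<epsilon> where \<epsilon>: "\<epsilon> > 0" "real N * \<epsilon> \<le> e" "r = 0 \<or> 0 < r \<and> \<epsilon> < r"
    using obtain_back_off[OF r(1) e N] by blast
  have N2: "(real N)\<^sup>2 > 0" using N by simp
  obtain q where q: "0 < q" "q < 1"
    and base: "\<forall>\<^sub>F \<rho> in at_top. \<exists>A>0. \<exists>s>0. conv_base ((real N)\<^sup>2 * \<rho> powr (r - \<epsilon>)) A s \<le> 2 powr (q * R' \<rho>)"
    and decay: "\<forall>\<^sub>F \<rho> in at_top. \<forall>x\<ge>1. 1 \<le> R' \<rho> * x \<longrightarrow> 2 powr (- (1 - q) * (R' \<rho> * x)) \<le> 18 / 25"
    using conv_base_asymp[OF R' N2 \<epsilon>(1,3)] by blast
  obtain c where c: "c > 0" "\<forall>\<^sub>F \<rho> in at_top. c \<le> R' \<rho>" using R' by (auto simp: has_multiplexing_gain_def)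
  have "\<forall>\<^sub>F \<rho> in at_top. (1 / (pi * exp 1)) ^ N * (3 / 100) * \<rho> powr (- (real N * (1 - r) + e))
      \<le> miso_error_prob N \<sigma>2 (T \<rho>) (n \<rho>) (X \<rho>) (D \<rho>)"
    using base decay c(2) eventually_gt_at_top[of "1::real"]
  proof eventually_elim
    case (elim \<rho>)
    obtain A s where As: "A > 0" "s > 0" "conv_base ((real N)\<^sup>2 * \<rho> powr (r - \<epsilon>)) A s \<le> 2 powr (q * R' \<rho>)"
      using elim(1) by auto
    have \<rho>: "\<rho> > 1" and cR: "c \<le> R' \<rho>" using elim by auto
    have co: "miso_code N (\<rho> * \<sigma>2) (T \<rho>) (n \<rho>) (X \<rho>) (D \<rho>)" using \<rho> by (intro code) auto
    hence T0: "T \<rho> > 0" and n0: "n \<rho> > 0" by (auto simp: miso_code_def)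
    define y where "y = R' \<rho> * real (T \<rho>)"
    have y: "y = log 2 (real (n \<rho>))" using T0 by (simp add: y_def R'_def)
    have ny: "real (n \<rho>) = 2 powr y" using n0 by (simp add: y)
    \<comment> \<open>A positive rate excludes codes with a single message, so there are at least
      two.\<close>
    have "y > 0" unfolding y_def using cR c(1) T0 by (intro mult_pos_pos) auto
    hence "real (n \<rho>) > 1" unfolding ny by simp
    hence n2: "real (n \<rho>) \<ge> 2" by simp
    have "log 2 2 \<le> log 2 (real (n \<rho>))" using n2 by (subst log_le_cancel_iff) auto
    hence y1: "1 \<le> y" by (simp add: y)
    have dec: "2 powr (- (1 - q) * y) \<le> 18 / 25" using elim(2) T0 y1 by (auto simp: y_def)
    define t where "t = \<rho> powr (- (1 - r) - \<epsilon>)"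
    note t = outage_gain[OF less_imp_le[OF \<rho>] r(2) less_imp_le[OF \<epsilon>(1)] \<epsilon>(2) t_def]
    define F where "F = conv_base ((real N)\<^sup>2 * \<rho> powr (r - \<epsilon>)) A s"
    have F0: "F > 0" unfolding F_def using \<rho> As N by (intro conv_base_pos) auto
    have "F ^ T \<rho> \<le> (2 powr (q * R' \<rho>)) ^ T \<rho>" using As F0 by (intro power_mono) (auto simp: F_def)
    also have "\<dots> = 2 powr (q * y)" by (simp add: powr_power y_def mult_ac)
    also have "\<dots> = 2 powr y * 2 powr (- (1 - q) * y)" by (simp add: powr_add[symmetric] algebra_simps)
    also have "\<dots> \<le> 2 powr y * (18 / 25)" using dec by (intro mult_left_mono) auto
    finally have "F ^ T \<rho> / real (n \<rho>) \<le> 18 / 25" by (simp add: ny field_simps)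
    \<comment> \<open>Here 18 / 25 has to lie below 3 / 4; the difference is 3 / 100.\<close>
    hence F4: "3 / 100 \<le> 3 / 4 - F ^ T \<rho> / real (n \<rho>)" by linarith
    have tE: "(real N)\<^sup>2 * t * (\<rho> * \<sigma>2) / \<sigma>2 = (real N)\<^sup>2 * \<rho> powr (r - \<epsilon>)"
      using \<sigma>2 unfolding t(3)[symmetric] by simp
    have "(1 / (pi * exp 1)) ^ N * (3 / 100) * \<rho> powr (- (real N * (1 - r) + e)) = (1 / (pi * exp 1)) ^ N * \<rho> powr (- (real N * (1 - r) + e)) * (3 / 100)"
      by simp
    also have "\<dots> \<le> (t / (pi * exp 1)) ^ N * (3 / 4 - F ^ T \<rho> / real (n \<rho>))"
      using t(1) F4 by (intro mult_mono t(4)) auto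
    also have "\<dots> \<le> miso_error_prob N \<sigma>2 (T \<rho>) (n \<rho>) (X \<rho>) (D \<rho>)"
      using miso_error_prob_ge[OF N co _ \<sigma>2 t(1,2) As(1,2)] \<rho> \<sigma>2 by (simp only: tE F_def) simp
    finally show ?case .
  qed
  moreover have "(1 / (pi * exp 1)) ^ N * (3 / 100) > (0 :: real)" by simp
  ultimately show ?thesis by blast
qed

lemma miso_error_prob_le_1:
  assumes "n > 0" "\<sigma>2 > 0"
  shows "miso_error_prob N \<sigma>2 T n X D \<le> 1"
proof -
  have "prob_space (uniform_count_measure {..<n})"
    using assms by (intro prob_space_uniform_count_measure) auto
  hence "prob_space (dest_gains N \<Otimes>\<^sub>M uniform_count_measure {..<n} \<Otimes>\<^sub>M PiM {..<T} (\<lambda>_. cn \<sigma>2))"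
    using assms by (intro prob_space_pair prob_space_dest_gains prob_space_PiM_cn)
  thus ?thesis unfolding miso_error_prob_def Let_def by (rule prob_space.prob_le_1)
qed

text \<open>The infimum over all codes need not be attained, hence the tolerance
  \<open>\<delta>\<close>.\<close>

lemma miso_near_optimal_code:
  assumes ex: "miso_code N E T n X\<^sub>0 D\<^sub>0" and \<delta>: "\<delta> > 0"
  shows "\<exists>X D. miso_code N E T n X D \<and>
    (\<forall>X' D'. miso_code N E T n X' D' \<longrightarrow> miso_error_prob N \<sigma>2 T n X D \<le> miso_error_prob N \<sigma>2 T n X' D' + \<delta>)"
proof -
  define S where "S = {miso_error_prob N \<sigma>2 T n X D | X D. miso_code N E T n X D}"
  have S: "S \<noteq> {}" "bdd_below S"
    using ex by (auto simp: S_def miso_error_prob_def Let_def intro!: bdd_belowI[of _ 0])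
  have "\<exists>z\<in>S. z < Inf S + \<delta>" using S \<delta> by (intro cInf_lessD) auto
  then obtain X D where XD: "miso_code N E T n X D" "miso_error_prob N \<sigma>2 T n X D < Inf S + \<delta>"
    by (auto simp: S_def)
  have "miso_error_prob N \<sigma>2 T n X D \<le> miso_error_prob N \<sigma>2 T n X' D' + \<delta>" if "miso_code N E T n X' D'" for X' D'
  proof -
    have "Inf S \<le> miso_error_prob N \<sigma>2 T n X' D'" using that S by (intro cInf_lower) (auto simp: S_def)
    thus ?thesis using XD(2) by linarith
  qed
  thus ?thesis using XD(1) by blast
qed

text \<open>
  Codes which are optimal up to \<open>\<rho> powr (- N)\<close> inherit the random coding bound for every choice of
  the outage threshold, so that one family serves all \<open>e\<close>.
\<close>

lemma miso_optimal_family: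
  assumes N: "N > 0" and \<sigma>2: "\<sigma>2 > 0" and r: "0 \<le> r" "r \<le> 1"
  shows "\<exists>T n X D. (\<forall>\<rho>>0. miso_code N (\<rho> * \<sigma>2) (T \<rho>) (n \<rho>) (X \<rho>) (D \<rho>)) \<and>
    has_multiplexing_gain (\<lambda>\<rho>. log 2 (real (n \<rho>)) / real (T \<rho>)) r \<and>
    ((\<lambda>\<rho>. error_exponent \<rho> (miso_error_prob N \<sigma>2 (T \<rho>) (n \<rho>) (X \<rho>) (D \<rho>))) \<longlongrightarrow> ereal (real N * (1 - r))) at_top"
proof -
  \<comment> \<open>Any number of blocks that tends to infinity would do: for each \<open>e\<close>
    the union bound has to fall below the order of \<open>\<rho> powr (- N)\<close>, which takes
    about 4 * N / e blocks.\<close>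
  define M where "M \<rho> = nat \<lceil>\<rho>\<rceil>" for \<rho> :: real
  define T where "T \<rho> = N * M \<rho>" for \<rho>
  \<comment> \<open>The summand 1 keeps the rate bounded below when r = 0; the maximum matters only
    for \<open>\<rho> < 1\<close>.\<close>
  define g where "g \<rho> = r * max 0 (log 2 \<rho>) + 1" for \<rho>
  define n where "n \<rho> = nat \<lceil>2 powr (real (T \<rho>) * g \<rho>)\<rceil>" for \<rho>
  have M0: "M \<rho> > 0" if "\<rho> > 0" for \<rho> using that by (simp add: M_def)
  have T0: "T \<rho> > 0" if "\<rho> > 0" for \<rho> using M0[OF that] N by (simp add: T_def)
  have g1: "g \<rho> \<ge> 1" for \<rho> using r by (simp add: g_def)
  have nge: "2 powr (real (T \<rho>) * g \<rho>) \<le> real (n \<rho>)" for \<rho> by (simp add: n_def)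
  have nle: "real (n \<rho>) \<le> 2 * 2 powr (real (T \<rho>) * g \<rho>)" for \<rho>
  proof -
    have "1 \<le> (2 :: real) powr (real (T \<rho>) * g \<rho>)" using g1[of \<rho>] by (intro ge_one_powr_ge_zero) auto
    thus ?thesis unfolding n_def by linarith
  qed
  have n0: "n \<rho> > 0" for \<rho> using nge[of \<rho>] by (rule contrapos_pp) simp
  define \<delta> where "\<delta> \<rho> = \<rho> powr (- real N)" for \<rho> :: real
  define opt where "opt \<rho> X D \<longleftrightarrow> miso_code N (\<rho> * \<sigma>2) (T \<rho>) (n \<rho>) X D \<and>
    (\<forall>X' D'. miso_code N (\<rho> * \<sigma>2) (T \<rho>) (n \<rho>) X' D' \<longrightarrow>
      miso_error_prob N \<sigma>2 (T \<rho>) (n \<rho>) X D \<le> miso_error_prob N \<sigma>2 (T \<rho>) (n \<rho>) X' D' + \<delta> \<rho>)" for \<rho> X D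
  have "\<exists>Z. \<rho> > 0 \<longrightarrow> opt \<rho> (fst Z) (snd Z)" for \<rho>
  proof (cases "\<rho> > 0")
    case True
    obtain X\<^sub>0 D\<^sub>0 where "miso_code N (\<rho> * \<sigma>2) (N * M \<rho>) (n \<rho>) X\<^sub>0 D\<^sub>0"
      \<comment> \<open>Any admissible code will do here; the threshold 1 and the moment order 1 / 2
        are arbitrary.\<close>
      using miso_code_exists[OF N n0[of \<rho>] M0[OF True] _ \<sigma>2 zero_less_one _ _ refl refl, of "\<rho> * \<sigma>2" "1 / 2"] True \<sigma>2 by auto
    moreover have "\<delta> \<rho> > 0" using True by (simp add: \<delta>_def)
    ultimately obtain X D where "opt \<rho> X D" unfolding opt_def T_def using miso_near_optimal_code by blast
    thus ?thesis by (intro exI[of _ "(X, D)"]) simp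
  qed auto
  hence "\<exists>Z. \<forall>\<rho>. \<rho> > 0 \<longrightarrow> opt \<rho> (fst (Z \<rho>)) (snd (Z \<rho>))" by (intro choice allI)
  then obtain Z where Z: "\<And>\<rho>. \<rho> > 0 \<Longrightarrow> opt \<rho> (fst (Z \<rho>)) (snd (Z \<rho>))" by blast
  define X where "X \<rho> = fst (Z \<rho>)" for \<rho>
  define D where "D \<rho> = snd (Z \<rho>)" for \<rho>
  have code: "miso_code N (\<rho> * \<sigma>2) (T \<rho>) (n \<rho>) (X \<rho>) (D \<rho>)" if "\<rho> > 0" for \<rho>
    using Z[OF that] by (simp add: opt_def X_def D_def)
  have opt: "miso_error_prob N \<sigma>2 (T \<rho>) (n \<rho>) (X \<rho>) (D \<rho>) \<le> miso_error_prob N \<sigma>2 (T \<rho>) (n \<rho>) X' D' + \<delta> \<rho>"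
    if "\<rho> > 0" "miso_code N (\<rho> * \<sigma>2) (T \<rho>) (n \<rho>) X' D'" for \<rho> X' D'
    using Z[OF that(1)] that(2) by (simp add: opt_def X_def D_def)
  let ?P = "\<lambda>\<rho>. miso_error_prob N \<sigma>2 (T \<rho>) (n \<rho>) (X \<rho>) (D \<rho>)"
  have rate: "g \<rho> \<le> log 2 (real (n \<rho>)) / real (T \<rho>) \<and> log 2 (real (n \<rho>)) / real (T \<rho>) \<le> g \<rho> + 1" if \<rho>: "\<rho> > 0" for \<rho>
  proof -
    have T1: "real (T \<rho>) \<ge> 1" using T0[OF \<rho>] by simp
    have "log 2 (2 powr (real (T \<rho>) * g \<rho>)) \<le> log 2 (real (n \<rho>))" using nge[of \<rho>] n0[of \<rho>] by (subst log_le_cancel_iff) auto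
    hence 1: "real (T \<rho>) * g \<rho> \<le> log 2 (real (n \<rho>))" by simp
    have "log 2 (real (n \<rho>)) \<le> log 2 (2 * 2 powr (real (T \<rho>) * g \<rho>))" using nle[of \<rho>] n0[of \<rho>] by (subst log_le_cancel_iff) auto
    also have "\<dots> = 1 + real (T \<rho>) * g \<rho>" by (subst log_mult) auto
    also have "\<dots> \<le> real (T \<rho>) * (g \<rho> + 1)" using T1 by (simp add: algebra_simps)
    finally show ?thesis using 1 T1 by (simp add: field_simps)
  qed
  have mg: "has_multiplexing_gain (\<lambda>\<rho>. log 2 (real (n \<rho>)) / real (T \<rho>)) r"
    unfolding has_multiplexing_gain_def
  proof (intro conjI exI[of _ 1])
    have l1: "((\<lambda>\<rho>. r + 1 / log 2 \<rho>) \<longlongrightarrow> r) at_top" and l2: "((\<lambda>\<rho>. r + 2 / log 2 \<rho>) \<longlongrightarrow> r) at_top" by real_asymp+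
    have ev: "\<forall>\<^sub>F \<rho> in at_top. r + 1 / log 2 \<rho> \<le> log 2 (real (n \<rho>)) / real (T \<rho>) / log 2 \<rho> \<and>
        log 2 (real (n \<rho>)) / real (T \<rho>) / log 2 \<rho> \<le> r + 2 / log 2 \<rho>"
      using eventually_gt_at_top[of "1::real"]
    proof eventually_elim
      case (elim \<rho>)
      have l: "log 2 \<rho> > 0" using elim by simp
      have g: "g \<rho> = r * log 2 \<rho> + 1" using l by (simp add: g_def)
      have "(r * log 2 \<rho> + 1) / log 2 \<rho> \<le> log 2 (real (n \<rho>)) / real (T \<rho>) / log 2 \<rho>"
        "log 2 (real (n \<rho>)) / real (T \<rho>) / log 2 \<rho> \<le> (r * log 2 \<rho> + 2) / log 2 \<rho>"
        using rate[of \<rho>] elim l by (intro divide_right_mono; simp add: g)+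
      thus ?case using l by (simp add: add_divide_distrib)
    qed
    show "((\<lambda>\<rho>. log 2 (real (n \<rho>)) / real (T \<rho>) / log 2 \<rho>) \<longlongrightarrow> r) at_top"
      by (rule tendsto_sandwich[OF _ _ l1 l2]) (use ev in eventually_elim, simp)+
    show "\<forall>\<^sub>F \<rho> in at_top. 1 \<le> log 2 (real (n \<rho>)) / real (T \<rho>)"
      using eventually_gt_at_top[of "0::real"] by eventually_elim (use rate g1 order_trans in blast)
  qed simp
  define d where "d = real N * (1 - r)"
  have dN: "d \<le> real N" using r by (simp add: d_def algebra_simps)
  have upper: "\<exists>C>0. \<forall>\<^sub>F \<rho> in at_top. ?P \<rho> \<le> C * \<rho> powr (- (d - e))" if e: "e > 0" for e
  proof (cases "d \<le> e")
    case True
    have "\<forall>\<^sub>F \<rho> in at_top. ?P \<rho> \<le> 1 * \<rho> powr (- (d - e))"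
      using eventually_gt_at_top[of "1::real"]
    proof eventually_elim
      case (elim \<rho>)
      have "?P \<rho> \<le> 1" by (rule miso_error_prob_le_1[OF n0 \<sigma>2])
      also have "1 \<le> \<rho> powr (- (d - e))" using elim True by (intro ge_one_powr_ge_zero) auto
      finally show ?case by simp
    qed
    thus ?thesis using zero_less_one by blast
  next
    case False
    define p where "p = (d - e) / (d - e / 2)"
    have p: "0 < p" "p < 1" using False e by (auto simp: p_def field_simps)
    define m where "m = enn2real (\<integral>\<^sup>+z. inv_weight p z \<partial>cn 1)"
    have m: "m \<ge> 0" by (simp add: m_def)
    \<comment> \<open>128 = 2 * 64, with the 2 from the summand 1 in the rate \<open>g\<close> and
      the 64 from \<open>\<kappa> = \<rho> / 64\<close>, each once per symbol of a block.\<close>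
    have "\<forall>\<^sub>F \<rho> in at_top. 128 ^ N * \<rho> powr (- e / 2) \<le> \<rho> powr (- e / 4)" using e by real_asymp
    hence "\<forall>\<^sub>F \<rho> in at_top. ?P \<rho> \<le> (4 * m ^ N + 9) * \<rho> powr (- (d - e))"
      using eventually_gt_at_top[of "1::real"] eventually_ge_at_top[of "4 * real N / e"]
    proof eventually_elim
      case (elim \<rho>)
      have \<rho>: "\<rho> > 1" by fact
      have \<rho>0: "\<rho> > 0" using \<rho> by simp
      define thr where "thr = \<rho> powr (- (d - e / 2))"
      have thr0: "thr > 0" using \<rho> by (simp add: thr_def)
      have thrp: "thr powr p = \<rho> powr (- (d - e))"
        unfolding thr_def powr_powr mult_minus_left back_off_quotient[OF False e, folded p_def] ..
      define \<kappa> where "\<kappa> = \<rho> * \<sigma>2 / (64 * \<sigma>2)"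
      have \<kappa>: "\<kappa> = \<rho> / 64" using \<sigma>2 by (simp add: \<kappa>_def)
      define B where "B = thr powr p * m ^ N + real (n \<rho>) * (1 / (\<kappa> ^ N * thr)) ^ M \<rho>"
      obtain X' D' where X': "miso_code N (\<rho> * \<sigma>2) (N * M \<rho>) (n \<rho>) X' D'"
          "miso_error_prob N \<sigma>2 (N * M \<rho>) (n \<rho>) X' D' \<le> 4 * B"
        using miso_code_exists[OF N n0 M0[OF \<rho>0] _ \<sigma>2 thr0 p \<kappa>_def B_def[unfolded m_def]] \<rho>0 \<sigma>2 by auto
      have PB: "?P \<rho> \<le> 4 * B + \<delta> \<rho>"
        using opt[OF \<rho>0, of X' D'] X' by (simp add: T_def)
      have \<kappa>N: "1 / (\<kappa> ^ N * thr) = 64 ^ N * \<rho> powr (- (real N * r + e / 2))"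
      proof -
        have "\<rho> ^ N * thr = \<rho> powr (real N * r + e / 2)"
          unfolding thr_def using \<rho>0 by (simp add: powr_realpow[symmetric] powr_add[symmetric] d_def algebra_simps)
        hence eq: "\<kappa> ^ N * thr = \<rho> powr (real N * r + e / 2) / 64 ^ N" by (simp add: \<kappa> power_divide)
        have "1 / (y / c) = c * inverse y" for y c :: real
          by (metis divide_divide_eq_right divide_inverse mult_1)
        thus ?thesis by (simp only: eq powr_minus)
      qed
      have "g \<rho> * ln 2 = r * ln \<rho> + ln 2" using \<rho> r by (simp add: g_def log_def distrib_right)
      hence "2 powr (real N * g \<rho>) = exp (real N * (r * ln \<rho> + ln 2))" by (simp add: powr_def mult_ac)
      also have "\<dots> = 2 ^ N * \<rho> powr (real N * r)"
        using \<rho>0 by (simp add: powr_def distrib_left exp_add exp_of_nat_mult mult_ac)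
      finally have gN: "2 powr (real N * g \<rho>) = 2 ^ N * \<rho> powr (real N * r)" .
      have "2 powr (real (T \<rho>) * g \<rho>) = (2 powr (real N * g \<rho>)) ^ M \<rho>" by (simp add: powr_power T_def mult_ac)
      hence nle': "real (n \<rho>) \<le> 2 * (2 ^ N * \<rho> powr (real N * r)) ^ M \<rho>" using nle[of \<rho>] by (simp only: gN)
      have "real (n \<rho>) * (1 / (\<kappa> ^ N * thr)) ^ M \<rho>
          \<le> 2 * (2 ^ N * \<rho> powr (real N * r)) ^ M \<rho> * (64 ^ N * \<rho> powr (- (real N * r + e / 2))) ^ M \<rho>"
        unfolding \<kappa>N by (intro mult_right_mono nle') auto
      also have "\<dots> = 2 * ((2 ^ N * \<rho> powr (real N * r)) * (64 ^ N * \<rho> powr (- (real N * r + e / 2)))) ^ M \<rho>"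
        by (simp only: power_mult_distrib mult.assoc)
      also have "(2 ^ N * \<rho> powr (real N * r)) * (64 ^ N * \<rho> powr (- (real N * r + e / 2)))
          = (2 ^ N * 64 ^ N) * (\<rho> powr (real N * r) * \<rho> powr (- (real N * r + e / 2)))" by (simp only: mult_ac)
      also have "\<dots> = 128 ^ N * \<rho> powr (- e / 2)"
        unfolding powr_add[symmetric] power_mult_distrib[symmetric] by simp
      also have "2 * (128 ^ N * \<rho> powr (- e / 2)) ^ M \<rho> \<le> 2 * (\<rho> powr (- e / 4)) ^ M \<rho>"
        using elim by (intro mult_left_mono power_mono) auto
      also have "\<dots> = 2 * \<rho> powr (real (M \<rho>) * (- e / 4))" using \<rho>0 by (simp add: powr_power)
      also have "\<dots> \<le> 2 * \<rho> powr (- real N)"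
      proof -
        have "4 * real N / e \<le> real (M \<rho>)" using elim(3) unfolding M_def by linarith
        hence "real (M \<rho>) * (- e / 4) \<le> - real N" using e by (simp add: field_simps)
        thus ?thesis using \<rho> by (intro mult_left_mono powr_mono) auto
      qed
      finally have "B \<le> \<rho> powr (- (d - e)) * m ^ N + 2 * \<rho> powr (- real N)" by (simp add: B_def thrp)
      moreover have "\<rho> powr (- real N) \<le> \<rho> powr (- (d - e))" using \<rho> dN e by (intro powr_mono) auto
      \<comment> \<open>9 = 4 * 2 + 1: four times the second term of \<open>B\<close>, and
        \<open>\<delta> \<rho>\<close> once.\<close>
      ultimately have "4 * B + \<delta> \<rho> \<le> 4 * (\<rho> powr (- (d - e)) * m ^ N) + 9 * \<rho> powr (- (d - e))"
        unfolding \<delta>_def by linarith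
      thus ?case using PB by (simp add: algebra_simps)
    qed
    moreover have "4 * m ^ N + 9 > 0" using m by (intro add_nonneg_pos) auto
    ultimately show ?thesis by blast
  qed
  have "((\<lambda>\<rho>. error_exponent \<rho> (?P \<rho>)) \<longlongrightarrow> ereal d) at_top"
    using upper miso_error_lower[OF N \<sigma>2 r _ code mg]
    by (intro error_exponent_tendsto[OF filterlim_ident]) (auto simp: d_def)
  thus ?thesis using code mg unfolding d_def by blast
qed

text \<open>\<open>miso_error_lower\<close> bounds every family up to an arbitrary e > 0, and the
  family of \<open>miso_optimal_family\<close> attains the supremum.\<close>

lemma genie_optimal_diversity_eq:
  assumes N: "N > 0" and \<sigma>2: "\<sigma>2 > 0" and r: "0 \<le> r" "r \<le> 1"
  shows "genie_optimal_diversity N \<sigma>2 r = ereal (real N * (1 - r))"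
  unfolding genie_optimal_diversity_def
proof (intro antisym Sup_least Sup_upper)
  fix d assume "d \<in> {d. \<exists>T n X D.
       (\<forall>\<rho>>0. miso_code N (\<rho> * \<sigma>2) (T \<rho>) (n \<rho>) (X \<rho>) (D \<rho>)) \<and>
       has_multiplexing_gain (\<lambda>\<rho>. log 2 (real (n \<rho>)) / real (T \<rho>)) r \<and>
       ((\<lambda>\<rho>. error_exponent \<rho> (miso_error_prob N \<sigma>2 (T \<rho>) (n \<rho>) (X \<rho>) (D \<rho>))) \<longlongrightarrow> d) at_top}"
  then obtain T n X D where code: "\<And>\<rho>. \<rho> > 0 \<Longrightarrow> miso_code N (\<rho> * \<sigma>2) (T \<rho>) (n \<rho>) (X \<rho>) (D \<rho>)"
    and mg: "has_multiplexing_gain (\<lambda>\<rho>. log 2 (real (n \<rho>)) / real (T \<rho>)) r"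
    and lim: "((\<lambda>\<rho>. error_exponent \<rho> (miso_error_prob N \<sigma>2 (T \<rho>) (n \<rho>) (X \<rho>) (D \<rho>))) \<longlongrightarrow> d) at_top"
    by blast
  show "d \<le> ereal (real N * (1 - r))"
  proof (rule ereal_le_epsilon2)
    fix e :: real assume e: "e > 0"
    obtain c where "c > 0" "\<forall>\<^sub>F \<rho> in at_top. c * \<rho> powr (- (real N * (1 - r) + e)) \<le> miso_error_prob N \<sigma>2 (T \<rho>) (n \<rho>) (X \<rho>) (D \<rho>)"
      using miso_error_lower[OF N \<sigma>2 r e code mg] by blast
    from error_exponent_limit_le[OF lim this] show "d \<le> ereal (real N * (1 - r)) + ereal e" by simp
  qed
qed (use miso_optimal_family[OF assms] in blast)

theorem theorem7:
  fixes N :: nat and \<sigma>v2 \<sigma>w2 :: real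
  assumes "N \<ge> 2" and "\<sigma>v2 > 0" and "\<sigma>w2 > 0"
  shows "\<exists>a b. cma_gains N \<sigma>v2 \<sigma>w2 a b \<and>
           (\<forall>r. 0 \<le> r \<longrightarrow> r \<le> 1 \<longrightarrow>
              (\<forall>R. has_multiplexing_gain R r \<longrightarrow>
                 has_overall_diversity_gain N (cma_naf_error N \<sigma>v2 \<sigma>w2 a b R)
                   (ereal (real N * (1 - r)))) \<and>
              genie_optimal_diversity N \<sigma>v2 r = ereal (real N * (1 - r)))"
proof (intro exI conjI allI impI)
  \<comment> \<open>The gains depend neither on \<open>r\<close> nor on the rate function, as the
    order of the quantifiers demands.\<close>
  show "cma_gains N \<sigma>v2 \<sigma>w2 (\<lambda>\<rho> m. 1 / 9) (rep_gain N \<sigma>v2 \<sigma>w2)" by (rule cma_gains_rep_gain[OF assms])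
  fix r :: real assume r: "0 \<le> r" "r \<le> 1"
  show "genie_optimal_diversity N \<sigma>v2 r = ereal (real N * (1 - r))"
    using assms by (intro genie_optimal_diversity_eq r) auto
  fix R assume "has_multiplexing_gain R r"
  thus "has_overall_diversity_gain N (cma_naf_error N \<sigma>v2 \<sigma>w2 (\<lambda>\<rho> m. 1 / 9) (rep_gain N \<sigma>v2 \<sigma>w2) R)
      (ereal (real N * (1 - r)))"
    by (rule naf_overall_diversity[OF assms r])
qed

end
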